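(* Let $(R,\mathfrak m)$ be a Cohen-Macaulay local ring of dimension $1$ with a canonical ideal, and suppose that $R$ is not a discrete valuation ring. Let $Q$ be the total ring of fractions of $R$ and let $A=\mathfrak m:_Q\mathfrak m$. Suppose that $(A,\mathfrak M)$ is a local ring. Let $e=[A/\mathfrak M:R/\mathfrak m]$ and let $r$ be the type of $R$. Then $$\operatorname{cdeg}(A)=e^{-1}\bigl(\operatorname{cdeg}(R)+\mathrm e_0(\mathfrak m)-2r\bigr).$$
   Context: $\mathfrak m:_Q\mathfrak m=\{q\in Q: q\mathfrak m\subseteq\mathfrak m\}$, a subring of $Q$ containing $R$ and finite over $R$. A canonical ideal of a Cohen-Macaulay local ring is an ideal isomorphic to a canonical module. For a $1$-dimensional Cohen-Macaulay local ring $S$ with a canonical ideal $\mathcal C$, the canonical degree is $\operatorname{cdeg}(S)=\mathrm e_0(\mathcal C)-\lambda_S(S/\mathcal C)$, where $\lambda_S$ is length and $\mathrm e_0(\mathcal C)$ is the multiplicity of $S$ with respect to $\mathcal C$ (read as $0$ if $\mathcal C=S$); equivalently, $\operatorname{cdeg}(S)=\lambda_S(\mathcal C/(c))$ if $(c)$ is a principal minimal reduction of $\mathcal C$. It does not depend on the choice of $\mathcal C$. $\mathrm e_0(\mathfrak m)$ is the multiplicity of $R$ with respect to $\mathfrak m$, and the type of $R$ is its Cohen-Macaulay type. *)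

theory Defs
  imports "HOL-Algebra.Module" "HOL-Algebra.Ideal_Product" "HOL-Algebra.Embedded_Algebras"
    "HOL-Algebra.Ring_Divisibility" "HOL-Algebra.QuotRing" "HOL-Library.Extended_Nat" Complex_Main
begin

text \<open>
  The record type of modules extends that of rings; the fields \<open>mult\<close> and \<open>one\<close> play no role for a
  module and are left undefined.
\<close>

definition ideal_module :: "('a, 'c) ring_scheme \<Rightarrow> 'a set \<Rightarrow> ('a, 'a) module" where
  "ideal_module R I =
     \<lparr>carrier = I, monoid.mult = undefined, one = undefined, ring.zero = \<zero>\<^bsub>R\<^esub>,
      ring.add = ring.add R, smult = monoid.mult R\<rparr>"

abbreviation regular_module :: "('a, 'c) ring_scheme \<Rightarrow> ('a, 'a) module" where
  "regular_module R \<equiv> ideal_module R (carrier R)"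

text \<open>
  Scalar multiplication on cosets is \<open>r (N + x) = N + r x\<close>; the union below is over equal cosets.
\<close>

definition quot_module ::
    "('a, 'c) ring_scheme \<Rightarrow> ('a, 'b, 'd) module_scheme \<Rightarrow> 'b set \<Rightarrow> ('a, 'b set) module" where
  "quot_module R M N =
     \<lparr>carrier = a_rcosets\<^bsub>M\<^esub> N, monoid.mult = undefined, one = undefined, ring.zero = N,
      ring.add = set_add M,
      smult = (\<lambda>r X. \<Union>x\<in>X. N +>\<^bsub>M\<^esub> (r \<odot>\<^bsub>M\<^esub> x))\<rparr>"

definition fin_gen_module :: "('a, 'c) ring_scheme \<Rightarrow> ('a, 'b, 'd) module_scheme \<Rightarrow> bool" where
  "fin_gen_module R M \<longleftrightarrow> module R M \<and>
     (\<exists>S. finite S \<and> S \<subseteq> carrier M \<and> (\<forall>N. submodule N R M \<longrightarrow> S \<subseteq> N \<longrightarrow> N = carrier M))"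

definition module_length :: "('a, 'c) ring_scheme \<Rightarrow> ('a, 'b, 'd) module_scheme \<Rightarrow> enat" where
  "module_length R M =
     Sup {enat n | n. \<exists>N :: nat \<Rightarrow> 'b set.
            (\<forall>i\<le>n. submodule (N i) R M) \<and> (\<forall>i<n. N i \<subset> N (Suc i))}"

definition mod_hom ::
    "('a, 'c) ring_scheme \<Rightarrow> ('a, 'b, 'd) module_scheme \<Rightarrow> ('a, 'e, 'f) module_scheme \<Rightarrow> ('b \<Rightarrow> 'e) set" where
  "mod_hom R M N =
     {f \<in> carrier M \<rightarrow>\<^sub>E carrier N.
        (\<forall>x\<in>carrier M. \<forall>y\<in>carrier M. f (x \<oplus>\<^bsub>M\<^esub> y) = f x \<oplus>\<^bsub>N\<^esub> f y) \<and>
        (\<forall>r\<in>carrier R. \<forall>x\<in>carrier M. f (r \<odot>\<^bsub>M\<^esub> x) = r \<odot>\<^bsub>N\<^esub> f x)}"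

definition hom_module ::
    "('a, 'c) ring_scheme \<Rightarrow> ('a, 'b, 'd) module_scheme \<Rightarrow> ('a, 'e, 'f) module_scheme \<Rightarrow> ('a, 'b \<Rightarrow> 'e) module" where
  "hom_module R M N =
     \<lparr>carrier = mod_hom R M N, monoid.mult = undefined, one = undefined,
      ring.zero = (\<lambda>x\<in>carrier M. \<zero>\<^bsub>N\<^esub>),
      ring.add = (\<lambda>f g. \<lambda>x\<in>carrier M. f x \<oplus>\<^bsub>N\<^esub> g x),
      smult = (\<lambda>r f. \<lambda>x\<in>carrier M. r \<odot>\<^bsub>N\<^esub> f x)\<rparr>"

definition free_module :: "('a, 'c) ring_scheme \<Rightarrow> nat \<Rightarrow> ('a, nat \<Rightarrow> 'a) module" where
  "free_module R n =
     \<lparr>carrier = {..<n} \<rightarrow>\<^sub>E carrier R, monoid.mult = undefined, one = undefined,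
      ring.zero = (\<lambda>i\<in>{..<n}. \<zero>\<^bsub>R\<^esub>),
      ring.add = (\<lambda>x y. \<lambda>i\<in>{..<n}. x i \<oplus>\<^bsub>R\<^esub> y i),
      smult = (\<lambda>r x. \<lambda>i\<in>{..<n}. r \<otimes>\<^bsub>R\<^esub> x i)\<rparr>"


text \<open>
  \<open>free_resolution R N rk d \<epsilon>\<close>: the sequence
  \<open>\<dots> \<rightarrow> R\<^bsup>rk 2\<^esup> \<rightarrow> R\<^bsup>rk 1\<^esup> \<rightarrow> R\<^bsup>rk 0\<^esup> \<rightarrow> N \<rightarrow> 0\<close> with maps \<open>\<dots>, d 1, d 0, \<epsilon>\<close> is exact.
\<close>

definition free_resolution ::
    "('a, 'c) ring_scheme \<Rightarrow> ('a, 'b, 'd) module_scheme \<Rightarrow> (nat \<Rightarrow> nat) \<Rightarrow>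
     (nat \<Rightarrow> (nat \<Rightarrow> 'a) \<Rightarrow> (nat \<Rightarrow> 'a)) \<Rightarrow> ((nat \<Rightarrow> 'a) \<Rightarrow> 'b) \<Rightarrow> bool" where
  "free_resolution R N rk d \<epsilon> \<longleftrightarrow>
     (let F = (\<lambda>i. free_module R (rk i)) in
        \<epsilon> \<in> mod_hom R (F 0) N \<and>
        (\<forall>i. d i \<in> mod_hom R (F (Suc i)) (F i)) \<and>
        \<epsilon> ` carrier (F 0) = carrier N \<and>
        d 0 ` carrier (F 1) = {x \<in> carrier (F 0). \<epsilon> x = \<zero>\<^bsub>N\<^esub>} \<and>
        (\<forall>i. d (Suc i) ` carrier (F (Suc (Suc i))) = {x \<in> carrier (F (Suc i)). d i x = \<zero>\<^bsub>F i\<^esub>}))"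

text \<open>
  Cocycles and coboundaries of the complex \<open>Hom(F\<^sub>\<bullet>, M)\<close>, whose term in degree \<open>i\<close> is
  \<open>Hom(R\<^bsup>rk i\<^esup>, M)\<close>.
\<close>

definition Ext_cocycles ::
    "('a, 'c) ring_scheme \<Rightarrow> (nat \<Rightarrow> nat) \<Rightarrow> (nat \<Rightarrow> (nat \<Rightarrow> 'a) \<Rightarrow> (nat \<Rightarrow> 'a)) \<Rightarrow>
     ('a, 'b, 'd) module_scheme \<Rightarrow> nat \<Rightarrow> ((nat \<Rightarrow> 'a) \<Rightarrow> 'b) set" where
  "Ext_cocycles R rk d M i =
     {f \<in> mod_hom R (free_module R (rk i)) M.
        \<forall>x\<in>carrier (free_module R (rk (Suc i))). f (d i x) = \<zero>\<^bsub>M\<^esub>}"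

fun Ext_coboundaries ::
    "('a, 'c) ring_scheme \<Rightarrow> (nat \<Rightarrow> nat) \<Rightarrow> (nat \<Rightarrow> (nat \<Rightarrow> 'a) \<Rightarrow> (nat \<Rightarrow> 'a)) \<Rightarrow>
     ('a, 'b, 'd) module_scheme \<Rightarrow> nat \<Rightarrow> ((nat \<Rightarrow> 'a) \<Rightarrow> 'b) set" where
  "Ext_coboundaries R rk d M 0 = {\<zero>\<^bsub>hom_module R (free_module R (rk 0)) M\<^esub>}"
| "Ext_coboundaries R rk d M (Suc i) =
     (\<lambda>g. \<lambda>x\<in>carrier (free_module R (rk (Suc i))). g (d i x)) ` mod_hom R (free_module R (rk i)) M"

text \<open>
  \<open>Ext R i N M\<close> is the \<open>i\<close>-th Ext module of \<open>N\<close> and \<open>M\<close> over \<open>R\<close>, for a Noetherian ring \<open>R\<close> and a finitely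
  generated module \<open>N\<close>, so that a resolution by free modules of finite rank exists. The choice of
  the resolution affects the result only up to isomorphism.
\<close>

definition Ext ::
    "('a, 'c) ring_scheme \<Rightarrow> nat \<Rightarrow> ('a, 'b, 'd) module_scheme \<Rightarrow> ('a, 'e, 'f) module_scheme \<Rightarrow>
     ('a, ((nat \<Rightarrow> 'a) \<Rightarrow> 'e) set) module" where
  "Ext R i N M =
     (let (rk, d) = (SOME (rk, d). \<exists>\<epsilon>. free_resolution R N rk d \<epsilon>) in
        quot_module R
          ((hom_module R (free_module R (rk i)) M)\<lparr>carrier := Ext_cocycles R rk d M i\<rparr>)
          (Ext_coboundaries R rk d M i))"


definition local_ring :: "('a, 'c) ring_scheme \<Rightarrow> 'a set \<Rightarrow> bool" where
  "local_ring R m \<longleftrightarrow> cring R \<and> maximalideal m R \<and> (\<forall>n. maximalideal n R \<longrightarrow> n = m)"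

definition discrete_valuation_ring :: "('a, 'c) ring_scheme \<Rightarrow> bool" where
  "discrete_valuation_ring R \<longleftrightarrow> principal_domain R \<and> (\<exists>m. local_ring R m) \<and> \<not> field R"

definition krull_dim :: "('a, 'c) ring_scheme \<Rightarrow> enat" where
  "krull_dim R =
     Sup {enat n | n. \<exists>P :: nat \<Rightarrow> 'a set.
            (\<forall>i\<le>n. primeideal (P i) R) \<and> (\<forall>i<n. P i \<subset> P (Suc i))}"

text \<open>
  For a sequence inside a proper ideal the condition that it does not generate the unit ideal is
  automatic.
\<close>

definition regular_seq_in :: "('a, 'c) ring_scheme \<Rightarrow> 'a set \<Rightarrow> 'a list \<Rightarrow> bool" where
  "regular_seq_in R m xs \<longleftrightarrow> set xs \<subseteq> m \<and>
     (\<forall>i<length xs. \<forall>a\<in>carrier R.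
        xs ! i \<otimes>\<^bsub>R\<^esub> a \<in> Idl\<^bsub>R\<^esub> (set (take i xs)) \<longrightarrow> a \<in> Idl\<^bsub>R\<^esub> (set (take i xs)))"

definition depth :: "('a, 'c) ring_scheme \<Rightarrow> 'a set \<Rightarrow> enat" where
  "depth R m = Sup {enat (length xs) | xs. regular_seq_in R m xs}"

definition cohen_macaulay_local :: "('a, 'c) ring_scheme \<Rightarrow> 'a set \<Rightarrow> bool" where
  "cohen_macaulay_local R m \<longleftrightarrow> local_ring R m \<and> noetherian_ring R \<and> depth R m = krull_dim R"

abbreviation residue_module :: "('a, 'c) ring_scheme \<Rightarrow> 'a set \<Rightarrow> ('a, 'a set) module" where
  "residue_module R m \<equiv> quot_module R (regular_module R) m"

text \<open>
  The type is the dimension over the residue field \<open>k\<close> of \<open>Ext\<^sup>d(k, R)\<close>, \<open>d = dim R\<close>; as this module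
  is annihilated by \<open>m\<close>, its dimension over \<open>k\<close> is its length over \<open>R\<close>.
\<close>

definition cm_type :: "('a, 'c) ring_scheme \<Rightarrow> 'a set \<Rightarrow> nat" where
  "cm_type R m =
     the_enat (module_length R
       (Ext R (the_enat (krull_dim R)) (residue_module R m) (regular_module R)))"

text \<open>
  A canonical module of a Cohen-Macaulay local ring with residue field \<open>k\<close> is a finitely generated
  module \<open>C\<close> such that \<open>Ext\<^sup>i(k, C)\<close> has dimension \<open>1\<close> over \<open>k\<close> for \<open>i = dim R\<close> and vanishes for all
  other \<open>i\<close>.
\<close>

definition canonical_module ::
    "('a, 'c) ring_scheme \<Rightarrow> 'a set \<Rightarrow> ('a, 'b, 'd) module_scheme \<Rightarrow> bool" where
  "canonical_module R m C \<longleftrightarrow> cohen_macaulay_local R m \<and> fin_gen_module R C \<and>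
     (\<forall>i. module_length R (Ext R i (residue_module R m) C) = (if enat i = krull_dim R then 1 else 0))"

text \<open>Being a canonical module is invariant under isomorphism.\<close>

definition canonical_ideal :: "('a, 'c) ring_scheme \<Rightarrow> 'a set \<Rightarrow> 'a set \<Rightarrow> bool" where
  "canonical_ideal R m C \<longleftrightarrow> ideal C R \<and> canonical_module R m (ideal_module R C)"

definition colength :: "('a, 'c) ring_scheme \<Rightarrow> 'a set \<Rightarrow> nat" where
  "colength R I = the_enat (module_length R (quot_module R (regular_module R) I))"

text \<open>
  The Hilbert-Samuel multiplicity \<open>lim d! \<lambda>(R/I\<^sup>n) / n\<^sup>d\<close>, \<open>d = dim R\<close>, of an \<open>m\<close>-primary ideal \<open>I\<close>.
  It is \<open>0\<close> for the unit ideal.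
\<close>

definition hs_multiplicity :: "('a, 'c) ring_scheme \<Rightarrow> 'a set \<Rightarrow> real" where
  "hs_multiplicity R I =
     (let d = the_enat (krull_dim R) in
        lim (\<lambda>n. fact d * real (colength R (I [^]\<^bsub>ideals_set R\<^esub> n)) / real n ^ d))"

definition cdeg :: "('a, 'c) ring_scheme \<Rightarrow> 'a set \<Rightarrow> real" where
  "cdeg R m =
     (let C = (SOME C. canonical_ideal R m C) in hs_multiplicity R C - real (colength R C))"


definition nonzerodivisors :: "('a, 'c) ring_scheme \<Rightarrow> 'a set" where
  "nonzerodivisors R =
     {s \<in> carrier R. \<forall>a\<in>carrier R. s \<otimes>\<^bsub>R\<^esub> a = \<zero>\<^bsub>R\<^esub> \<longrightarrow> a = \<zero>\<^bsub>R\<^esub>}"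

text \<open>\<open>R\<close> is regarded as a subring of its total ring of fractions.\<close>

definition total_ring_of_fractions :: "'a ring \<Rightarrow> 'a ring \<Rightarrow> bool" where
  "total_ring_of_fractions R Q \<longleftrightarrow>
     cring Q \<and> subring (carrier R) Q \<and> R = Q\<lparr>carrier := carrier R\<rparr> \<and>
     nonzerodivisors R \<subseteq> Units Q \<and>
     (\<forall>q\<in>carrier Q. \<exists>a\<in>carrier R. \<exists>s\<in>nonzerodivisors R. q = a \<otimes>\<^bsub>Q\<^esub> inv\<^bsub>Q\<^esub> s)"

definition colon :: "('a, 'c) ring_scheme \<Rightarrow> 'a set \<Rightarrow> 'a set \<Rightarrow> 'a set" where
  "colon Q I J = {q \<in> carrier Q. \<forall>x\<in>J. q \<otimes>\<^bsub>Q\<^esub> x \<in> I}"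

text \<open>
  For a local extension of local rings from \<open>R\<close> with maximal ideal \<open>m\<close> to \<open>A\<close> with maximal ideal \<open>M\<close>,
  the residue field of \<open>R\<close> is identified with the image of \<open>R\<close> in \<open>A/M\<close>.
\<close>

definition residue_degree :: "('a, 'c) ring_scheme \<Rightarrow> ('a, 'd) ring_scheme \<Rightarrow> 'a set \<Rightarrow> nat" where
  "residue_degree R A M =
     ring.dim (A Quot M) ((\<lambda>x. M +>\<^bsub>A\<^esub> x) ` carrier R) (carrier (A Quot M))"

end

theory Submission
  imports Defs
begin

text \<open>
  All invariants are expressed through lengths of intervals of \<open>R\<close>-submodules of \<open>Q\<close>, and a canonical
  ideal \<open>C\<close> is characterised by the property that every homomorphism from a fractional ideal \<open>I\<close> to
  \<open>Q/C\<close> is a multiplication. As \<open>R\<close> is not a discrete valuation ring, \<open>A = m : m = R : m = C : mC\<close>, so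
  by duality \<open>mC = C : A\<close> is a canonical ideal of \<open>A\<close>. Lengths over \<open>R\<close> are \<open>e\<close> times lengths over \<open>A\<close>,
  \<open>\<lambda>(A/R) = \<lambda>(C/mC) = r\<close>, and \<open>e\<^sub>0\<close> is additive on products of ideals, hence
  \<open>e cdeg A = e\<^sub>0(m) + e\<^sub>0(C) - \<lambda>(A/R) - \<lambda>(R/C) - \<lambda>(C/mC) = e\<^sub>0(m) + cdeg R - 2 r\<close>.
\<close>

section \<open>Lengths of intervals of submodules\<close>

text \<open>The definitions speak of Ext over a free resolution chosen by \<open>SOME\<close>. A
  nonzerodivisor x in m acts invertibly on Q and as zero on k, so Q contributes nothing to the Ext
  modules of k: in degree 1, Ext of (k, C) is (C : m) / C, and in degree 2 it is the cokernel of Q/C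
  \<rightarrow> Hom(m, Q/C). The canonical condition thus says that Q/C has a simple socle and that
  every homomorphism from m to Q/C is a multiplication; a Noetherian induction in the style of Baer
  carries the latter from m to all fractional ideals. The residue field may be finite, and then a
  regular ideal need not have a principal reduction. Some power of it has one, so the colength of
  the n-th power grows by a constant over a fixed period. This yields the limit defining e_0, and
  the periods of m and C combine into one for mC. Finally \<open>cdeg\<close> picks a canonical
  ideal by \<open>SOME\<close>. Two canonical ideals differ by a unit u of Q, and multiplication by
  u changes multiplicity and colength by the same amount.\<close>

definition chain_in :: "'b set set \<Rightarrow> 'b set \<Rightarrow> 'b set \<Rightarrow> nat \<Rightarrow> (nat \<Rightarrow> 'b set) \<Rightarrow> bool" where
  "chain_in L J I n N \<longleftrightarrow>
     (\<forall>i\<le>n. N i \<in> L \<and> J \<subseteq> N i \<and> N i \<subseteq> I) \<and> (\<forall>i<n. N i \<subset> N (Suc i))"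

text \<open>The length of I / J, read off from the interval of a lattice \<open>L\<close> of
  submodules of one ambient module. Quotients are never formed, and changing the scalars only
  changes \<open>L\<close>.\<close>

definition chain_len :: "'b set set \<Rightarrow> 'b set \<Rightarrow> 'b set \<Rightarrow> enat" where
  "chain_len L J I = Sup {enat n | n. \<exists>N. chain_in L J I n N}"

lemma chain_inD:
  assumes "chain_in L J I n N" "i \<le> n"
  shows "N i \<in> L" "J \<subseteq> N i" "N i \<subseteq> I"
  using assms unfolding chain_in_def by auto

lemma chain_in_strict: "chain_in L J I n N \<Longrightarrow> i < n \<Longrightarrow> N i \<subset> N (Suc i)"
  unfolding chain_in_def by auto

lemma chain_len_ge: "chain_in L J I n N \<Longrightarrow> enat n \<le> chain_len L J I"
  unfolding chain_len_def by (rule Sup_upper) blast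

lemma chain_len_leI: "(\<And>n N. chain_in L J I n N \<Longrightarrow> enat n \<le> k) \<Longrightarrow> chain_len L J I \<le> k"
  unfolding chain_len_def by (rule Sup_least) blast

lemma chain_in_trunc: "chain_in L J I n N \<Longrightarrow> k \<le> n \<Longrightarrow> chain_in L J I k N"
  unfolding chain_in_def by auto

lemma chain_len_geE:
  assumes "enat n \<le> chain_len L J I" "J \<in> L" "J \<subseteq> I"
  obtains N where "chain_in L J I n N"
proof (cases n)
  case 0
  have "chain_in L J I 0 (\<lambda>_. J)" using assms unfolding chain_in_def by auto
  then show ?thesis using that 0 by blast
next
  case (Suc k)
  have "\<exists>n' N. chain_in L J I n' N \<and> n \<le> n'"
  proof (rule ccontr)
    assume *: "\<not> ?thesis"
    have "chain_len L J I \<le> enat k"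
    proof (rule chain_len_leI)
      fix n' N assume "chain_in L J I n' N"
      then have "\<not> n \<le> n'" using * by blast
      then show "enat n' \<le> enat k" using Suc by simp
    qed
    then have "enat n \<le> enat k" using assms(1) by (rule order_trans[rotated])
    then show False using Suc by simp
  qed
  then show ?thesis using that chain_in_trunc by blast
qed

text \<open>Strictly monotone maps transport chains. Used in both directions, this gives the
  equalities of length below without an isomorphism of modules.\<close>

lemma chain_len_mono_map:
  assumes "\<And>N. N \<in> L \<Longrightarrow> J \<subseteq> N \<Longrightarrow> N \<subseteq> I \<Longrightarrow> \<Phi> N \<in> L' \<and> J' \<subseteq> \<Phi> N \<and> \<Phi> N \<subseteq> I'"
    and "\<And>N N'. N \<in> L \<Longrightarrow> J \<subseteq> N \<Longrightarrow> N' \<subseteq> I \<Longrightarrow> N' \<in> L \<Longrightarrow> N \<subset> N' \<Longrightarrow> \<Phi> N \<subset> \<Phi> N'"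
  shows "chain_len L J I \<le> chain_len L' J' I'"
proof (rule chain_len_leI)
  fix n N assume N: "chain_in L J I n N"
  have "chain_in L' J' I' n (\<lambda>i. \<Phi> (N i))"
    unfolding chain_in_def
  proof (intro conjI allI impI)
    fix i assume i: "i < n"
    show "\<Phi> (N i) \<subset> \<Phi> (N (Suc i))"
      using i by (intro assms(2) chain_inD[OF N] chain_in_strict[OF N]) simp_all
  next
    fix i assume i: "i \<le> n"
    show "\<Phi> (N i) \<in> L'" "J' \<subseteq> \<Phi> (N i)" "\<Phi> (N i) \<subseteq> I'"
      using assms(1)[OF chain_inD[OF N i]] by simp_all
  qed
  then show "enat n \<le> chain_len L' J' I'" by (rule chain_len_ge)
qed

lemma chain_len_antimono_map:
  assumes "\<And>N. N \<in> L \<Longrightarrow> J \<subseteq> N \<Longrightarrow> N \<subseteq> I \<Longrightarrow> \<Phi> N \<in> L' \<and> J' \<subseteq> \<Phi> N \<and> \<Phi> N \<subseteq> I'"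
    and "\<And>N N'. N \<in> L \<Longrightarrow> J \<subseteq> N \<Longrightarrow> N' \<subseteq> I \<Longrightarrow> N' \<in> L \<Longrightarrow> N \<subset> N' \<Longrightarrow> \<Phi> N' \<subset> \<Phi> N"
  shows "chain_len L J I \<le> chain_len L' J' I'"
proof (rule chain_len_leI)
  fix n N assume N: "chain_in L J I n N"
  have "chain_in L' J' I' n (\<lambda>i. \<Phi> (N (n - i)))"
    unfolding chain_in_def
  proof (intro conjI allI impI)
    fix i assume i: "i < n"
    then have "N (n - Suc i) \<subset> N (Suc (n - Suc i))" using N unfolding chain_in_def by simp
    moreover have "Suc (n - Suc i) = n - i" using i by simp
    ultimately have lt: "N (n - Suc i) \<subset> N (n - i)" by simp
    show "\<Phi> (N (n - i)) \<subset> \<Phi> (N (n - Suc i))"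
      by (intro assms(2) chain_inD[OF N] lt) simp_all
  next
    fix i assume "i \<le> n"
    have n: "n - i \<le> n" by simp
    show "\<Phi> (N (n - i)) \<in> L'" "J' \<subseteq> \<Phi> (N (n - i))" "\<Phi> (N (n - i)) \<subseteq> I'"
      using assms(1)[OF chain_inD[OF N n]] by simp_all
  qed
  then show "enat n \<le> chain_len L' J' I'" by (rule chain_len_ge)
qed

lemma chain_len_mono:
  assumes "J' \<subseteq> J" "I \<subseteq> I'"
  shows "chain_len L J I \<le> chain_len L J' I'"
  by (rule chain_len_mono_map[where \<Phi> = "\<lambda>N. N"]) (use assms in auto)

lemma chain_len_self [simp]: "chain_len L I I = 0"
proof -
  have "chain_len L I I \<le> 0"
  proof (rule chain_len_leI)
    fix n N assume N: "chain_in L I I n N"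
    show "enat n \<le> 0"
    proof (cases n)
      case (Suc k)
      then have "N 0 \<subset> N 1" "N 0 = I" "N 1 = I" using N unfolding chain_in_def by auto
      then show ?thesis by simp
    qed (simp add: zero_enat_def)
  qed
  then show ?thesis by simp
qed

lemma chain_len_0_imp_eq:
  assumes "chain_len L J I = 0" "J \<in> L" "I \<in> L" "J \<subseteq> I"
  shows "J = I"
proof (rule ccontr)
  assume "J \<noteq> I"
  then have "chain_in L J I 1 (\<lambda>i. if i = 0 then J else I)" using assms unfolding chain_in_def by auto
  then show False using chain_len_ge[of L J I 1] assms(1) by (simp add: zero_enat_def)
qed

lemma chain_len_simple:
  assumes "J \<in> L" "I \<in> L" "J \<subset> I" "\<And>N. N \<in> L \<Longrightarrow> J \<subseteq> N \<Longrightarrow> N \<subseteq> I \<Longrightarrow> N = J \<or> N = I"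
  shows "chain_len L J I = 1"
proof (rule antisym)
  have "chain_in L J I 1 (\<lambda>i. if i = 0 then J else I)" using assms unfolding chain_in_def by auto
  then show "1 \<le> chain_len L J I" using chain_len_ge[of L J I 1] by (simp add: one_enat_def)
  show "chain_len L J I \<le> 1"
  proof (rule chain_len_leI)
    fix n N assume N: "chain_in L J I n N"
    show "enat n \<le> 1"
    proof (cases "n \<le> 1")
      case False
      then have c: "N 0 \<subset> N 1" "N 1 \<subset> N 2"
        using N unfolding chain_in_def by (auto simp: eval_nat_numeral)
      have "N 0 = J \<or> N 0 = I" "N 1 = J \<or> N 1 = I" "N 2 = J \<or> N 2 = I"
        using N False assms(4) unfolding chain_in_def by auto
      then show ?thesis using c by auto
    qed (simp add: one_enat_def)
  qed
qed

lemma enat_leI_enat: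
  assumes "\<And>n. enat n \<le> a \<Longrightarrow> enat n \<le> (c::enat)"
  shows "a \<le> c"
proof (cases c)
  case (enat p)
  then have "\<not> enat (Suc p) \<le> a" using assms[of "Suc p"] by auto
  then show ?thesis using enat by (cases a) auto
qed simp

lemma chain_len_concat:
  assumes "J \<in> L" "K \<in> L" "J \<subseteq> K" "K \<subseteq> I"
  shows "chain_len L J K + chain_len L K I \<le> chain_len L J I"
proof -
  have "enat n \<le> chain_len L J I" if n: "enat n \<le> chain_len L J K + chain_len L K I" for n
  proof -
    \<comment> \<open>Either length may be infinite, so a finite n is split into parts bounded by
      the two lengths.\<close>
    obtain a b where ab: "enat a \<le> chain_len L J K" "enat b \<le> chain_len L K I" "n = a + b"
    proof (cases "chain_len L J K")
      case (enat p)
      show ?thesis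
      proof (cases "n \<le> p")
        case True
        then show ?thesis using that[of n 0] enat by (simp add: zero_enat_def[symmetric])
      next
        case False
        have "enat (n - p) \<le> chain_len L K I"
          using n enat False by (cases "chain_len L K I") auto
        then show ?thesis using that[of p "n - p"] enat False by simp
      qed
    next
      case infinity
      then show ?thesis using that[of n 0] by (simp add: zero_enat_def[symmetric])
    qed
    obtain N where N: "chain_in L J K a N" using ab(1) assms by (auto elim: chain_len_geE)
    obtain N' where N': "chain_in L K I b N'" using ab(2) assms by (auto elim: chain_len_geE)
    \<comment> \<open>The glued chain skips \<open>N' 0\<close>. Since N a \<subseteq> K \<subseteq>
      N' 0 \<subset> N' 1, the junction is strict even if N a and N' 0 differ, and if they agree
      nothing is counted twice.\<close>
    define M where "M = (\<lambda>i. if i \<le> a then N i else N' (i - a))"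
    have "chain_in L J I (a + b) M"
      unfolding chain_in_def
    proof (intro conjI allI impI)
      fix i assume i: "i \<le> a + b"
      then have ia: "i - a \<le> b" by simp
      have "M i \<in> L \<and> J \<subseteq> M i \<and> M i \<subseteq> I"
      proof (cases "i \<le> a")
        case True
        then have "N i \<in> L \<and> J \<subseteq> N i \<and> N i \<subseteq> K" using N unfolding chain_in_def by blast
        then show ?thesis using True assms unfolding M_def by auto
      next
        case False
        have "N' (i - a) \<in> L \<and> K \<subseteq> N' (i - a) \<and> N' (i - a) \<subseteq> I"
          using N' ia unfolding chain_in_def by blast
        then show ?thesis using False assms unfolding M_def by auto
      qed
      then show "M i \<in> L" "J \<subseteq> M i" "M i \<subseteq> I" by blast+
    next
      fix i assume i: "i < a + b"
      consider "i < a" | "i = a" | "i > a" by linarith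
      then show "M i \<subset> M (Suc i)"
      proof cases
        case 1
        then show ?thesis using N unfolding M_def chain_in_def by simp
      next
        case 2
        then have "N a \<subseteq> K" "K \<subseteq> N' 0" "N' 0 \<subset> N' 1" using N N' i unfolding chain_in_def by auto
        then show ?thesis using 2 unfolding M_def by auto
      next
        case 3
        then have "i - a < b" "Suc i - a = Suc (i - a)" using i by auto
        then show ?thesis using N' 3 unfolding M_def chain_in_def by simp
      qed
    qed
    then show ?thesis using ab(3) chain_len_ge by blast
  qed
  then show ?thesis by (rule enat_leI_enat)
qed

text \<open>Deleting the repetitions from a weakly increasing sequence leaves a chain whose length
  is the number of its strict steps.\<close>

lemma chain_strict_steps:
  assumes "\<And>i. i \<le> n \<Longrightarrow> N i \<in> L \<and> J \<subseteq> N i \<and> N i \<subseteq> I" "\<And>i. i < n \<Longrightarrow> N i \<subseteq> N (Suc i)"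
  shows "enat (card {i. i < n \<and> N i \<subset> N (Suc i)}) \<le> chain_len L J I"
proof -
  have "\<exists>M. chain_in L J I (card {i. i < k \<and> N i \<subset> N (Suc i)}) M \<and>
      M (card {i. i < k \<and> N i \<subset> N (Suc i)}) = N k" if "k \<le> n" for k
    using that
  proof (induction k)
    case 0
    then show ?case using assms(1)[of 0] by (intro exI[of _ "\<lambda>_. N 0"]) (auto simp: chain_in_def)
  next
    case (Suc k)
    let ?c = "card {i. i < k \<and> N i \<subset> N (Suc i)}"
    obtain M where M: "chain_in L J I ?c M" "M ?c = N k" using Suc by auto
    show ?case
    proof (cases "N k \<subset> N (Suc k)")
      case True
      have "{i. i < Suc k \<and> N i \<subset> N (Suc i)} = insert k {i. i < k \<and> N i \<subset> N (Suc i)}"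
        using True by (auto simp: less_Suc_eq)
      then have c: "card {i. i < Suc k \<and> N i \<subset> N (Suc i)} = Suc ?c" by simp
      have "chain_in L J I (Suc ?c) (M(Suc ?c := N (Suc k)))"
        using M assms(1)[of "Suc k"] Suc.prems True unfolding chain_in_def by (auto simp: le_Suc_eq less_Suc_eq)
      then show ?thesis unfolding c by auto
    next
      case False
      then have eq: "N k = N (Suc k)" using assms(2)[of k] Suc.prems by auto
      have "{i. i < Suc k \<and> N i \<subset> N (Suc i)} = {i. i < k \<and> N i \<subset> N (Suc i)}"
        using False by (auto simp: less_Suc_eq)
      then show ?thesis using M eq by auto
    qed
  qed
  then show ?thesis using chain_len_ge by blast
qed

text \<open>Every strict step stays strict under at least one of two monotone maps, so counting
  steps bounds the length by a sum. With intersection with K and sum with K as the maps, this is one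
  half of the additivity of length.\<close>

lemma chain_len_subadd:
  assumes a: "\<And>N. N \<in> L \<Longrightarrow> J \<subseteq> N \<Longrightarrow> N \<subseteq> I \<Longrightarrow> a N \<in> L1 \<and> J1 \<subseteq> a N \<and> a N \<subseteq> I1"
    and b: "\<And>N. N \<in> L \<Longrightarrow> J \<subseteq> N \<Longrightarrow> N \<subseteq> I \<Longrightarrow> b N \<in> L2 \<and> J2 \<subseteq> b N \<and> b N \<subseteq> I2"
    and ab: "\<And>N N'. N \<in> L \<Longrightarrow> J \<subseteq> N \<Longrightarrow> N' \<subseteq> I \<Longrightarrow> N' \<in> L \<Longrightarrow> N \<subset> N' \<Longrightarrow>
      a N \<subseteq> a N' \<and> b N \<subseteq> b N' \<and> (a N \<noteq> a N' \<or> b N \<noteq> b N')"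
  shows "chain_len L J I \<le> chain_len L1 J1 I1 + chain_len L2 J2 I2"
proof (rule chain_len_leI)
  fix n N assume N: "chain_in L J I n N"
  let ?A = "{i. i < n \<and> a (N i) \<subset> a (N (Suc i))}" and ?B = "{i. i < n \<and> b (N i) \<subset> b (N (Suc i))}"
  have N1: "N i \<in> L" "J \<subseteq> N i" "N i \<subseteq> I" if "i \<le> n" for i
    using N that unfolding chain_in_def by auto
  have N2: "a (N i) \<subseteq> a (N (Suc i)) \<and> b (N i) \<subseteq> b (N (Suc i)) \<and> (a (N i) \<noteq> a (N (Suc i)) \<or> b (N i) \<noteq> b (N (Suc i)))"
    if "i < n" for i
    using ab[of "N i" "N (Suc i)"] N1[of i] N1[of "Suc i"] N that unfolding chain_in_def by simp
  have "{..<n} \<subseteq> ?A \<union> ?B" using N2 by auto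
  then have "card {..<n} \<le> card (?A \<union> ?B)" by (intro card_mono) simp_all
  also have "\<dots> \<le> card ?A + card ?B" by (rule card_Un_le)
  finally have "enat n \<le> enat (card ?A) + enat (card ?B)" by simp
  also have "\<dots> \<le> chain_len L1 J1 I1 + chain_len L2 J2 I2"
  proof (rule add_mono)
    show "enat (card ?A) \<le> chain_len L1 J1 I1"
      by (rule chain_strict_steps[where N="\<lambda>i. a (N i)"]) (use N1 N2 a in simp_all)
    show "enat (card ?B) \<le> chain_len L2 J2 I2"
      by (rule chain_strict_steps[where N="\<lambda>i. b (N i)"]) (use N1 N2 b in simp_all)
  qed
  finally show "enat n \<le> chain_len L1 J1 I1 + chain_len L2 J2 I2" .
qed

section \<open>Modules, homomorphisms and quotients\<close>

abbreviation submods :: "('a, 'c) ring_scheme \<Rightarrow> ('a, 'b, 'd) module_scheme \<Rightarrow> 'b set set" where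
  "submods R M \<equiv> {N. submodule N R M}"

lemma submoduleD:
  assumes "module R M" "submodule N R M"
  shows "N \<subseteq> carrier M" "\<zero>\<^bsub>M\<^esub> \<in> N" "\<And>x y. x \<in> N \<Longrightarrow> y \<in> N \<Longrightarrow> x \<oplus>\<^bsub>M\<^esub> y \<in> N"
    "\<And>r x. r \<in> carrier R \<Longrightarrow> x \<in> N \<Longrightarrow> r \<odot>\<^bsub>M\<^esub> x \<in> N" "\<And>x. x \<in> N \<Longrightarrow> \<ominus>\<^bsub>M\<^esub> x \<in> N"
proof -
  interpret module R M by fact
  show "N \<subseteq> carrier M" "\<And>x y. x \<in> N \<Longrightarrow> y \<in> N \<Longrightarrow> x \<oplus>\<^bsub>M\<^esub> y \<in> N"
    "\<And>r x. r \<in> carrier R \<Longrightarrow> x \<in> N \<Longrightarrow> r \<odot>\<^bsub>M\<^esub> x \<in> N" "\<And>x. x \<in> N \<Longrightarrow> \<ominus>\<^bsub>M\<^esub> x \<in> N"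
    using submoduleE[OF assms(2)] by auto
  show "\<zero>\<^bsub>M\<^esub> \<in> N" using subgroup.one_closed[OF submodule.axioms(1)[OF assms(2)]] by simp
qed

lemma submoduleI':
  assumes "module R M" "N \<subseteq> carrier M" "\<zero>\<^bsub>M\<^esub> \<in> N" "\<And>x y. x \<in> N \<Longrightarrow> y \<in> N \<Longrightarrow> x \<oplus>\<^bsub>M\<^esub> y \<in> N"
    "\<And>r x. r \<in> carrier R \<Longrightarrow> x \<in> N \<Longrightarrow> r \<odot>\<^bsub>M\<^esub> x \<in> N"
  shows "submodule N R M"
proof -
  interpret module R M by fact
  show ?thesis
  proof (rule submoduleI)
    fix a assume a: "a \<in> N"
    have "(\<ominus>\<^bsub>R\<^esub> \<one>\<^bsub>R\<^esub>) \<odot>\<^bsub>M\<^esub> a \<in> N" using assms(5) a by simp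
    moreover have "(\<ominus>\<^bsub>R\<^esub> \<one>\<^bsub>R\<^esub>) \<odot>\<^bsub>M\<^esub> a = \<ominus>\<^bsub>M\<^esub> a" using a assms(2) smult_l_minus[of "\<one>\<^bsub>R\<^esub>" a] by auto
    ultimately show "\<ominus>\<^bsub>M\<^esub> a \<in> N" by simp
  qed (use assms in auto)
qed

lemma module_submodule: "module R M \<Longrightarrow> submodule N R M \<Longrightarrow> module R (M\<lparr>carrier := N\<rparr>)"
  by (rule submodule.submodule_is_module)

context
  fixes R (structure) and M (structure) and N
  assumes RM: "module R M" and N: "submodule N R M"
begin

interpretation module R M by (rule RM)
interpretation N: abelian_subgroup N M
  using submodule.axioms(1)[OF N] M.abelian_group_axioms
  by (intro abelian_subgroupI3) (simp_all add: additive_subgroup_def)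

lemma quot_carrier: "carrier (quot_module R M N) = {N +>\<^bsub>M\<^esub> x | x. x \<in> carrier M}"
  unfolding quot_module_def by (auto simp: A_RCOSETS_def')

lemma coset_eq_iff:
  assumes "x \<in> carrier M" "y \<in> carrier M"
  shows "N +>\<^bsub>M\<^esub> x = N +>\<^bsub>M\<^esub> y \<longleftrightarrow> x \<ominus>\<^bsub>M\<^esub> y \<in> N"
proof
  assume "N +>\<^bsub>M\<^esub> x = N +>\<^bsub>M\<^esub> y"
  then have "x \<in> N +>\<^bsub>M\<^esub> y" using N.a_rcos_self assms(1) by auto
  then obtain n where "n \<in> N" "x = n \<oplus>\<^bsub>M\<^esub> y" by (auto simp: a_r_coset_def')
  moreover from this have "n \<in> carrier M" using N.a_subset by auto
  ultimately show "x \<ominus>\<^bsub>M\<^esub> y \<in> N" using assms by (simp add: a_minus_def M.a_assoc M.r_neg)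
next
  assume xy: "x \<ominus>\<^bsub>M\<^esub> y \<in> N"
  have "x = (x \<ominus>\<^bsub>M\<^esub> y) \<oplus>\<^bsub>M\<^esub> y" using assms by (simp add: a_minus_def M.a_assoc M.l_neg)
  then have "x \<in> N +>\<^bsub>M\<^esub> y" using xy by (auto simp: a_r_coset_def')
  then show "N +>\<^bsub>M\<^esub> x = N +>\<^bsub>M\<^esub> y" using M.a_repr_independence[of x N y] assms N.a_subgroup by auto
qed

lemma quot_add:
  assumes "x \<in> carrier M" "y \<in> carrier M"
  shows "(N +>\<^bsub>M\<^esub> x) \<oplus>\<^bsub>quot_module R M N\<^esub> (N +>\<^bsub>M\<^esub> y) = N +>\<^bsub>M\<^esub> (x \<oplus>\<^bsub>M\<^esub> y)"
  unfolding quot_module_def using N.a_rcos_sum assms by simp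

lemma quot_smult:
  assumes "r \<in> carrier R" "x \<in> carrier M"
  shows "r \<odot>\<^bsub>quot_module R M N\<^esub> (N +>\<^bsub>M\<^esub> x) = N +>\<^bsub>M\<^esub> (r \<odot>\<^bsub>M\<^esub> x)"
proof -
  have "N +>\<^bsub>M\<^esub> (r \<odot>\<^bsub>M\<^esub> y) = N +>\<^bsub>M\<^esub> (r \<odot>\<^bsub>M\<^esub> x)" if y: "y \<in> N +>\<^bsub>M\<^esub> x" for y
  proof -
    obtain n where n: "n \<in> N" "y = n \<oplus>\<^bsub>M\<^esub> x" using y by (auto simp: a_r_coset_def')
    have nM: "n \<in> carrier M" using n(1) N.a_subset by auto
    have "r \<odot>\<^bsub>M\<^esub> y = r \<odot>\<^bsub>M\<^esub> n \<oplus>\<^bsub>M\<^esub> r \<odot>\<^bsub>M\<^esub> x" using n nM assms smult_r_distr by simp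
    moreover have "r \<odot>\<^bsub>M\<^esub> n \<in> N" using submoduleD[OF RM N] assms n by auto
    ultimately have "r \<odot>\<^bsub>M\<^esub> y \<in> N +>\<^bsub>M\<^esub> (r \<odot>\<^bsub>M\<^esub> x)" by (auto simp: a_r_coset_def')
    then show ?thesis using M.a_repr_independence[of "r \<odot>\<^bsub>M\<^esub> y" N "r \<odot>\<^bsub>M\<^esub> x"] assms N.a_subgroup by auto
  qed
  then have "(\<Union>y\<in>N +>\<^bsub>M\<^esub> x. N +>\<^bsub>M\<^esub> (r \<odot>\<^bsub>M\<^esub> y)) = (\<Union>y\<in>N +>\<^bsub>M\<^esub> x. N +>\<^bsub>M\<^esub> (r \<odot>\<^bsub>M\<^esub> x))"
    by (intro SUP_cong refl)
  moreover have "x \<in> N +>\<^bsub>M\<^esub> x" using N.a_rcos_self assms by simp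
  then have "N +>\<^bsub>M\<^esub> x \<noteq> {}" by blast
  ultimately show ?thesis by (simp add: quot_module_def)
qed

lemma quot_zero: "\<zero>\<^bsub>quot_module R M N\<^esub> = N +>\<^bsub>M\<^esub> \<zero>\<^bsub>M\<^esub>"
  unfolding quot_module_def using N.a_subset by (simp add: a_coset_add_zero)

lemma module_quot: "module R (quot_module R M N)"
proof (rule moduleI)
  show "cring R" ..
  show "abelian_group (quot_module R M N)"
  proof (rule abelian_groupI)
    fix x assume "x \<in> carrier (quot_module R M N)"
    then obtain a where a: "x = N +>\<^bsub>M\<^esub> a" "a \<in> carrier M" unfolding quot_carrier by auto
    have "(N +>\<^bsub>M\<^esub> (\<ominus>\<^bsub>M\<^esub> a)) \<oplus>\<^bsub>quot_module R M N\<^esub> x = \<zero>\<^bsub>quot_module R M N\<^esub>"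
      unfolding a quot_zero using a by (simp add: quot_add M.l_neg)
    then show "\<exists>y\<in>carrier (quot_module R M N). y \<oplus>\<^bsub>quot_module R M N\<^esub> x = \<zero>\<^bsub>quot_module R M N\<^esub>"
      using a unfolding quot_carrier by (intro bexI[of _ "N +>\<^bsub>M\<^esub> (\<ominus>\<^bsub>M\<^esub> a)"]) auto
  next
    fix x y assume "x \<in> carrier (quot_module R M N)" "y \<in> carrier (quot_module R M N)"
    then show "x \<oplus>\<^bsub>quot_module R M N\<^esub> y = y \<oplus>\<^bsub>quot_module R M N\<^esub> x"
      by (auto simp: quot_carrier quot_add M.a_comm)
  qed (auto simp: quot_carrier quot_add quot_zero M.a_assoc)
next
  fix x assume "x \<in> carrier (quot_module R M N)"
  then show "\<one> \<odot>\<^bsub>quot_module R M N\<^esub> x = x" by (auto simp: quot_carrier quot_smult)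
next
  fix a b x assume "a \<in> carrier R" "b \<in> carrier R" "x \<in> carrier (quot_module R M N)"
  then show "(a \<otimes> b) \<odot>\<^bsub>quot_module R M N\<^esub> x = a \<odot>\<^bsub>quot_module R M N\<^esub> (b \<odot>\<^bsub>quot_module R M N\<^esub> x)"
    by (auto simp: quot_carrier quot_smult smult_assoc1)
qed (auto simp: quot_carrier quot_add quot_smult smult_l_distr smult_r_distr)

text \<open>The correspondence between submodules of M / N and submodules of M containing N, by
  preimage and image under the coset map.\<close>

lemma module_length_quot:
  "module_length R (quot_module R M N) = chain_len (submods R M) N (carrier M)"
proof -
  let ?q = "quot_module R M N"
  interpret q: module R ?q by (rule module_quot)
  \<comment> \<open>The definition of length has no bounds on its chains; the bounds inserted here
    hold for every submodule.\<close>
  have eq: "module_length R ?q = chain_len (submods R ?q) {} (carrier ?q)"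
  proof -
    have "chain_in (submods R ?q) {} (carrier ?q) n C \<longleftrightarrow>
        (\<forall>i\<le>n. submodule (C i) R ?q) \<and> (\<forall>i<n. C i \<subset> C (Suc i))" for n C
      using submoduleD(1)[OF module_quot] unfolding chain_in_def by auto
    then have "(\<exists>C. chain_in (submods R ?q) {} (carrier ?q) n C) \<longleftrightarrow>
        (\<exists>C. (\<forall>i\<le>n. submodule (C i) R ?q) \<and> (\<forall>i<n. C i \<subset> C (Suc i)))" for n by auto
    then show ?thesis unfolding module_length_def chain_len_def by presburger
  qed
  have "chain_len (submods R ?q) {} (carrier ?q) \<le> chain_len (submods R M) N (carrier M)"
  proof (rule chain_len_mono_map[where \<Phi> = "\<lambda>W. {x \<in> carrier M. N +>\<^bsub>M\<^esub> x \<in> W}"])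
    fix W assume W: "W \<in> submods R ?q"
    note WD = submoduleD[OF module_quot, of W]
    have W': "submodule W R ?q" using W by simp
    have "submodule {x \<in> carrier M. N +>\<^bsub>M\<^esub> x \<in> W} R M"
    proof (rule submoduleI'[OF RM])
      show "\<zero>\<^bsub>M\<^esub> \<in> {x \<in> carrier M. N +>\<^bsub>M\<^esub> x \<in> W}" using WD(2)[OF W'] quot_zero by simp
      fix x y assume "x \<in> {x \<in> carrier M. N +>\<^bsub>M\<^esub> x \<in> W}" "y \<in> {x \<in> carrier M. N +>\<^bsub>M\<^esub> x \<in> W}"
      then show "x \<oplus>\<^bsub>M\<^esub> y \<in> {x \<in> carrier M. N +>\<^bsub>M\<^esub> x \<in> W}"
        using WD(3)[OF W', of "N +>\<^bsub>M\<^esub> x" "N +>\<^bsub>M\<^esub> y"] by (simp add: quot_add)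
    next
      fix r x assume "r \<in> carrier R" "x \<in> {x \<in> carrier M. N +>\<^bsub>M\<^esub> x \<in> W}"
      then show "r \<odot>\<^bsub>M\<^esub> x \<in> {x \<in> carrier M. N +>\<^bsub>M\<^esub> x \<in> W}"
        using WD(4)[OF W', of r "N +>\<^bsub>M\<^esub> x"] by (simp add: quot_smult)
    qed auto
    moreover have "N \<subseteq> {x \<in> carrier M. N +>\<^bsub>M\<^esub> x \<in> W}"
    proof
      fix x assume x: "x \<in> N"
      then have xM: "x \<in> carrier M" using N.a_subset by auto
      then have "N +>\<^bsub>M\<^esub> x = N +>\<^bsub>M\<^esub> \<zero>\<^bsub>M\<^esub>" using x coset_eq_iff[of x "\<zero>\<^bsub>M\<^esub>"] by (simp add: a_minus_def)
      then show "x \<in> {x \<in> carrier M. N +>\<^bsub>M\<^esub> x \<in> W}" using WD(2)[OF W'] xM quot_zero by simp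
    qed
    ultimately show "{x \<in> carrier M. N +>\<^bsub>M\<^esub> x \<in> W} \<in> submods R M \<and> N \<subseteq> {x \<in> carrier M. N +>\<^bsub>M\<^esub> x \<in> W} \<and>
       {x \<in> carrier M. N +>\<^bsub>M\<^esub> x \<in> W} \<subseteq> carrier M" by auto
  next
    fix W W' assume W: "W \<in> submods R ?q" "W' \<subseteq> carrier ?q" "W' \<in> submods R ?q" "W \<subset> W'"
    then obtain X where "X \<in> W'" "X \<notin> W" by auto
    moreover from this obtain x where "X = N +>\<^bsub>M\<^esub> x" "x \<in> carrier M" using W(2) unfolding quot_carrier by auto
    ultimately show "{x \<in> carrier M. N +>\<^bsub>M\<^esub> x \<in> W} \<subset> {x \<in> carrier M. N +>\<^bsub>M\<^esub> x \<in> W'}" using W(4) by auto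
  qed
  moreover have "chain_len (submods R M) N (carrier M) \<le> chain_len (submods R ?q) {} (carrier ?q)"
  proof (rule chain_len_mono_map[where \<Phi> = "\<lambda>W. (\<lambda>x. N +>\<^bsub>M\<^esub> x) ` W"])
    fix W assume W: "W \<in> submods R M" "N \<subseteq> W" "W \<subseteq> carrier M"
    note WD = submoduleD[OF RM, of W]
    have "submodule ((\<lambda>x. N +>\<^bsub>M\<^esub> x) ` W) R ?q"
    proof (rule submoduleI'[OF module_quot])
      fix X Y assume "X \<in> (\<lambda>x. N +>\<^bsub>M\<^esub> x) ` W" "Y \<in> (\<lambda>x. N +>\<^bsub>M\<^esub> x) ` W"
      then obtain x y where xy: "x \<in> W" "y \<in> W" "X = N +>\<^bsub>M\<^esub> x" "Y = N +>\<^bsub>M\<^esub> y" by auto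
      then have "X \<oplus>\<^bsub>?q\<^esub> Y = N +>\<^bsub>M\<^esub> (x \<oplus>\<^bsub>M\<^esub> y)" using W quot_add by blast
      then show "X \<oplus>\<^bsub>?q\<^esub> Y \<in> (\<lambda>x. N +>\<^bsub>M\<^esub> x) ` W" using xy WD(3) W by auto
    next
      fix r X assume "r \<in> carrier R" "X \<in> (\<lambda>x. N +>\<^bsub>M\<^esub> x) ` W"
      then obtain x where x: "x \<in> W" "X = N +>\<^bsub>M\<^esub> x" "r \<in> carrier R" by auto
      then have "r \<odot>\<^bsub>?q\<^esub> X = N +>\<^bsub>M\<^esub> (r \<odot>\<^bsub>M\<^esub> x)" using W quot_smult by blast
      then show "r \<odot>\<^bsub>?q\<^esub> X \<in> (\<lambda>x. N +>\<^bsub>M\<^esub> x) ` W" using x WD(4) W by auto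
    next
      show "\<zero>\<^bsub>?q\<^esub> \<in> (\<lambda>x. N +>\<^bsub>M\<^esub> x) ` W" unfolding quot_zero using WD(2) W by blast
      show "(\<lambda>x. N +>\<^bsub>M\<^esub> x) ` W \<subseteq> carrier ?q" using W(3) unfolding quot_carrier by blast
    qed
    moreover have "(\<lambda>x. N +>\<^bsub>M\<^esub> x) ` W \<subseteq> carrier ?q" using W(3) unfolding quot_carrier by blast
    ultimately show "(\<lambda>x. N +>\<^bsub>M\<^esub> x) ` W \<in> submods R ?q \<and> {} \<subseteq> (\<lambda>x. N +>\<^bsub>M\<^esub> x) ` W \<and> (\<lambda>x. N +>\<^bsub>M\<^esub> x) ` W \<subseteq> carrier ?q"
      by simp
  next
    fix W W' assume W: "W \<in> submods R M" "N \<subseteq> W" "W' \<subseteq> carrier M" "W' \<in> submods R M" "W \<subset> W'"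
    then obtain x where x: "x \<in> W'" "x \<notin> W" by auto
    have "N +>\<^bsub>M\<^esub> x \<notin> (\<lambda>x. N +>\<^bsub>M\<^esub> x) ` W"
    proof
      assume "N +>\<^bsub>M\<^esub> x \<in> (\<lambda>x. N +>\<^bsub>M\<^esub> x) ` W"
      then obtain y where y: "y \<in> W" "N +>\<^bsub>M\<^esub> x = N +>\<^bsub>M\<^esub> y" by auto
      have xy: "x \<in> carrier M" "y \<in> carrier M" using W x y by auto
      then have "x \<ominus>\<^bsub>M\<^esub> y \<in> W" using y W(2) coset_eq_iff by auto
      then have "(x \<ominus>\<^bsub>M\<^esub> y) \<oplus>\<^bsub>M\<^esub> y \<in> W" using submoduleD[OF RM, of W] W y by auto
      moreover have "(x \<ominus>\<^bsub>M\<^esub> y) \<oplus>\<^bsub>M\<^esub> y = x" using xy by (simp add: a_minus_def M.a_assoc M.l_neg)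
      ultimately show False using x by simp
    qed
    then show "(\<lambda>x. N +>\<^bsub>M\<^esub> x) ` W \<subset> (\<lambda>x. N +>\<^bsub>M\<^esub> x) ` W'" using W(5) x by auto
  qed
  ultimately show ?thesis unfolding eq by (rule antisym)
qed

end

section \<open>Homomorphisms and Hom modules\<close>

lemma mod_homD:
  assumes "f \<in> mod_hom R M N"
  shows "\<And>x. x \<in> carrier M \<Longrightarrow> f x \<in> carrier N"
    "\<And>x y. x \<in> carrier M \<Longrightarrow> y \<in> carrier M \<Longrightarrow> f (x \<oplus>\<^bsub>M\<^esub> y) = f x \<oplus>\<^bsub>N\<^esub> f y"
    "\<And>r x. r \<in> carrier R \<Longrightarrow> x \<in> carrier M \<Longrightarrow> f (r \<odot>\<^bsub>M\<^esub> x) = r \<odot>\<^bsub>N\<^esub> f x"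
    "f \<in> extensional (carrier M)"
  using assms unfolding mod_hom_def PiE_def by auto

lemma mod_homI:
  assumes "\<And>x. x \<in> carrier M \<Longrightarrow> f x \<in> carrier N"
    "\<And>x y. x \<in> carrier M \<Longrightarrow> y \<in> carrier M \<Longrightarrow> x \<oplus>\<^bsub>M\<^esub> y \<in> carrier M \<Longrightarrow> f (x \<oplus>\<^bsub>M\<^esub> y) = f x \<oplus>\<^bsub>N\<^esub> f y"
    "\<And>r x. r \<in> carrier R \<Longrightarrow> x \<in> carrier M \<Longrightarrow> r \<odot>\<^bsub>M\<^esub> x \<in> carrier M \<Longrightarrow> f (r \<odot>\<^bsub>M\<^esub> x) = r \<odot>\<^bsub>N\<^esub> f x"
    "module R M"
  shows "restrict f (carrier M) \<in> mod_hom R M N"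
proof -
  interpret module R M by fact
  show ?thesis unfolding mod_hom_def using assms by auto
qed

lemma mod_hom_zero:
  assumes "f \<in> mod_hom R M N" "module R M" "module R N"
  shows "f \<zero>\<^bsub>M\<^esub> = \<zero>\<^bsub>N\<^esub>"
proof -
  interpret M: module R M by fact
  interpret N: module R N by fact
  have "f (\<zero>\<^bsub>R\<^esub> \<odot>\<^bsub>M\<^esub> \<zero>\<^bsub>M\<^esub>) = \<zero>\<^bsub>R\<^esub> \<odot>\<^bsub>N\<^esub> f \<zero>\<^bsub>M\<^esub>"
    using mod_homD(3)[OF assms(1)] by blast
  then show ?thesis using mod_homD(1)[OF assms(1)] by simp
qed

lemma mod_hom_minus:
  assumes "f \<in> mod_hom R M N" "module R M" "module R N" "x \<in> carrier M"
  shows "f (\<ominus>\<^bsub>M\<^esub> x) = \<ominus>\<^bsub>N\<^esub> f x"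
proof -
  interpret M: module R M by fact
  interpret N: module R N by fact
  have "f ((\<ominus>\<^bsub>R\<^esub> \<one>\<^bsub>R\<^esub>) \<odot>\<^bsub>M\<^esub> x) = (\<ominus>\<^bsub>R\<^esub> \<one>\<^bsub>R\<^esub>) \<odot>\<^bsub>N\<^esub> f x"
    using mod_homD(3)[OF assms(1)] assms(4) by blast
  moreover have "(\<ominus>\<^bsub>R\<^esub> \<one>\<^bsub>R\<^esub>) \<odot>\<^bsub>M\<^esub> x = \<ominus>\<^bsub>M\<^esub> x"
    using assms(4) by (subst M.smult_l_minus) simp_all
  moreover have "(\<ominus>\<^bsub>R\<^esub> \<one>\<^bsub>R\<^esub>) \<odot>\<^bsub>N\<^esub> f x = \<ominus>\<^bsub>N\<^esub> f x"
    using mod_homD(1)[OF assms(1,4)] by (subst N.smult_l_minus) simp_all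
  ultimately show ?thesis by simp
qed

lemma module_hom:
  assumes "module R M" "module R N"
  shows "module R (hom_module R M N)"
proof -
  interpret M: module R M by fact
  interpret N: module R N by fact
  let ?H = "hom_module R M N"
  have c: "carrier ?H = mod_hom R M N" by (simp add: hom_module_def)
  have ext: "f = g" if "f \<in> mod_hom R M N" "g \<in> mod_hom R M N" "\<And>x. x \<in> carrier M \<Longrightarrow> f x = g x" for f g
    using that mod_homD(4) by (metis extensionalityI)
  have add: "f \<oplus>\<^bsub>?H\<^esub> g = (\<lambda>x\<in>carrier M. f x \<oplus>\<^bsub>N\<^esub> g x)" for f g by (simp add: hom_module_def)
  have sm: "r \<odot>\<^bsub>?H\<^esub> g = (\<lambda>x\<in>carrier M. r \<odot>\<^bsub>N\<^esub> g x)" for r g by (simp add: hom_module_def)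
  have z: "\<zero>\<^bsub>?H\<^esub> = (\<lambda>x\<in>carrier M. \<zero>\<^bsub>N\<^esub>)" by (simp add: hom_module_def)
  have addc: "(\<lambda>x\<in>carrier M. f x \<oplus>\<^bsub>N\<^esub> g x) \<in> mod_hom R M N" if "f \<in> mod_hom R M N" "g \<in> mod_hom R M N" for f g
    using mod_homD(1-3)[OF that(1)] mod_homD(1-3)[OF that(2)]
    by (intro mod_homI[OF _ _ _ assms(1)]) (simp_all add: N.smult_r_distr N.a_ac)
  have smc: "(\<lambda>x\<in>carrier M. r \<odot>\<^bsub>N\<^esub> f x) \<in> mod_hom R M N" if r: "r \<in> carrier R" and f: "f \<in> mod_hom R M N" for r f
  proof (rule mod_homI[OF _ _ _ assms(1)])
    fix s x assume s: "s \<in> carrier R" "x \<in> carrier M"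
    have "r \<odot>\<^bsub>N\<^esub> f (s \<odot>\<^bsub>M\<^esub> x) = (r \<otimes>\<^bsub>R\<^esub> s) \<odot>\<^bsub>N\<^esub> f x" using s r mod_homD(1,3)[OF f] by (simp add: N.smult_assoc1)
    also have "\<dots> = (s \<otimes>\<^bsub>R\<^esub> r) \<odot>\<^bsub>N\<^esub> f x" using s r by (simp add: M.m_comm)
    also have "\<dots> = s \<odot>\<^bsub>N\<^esub> (r \<odot>\<^bsub>N\<^esub> f x)" using s r mod_homD(1)[OF f] by (simp add: N.smult_assoc1)
    finally show "r \<odot>\<^bsub>N\<^esub> f (s \<odot>\<^bsub>M\<^esub> x) = s \<odot>\<^bsub>N\<^esub> (r \<odot>\<^bsub>N\<^esub> f x)" .
  qed (use r mod_homD(1,2)[OF f] in \<open>simp_all add: N.smult_r_distr\<close>)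
  have zc: "(\<lambda>x\<in>carrier M. \<zero>\<^bsub>N\<^esub>) \<in> mod_hom R M N"
    by (intro mod_homI[OF _ _ _ assms(1)]) simp_all
  show ?thesis
  proof (rule moduleI)
    show "cring R" ..
    show "abelian_group ?H"
    proof (rule abelian_groupI)
      fix f assume f: "f \<in> carrier ?H"
      show "\<exists>g\<in>carrier ?H. g \<oplus>\<^bsub>?H\<^esub> f = \<zero>\<^bsub>?H\<^esub>"
      proof (intro bexI)
        show "(\<lambda>x\<in>carrier M. (\<ominus>\<^bsub>R\<^esub> \<one>\<^bsub>R\<^esub>) \<odot>\<^bsub>N\<^esub> f x) \<in> carrier ?H" using smc f c by auto
        show "(\<lambda>x\<in>carrier M. (\<ominus>\<^bsub>R\<^esub> \<one>\<^bsub>R\<^esub>) \<odot>\<^bsub>N\<^esub> f x) \<oplus>\<^bsub>?H\<^esub> f = \<zero>\<^bsub>?H\<^esub>"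
          unfolding add z using f mod_homD(1)[of f R M N] c N.smult_l_minus[of "\<one>\<^bsub>R\<^esub>"]
          by (intro restrict_ext) (auto simp: N.l_neg)
      qed
    next
      fix f g assume f: "f \<in> carrier ?H" "g \<in> carrier ?H"
      show "f \<oplus>\<^bsub>?H\<^esub> g \<in> carrier ?H" using f unfolding c add by (intro addc)
      show "f \<oplus>\<^bsub>?H\<^esub> g = g \<oplus>\<^bsub>?H\<^esub> f" using f unfolding c add
        by (intro restrict_ext N.a_comm) (auto simp: mod_homD(1))
      fix h assume h: "h \<in> carrier ?H"
      show "f \<oplus>\<^bsub>?H\<^esub> g \<oplus>\<^bsub>?H\<^esub> h = f \<oplus>\<^bsub>?H\<^esub> (g \<oplus>\<^bsub>?H\<^esub> h)" using f h unfolding c add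
        by (intro restrict_ext) (simp add: N.a_assoc mod_homD(1))
    next
      show "\<zero>\<^bsub>?H\<^esub> \<in> carrier ?H" unfolding c z by (rule zc)
      fix f assume f: "f \<in> carrier ?H"
      show "\<zero>\<^bsub>?H\<^esub> \<oplus>\<^bsub>?H\<^esub> f = f" unfolding add z using f c
        by (intro ext addc zc) (auto simp: mod_homD(1) intro!: addc[of "\<lambda>x\<in>carrier M. \<zero>\<^bsub>N\<^esub>"] zc)
    qed
  next
    fix f assume f: "f \<in> carrier ?H"
    show "\<one>\<^bsub>R\<^esub> \<odot>\<^bsub>?H\<^esub> f = f" unfolding sm using f c
      by (intro ext) (auto intro!: smc simp: mod_homD(1))
  next
    fix a f g assume a: "a \<in> carrier R" "f \<in> carrier ?H"
    then show "a \<odot>\<^bsub>?H\<^esub> f \<in> carrier ?H" unfolding c sm by (intro smc)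
    assume "g \<in> carrier ?H"
    with a show "a \<odot>\<^bsub>?H\<^esub> (f \<oplus>\<^bsub>?H\<^esub> g) = a \<odot>\<^bsub>?H\<^esub> f \<oplus>\<^bsub>?H\<^esub> a \<odot>\<^bsub>?H\<^esub> g"
      unfolding c sm add by (intro restrict_ext) (simp add: mod_homD(1) N.smult_r_distr)
  next
    fix a b f assume a: "a \<in> carrier R" "b \<in> carrier R" "f \<in> carrier ?H"
    then show "(a \<oplus>\<^bsub>R\<^esub> b) \<odot>\<^bsub>?H\<^esub> f = a \<odot>\<^bsub>?H\<^esub> f \<oplus>\<^bsub>?H\<^esub> b \<odot>\<^bsub>?H\<^esub> f"
      unfolding c sm add by (intro restrict_ext) (simp add: mod_homD(1) N.smult_l_distr)
    from a show "(a \<otimes>\<^bsub>R\<^esub> b) \<odot>\<^bsub>?H\<^esub> f = a \<odot>\<^bsub>?H\<^esub> (b \<odot>\<^bsub>?H\<^esub> f)"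
      unfolding c sm by (intro restrict_ext) (simp add: mod_homD(1) N.smult_assoc1)
  qed
qed

section \<open>Free modules and free resolutions\<close>

lemma cring_idealI:
  assumes "cring R" "I \<subseteq> carrier R" "\<zero>\<^bsub>R\<^esub> \<in> I" "\<And>x y. x \<in> I \<Longrightarrow> y \<in> I \<Longrightarrow> x \<oplus>\<^bsub>R\<^esub> y \<in> I"
    "\<And>r x. r \<in> carrier R \<Longrightarrow> x \<in> I \<Longrightarrow> r \<otimes>\<^bsub>R\<^esub> x \<in> I"
  shows "ideal I R"
proof -
  interpret cring R by fact
  have "\<ominus>\<^bsub>R\<^esub> x \<in> I" if x: "x \<in> I" for x
  proof -
    have "(\<ominus>\<^bsub>R\<^esub> \<one>\<^bsub>R\<^esub>) \<otimes>\<^bsub>R\<^esub> x \<in> I" using assms(5) x by simp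
    moreover have "(\<ominus>\<^bsub>R\<^esub> \<one>\<^bsub>R\<^esub>) \<otimes>\<^bsub>R\<^esub> x = \<ominus>\<^bsub>R\<^esub> x" using x assms(2) by (subst l_minus) auto
    ultimately show ?thesis by simp
  qed
  then have "subgroup I (add_monoid R)"
    using assms by (intro subgroup.intro) (auto simp: a_inv_def)
  moreover have "x \<otimes>\<^bsub>R\<^esub> r \<in> I" if "r \<in> carrier R" "x \<in> I" for r x
    using assms(5)[OF that] that assms(2) m_comm by auto
  ultimately show ?thesis using assms(5) by (intro idealI) (auto intro: ring_axioms)
qed

lemma cring_idealD:
  assumes "cring R" "ideal I R"
  shows "I \<subseteq> carrier R" "\<zero>\<^bsub>R\<^esub> \<in> I" "\<And>x y. x \<in> I \<Longrightarrow> y \<in> I \<Longrightarrow> x \<oplus>\<^bsub>R\<^esub> y \<in> I"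
    "\<And>r x. r \<in> carrier R \<Longrightarrow> x \<in> I \<Longrightarrow> r \<otimes>\<^bsub>R\<^esub> x \<in> I"
proof -
  interpret ideal I R by fact
  show "I \<subseteq> carrier R" "\<zero>\<^bsub>R\<^esub> \<in> I" "\<And>x y. x \<in> I \<Longrightarrow> y \<in> I \<Longrightarrow> x \<oplus>\<^bsub>R\<^esub> y \<in> I"
    "\<And>r x. r \<in> carrier R \<Longrightarrow> x \<in> I \<Longrightarrow> r \<otimes>\<^bsub>R\<^esub> x \<in> I"
    using a_subset I_l_closed by auto
qed

lemma free_module_simps [simp]:
  "carrier (free_module R n) = {..<n} \<rightarrow>\<^sub>E carrier R"
  "\<zero>\<^bsub>free_module R n\<^esub> = (\<lambda>i\<in>{..<n}. \<zero>\<^bsub>R\<^esub>)"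
  "x \<oplus>\<^bsub>free_module R n\<^esub> y = (\<lambda>i\<in>{..<n}. x i \<oplus>\<^bsub>R\<^esub> y i)"
  "r \<odot>\<^bsub>free_module R n\<^esub> x = (\<lambda>i\<in>{..<n}. r \<otimes>\<^bsub>R\<^esub> x i)"
  by (simp_all add: free_module_def)

definition unit_vec :: "('a, 'c) ring_scheme \<Rightarrow> nat \<Rightarrow> nat \<Rightarrow> nat \<Rightarrow> 'a" where
  "unit_vec R n i = (\<lambda>j\<in>{..<n}. if j = i then \<one>\<^bsub>R\<^esub> else \<zero>\<^bsub>R\<^esub>)"

context cring
begin

abbreviation "FM n \<equiv> free_module R n"

lemma FM_mem: "x \<in> carrier (FM n) \<Longrightarrow> i < n \<Longrightarrow> x i \<in> carrier R"
  by (auto simp: PiE_mem)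

lemma FM_eqI:
  assumes "x \<in> carrier (FM n)" "y \<in> carrier (FM n)" "\<And>i. i < n \<Longrightarrow> x i = y i"
  shows "x = y"
  using assms by (auto intro: PiE_ext[of _ "{..<n}"])

lemma module_free: "module R (FM n)"
proof (rule moduleI)
  show "cring R" ..
  show "abelian_group (FM n)"
  proof (rule abelian_groupI)
    fix x assume x: "x \<in> carrier (FM n)"
    have "(\<lambda>i\<in>{..<n}. \<ominus> x i) \<in> carrier (FM n)" using FM_mem[OF x] by auto
    moreover have "(\<lambda>i\<in>{..<n}. \<ominus> x i) \<oplus>\<^bsub>FM n\<^esub> x = \<zero>\<^bsub>FM n\<^esub>"
      using FM_mem[OF x] by (auto intro!: restrict_ext simp: l_neg)
    ultimately show "\<exists>y\<in>carrier (FM n). y \<oplus>\<^bsub>FM n\<^esub> x = \<zero>\<^bsub>FM n\<^esub>" by blast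
  next
    fix x y assume xy: "x \<in> carrier (FM n)" "y \<in> carrier (FM n)"
    show "x \<oplus>\<^bsub>FM n\<^esub> y \<in> carrier (FM n)" using FM_mem[OF xy(1)] FM_mem[OF xy(2)] by auto
    show "x \<oplus>\<^bsub>FM n\<^esub> y = y \<oplus>\<^bsub>FM n\<^esub> x" using FM_mem[OF xy(1)] FM_mem[OF xy(2)] by (auto intro!: restrict_ext a_comm)
    fix z assume z: "z \<in> carrier (FM n)"
    show "x \<oplus>\<^bsub>FM n\<^esub> y \<oplus>\<^bsub>FM n\<^esub> z = x \<oplus>\<^bsub>FM n\<^esub> (y \<oplus>\<^bsub>FM n\<^esub> z)"
      using FM_mem[OF xy(1)] FM_mem[OF xy(2)] FM_mem[OF z] by (auto intro!: restrict_ext a_assoc)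
  next
    fix x assume x: "x \<in> carrier (FM n)"
    show "\<zero>\<^bsub>FM n\<^esub> \<oplus>\<^bsub>FM n\<^esub> x = x"
      using FM_mem[OF x] x by (intro FM_eqI[where n=n]) auto
  qed auto
next
  fix a x assume x: "a \<in> carrier R" "x \<in> carrier (FM n)"
  show "a \<odot>\<^bsub>FM n\<^esub> x \<in> carrier (FM n)" using FM_mem[OF x(2)] x by auto
  fix y assume y: "y \<in> carrier (FM n)"
  show "a \<odot>\<^bsub>FM n\<^esub> (x \<oplus>\<^bsub>FM n\<^esub> y) = a \<odot>\<^bsub>FM n\<^esub> x \<oplus>\<^bsub>FM n\<^esub> a \<odot>\<^bsub>FM n\<^esub> y"
    using FM_mem[OF x(2)] FM_mem[OF y] x by (auto intro!: restrict_ext simp: r_distr)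
next
  fix a b x assume x: "a \<in> carrier R" "b \<in> carrier R" "x \<in> carrier (FM n)"
  show "(a \<oplus> b) \<odot>\<^bsub>FM n\<^esub> x = a \<odot>\<^bsub>FM n\<^esub> x \<oplus>\<^bsub>FM n\<^esub> b \<odot>\<^bsub>FM n\<^esub> x"
    using FM_mem[OF x(3)] x by (auto intro!: restrict_ext simp: l_distr)
  show "(a \<otimes> b) \<odot>\<^bsub>FM n\<^esub> x = a \<odot>\<^bsub>FM n\<^esub> (b \<odot>\<^bsub>FM n\<^esub> x)"
    using FM_mem[OF x(3)] x by (auto intro!: restrict_ext simp: m_assoc)
next
  fix x assume x: "x \<in> carrier (FM n)"
  show "\<one> \<odot>\<^bsub>FM n\<^esub> x = x"
    using FM_mem[OF x] x by (intro FM_eqI[where n=n]) auto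
qed

lemma unit_vec_closed: "unit_vec R n i \<in> carrier (FM n)"
  by (auto simp: unit_vec_def)

text \<open>The unit vectors generate: by induction on k, the vector v cut off after its first k
  coordinates lies in U. Equality of homomorphisms and other linear conditions are later checked on
  unit vectors through this lemma.\<close>

lemma free_submodule_all:
  assumes "submodule U R (FM n)" "\<And>i. i < n \<Longrightarrow> unit_vec R n i \<in> U"
  shows "U = carrier (FM n)"
proof
  note UD = submoduleD[OF module_free assms(1)]
  show "U \<subseteq> carrier (FM n)" by (rule UD(1))
  show "carrier (FM n) \<subseteq> U"
  proof
    fix v assume v: "v \<in> carrier (FM n)"
    have "(\<lambda>j\<in>{..<n}. if j < k then v j else \<zero>) \<in> U" if "k \<le> n" for k
      using that
    proof (induction k)
      case 0
      have "(\<lambda>j\<in>{..<n}. if j < 0 then v j else \<zero>) = \<zero>\<^bsub>FM n\<^esub>"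
        unfolding free_module_simps by (intro restrict_ext) simp
      then show ?case using UD(2) by metis
    next
      case (Suc k)
      have "(\<lambda>j\<in>{..<n}. if j < Suc k then v j else \<zero>) =
        (\<lambda>j\<in>{..<n}. if j < k then v j else \<zero>) \<oplus>\<^bsub>FM n\<^esub> (v k \<odot>\<^bsub>FM n\<^esub> unit_vec R n k)"
        unfolding free_module_simps unit_vec_def
        using FM_mem[OF v] Suc.prems by (intro restrict_ext) (auto simp: less_Suc_eq)
      also have "\<dots> \<in> U"
        by (rule UD(3)[OF Suc.IH[OF Suc_leD[OF Suc.prems]] UD(4)[OF FM_mem[OF v] assms(2)]]) (use Suc.prems in simp_all)
      finally show ?case .
    qed
    from this[OF order_refl] have U: "(\<lambda>j\<in>{..<n}. if j < n then v j else \<zero>) \<in> U" .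
    have "(\<lambda>j\<in>{..<n}. if j < n then v j else \<zero>) = v"
      by (rule FM_eqI[OF subsetD[OF UD(1) U] v]) simp
    then show "v \<in> U" using U by metis
  qed
qed

lemma free_hom_eq:
  assumes "f \<in> mod_hom R (FM n) N" "g \<in> mod_hom R (FM n) N" "module R N"
    "\<And>i. i < n \<Longrightarrow> f (unit_vec R n i) = g (unit_vec R n i)" "v \<in> carrier (FM n)"
  shows "f v = g v"
proof -
  interpret N: module R N by fact
  interpret F: module R "FM n" by (rule module_free)
  have "submodule {v \<in> carrier (FM n). f v = g v} R (FM n)"
    using mod_homD(1-3)[OF assms(1)] mod_homD(1-3)[OF assms(2)] mod_hom_zero[OF assms(1) module_free assms(3)]
      mod_hom_zero[OF assms(2) module_free assms(3)] F.zero_closed F.a_closed F.smult_closed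
    by (intro submoduleI'[OF module_free]) (auto simp del: free_module_simps)
  then have "{v \<in> carrier (FM n). f v = g v} = carrier (FM n)"
    using assms(4) unit_vec_closed by (intro free_submodule_all) auto
  then show ?thesis using assms(5) by blast
qed

lemma free_hom_ex:
  assumes "module R N" "\<And>i. i < n \<Longrightarrow> t i \<in> carrier N"
  obtains h where "h \<in> mod_hom R (FM n) N" "\<And>i. i < n \<Longrightarrow> h (unit_vec R n i) = t i"
proof -
  interpret N: module R N by fact
  interpret F: module R "FM n" by (rule module_free)
  define h where "h = (\<lambda>v. \<Oplus>\<^bsub>N\<^esub>i\<in>{..<n}. v i \<odot>\<^bsub>N\<^esub> t i)"
  have cl: "(\<lambda>i. v i \<odot>\<^bsub>N\<^esub> t i) \<in> {..<n} \<rightarrow> carrier N" if "v \<in> carrier (FM n)" for v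
    using FM_mem[OF that] assms(2) by auto
  have "restrict h (carrier (FM n)) \<in> mod_hom R (FM n) N"
  proof (rule mod_homI[OF _ _ _ module_free])
    fix x y assume xy: "x \<in> carrier (FM n)" "y \<in> carrier (FM n)"
    have "h (x \<oplus>\<^bsub>FM n\<^esub> y) = (\<Oplus>\<^bsub>N\<^esub>i\<in>{..<n}. x i \<odot>\<^bsub>N\<^esub> t i \<oplus>\<^bsub>N\<^esub> y i \<odot>\<^bsub>N\<^esub> t i)"
      unfolding h_def using FM_mem[OF xy(1)] FM_mem[OF xy(2)] assms(2)
      by (intro N.finsum_cong') (auto simp: N.smult_l_distr)
    also have "\<dots> = h x \<oplus>\<^bsub>N\<^esub> h y" unfolding h_def using cl[OF xy(1)] cl[OF xy(2)] by (simp add: N.finsum_addf)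
    finally show "h (x \<oplus>\<^bsub>FM n\<^esub> y) = h x \<oplus>\<^bsub>N\<^esub> h y" .
  next
    fix r x assume r: "r \<in> carrier R" "x \<in> carrier (FM n)"
    have "h (r \<odot>\<^bsub>FM n\<^esub> x) = (\<Oplus>\<^bsub>N\<^esub>i\<in>{..<n}. r \<odot>\<^bsub>N\<^esub> (x i \<odot>\<^bsub>N\<^esub> t i))"
      unfolding h_def using FM_mem[OF r(2)] r assms(2)
      by (intro N.finsum_cong') (auto simp: N.smult_assoc1)
    also have "\<dots> = r \<odot>\<^bsub>N\<^esub> h x" unfolding h_def using cl[OF r(2)] r by (subst N.finsum_smult_ldistr) auto
    finally show "h (r \<odot>\<^bsub>FM n\<^esub> x) = r \<odot>\<^bsub>N\<^esub> h x" .
  next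
    fix x assume "x \<in> carrier (FM n)"
    then show "h x \<in> carrier N" unfolding h_def using cl by (intro N.finsum_closed)
  qed
  moreover have "restrict h (carrier (FM n)) (unit_vec R n i) = t i" if i: "i < n" for i
  proof -
    have "h (unit_vec R n i) = (\<Oplus>\<^bsub>N\<^esub>j\<in>{..<n}. if i = j then t j else \<zero>\<^bsub>N\<^esub>)"
      unfolding h_def unit_vec_def using assms(2) by (intro N.finsum_cong') auto
    also have "\<dots> = t i" using i assms(2) by (intro N.finsum_singleton) auto
    finally show ?thesis using unit_vec_closed by simp
  qed
  ultimately show ?thesis using that by blast
qed

text \<open>Projectivity of free modules: choose preimages of the images of the unit
  vectors.\<close>

lemma free_lift:
  assumes "module R P" "module R N" "d \<in> mod_hom R P N" "s \<in> mod_hom R (FM n) N"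
    "\<And>v. v \<in> carrier (FM n) \<Longrightarrow> s v \<in> d ` carrier P"
  obtains \<sigma> where "\<sigma> \<in> mod_hom R (FM n) P" "\<And>v. v \<in> carrier (FM n) \<Longrightarrow> d (\<sigma> v) = s v"
proof -
  interpret P: module R P by fact
  interpret F: module R "FM n" by (rule module_free)
  have "\<exists>w. w \<in> carrier P \<and> d w = s (unit_vec R n i)" for i
    using assms(5)[OF unit_vec_closed[of n i]] unfolding image_iff by metis
  then obtain t where t: "\<And>i. t i \<in> carrier P" "\<And>i. d (t i) = s (unit_vec R n i)" by metis
  obtain \<sigma> where \<sigma>: "\<sigma> \<in> mod_hom R (FM n) P" "\<And>i. i < n \<Longrightarrow> \<sigma> (unit_vec R n i) = t i"
    using free_hom_ex[OF assms(1), of n t] t(1) by blast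
  have c: "(\<lambda>v\<in>carrier (FM n). d (\<sigma> v)) \<in> mod_hom R (FM n) N"
    by (rule mod_homI[OF _ _ _ module_free])
      (use mod_homD(1-3)[OF \<sigma>(1)] mod_homD(1-3)[OF assms(3)] in \<open>simp_all del: free_module_simps\<close>)
  have "d (\<sigma> v) = s v" if v: "v \<in> carrier (FM n)" for v
    using free_hom_eq[OF c assms(4,2) _ v] t(2) \<sigma>(2) v unit_vec_closed by (simp del: free_module_simps)
  then show ?thesis using that \<sigma>(1) by blast
qed

lemma ker_submodule:
  assumes "module R M" "module R N" "f \<in> mod_hom R M N"
  shows "submodule {x \<in> carrier M. f x = \<zero>\<^bsub>N\<^esub>} R M"
proof -
  interpret M: module R M by fact
  interpret N: module R N by fact
  show ?thesis
    using mod_homD(1-3)[OF assms(3)] mod_hom_zero[OF assms(3,1,2)]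
    by (intro submoduleI'[OF assms(1)]) auto
qed

lemma image_submodule:
  assumes "module R M" "module R N" "f \<in> mod_hom R M N"
  shows "submodule (f ` carrier M) R N"
proof -
  interpret M: module R M by fact
  interpret N: module R N by fact
  note D = mod_homD(1-3)[OF assms(3)]
  show ?thesis
  proof (intro submoduleI'[OF assms(2)])
    show "\<zero>\<^bsub>N\<^esub> \<in> f ` carrier M" using mod_hom_zero[OF assms(3,1,2)] M.M.zero_closed by (metis imageI)
    fix x y assume "x \<in> f ` carrier M" "y \<in> f ` carrier M"
    then obtain a b where "a \<in> carrier M" "b \<in> carrier M" "x = f a" "y = f b" by blast
    then show "x \<oplus>\<^bsub>N\<^esub> y \<in> f ` carrier M" using D(2)[of a b] M.M.a_closed by (metis imageI)
  next
    fix r x assume "r \<in> carrier R" "x \<in> f ` carrier M"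
    then obtain a where "a \<in> carrier M" "x = f a" "r \<in> carrier R" by blast
    then show "r \<odot>\<^bsub>N\<^esub> x \<in> f ` carrier M" using D(3)[of r a] M.smult_closed by (metis imageI)
  qed (use D in auto)
qed

lemma coord_ideal:
  assumes Z: "submodule Z R (FM N)" and n: "n < N"
  shows "ideal {v n |v. v \<in> Z} R"
proof (rule cring_idealI)
  note D = submoduleD[OF module_free Z]
  show "cring R" ..
  show "{v n |v. v \<in> Z} \<subseteq> carrier R" using D(1) n FM_mem by blast
  show "\<zero> \<in> {v n |v. v \<in> Z}" using D(2) n by (auto intro!: exI[of _ "\<lambda>i\<in>{..<N}. \<zero>"])
  fix x y assume "x \<in> {v n |v. v \<in> Z}" "y \<in> {v n |v. v \<in> Z}"
  then obtain v w where "v \<in> Z" "w \<in> Z" "x = v n" "y = w n" by auto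
  then show "x \<oplus> y \<in> {v n |v. v \<in> Z}" using D(3)[of v w] n by (auto intro!: exI[of _ "v \<oplus>\<^bsub>FM N\<^esub> w"])
next
  note D = submoduleD[OF module_free Z]
  fix r x assume "r \<in> carrier R" "x \<in> {v n |v. v \<in> Z}"
  then obtain v where "v \<in> Z" "x = v n" "r \<in> carrier R" by auto
  then show "r \<otimes> x \<in> {v n |v. v \<in> Z}" using D(4)[of r v] n by (auto intro!: exI[of _ "r \<odot>\<^bsub>FM N\<^esub> v"])
qed

text \<open>Submodules of a free module of finite rank over a Noetherian ring are finitely
  generated. The coordinates at position n form a finitely generated ideal, and the part of Z where
  that coordinate vanishes is covered by induction. The vanishing of the coordinates from n on
  replaces smaller free modules, so the ambient rank N stays fixed.\<close>

lemma free_submodule_fg_aux: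
  assumes "noetherian_ring R"
  shows "n \<le> N \<Longrightarrow> submodule Z R (FM N) \<Longrightarrow> (\<And>v i. v \<in> Z \<Longrightarrow> n \<le> i \<Longrightarrow> i < N \<Longrightarrow> v i = \<zero>) \<Longrightarrow>
    \<exists>S. finite S \<and> S \<subseteq> Z \<and> (\<forall>W. submodule W R (FM N) \<longrightarrow> S \<subseteq> W \<longrightarrow> Z \<subseteq> W)"
proof (induction n arbitrary: Z)
  case 0
  have "Z \<subseteq> W" if W: "submodule W R (FM N)" for W
  proof
    fix v assume v: "v \<in> Z"
    have "v = \<zero>\<^bsub>FM N\<^esub>" using v 0 submoduleD(1)[OF module_free 0(2)]
      by (intro FM_eqI[where n=N]) auto
    then show "v \<in> W" using submoduleD(2)[OF module_free W] by metis
  qed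
  then show ?case by (intro exI[of _ "{}"]) auto
next
  case (Suc n)
  interpret noetherian_ring R by fact
  interpret F: module R "FM N" by (rule module_free)
  have n: "n < N" using Suc.prems by simp
  note D = submoduleD[OF module_free Suc.prems(2)]
  obtain T where T: "T \<subseteq> carrier R" "finite T" "{v n |v. v \<in> Z} = Idl T"
    using finetely_gen[OF coord_ideal[OF Suc.prems(2) n]] by blast
  have "T \<subseteq> {v n |v. v \<in> Z}" using T genideal_self by auto
  then have "\<forall>a\<in>T. \<exists>v\<in>Z. v n = a" by blast
  then obtain t where t: "\<And>a. a \<in> T \<Longrightarrow> t a \<in> Z" "\<And>a. a \<in> T \<Longrightarrow> t a n = a" by metis
  define Z0 where "Z0 = {v \<in> Z. v n = \<zero>}"
  have Z0: "submodule Z0 R (FM N)"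
    using D(1-4) n unfolding Z0_def by (intro submoduleI'[OF module_free]) auto
  have "\<exists>S. finite S \<and> S \<subseteq> Z0 \<and> (\<forall>W. submodule W R (FM N) \<longrightarrow> S \<subseteq> W \<longrightarrow> Z0 \<subseteq> W)"
  proof (rule Suc.IH[OF _ Z0])
    fix v i assume "v \<in> Z0" "n \<le> i" "i < N"
    then show "v i = \<zero>" using Suc.prems(3)[of v i] unfolding Z0_def by (cases "i = n") auto
  qed (use n in simp)
  then obtain S0 where S0: "finite S0" "S0 \<subseteq> Z0" "\<And>W. submodule W R (FM N) \<Longrightarrow> S0 \<subseteq> W \<Longrightarrow> Z0 \<subseteq> W" by blast
  have "Z \<subseteq> W" if W: "submodule W R (FM N)" "t ` T \<union> S0 \<subseteq> W" for W
  proof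
    fix v assume v: "v \<in> Z"
    note WD = submoduleD[OF module_free W(1)]
    have WZ: "submodule (W \<inter> Z) R (FM N)"
      using D(1-4) WD(1-4) by (intro submoduleI'[OF module_free]) (auto simp del: free_module_simps)
    have "T \<subseteq> {w n |w. w \<in> W \<inter> Z}"
    proof
      fix a assume a: "a \<in> T"
      then have "t a \<in> W \<inter> Z" "a = t a n" using t[OF a] W(2) by auto
      then show "a \<in> {w n |w. w \<in> W \<inter> Z}" by (intro CollectI exI conjI)
    qed
    then have "Idl T \<subseteq> {w n |w. w \<in> W \<inter> Z}" by (rule genideal_minimal[OF coord_ideal[OF WZ n]])
    moreover have "v n \<in> Idl T" unfolding T(3)[symmetric] by (intro CollectI exI[of _ v] conjI v refl)
    ultimately have "v n \<in> {w n |w. w \<in> W \<inter> Z}" by (rule subsetD)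
    then obtain w where w: "w \<in> W" "w \<in> Z" "v n = w n" by (elim CollectE exE conjE IntE)
    have vw: "v \<in> carrier (FM N)" "w \<in> carrier (FM N)" using v w D(1) by auto
    let ?u = "v \<oplus>\<^bsub>FM N\<^esub> ((\<ominus> \<one>) \<odot>\<^bsub>FM N\<^esub> w)"
    have "?u \<in> Z" by (rule D(3)[OF v D(4)[OF _ w(2)]]) simp
    moreover have "?u n = \<zero>" using w(3) n FM_mem[OF vw(2) n] by (simp add: l_minus r_neg)
    ultimately have "?u \<in> Z0" unfolding Z0_def by (intro CollectI conjI)
    moreover have "S0 \<subseteq> W" using W(2) by simp
    ultimately have "?u \<in> W" using S0(3)[OF W(1)] by (metis subsetD)
    then have "?u \<oplus>\<^bsub>FM N\<^esub> w \<in> W" by (rule WD(3)[OF _ w(1)])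
    moreover have "?u \<oplus>\<^bsub>FM N\<^esub> w = v"
    proof (rule FM_eqI[OF _ vw(1)])
      show "?u \<oplus>\<^bsub>FM N\<^esub> w \<in> carrier (FM N)" by (rule subsetD[OF WD(1) calculation])
    qed (use FM_mem[OF vw(1)] FM_mem[OF vw(2)] in \<open>simp add: l_minus a_assoc l_neg\<close>)
    ultimately show "v \<in> W" by metis
  qed
  then show ?case using T(2) S0(1,2) t(1) unfolding Z0_def by (intro exI[of _ "t ` T \<union> S0"]) auto
qed

lemma free_cover:
  assumes "noetherian_ring R" "submodule Z R (FM N)"
  obtains k d where "d \<in> mod_hom R (FM k) (FM N)" "d ` carrier (FM k) = Z"
proof -
  interpret F: module R "FM N" by (rule module_free)
  note D = submoduleD[OF module_free assms(2)]
  obtain S where S: "finite S" "S \<subseteq> Z" "\<And>W. submodule W R (FM N) \<Longrightarrow> S \<subseteq> W \<Longrightarrow> Z \<subseteq> W"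
    using free_submodule_fg_aux[OF assms(1) order_refl assms(2)] by auto
  obtain k t where kt: "S = t ` {i::nat. i < k}" using finite_imp_nat_seg_image_inj_on[OF S(1)] by auto
  have tZ: "t i \<in> Z" if "i < k" for i using kt S(2) that by auto
  obtain d where d: "d \<in> mod_hom R (FM k) (FM N)" "\<And>i. i < k \<Longrightarrow> d (unit_vec R k i) = t i"
    using free_hom_ex[OF module_free, of k t] subsetD[OF D(1) tZ] by metis
  have "submodule {v \<in> carrier (FM k). d v \<in> Z} R (FM k)"
  proof -
    interpret Fk: module R "FM k" by (rule module_free)
    show ?thesis
      using mod_homD(1-3)[OF d(1)] mod_hom_zero[OF d(1) module_free module_free] D(2-4) Fk.zero_closed
      by (intro submoduleI'[OF module_free]) (auto simp del: free_module_simps)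
  qed
  then have "{v \<in> carrier (FM k). d v \<in> Z} = carrier (FM k)"
    using unit_vec_closed d(2) tZ by (intro free_submodule_all) (auto simp del: free_module_simps)
  then have "d ` carrier (FM k) \<subseteq> Z" by auto
  moreover have "S \<subseteq> d ` carrier (FM k)"
  proof
    fix s assume "s \<in> S"
    then obtain i where "i < k" "s = t i" using kt by auto
    then show "s \<in> d ` carrier (FM k)" using d(2)[of i] unit_vec_closed by (metis imageI)
  qed
  then have "Z \<subseteq> d ` carrier (FM k)" by (rule S(3)[OF image_submodule[OF module_free module_free d(1)]])
  ultimately show ?thesis using that d(1) by blast
qed

text \<open>Each syzygy is a submodule of a free module of finite rank, hence the image of another
  one; dependent choice iterates this.\<close>

lemma free_resolution_ex:
  assumes "noetherian_ring R" "module R N" "\<epsilon> \<in> mod_hom R (FM n0) N" "\<epsilon> ` carrier (FM n0) = carrier N"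
  shows "\<exists>rk d. free_resolution R N rk d \<epsilon>"
proof -
  \<comment> \<open>A state is a rank together with the submodule that the next differential has to
    cover; the initial submodule is the kernel of \<epsilon>.\<close>
  define P where "P = (\<lambda>(i::nat) (x :: nat \<times> (nat \<Rightarrow> 'a) set). submodule (snd x) R (FM (fst x)) \<and>
    (i = 0 \<longrightarrow> x = (n0, {v \<in> carrier (FM n0). \<epsilon> v = \<zero>\<^bsub>N\<^esub>})))"
  define T where "T = (\<lambda>(x :: nat \<times> (nat \<Rightarrow> 'a) set) (y :: nat \<times> (nat \<Rightarrow> 'a) set) d. d \<in> mod_hom R (FM (fst y)) (FM (fst x)) \<and>
    d ` carrier (FM (fst y)) = snd x \<and> snd y = {v \<in> carrier (FM (fst y)). d v = \<zero>\<^bsub>FM (fst x)\<^esub>})"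
  have "\<exists>f. \<forall>i. P i (f i) \<and> (\<exists>d. T (f i) (f (Suc i)) d)"
  proof (rule dependent_nat_choice)
    show "\<exists>x. P 0 x"
      unfolding P_def using ker_submodule[OF module_free assms(2,3)]
      by (intro exI[of _ "(n0, {v \<in> carrier (FM n0). \<epsilon> v = \<zero>\<^bsub>N\<^esub>})"]) simp
    fix x i assume "P i x"
    then have x: "submodule (snd x) R (FM (fst x))" unfolding P_def by simp
    obtain k d where d: "d \<in> mod_hom R (FM k) (FM (fst x))" "d ` carrier (FM k) = snd x"
      by (rule free_cover[OF assms(1) x])
    have "P (Suc i) (k, {v \<in> carrier (FM k). d v = \<zero>\<^bsub>FM (fst x)\<^esub>}) \<and> (\<exists>d'. T x (k, {v \<in> carrier (FM k). d v = \<zero>\<^bsub>FM (fst x)\<^esub>}) d')"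
      unfolding P_def T_def using ker_submodule[OF module_free module_free d(1)]
      by (intro conjI exI[of _ d]) (simp_all add: d del: free_module_simps)
    then show "\<exists>y. P (Suc i) y \<and> (\<exists>d. T x y d)" by (rule exI)
  qed
  then obtain f where f: "\<And>i. P i (f i)" "\<And>i. \<exists>d. T (f i) (f (Suc i)) d" by blast
  then obtain d where d: "\<And>i. T (f i) (f (Suc i)) (d i)" by metis
  have f0: "f 0 = (n0, {v \<in> carrier (FM n0). \<epsilon> v = \<zero>\<^bsub>N\<^esub>})" using f(1)[of 0] unfolding P_def by simp
  have "free_resolution R N (\<lambda>i. fst (f i)) d \<epsilon>"
    unfolding free_resolution_def Let_def
    using f0 assms(3,4) d unfolding T_def by (simp del: free_module_simps)
  then show ?thesis by blast
qed

end

text \<open>The choice inside \<open>Ext\<close> depends on R and N only, so one resolution computes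
  all degrees and all second arguments at once.\<close>

lemma Ext_resolution:
  assumes "\<exists>rk d \<epsilon>. free_resolution R N rk d \<epsilon>"
  obtains rk d \<epsilon> where "free_resolution R N rk d \<epsilon>"
    "\<And>i M. Ext R i N M = quot_module R
          ((hom_module R (free_module R (rk i)) M)\<lparr>carrier := Ext_cocycles R rk d M i\<rparr>)
          (Ext_coboundaries R rk d M i)"
proof -
  define p where "p = (SOME (rk, d). \<exists>\<epsilon>. free_resolution R N rk d \<epsilon>)"
  obtain rk d where p: "p = (rk, d)" by (cases p)
  have "\<exists>p. (case p of (rk, d) \<Rightarrow> \<exists>\<epsilon>. free_resolution R N rk d \<epsilon>)" using assms by auto
  then have "case p of (rk, d) \<Rightarrow> \<exists>\<epsilon>. free_resolution R N rk d \<epsilon>" unfolding p_def by (rule someI_ex)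
  then obtain \<epsilon> where "free_resolution R N rk d \<epsilon>" using p by auto
  then show ?thesis using that p unfolding Ext_def p_def[symmetric] by simp
qed

section \<open>Fractional ideals\<close>

text \<open>Submodules as plain subsets of Q: those over \<open>AA\<close> are then literally among
  those over S. Closure under negatives follows from the scalar -1.\<close>

definition smods :: "('a, 'c) ring_scheme \<Rightarrow> 'a set \<Rightarrow> 'a set set" where
  "smods Q S = {N. N \<subseteq> carrier Q \<and> \<zero>\<^bsub>Q\<^esub> \<in> N \<and> (\<forall>a\<in>N. \<forall>b\<in>N. a \<oplus>\<^bsub>Q\<^esub> b \<in> N) \<and>
     (\<forall>s\<in>S. \<forall>a\<in>N. s \<otimes>\<^bsub>Q\<^esub> a \<in> N)}"

definition msum :: "('a, 'c) ring_scheme \<Rightarrow> 'a set \<Rightarrow> 'a set \<Rightarrow> 'a set" where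
  "msum Q N K = {a \<oplus>\<^bsub>Q\<^esub> b | a b. a \<in> N \<and> b \<in> K}"

definition scal :: "('a, 'c) ring_scheme \<Rightarrow> 'a \<Rightarrow> 'a set \<Rightarrow> 'a set" where
  "scal Q a N = (\<lambda>b. a \<otimes>\<^bsub>Q\<^esub> b) ` N"

text \<open>Regular fractional ideals. A common denominator stands in for finite generation, and
  containing a unit of Q expresses regularity.\<close>

definition fids :: "('a, 'c) ring_scheme \<Rightarrow> 'a set \<Rightarrow> 'a set set" where
  "fids Q S = {N \<in> smods Q S. N \<inter> Units Q \<noteq> {} \<and> (\<exists>s\<in>S \<inter> Units Q. \<forall>a\<in>N. s \<otimes>\<^bsub>Q\<^esub> a \<in> S)}"

text \<open>The denominator condition is inherited by every ring between S and Q, so that both R and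
  \<open>AA\<close> are instances over the same Q.\<close>

locale frac_ring = cring Q for Q (structure) +
  fixes S
  assumes subring: "subring S Q"
    and frac: "q \<in> carrier Q \<Longrightarrow> \<exists>s\<in>S \<inter> Units Q. s \<otimes> q \<in> S"
begin

abbreviation "SM \<equiv> smods Q S"
abbreviation "FI \<equiv> fids Q S"
abbreviation "len \<equiv> chain_len (smods Q S)"

lemma S_sub: "S \<subseteq> carrier Q" and S_zero: "\<zero> \<in> S" and S_one: "\<one> \<in> S"
  and S_add: "a \<in> S \<Longrightarrow> b \<in> S \<Longrightarrow> a \<oplus> b \<in> S" and S_mult: "a \<in> S \<Longrightarrow> b \<in> S \<Longrightarrow> a \<otimes> b \<in> S"
  and S_neg: "a \<in> S \<Longrightarrow> \<ominus> a \<in> S" and S_minus: "a \<in> S \<Longrightarrow> b \<in> S \<Longrightarrow> a \<ominus> b \<in> S"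
  using subringE[OF subring] by (auto simp: a_minus_def)

lemma S_carr [simp, intro]: "a \<in> S \<Longrightarrow> a \<in> carrier Q" using S_sub by auto

lemma smodsI:
  assumes "N \<subseteq> carrier Q" "\<zero> \<in> N" "\<And>a b. a \<in> N \<Longrightarrow> b \<in> N \<Longrightarrow> a \<oplus> b \<in> N" "\<And>s a. s \<in> S \<Longrightarrow> a \<in> N \<Longrightarrow> s \<otimes> a \<in> N"
  shows "N \<in> SM"
  using assms unfolding smods_def by auto

lemma smodsD:
  assumes "N \<in> SM"
  shows "\<And>a. a \<in> N \<Longrightarrow> a \<in> carrier Q" "\<zero> \<in> N" "\<And>a b. a \<in> N \<Longrightarrow> b \<in> N \<Longrightarrow> a \<oplus> b \<in> N"
    "\<And>s a. s \<in> S \<Longrightarrow> a \<in> N \<Longrightarrow> s \<otimes> a \<in> N" "\<And>s a. s \<in> S \<Longrightarrow> a \<in> N \<Longrightarrow> a \<otimes> s \<in> N"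
    "\<And>a. a \<in> N \<Longrightarrow> \<ominus> a \<in> N" "\<And>a b. a \<in> N \<Longrightarrow> b \<in> N \<Longrightarrow> a \<ominus> b \<in> N"
proof -
  show c: "\<And>a. a \<in> N \<Longrightarrow> a \<in> carrier Q" and "\<zero> \<in> N" and add: "\<And>a b. a \<in> N \<Longrightarrow> b \<in> N \<Longrightarrow> a \<oplus> b \<in> N"
    and m: "\<And>s a. s \<in> S \<Longrightarrow> a \<in> N \<Longrightarrow> s \<otimes> a \<in> N"
    using assms unfolding smods_def by auto
  show "\<And>s a. s \<in> S \<Longrightarrow> a \<in> N \<Longrightarrow> a \<otimes> s \<in> N" using m c m_comm by simp
  show neg: "\<ominus> a \<in> N" if "a \<in> N" for a
  proof -
    have "(\<ominus> \<one>) \<otimes> a \<in> N" using m that S_neg[OF S_one] by blast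
    then show ?thesis using c[OF that] by (simp add: l_minus)
  qed
  show "\<And>a b. a \<in> N \<Longrightarrow> b \<in> N \<Longrightarrow> a \<ominus> b \<in> N" unfolding a_minus_def using neg add by blast
qed

lemma S_smod: "S \<in> SM" by (rule smodsI) (auto simp: S_zero S_add S_mult)

lemma carrier_smod: "carrier Q \<in> SM" by (rule smodsI) auto

lemma Int_smod: "N \<in> SM \<Longrightarrow> K \<in> SM \<Longrightarrow> N \<inter> K \<in> SM"
  by (rule smodsI) (auto dest: smodsD)

section \<open>Sums, multiples, products and colons of submodules of Q\<close>

lemma msumI: "a \<in> N \<Longrightarrow> b \<in> K \<Longrightarrow> a \<oplus> b \<in> msum Q N K"
  unfolding msum_def by auto

lemma msumE: "c \<in> msum Q N K \<Longrightarrow> (\<And>a b. a \<in> N \<Longrightarrow> b \<in> K \<Longrightarrow> c = a \<oplus> b \<Longrightarrow> P) \<Longrightarrow> P"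
  unfolding msum_def by auto

lemma msum_smod:
  assumes N: "N \<in> SM" and K: "K \<in> SM"
  shows "msum Q N K \<in> SM"
proof (rule smodsI)
  show "msum Q N K \<subseteq> carrier Q" using smodsD(1)[OF N] smodsD(1)[OF K] by (auto elim!: msumE)
  show "\<zero> \<in> msum Q N K" using msumI[OF smodsD(2)[OF N] smodsD(2)[OF K]] by simp
next
  fix a b assume "a \<in> msum Q N K" "b \<in> msum Q N K"
  then obtain n k n' k' where *: "n \<in> N" "k \<in> K" "n' \<in> N" "k' \<in> K" "a = n \<oplus> k" "b = n' \<oplus> k'"
    by (auto elim!: msumE)
  have "a \<oplus> b = (n \<oplus> n') \<oplus> (k \<oplus> k')" using * smodsD(1)[OF N] smodsD(1)[OF K] by (simp add: a_ac)
  then show "a \<oplus> b \<in> msum Q N K" using msumI[OF smodsD(3)[OF N] smodsD(3)[OF K]] * by simp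
next
  fix s a assume "s \<in> S" "a \<in> msum Q N K"
  then obtain n k where *: "n \<in> N" "k \<in> K" "a = n \<oplus> k" "s \<in> S" by (auto elim!: msumE)
  have "s \<otimes> a = s \<otimes> n \<oplus> s \<otimes> k" using * smodsD(1)[OF N] smodsD(1)[OF K] by (simp add: r_distr)
  then show "s \<otimes> a \<in> msum Q N K" using msumI[OF smodsD(4)[OF N] smodsD(4)[OF K]] * by simp
qed

lemma msum_left: "N \<in> SM \<Longrightarrow> K \<in> SM \<Longrightarrow> N \<subseteq> msum Q N K"
proof
  fix a assume "N \<in> SM" "K \<in> SM" "a \<in> N"
  then show "a \<in> msum Q N K" using msumI[of a N \<zero> K] smodsD(1,2) by simp
qed

lemma msum_right: "N \<in> SM \<Longrightarrow> K \<in> SM \<Longrightarrow> K \<subseteq> msum Q N K"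
proof
  fix a assume "N \<in> SM" "K \<in> SM" "a \<in> K"
  then show "a \<in> msum Q N K" using msumI[of \<zero> N a K] smodsD(1,2) by simp
qed

lemma msum_least: "P \<in> SM \<Longrightarrow> N \<subseteq> P \<Longrightarrow> K \<subseteq> P \<Longrightarrow> msum Q N K \<subseteq> P"
  by (auto elim!: msumE intro: smodsD)

lemma scalI: "b \<in> N \<Longrightarrow> a \<otimes> b \<in> scal Q a N" unfolding scal_def by auto

lemma scalE: "c \<in> scal Q a N \<Longrightarrow> (\<And>b. b \<in> N \<Longrightarrow> c = a \<otimes> b \<Longrightarrow> P) \<Longrightarrow> P" unfolding scal_def by auto

lemma scal_mono: "N \<subseteq> K \<Longrightarrow> scal Q a N \<subseteq> scal Q a K" unfolding scal_def by auto

lemma scal_smod: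
  assumes "N \<in> SM" "a \<in> carrier Q"
  shows "scal Q a N \<in> SM"
proof (rule smodsI)
  note D = smodsD[OF assms(1)]
  show "scal Q a N \<subseteq> carrier Q" using D(1) assms(2) by (auto elim!: scalE)
  show "\<zero> \<in> scal Q a N" using scalI[OF D(2), of a] assms(2) by simp
  fix x y assume "x \<in> scal Q a N" "y \<in> scal Q a N"
  then obtain b c where "b \<in> N" "c \<in> N" "x = a \<otimes> b" "y = a \<otimes> c" by (auto elim!: scalE)
  then show "x \<oplus> y \<in> scal Q a N" using scalI[OF D(3), of b c a] D(1) assms(2) by (simp add: r_distr)
next
  note D = smodsD[OF assms(1)]
  fix s x assume "s \<in> S" "x \<in> scal Q a N"
  then obtain b where "b \<in> N" "x = a \<otimes> b" "s \<in> S" by (auto elim!: scalE)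
  then show "s \<otimes> x \<in> scal Q a N" using scalI[OF D(4), of s b a] D(1) assms(2) by (simp add: m_ac)
qed

lemma scal_scal:
  assumes "N \<subseteq> carrier Q" "a \<in> carrier Q" "b \<in> carrier Q"
  shows "scal Q a (scal Q b N) = scal Q (a \<otimes> b) N"
  unfolding scal_def image_image using assms by (intro image_cong refl) (auto simp: m_assoc)

lemma scal_one: "N \<subseteq> carrier Q \<Longrightarrow> scal Q \<one> N = N"
  unfolding scal_def by (auto simp: image_iff subset_iff)

lemma scal_inv:
  assumes "N \<subseteq> carrier Q" "u \<in> Units Q"
  shows "scal Q (inv u) (scal Q u N) = N" "scal Q u (scal Q (inv u) N) = N"
  using assms by (simp_all add: scal_scal scal_one Units_closed)

lemma smod_sub: "N \<in> SM \<Longrightarrow> N \<subseteq> carrier Q" unfolding smods_def by auto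

lemma cyc_mem: "y \<in> carrier Q \<Longrightarrow> y \<in> scal Q y S"
  using scalI[OF S_one, of y] by simp

lemma cyc_least: "N \<in> SM \<Longrightarrow> y \<in> N \<Longrightarrow> scal Q y S \<subseteq> N"
  by (auto elim!: scalE intro: smodsD)

lemma prod_smod:
  assumes N: "N \<in> SM" and K: "K \<in> SM"
  shows "N \<cdot> K \<in> SM"
proof (rule smodsI)
  have c: "x \<in> carrier Q" if "x \<in> N \<cdot> K" for x
    using that by (induct rule: ideal_prod.induct) (use smodsD(1)[OF N] smodsD(1)[OF K] in auto)
  then show "N \<cdot> K \<subseteq> carrier Q" by auto
  show "\<zero> \<in> N \<cdot> K" using ideal_prod.prod[OF smodsD(2)[OF N] smodsD(2)[OF K], of Q] by simp
  show "a \<oplus> b \<in> N \<cdot> K" if "a \<in> N \<cdot> K" "b \<in> N \<cdot> K" for a b using that by (rule ideal_prod.sum)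
  show "s \<otimes> a \<in> N \<cdot> K" if "s \<in> S" "a \<in> N \<cdot> K" for s a
    using that(2)
  proof (induct rule: ideal_prod.induct)
    case (prod i j)
    then have "s \<otimes> (i \<otimes> j) = (s \<otimes> i) \<otimes> j" using that smodsD(1)[OF N] smodsD(1)[OF K] by (simp add: m_assoc)
    then show ?case using ideal_prod.prod[OF smodsD(4)[OF N that(1) prod(1)] prod(2), of Q] by simp
  next
    case (sum s1 s2)
    then show ?case using ideal_prod.sum[OF sum(2,4)] c that by (simp add: r_distr)
  qed
qed

lemma prod_least:
  assumes "P \<in> SM" "\<And>i j. i \<in> N \<Longrightarrow> j \<in> K \<Longrightarrow> i \<otimes> j \<in> P"
  shows "N \<cdot> K \<subseteq> P"
proof
  fix x assume "x \<in> N \<cdot> K"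
  then show "x \<in> P" by (induct rule: ideal_prod.induct) (use assms smodsD(3)[OF assms(1)] in auto)
qed

lemma prod_mono: "N \<subseteq> N' \<Longrightarrow> K \<subseteq> K' \<Longrightarrow> N \<cdot> K \<subseteq> N' \<cdot> K'"
proof
  fix x assume "N \<subseteq> N'" "K \<subseteq> K'" "x \<in> N \<cdot> K"
  from this(3) show "x \<in> N' \<cdot> K'"
    by (induct rule: ideal_prod.induct) (use \<open>N \<subseteq> N'\<close> \<open>K \<subseteq> K'\<close> in \<open>auto intro: ideal_prod.intros\<close>)
qed

lemma prod_comm:
  assumes "N \<in> SM" "K \<in> SM"
  shows "N \<cdot> K = K \<cdot> N"
proof (rule antisym)
  have "i \<otimes> j \<in> K \<cdot> N" if "i \<in> N" "j \<in> K" for i j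
    using ideal_prod.prod[OF that(2,1), of Q] m_comm[of i j] smodsD(1)[OF assms(1) that(1)] smodsD(1)[OF assms(2) that(2)] by simp
  then show "N \<cdot> K \<subseteq> K \<cdot> N" by (intro prod_least prod_smod assms)
  have "i \<otimes> j \<in> N \<cdot> K" if "i \<in> K" "j \<in> N" for i j
    using ideal_prod.prod[OF that(2,1), of Q] m_comm[of i j] smodsD(1)[OF assms(1) that(2)] smodsD(1)[OF assms(2) that(1)] by simp
  then show "K \<cdot> N \<subseteq> N \<cdot> K" by (intro prod_least prod_smod assms)
qed

lemma colon_smod:
  assumes N: "N \<in> SM" and K: "K \<subseteq> carrier Q"
  shows "colon Q N K \<in> SM"
proof (rule smodsI)
  note D = smodsD[OF N]
  show "colon Q N K \<subseteq> carrier Q" "\<zero> \<in> colon Q N K" using K D(2) unfolding colon_def by auto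
  fix a b assume "a \<in> colon Q N K" "b \<in> colon Q N K"
  then show "a \<oplus> b \<in> colon Q N K" using K D(3) unfolding colon_def by (auto simp: l_distr subset_iff)
next
  note D = smodsD[OF N]
  fix s a assume "s \<in> S" "a \<in> colon Q N K"
  then show "s \<otimes> a \<in> colon Q N K" using K D(4) unfolding colon_def by (auto simp: m_assoc subset_iff)
qed

text \<open>An inclusion A P \<subseteq> X is the same as A \<subseteq> X : P, and a colon is a
  submodule. Each inclusion is thereby reduced, in two stages, to products of three
  elements.\<close>

lemma prod_assoc:
  assumes N: "N \<in> SM" and K: "K \<in> SM" and P: "P \<in> SM"
  shows "N \<cdot> K \<cdot> P = N \<cdot> (K \<cdot> P)"
proof (rule antisym)
  note NK = prod_smod[OF N K] and KP = prod_smod[OF K P]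
  have "k \<in> colon Q (N \<cdot> (K \<cdot> P)) P" if "k \<in> N \<cdot> K" for k
  proof -
    have "N \<cdot> K \<subseteq> colon Q (N \<cdot> (K \<cdot> P)) P"
    proof (rule prod_least[OF colon_smod[OF prod_smod[OF N KP] smod_sub[OF P]]])
      fix i j assume ij: "i \<in> N" "j \<in> K"
      have "i \<otimes> j \<otimes> p \<in> N \<cdot> (K \<cdot> P)" if p: "p \<in> P" for p
        using ideal_prod.prod[OF ij(1) ideal_prod.prod[OF ij(2) p, of Q], of Q] ij p smodsD(1)[OF N] smodsD(1)[OF K] smodsD(1)[OF P]
        by (simp add: m_assoc)
      then show "i \<otimes> j \<in> colon Q (N \<cdot> (K \<cdot> P)) P"
        unfolding colon_def using ij smodsD(1)[OF N] smodsD(1)[OF K] by auto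
    qed
    then show ?thesis using that by blast
  qed
  then show "N \<cdot> K \<cdot> P \<subseteq> N \<cdot> (K \<cdot> P)"
    by (intro prod_least[OF prod_smod[OF N KP]]) (auto simp: colon_def)
  have "k \<in> colon Q (N \<cdot> K \<cdot> P) N" if "k \<in> K \<cdot> P" for k
  proof -
    have "K \<cdot> P \<subseteq> colon Q (N \<cdot> K \<cdot> P) N"
    proof (rule prod_least[OF colon_smod[OF prod_smod[OF NK P] smod_sub[OF N]]])
      fix i j assume ij: "i \<in> K" "j \<in> P"
      have "i \<otimes> j \<otimes> p \<in> N \<cdot> K \<cdot> P" if p: "p \<in> N" for p
        using ideal_prod.prod[OF ideal_prod.prod[OF p ij(1), of Q] ij(2), of Q] ij p smodsD(1)[OF N] smodsD(1)[OF K] smodsD(1)[OF P]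
        by (simp add: m_ac)
      then show "i \<otimes> j \<in> colon Q (N \<cdot> K \<cdot> P) N"
        unfolding colon_def using ij smodsD(1)[OF P] smodsD(1)[OF K] by auto
    qed
    then show ?thesis using that by blast
  qed
  then have KPD: "k \<otimes> n \<in> N \<cdot> K \<cdot> P" if "k \<in> K \<cdot> P" "n \<in> N" for k n using that unfolding colon_def by auto
  show "N \<cdot> (K \<cdot> P) \<subseteq> N \<cdot> K \<cdot> P"
  proof (rule prod_least[OF prod_smod[OF NK P]])
    fix i j assume ij: "i \<in> N" "j \<in> K \<cdot> P"
    then show "i \<otimes> j \<in> N \<cdot> K \<cdot> P"
      using KPD[OF ij(2,1)] m_comm[OF smodsD(1)[OF N ij(1)] smodsD(1)[OF KP ij(2)]] by simp
  qed
qed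

text \<open>The adjunction between product and colon. It is the source of C : mC = (C : C) : m = S :
  m.\<close>

lemma colon_prod:
  assumes C: "C \<in> SM" and N: "N \<in> SM" and K: "K \<in> SM"
  shows "colon Q C (N \<cdot> K) = colon Q (colon Q C N) K"
proof (rule antisym; rule subsetI)
  fix q assume "q \<in> colon Q C (N \<cdot> K)"
  then have q: "q \<in> carrier Q" "\<And>x. x \<in> N \<cdot> K \<Longrightarrow> q \<otimes> x \<in> C" unfolding colon_def by auto
  have "q \<otimes> k \<otimes> n \<in> C" if "k \<in> K" "n \<in> N" for k n
    using q(2)[OF ideal_prod.prod[OF that(2,1)]] q(1) smodsD(1)[OF N that(2)] smodsD(1)[OF K that(1)] by (simp add: m_ac)
  then show "q \<in> colon Q (colon Q C N) K" unfolding colon_def using q(1) smodsD(1)[OF K] by auto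
next
  fix q assume "q \<in> colon Q (colon Q C N) K"
  then have q: "q \<in> carrier Q" "\<And>k n. k \<in> K \<Longrightarrow> n \<in> N \<Longrightarrow> q \<otimes> k \<otimes> n \<in> C" unfolding colon_def by auto
  have "N \<cdot> K \<subseteq> colon Q C {q}"
  proof (rule prod_least[OF colon_smod[OF C]])
    fix n k assume nk: "n \<in> N" "k \<in> K"
    then show "n \<otimes> k \<in> colon Q C {q}"
      unfolding colon_def using q(2)[OF nk(2,1)] q(1) smodsD(1)[OF N] smodsD(1)[OF K] by (simp add: m_ac)
  qed (use q in auto)
  then have "x \<in> carrier Q \<and> x \<otimes> q \<in> C" if "x \<in> N \<cdot> K" for x using that unfolding colon_def by auto
  then show "q \<in> colon Q C (N \<cdot> K)" using q(1) m_comm unfolding colon_def by auto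
qed

lemma prod_S: "N \<in> SM \<Longrightarrow> N \<cdot> S = N"
proof (rule antisym)
  assume N: "N \<in> SM"
  show "N \<cdot> S \<subseteq> N" by (rule prod_least[OF N]) (use smodsD[OF N] in auto)
  show "N \<subseteq> N \<cdot> S"
  proof
    fix a assume a: "a \<in> N"
    then show "a \<in> N \<cdot> S" using ideal_prod.prod[OF a S_one, of Q] smodsD(1)[OF N a] by simp
  qed
qed

lemma prod_scal:
  assumes N: "N \<in> SM" and K: "K \<in> SM" and u: "u \<in> carrier Q"
  shows "scal Q u N \<cdot> K = scal Q u (N \<cdot> K)"
proof (rule antisym)
  show "scal Q u N \<cdot> K \<subseteq> scal Q u (N \<cdot> K)"
  proof (rule prod_least[OF scal_smod[OF prod_smod[OF N K] u]])
    fix i j assume "i \<in> scal Q u N" "j \<in> K"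
    then obtain n where n: "n \<in> N" "i = u \<otimes> n" "j \<in> K" by (auto elim: scalE)
    then show "i \<otimes> j \<in> scal Q u (N \<cdot> K)"
      using scalI[OF ideal_prod.prod[OF n(1,3)], of u Q] u smodsD(1)[OF N] smodsD(1)[OF K] by (simp add: m_assoc)
  qed
  show "scal Q u (N \<cdot> K) \<subseteq> scal Q u N \<cdot> K"
  proof
    fix x assume "x \<in> scal Q u (N \<cdot> K)"
    then obtain y where y: "y \<in> N \<cdot> K" "x = u \<otimes> y" by (auto elim: scalE)
    have P: "scal Q u N \<cdot> K \<in> SM" by (intro prod_smod scal_smod N K u)
    have "N \<cdot> K \<subseteq> colon Q (scal Q u N \<cdot> K) {u}"
    proof (rule prod_least[OF colon_smod[OF P]])
      fix i j assume ij: "i \<in> N" "j \<in> K"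
      then show "i \<otimes> j \<in> colon Q (scal Q u N \<cdot> K) {u}"
        unfolding colon_def using ideal_prod.prod[OF scalI[OF ij(1), of u] ij(2), of Q] u smodsD(1)[OF N] smodsD(1)[OF K] by (simp add: m_ac)
    qed (use u in auto)
    then have "y \<otimes> u \<in> scal Q u N \<cdot> K" using y(1) unfolding colon_def by auto
    then show "x \<in> scal Q u N \<cdot> K" using y u smodsD(1)[OF prod_smod[OF N K] y(1)] by (simp add: m_comm)
  qed
qed

text \<open>The modular law: it excludes that a strict inclusion becomes an equality both after
  intersecting with K and after adding K.\<close>

lemma modular:
  assumes "N \<in> SM" "N' \<in> SM" "K \<in> SM" "N \<subseteq> N'" "N' \<inter> K \<subseteq> N" "N' \<subseteq> msum Q N K"
  shows "N = N'"
proof (rule antisym[OF assms(4)], rule subsetI)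
  fix a assume a: "a \<in> N'"
  then obtain n k where nk: "n \<in> N" "k \<in> K" "a = n \<oplus> k" using assms(6) by (auto elim!: msumE)
  have c: "a \<in> carrier Q" "n \<in> carrier Q" "k \<in> carrier Q" using a nk smodsD(1) assms by blast+
  have "k = a \<ominus> n" using nk(3) c by algebra
  moreover have "a \<ominus> n \<in> N'" by (rule smodsD(7)[OF assms(2) a]) (use nk assms(4) in auto)
  ultimately have "k \<in> N" using assms(5) nk by auto
  then show "a \<in> N" using nk smodsD(3)[OF assms(1)] by auto
qed

lemma len_add:
  assumes "J \<in> SM" "K \<in> SM" "I \<in> SM" "J \<subseteq> K" "K \<subseteq> I"
  shows "len J I = len J K + len K I"
proof (rule antisym)
  show "len J K + len K I \<le> len J I" by (rule chain_len_concat) (use assms in auto)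
  show "len J I \<le> len J K + len K I"
  proof (rule chain_len_subadd[where a="\<lambda>N. N \<inter> K" and b="\<lambda>N. msum Q N K"])
    fix N assume N: "N \<in> SM" "J \<subseteq> N" "N \<subseteq> I"
    show "N \<inter> K \<in> SM \<and> J \<subseteq> N \<inter> K \<and> N \<inter> K \<subseteq> K" using Int_smod N assms by auto
    show "msum Q N K \<in> SM \<and> K \<subseteq> msum Q N K \<and> msum Q N K \<subseteq> I"
      using msum_smod[OF N(1) assms(2)] msum_right[OF N(1) assms(2)] msum_least[OF assms(3) N(3) assms(5)] by simp
  next
    fix N N' assume N: "N \<in> SM" "J \<subseteq> N" "N' \<subseteq> I" "N' \<in> SM" "N \<subset> N'"
    have 2: "msum Q N K \<subseteq> msum Q N' K" using N unfolding msum_def by blast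
    have "N \<inter> K \<noteq> N' \<inter> K \<or> msum Q N K \<noteq> msum Q N' K"
    proof (rule ccontr)
      assume *: "\<not> ?thesis"
      then have "N' \<inter> K \<subseteq> N" "N' \<subseteq> msum Q N K" using msum_left[OF N(4) assms(2)] by auto
      then show False using modular[OF N(1,4) assms(2)] N(5) by auto
    qed
    then show "N \<inter> K \<subseteq> N' \<inter> K \<and> msum Q N K \<subseteq> msum Q N' K \<and> (N \<inter> K \<noteq> N' \<inter> K \<or> msum Q N K \<noteq> msum Q N' K)"
      using 2 N(5) by auto
  qed
qed

lemma len_scal_le:
  assumes "J \<subseteq> carrier Q" "I \<subseteq> carrier Q" "u \<in> Units Q"
  shows "len J I \<le> len (scal Q u J) (scal Q u I)"
proof (rule chain_len_mono_map[where \<Phi>="scal Q u"])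
  fix N assume N: "N \<in> SM" "J \<subseteq> N" "N \<subseteq> I"
  then show "scal Q u N \<in> SM \<and> scal Q u J \<subseteq> scal Q u N \<and> scal Q u N \<subseteq> scal Q u I"
    using scal_smod scal_mono assms by auto
next
  fix N N' assume N: "N \<in> SM" "J \<subseteq> N" "N' \<subseteq> I" "N' \<in> SM" "N \<subset> N'"
  have "scal Q u N \<noteq> scal Q u N'"
    using N(5) scal_inv(1)[OF smod_sub[OF N(1)] assms(3)] scal_inv(1)[OF smod_sub[OF N(4)] assms(3)] by (metis psubset_eq)
  then show "scal Q u N \<subset> scal Q u N'" using scal_mono N(5) by (metis psubsetE psubsetI)
qed

lemma len_scal:
  assumes "J \<subseteq> carrier Q" "I \<subseteq> carrier Q" "u \<in> Units Q"
  shows "len (scal Q u J) (scal Q u I) = len J I"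
proof (rule antisym)
  have "scal Q u J \<subseteq> carrier Q" "scal Q u I \<subseteq> carrier Q" using assms by (auto elim!: scalE)
  from len_scal_le[OF this Units_inv_Units[OF assms(3)]]
  show "len (scal Q u J) (scal Q u I) \<le> len J I" using scal_inv assms by simp
qed (rule len_scal_le[OF assms])

section \<open>Closure properties of regular fractional ideals\<close>

lemma fidsD:
  assumes "N \<in> FI"
  shows "N \<in> SM" "\<exists>u\<in>N. u \<in> Units Q" "\<exists>s\<in>S \<inter> Units Q. \<forall>a\<in>N. s \<otimes> a \<in> S"
  using assms unfolding fids_def by auto

lemma fidsI: "N \<in> SM \<Longrightarrow> u \<in> N \<Longrightarrow> u \<in> Units Q \<Longrightarrow> s \<in> S \<Longrightarrow> s \<in> Units Q \<Longrightarrow> (\<And>a. a \<in> N \<Longrightarrow> s \<otimes> a \<in> S) \<Longrightarrow> N \<in> FI"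
  unfolding fids_def by auto

lemma fids_sub_S: "N \<in> SM \<Longrightarrow> N \<subseteq> S \<Longrightarrow> u \<in> N \<Longrightarrow> u \<in> Units Q \<Longrightarrow> N \<in> FI"
  by (rule fidsI[where s=\<one> and u=u]) (auto simp: S_one subset_iff)

lemma fids_between: "N \<in> SM \<Longrightarrow> J \<in> FI \<Longrightarrow> I \<in> FI \<Longrightarrow> J \<subseteq> N \<Longrightarrow> N \<subseteq> I \<Longrightarrow> N \<in> FI"
  unfolding fids_def by blast

lemma S_fid: "S \<in> FI" by (rule fids_sub_S[OF S_smod _ S_one]) auto

lemma Units_mult_left: "a \<otimes> b \<in> Units Q \<Longrightarrow> a \<in> carrier Q \<Longrightarrow> b \<in> carrier Q \<Longrightarrow> a \<in> Units Q"
  using unit_factor by blast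

lemma fids_scal:
  assumes "N \<in> FI" "u \<in> Units Q"
  shows "scal Q u N \<in> FI"
proof -
  obtain v where v: "v \<in> N" "v \<in> Units Q" using fidsD(2)[OF assms(1)] by blast
  obtain s where s: "s \<in> S" "s \<in> Units Q" "\<And>a. a \<in> N \<Longrightarrow> s \<otimes> a \<in> S" using fidsD(3)[OF assms(1)] by blast
  obtain t where t: "t \<in> S" "t \<in> Units Q" "t \<otimes> u \<in> S" using frac[of u] assms(2) by blast
  note N = fidsD(1)[OF assms(1)]
  show ?thesis
  proof (rule fidsI[where u="u \<otimes> v" and s="s \<otimes> t"])
    show "scal Q u N \<in> SM" using scal_smod N assms(2) by blast
    fix a assume "a \<in> scal Q u N"
    then obtain b where b: "b \<in> N" "a = u \<otimes> b" by (auto elim: scalE)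
    have "s \<otimes> t \<otimes> a = (t \<otimes> u) \<otimes> (s \<otimes> b)" using b smodsD(1)[OF N] s(1) t(1) assms(2) by (simp add: m_ac Units_closed)
    then show "s \<otimes> t \<otimes> a \<in> S" using S_mult[OF t(3) s(3)[OF b(1)]] by simp
  qed (use scalI[OF v(1)] v s t assms S_mult in auto)
qed

lemma fids_prod:
  assumes "N \<in> FI" "K \<in> FI"
  shows "N \<cdot> K \<in> FI"
proof -
  note N = fidsD(1)[OF assms(1)] and K = fidsD(1)[OF assms(2)]
  obtain u v where u: "u \<in> N" "u \<in> Units Q" "v \<in> K" "v \<in> Units Q" using fidsD(2) assms by blast
  obtain s where s: "s \<in> S" "s \<in> Units Q" "\<And>a. a \<in> N \<Longrightarrow> s \<otimes> a \<in> S" using fidsD(3)[OF assms(1)] by blast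
  obtain t where t: "t \<in> S" "t \<in> Units Q" "\<And>a. a \<in> K \<Longrightarrow> t \<otimes> a \<in> S" using fidsD(3)[OF assms(2)] by blast
  have st: "s \<otimes> t \<in> carrier Q" using s t by auto
  have "N \<cdot> K \<subseteq> colon Q S {s \<otimes> t}"
  proof (rule prod_least[OF colon_smod[OF S_smod]])
    fix i j assume ij: "i \<in> N" "j \<in> K"
    have "i \<otimes> j \<otimes> (s \<otimes> t) = (s \<otimes> i) \<otimes> (t \<otimes> j)" using ij smodsD(1)[OF N] smodsD(1)[OF K] s(1) t(1) by (simp add: m_ac)
    then show "i \<otimes> j \<in> colon Q S {s \<otimes> t}"
      using S_mult[OF s(3)[OF ij(1)] t(3)[OF ij(2)]] ij smodsD(1)[OF N] smodsD(1)[OF K] unfolding colon_def by simp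
  qed (use st in auto)
  then have c: "a \<in> carrier Q \<and> a \<otimes> (s \<otimes> t) \<in> S" if "a \<in> N \<cdot> K" for a using that unfolding colon_def by auto
  show ?thesis
  proof (rule fidsI[where u="u \<otimes> v" and s="s \<otimes> t", OF prod_smod[OF N K] ideal_prod.prod[OF u(1,3)]])
    fix a assume "a \<in> N \<cdot> K"
    then show "s \<otimes> t \<otimes> a \<in> S" using c[of a] st m_comm by simp
  qed (use u s t S_mult in auto)
qed

text \<open>If t K \<subseteq> S and u is a unit in N, then u t is a unit in N : K. Conversely, for
  a unit v in K, each q in N : K satisfies q v \<in> N, so a denominator of N times a multiple of v
  clears q; the factor w serves to bring v into S.\<close>

lemma fids_colon:
  assumes "N \<in> FI" "K \<in> FI"
  shows "colon Q N K \<in> FI"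
proof -
  note N = fidsD(1)[OF assms(1)] and K = fidsD(1)[OF assms(2)]
  obtain u v where u: "u \<in> N" "u \<in> Units Q" "v \<in> K" "v \<in> Units Q" using fidsD(2) assms by blast
  obtain s where s: "s \<in> S" "s \<in> Units Q" "\<And>a. a \<in> N \<Longrightarrow> s \<otimes> a \<in> S" using fidsD(3)[OF assms(1)] by blast
  obtain t where t: "t \<in> S" "t \<in> Units Q" "\<And>a. a \<in> K \<Longrightarrow> t \<otimes> a \<in> S" using fidsD(3)[OF assms(2)] by blast
  obtain w where w: "w \<in> S" "w \<in> Units Q" "w \<otimes> v \<in> S" using frac[of v] u by blast
  show ?thesis
  proof (rule fidsI[where u="u \<otimes> t" and s="s \<otimes> (w \<otimes> v)"])
    show "colon Q N K \<in> SM" by (rule colon_smod[OF N smod_sub[OF K]])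
    have "u \<otimes> t \<otimes> k \<in> N" if "k \<in> K" for k
      using smodsD(5)[OF N t(3)[OF that] u(1)] u(2) t(2) smodsD(1)[OF K that] by (simp add: m_assoc Units_closed)
    then show "u \<otimes> t \<in> colon Q N K" using u t unfolding colon_def by auto
    fix q assume "q \<in> colon Q N K"
    then have q: "q \<in> carrier Q" "q \<otimes> v \<in> N" using u unfolding colon_def by auto
    have "s \<otimes> (w \<otimes> v) \<otimes> q = w \<otimes> (s \<otimes> (q \<otimes> v))" using q s(2) w(2) u(4) by (simp add: m_ac Units_closed)
    then show "s \<otimes> (w \<otimes> v) \<otimes> q \<in> S" using S_mult[OF w(1) s(3)[OF q(2)]] by simp
  qed (use u s t w S_mult in auto)
qed

lemma fids_add_cyc:
  assumes N: "N \<in> FI" and y: "y \<in> carrier Q"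
  shows "msum Q N (scal Q y S) \<in> FI"
proof -
  note NS = fidsD(1)[OF N] and yS = scal_smod[OF S_smod y]
  obtain u where u: "u \<in> N" "u \<in> Units Q" using fidsD(2) N by blast
  obtain s where s: "s \<in> S" "s \<in> Units Q" "\<And>a. a \<in> N \<Longrightarrow> s \<otimes> a \<in> S" using fidsD(3)[OF N] by blast
  obtain t where t: "t \<in> S" "t \<in> Units Q" "t \<otimes> y \<in> S" using frac[OF y] by blast
  show ?thesis
  proof (rule fidsI[where u=u and s="s \<otimes> t", OF msum_smod[OF NS yS]])
    show "u \<in> msum Q N (scal Q y S)" using msum_left[OF NS yS] u by auto
    fix a assume "a \<in> msum Q N (scal Q y S)"
    then obtain n k where nk: "n \<in> N" "k \<in> S" "a = n \<oplus> y \<otimes> k" by (auto elim!: msumE scalE)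
    then have "s \<otimes> t \<otimes> a = t \<otimes> (s \<otimes> n) \<oplus> s \<otimes> ((t \<otimes> y) \<otimes> k)"
      using smodsD(1)[OF NS] s t y by (simp add: r_distr m_ac)
    then show "s \<otimes> t \<otimes> a \<in> S"
      using S_add[OF S_mult[OF t(1) s(3)[OF nk(1)]] S_mult[OF s(1) S_mult[OF t(3) nk(2)]]] by simp
  qed (use u s t S_mult in auto)
qed

end

section \<open>One-dimensional Cohen-Macaulay rings and dualizing fractional ideals\<close>

text \<open>
  For a Noetherian local ring with a nonzerodivisor in its maximal ideal, the last axiom says that
  every proper regular ideal has a nonzero socle modulo it, that is, that the dimension is one.
\<close>

locale cm_one = frac_ring Q S for Q (structure) and S +
  fixes m
  assumes m_smod: "m \<in> SM" and m_sub: "m \<subseteq> S" and one_notin_m: "\<one> \<notin> m"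
    and loc: "s \<in> S \<Longrightarrow> s \<notin> m \<Longrightarrow> s \<in> Units Q \<and> inv s \<in> S"
    and noeth: "X \<noteq> {} \<Longrightarrow> X \<subseteq> {N \<in> SM. N \<subseteq> S} \<Longrightarrow> \<exists>N\<in>X. \<forall>N'\<in>X. N \<subseteq> N' \<longrightarrow> N' = N"
    and nzd: "\<exists>x\<in>m. x \<in> Units Q"
    and soc: "N \<in> SM \<Longrightarrow> N \<subseteq> S \<Longrightarrow> u \<in> N \<Longrightarrow> u \<in> Units Q \<Longrightarrow> N \<noteq> S \<Longrightarrow> \<exists>y\<in>S - N. \<forall>a\<in>m. a \<otimes> y \<in> N"
begin

lemma m_carr: "a \<in> m \<Longrightarrow> a \<in> carrier Q" using m_sub by auto

lemma m_fid: "m \<in> FI" using nzd fids_sub_S[OF m_smod m_sub] by blast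

lemma one_minus:
  assumes "a \<in> m"
  shows "\<one> \<ominus> a \<in> Units Q" "inv (\<one> \<ominus> a) \<in> S"
proof -
  have c: "a \<in> carrier Q" using m_carr[OF assms] .
  have "\<one> \<ominus> a \<in> S" using S_minus[OF S_one] assms m_sub by auto
  moreover have "\<one> \<ominus> a \<notin> m"
  proof
    assume "\<one> \<ominus> a \<in> m"
    then have "(\<one> \<ominus> a) \<oplus> a \<in> m" using smodsD(3)[OF m_smod] assms by auto
    moreover have "(\<one> \<ominus> a) \<oplus> a = \<one>" using c by algebra
    ultimately show False using one_notin_m by simp
  qed
  ultimately show "\<one> \<ominus> a \<in> Units Q" "inv (\<one> \<ominus> a) \<in> S" using loc by auto
qed

text \<open>Nakayama for one element: 1 - a is invertible in S. The recurring pattern below is v = k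
  + a v t with a in m, which forces v into the submodule containing k.\<close>

lemma cancel_one_minus:
  assumes N: "N \<in> SM" and "a \<in> m" "v \<in> carrier Q" "v \<ominus> a \<otimes> v \<in> N"
  shows "v \<in> N"
proof -
  note u = one_minus[OF assms(2)]
  have a: "a \<in> carrier Q" using m_carr assms(2) .
  have "(\<one> \<ominus> a) \<otimes> v = v \<ominus> a \<otimes> v" using a assms(3) by algebra
  then have "inv (\<one> \<ominus> a) \<otimes> ((\<one> \<ominus> a) \<otimes> v) \<in> N" using smodsD(4)[OF N u(2) assms(4)] by simp
  then show ?thesis using u(1) assms(3) by (simp add: m_assoc[symmetric] Units_closed)
qed

text \<open>(J + S y) / J is a quotient of the field S / m, so nothing lies strictly
  between.\<close>

lemma step_cases:
  assumes J: "J \<in> SM" and y: "y \<in> carrier Q" "\<And>a. a \<in> m \<Longrightarrow> a \<otimes> y \<in> J"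
    and N: "N \<in> SM" "J \<subseteq> N" "N \<subseteq> msum Q J (scal Q y S)"
  shows "N = J \<or> N = msum Q J (scal Q y S)"
proof (rule disjCI)
  assume "N \<noteq> msum Q J (scal Q y S)"
  then have yN: "y \<notin> N"
    using N msum_least[OF N(1,2) cyc_least[OF N(1)]] by auto
  have "n \<in> J" if n: "n \<in> N" for n
  proof -
    obtain j s where js: "j \<in> J" "s \<in> S" "n = j \<oplus> y \<otimes> s" using n N(3) by (auto elim!: msumE scalE)
    have c: "j \<in> carrier Q" "n \<in> carrier Q" "s \<in> carrier Q" using js n smodsD(1)[OF J] smodsD(1)[OF N(1)] by auto
    have "s \<in> m"
    proof (rule ccontr)
      assume "s \<notin> m"
      then have s: "s \<in> Units Q" "inv s \<in> S" using loc js(2) by auto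
      have "n \<ominus> j = s \<otimes> y" using js(3) c y(1) by algebra
      moreover have "n \<ominus> j \<in> N" using smodsD(7)[OF N(1) n] js(1) N(2) by auto
      ultimately have "inv s \<otimes> (s \<otimes> y) \<in> N" using smodsD(4)[OF N(1) s(2)] by simp
      then show False using yN s(1) y(1) by (simp add: m_assoc[symmetric] Units_closed)
    qed
    then have "y \<otimes> s \<in> J" using y(2)[of s] y(1) c by (simp add: m_comm)
    then show ?thesis using js smodsD(3)[OF J] by auto
  qed
  then show "N = J" using N(2) by auto
qed

lemma len_step:
  assumes J: "J \<in> SM" and y: "y \<in> carrier Q" "y \<notin> J" "\<And>a. a \<in> m \<Longrightarrow> a \<otimes> y \<in> J"
  shows "len J (msum Q J (scal Q y S)) = 1"
proof (rule chain_len_simple[OF J])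
  note yS = scal_smod[OF S_smod y(1)]
  show "msum Q J (scal Q y S) \<in> SM" by (rule msum_smod[OF J yS])
  show "J \<subset> msum Q J (scal Q y S)" using msum_left[OF J yS] msum_right[OF J yS] cyc_mem[OF y(1)] y(2) by auto
qed (rule step_cases[OF J y(1,3)])

section \<open>Finiteness and invariance of length\<close>

lemma noeth_frac:
  assumes "X \<noteq> {}" "\<And>N. N \<in> X \<Longrightarrow> N \<in> SM" "s \<in> Units Q" "\<And>N a. N \<in> X \<Longrightarrow> a \<in> N \<Longrightarrow> s \<otimes> a \<in> S"
  shows "\<exists>N\<in>X. \<forall>N'\<in>X. N \<subseteq> N' \<longrightarrow> N' = N"
proof -
  have "scal Q s ` X \<noteq> {}" "scal Q s ` X \<subseteq> {N \<in> SM. N \<subseteq> S}"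
    using assms scal_smod[OF assms(2)] by (auto elim!: scalE simp: Units_closed)
  from noeth[OF this] obtain N where N: "N \<in> X" and "\<forall>K\<in>scal Q s ` X. scal Q s N \<subseteq> K \<longrightarrow> K = scal Q s N" by (elim bexE imageE) simp
  then have Nmax: "\<And>N'. N' \<in> X \<Longrightarrow> scal Q s N \<subseteq> scal Q s N' \<Longrightarrow> scal Q s N' = scal Q s N" by simp
  have "N' = N" if "N' \<in> X" "N \<subseteq> N'" for N'
    using Nmax[OF that(1) scal_mono[OF that(2)]] scal_inv(1)[OF smod_sub[OF assms(2)] assms(3)] that(1) N by metis
  then show ?thesis using N by blast
qed

text \<open>A maximal N of finite length over J must be S: otherwise a socle element of S / N
  enlarges N by a step of length one.\<close>

lemma len_finite_S:
  assumes J: "J \<in> SM" "J \<subseteq> S" "u \<in> J" "u \<in> Units Q"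
  shows "len J S \<noteq> \<infinity>"
proof -
  let ?X = "{N \<in> SM. J \<subseteq> N \<and> N \<subseteq> S \<and> len J N \<noteq> \<infinity>}"
  have "J \<in> ?X" using J by (simp add: zero_enat_def)
  then have "?X \<noteq> {}" "?X \<subseteq> {N \<in> SM. N \<subseteq> S}" by blast+
  from noeth[OF this] obtain N where NX: "N \<in> ?X" and Nmax: "\<forall>N'\<in>?X. N \<subseteq> N' \<longrightarrow> N' = N" by (rule bexE)
  from NX have N: "N \<in> SM" "J \<subseteq> N" "N \<subseteq> S" "len J N \<noteq> \<infinity>" by simp_all
  have "N = S"
  proof (rule ccontr)
    assume "N \<noteq> S"
    then obtain y where y: "y \<in> S" "y \<notin> N" "\<And>a. a \<in> m \<Longrightarrow> a \<otimes> y \<in> N"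
      using soc[OF N(1,3) _ J(4)] J(3) N(2) by blast
    let ?N = "msum Q N (scal Q y S)"
    have yc: "y \<in> carrier Q" using y by auto
    note yS = scal_smod[OF S_smod yc]
    have N': "?N \<in> SM" "N \<subseteq> ?N" "?N \<subseteq> S" "y \<in> ?N"
      using msum_smod[OF N(1) yS] msum_left[OF N(1) yS] msum_least[OF S_smod N(3) cyc_least[OF S_smod y(1)]]
        msum_right[OF N(1) yS] cyc_mem[OF yc] by auto
    have "len J ?N = len J N + len N ?N" by (rule len_add[OF J(1) N(1) N'(1) N(2) N'(2)])
    also have "len N ?N = 1" by (rule len_step[OF N(1) yc y(2,3)])
    finally have "len J ?N \<noteq> \<infinity>" using N(4) by (cases "len J N") (auto simp: one_enat_def)
    then have "?N \<in> ?X" using N' N(2) by simp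
    then have "?N = N" using Nmax N'(2) by (metis (no_types, lifting))
    then show False using y N'(4) by auto
  qed
  then show ?thesis using N(4) by simp
qed

lemma len_finite:
  assumes "J \<in> FI" "I \<in> FI" "J \<subseteq> I"
  shows "len J I \<noteq> \<infinity>"
proof -
  note J = fidsD(1)[OF assms(1)] and I = fidsD(1)[OF assms(2)]
  obtain s where s: "s \<in> S" "s \<in> Units Q" "\<And>a. a \<in> I \<Longrightarrow> s \<otimes> a \<in> S" using fidsD(3)[OF assms(2)] by blast
  obtain u where u: "u \<in> J" "u \<in> Units Q" using fidsD(2)[OF assms(1)] by blast
  have sI: "scal Q s I \<subseteq> S" using s by (auto elim!: scalE)
  have "len J I = len (scal Q s J) (scal Q s I)" using len_scal[OF smod_sub[OF J] smod_sub[OF I] s(2)] by simp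
  also have "\<dots> \<le> len (scal Q s J) S" by (rule chain_len_mono[OF order_refl sI])
  finally have le: "len J I \<le> len (scal Q s J) S" .
  have "len (scal Q s J) S \<noteq> \<infinity>"
  proof (rule len_finite_S)
    show "scal Q s J \<in> SM" using scal_smod[OF J] s by auto
    show "scal Q s J \<subseteq> S" using sI scal_mono[OF assms(3)] by blast
    show "s \<otimes> u \<in> scal Q s J" by (rule scalI[OF u(1)])
  qed (use s u in auto)
  then show ?thesis using le by (cases "len J I") auto
qed

text \<open>\<open>lenn J I\<close> is the length of \<open>I / J\<close>, meaningful for fractional ideals \<open>J \<subseteq> I\<close>.\<close>

definition lenn :: "'a set \<Rightarrow> 'a set \<Rightarrow> nat" where "lenn J I = the_enat (len J I)"

lemma len_lenn: "J \<in> FI \<Longrightarrow> I \<in> FI \<Longrightarrow> J \<subseteq> I \<Longrightarrow> len J I = enat (lenn J I)"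
  unfolding lenn_def using len_finite[of J I] by (cases "len J I") auto

lemma lenn_add:
  assumes "J \<in> FI" "K \<in> FI" "I \<in> FI" "J \<subseteq> K" "K \<subseteq> I"
  shows "lenn J I = lenn J K + lenn K I"
proof -
  have "enat (lenn J I) = enat (lenn J K) + enat (lenn K I)"
    using len_add[of J K I] len_lenn[of J I] len_lenn[of J K] len_lenn[of K I] assms fidsD(1) by auto
  then show ?thesis by simp
qed

lemma lenn_mono: "J \<in> FI \<Longrightarrow> K \<in> FI \<Longrightarrow> I \<in> FI \<Longrightarrow> J \<subseteq> K \<Longrightarrow> K \<subseteq> I \<Longrightarrow> lenn K I \<le> lenn J I"
  using lenn_add[of J K I] by linarith

lemma lenn_0_imp: "J \<in> FI \<Longrightarrow> I \<in> FI \<Longrightarrow> J \<subseteq> I \<Longrightarrow> lenn J I = 0 \<Longrightarrow> J = I"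
  using len_lenn[of J I] chain_len_0_imp_eq[of SM J I] fidsD(1) by (simp add: zero_enat_def)

lemma lenn_scal: "J \<in> FI \<Longrightarrow> I \<in> FI \<Longrightarrow> u \<in> Units Q \<Longrightarrow> lenn (scal Q u J) (scal Q u I) = lenn J I"
  unfolding lenn_def using len_scal[of J I u] fidsD(1) smod_sub by simp

lemma scal_sub: "V \<in> SM \<Longrightarrow> u \<in> S \<Longrightarrow> scal Q u V \<subseteq> V"
  by (auto elim!: scalE intro: smodsD)

text \<open>Scale V to W \<subseteq> S and compute the length of S / uW along uW \<subseteq> W
  \<subseteq> S and along uW \<subseteq> uS \<subseteq> S. As uS / uW and S / W have equal length, W
  / uW and S / uS have equal length too.\<close>

lemma lenn_scal_self:
  assumes V: "V \<in> FI" and u: "u \<in> S" "u \<in> Units Q"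
  shows "lenn (scal Q u V) V = lenn (scal Q u S) S"
proof -
  obtain s where s: "s \<in> S" "s \<in> Units Q" "\<And>a. a \<in> V \<Longrightarrow> s \<otimes> a \<in> S" using fidsD(3)[OF V] by blast
  let ?W = "scal Q s V"
  have W: "?W \<in> FI" "?W \<subseteq> S" using fids_scal[OF V s(2)] s(3) by (auto elim!: scalE)
  have uW: "scal Q u ?W \<in> FI" "scal Q u S \<in> FI" "scal Q u ?W \<subseteq> ?W" "scal Q u ?W \<subseteq> scal Q u S" "scal Q u S \<subseteq> S"
    using fids_scal[OF W(1) u(2)] fids_scal[OF S_fid u(2)] scal_sub[OF fidsD(1)[OF W(1)] u(1)] scal_mono[OF W(2)]
      scal_sub[OF S_smod u(1)] by auto
  have c: "V \<subseteq> carrier Q" using smod_sub[OF fidsD(1)[OF V]] .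
  have "lenn (scal Q u ?W) ?W + lenn ?W S = lenn (scal Q u ?W) (scal Q u S) + lenn (scal Q u S) S"
    using lenn_add[OF uW(1) W(1) S_fid uW(3) W(2)] lenn_add[OF uW(1,2) S_fid uW(4,5)] by simp
  then have "lenn (scal Q u ?W) ?W = lenn (scal Q u S) S"
    using lenn_scal[OF W(1) S_fid u(2)] by simp
  moreover have "scal Q u ?W = scal Q s (scal Q u V)" using c s u by (simp add: scal_scal m_comm Units_closed)
  ultimately show ?thesis using lenn_scal[OF fids_scal[OF V u(2)] V s(2)] by simp
qed

lemma lenn_scal_S:
  assumes V: "V \<in> FI" "V \<subseteq> S" and u: "u \<in> S" "u \<in> Units Q"
  shows "lenn (scal Q u V) S = lenn (scal Q u S) S + lenn V S"
  using lenn_add[OF fids_scal[OF V(1) u(2)] fids_scal[OF S_fid u(2)] S_fid scal_mono[OF V(2)] scal_sub[OF S_smod u(1)]]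
    lenn_scal[OF V(1) S_fid u(2)] by simp

text \<open>Generators of L are replaced by a maximal proper submodule K containing N: the quotient
  L / K is simple, hence killed by m, so m L \<subseteq> K and L \<subseteq> K.\<close>

lemma nakayama:
  assumes L: "L \<in> SM" "s \<in> Units Q" "\<And>a. a \<in> L \<Longrightarrow> s \<otimes> a \<in> S"
    and N: "N \<in> SM" "N \<subseteq> L" "L \<subseteq> msum Q N (m \<cdot> L)"
  shows "L = N"
proof (rule ccontr)
  assume ne: "L \<noteq> N"
  let ?X = "{K \<in> SM. N \<subseteq> K \<and> K \<subset> L}"
  have "\<exists>K\<in>?X. \<forall>K'\<in>?X. K \<subseteq> K' \<longrightarrow> K' = K"
    by (rule noeth_frac[OF _ _ L(2)]) (use ne N L in auto)
  then obtain K where K: "K \<in> SM" "N \<subseteq> K" "K \<subset> L" "\<And>K'. K' \<in> SM \<Longrightarrow> K \<subseteq> K' \<Longrightarrow> K' \<subset> L \<Longrightarrow> K' = K"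
    by (smt (verit) mem_Collect_eq subset_trans)
  obtain v where v: "v \<in> L" "v \<notin> K" using K(3) by auto
  have vc: "v \<in> carrier Q" using v smodsD(1)[OF L(1)] by auto
  have gen: "msum Q K (scal Q w S) = L" if w: "w \<in> L" "w \<notin> K" for w
  proof -
    have wc: "w \<in> carrier Q" using w smodsD(1)[OF L(1)] by auto
    note wS = scal_smod[OF S_smod wc]
    have "msum Q K (scal Q w S) \<subseteq> L" using msum_least[OF L(1) _ cyc_least[OF L(1) w(1)]] K(3) by auto
    moreover have "msum Q K (scal Q w S) \<noteq> K" using msum_right[OF K(1) wS] cyc_mem[OF wc] w by auto
    ultimately show ?thesis using K(4)[OF msum_smod[OF K(1) wS] msum_left[OF K(1) wS]] by auto
  qed
  have mv: "a \<otimes> v \<in> K" if a: "a \<in> m" for a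
  proof (rule ccontr)
    assume n: "a \<otimes> v \<notin> K"
    have ac: "a \<in> carrier Q" using m_carr[OF a] .
    have "a \<otimes> v \<in> L" using smodsD(4)[OF L(1)] a m_sub v by auto
    then have "v \<in> msum Q K (scal Q (a \<otimes> v) S)" using gen[OF _ n] v by auto
    then obtain k t where kt: "k \<in> K" "t \<in> S" "v = k \<oplus> (a \<otimes> v) \<otimes> t" by (auto elim!: msumE scalE)
    have kc: "k \<in> carrier Q" using kt smodsD(1)[OF K(1)] by auto
    have "(k \<oplus> (a \<otimes> v) \<otimes> t) \<ominus> (t \<otimes> a) \<otimes> v = k" using kc ac vc S_carr[OF kt(2)] by algebra
    then have "v \<ominus> (t \<otimes> a) \<otimes> v \<in> K" using kt(1) kt(3)[symmetric] by simp
    then have "v \<in> K" by (rule cancel_one_minus[OF K(1) smodsD(4)[OF m_smod kt(2) a] vc])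
    then show False using v by simp
  qed
  have "m \<cdot> L \<subseteq> K"
  proof (rule prod_least[OF K(1)])
    fix a l assume al: "a \<in> m" "l \<in> L"
    then obtain k t where kt: "k \<in> K" "t \<in> S" "l = k \<oplus> v \<otimes> t" using gen[OF v] by (auto elim!: msumE scalE)
    have "a \<otimes> l = a \<otimes> k \<oplus> (a \<otimes> v) \<otimes> t"
      using kt m_carr[OF al(1)] vc smodsD(1)[OF K(1) kt(1)] by (simp add: r_distr m_assoc)
    moreover have "a \<otimes> k \<in> K" using smodsD(4)[OF K(1) _ kt(1)] al m_sub by auto
    moreover have "(a \<otimes> v) \<otimes> t \<in> K" using smodsD(5)[OF K(1) kt(2) mv[OF al(1)]] .
    ultimately show "a \<otimes> l \<in> K" using smodsD(3)[OF K(1)] by auto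
  qed
  then show False using N(3) msum_least[OF K(1,2)] K(3) by blast
qed

subsection \<open>Duality\<close>

text \<open>
  \<open>qhom C I h\<close> says that \<open>h\<close> induces a homomorphism from \<open>I\<close> to \<open>Q / C\<close>; it is represented by
  a function into \<open>Q\<close> that is linear modulo \<open>C\<close>.
\<close>

definition qhom :: "'a set \<Rightarrow> 'a set \<Rightarrow> ('a \<Rightarrow> 'a) \<Rightarrow> bool" where
  "qhom C I h \<longleftrightarrow> (\<forall>a\<in>I. h a \<in> carrier Q) \<and> (\<forall>a\<in>I. \<forall>b\<in>I. h (a \<oplus> b) \<ominus> (h a \<oplus> h b) \<in> C) \<and>
     (\<forall>s\<in>S. \<forall>a\<in>I. h (s \<otimes> a) \<ominus> s \<otimes> h a \<in> C)"

definition qmult :: "'a set \<Rightarrow> 'a set \<Rightarrow> ('a \<Rightarrow> 'a) \<Rightarrow> bool" where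
  "qmult C I h \<longleftrightarrow> (\<exists>q\<in>carrier Q. \<forall>a\<in>I. h a \<ominus> q \<otimes> a \<in> C)"

lemma cong_trans:
  assumes "C \<in> SM" "a \<in> carrier Q" "b \<in> carrier Q" "c \<in> carrier Q" "a \<ominus> b \<in> C" "b \<ominus> c \<in> C"
  shows "a \<ominus> c \<in> C"
proof -
  have "(a \<ominus> b) \<oplus> (b \<ominus> c) = a \<ominus> c" using assms by algebra
  then show ?thesis using smodsD(3)[OF assms(1,5,6)] by simp
qed

lemma cong_sym:
  assumes "C \<in> SM" "a \<in> carrier Q" "b \<in> carrier Q" "a \<ominus> b \<in> C"
  shows "b \<ominus> a \<in> C"
proof -
  have "\<ominus> (a \<ominus> b) = b \<ominus> a" using assms by algebra
  then show ?thesis using smodsD(6)[OF assms(1,4)] by simp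
qed

lemma cong_add:
  assumes "C \<in> SM" "a \<in> carrier Q" "b \<in> carrier Q" "c \<in> carrier Q" "d \<in> carrier Q" "a \<ominus> b \<in> C" "c \<ominus> d \<in> C"
  shows "(a \<oplus> c) \<ominus> (b \<oplus> d) \<in> C"
proof -
  have "(a \<ominus> b) \<oplus> (c \<ominus> d) = (a \<oplus> c) \<ominus> (b \<oplus> d)" using assms by algebra
  then show ?thesis using smodsD(3)[OF assms(1,6,7)] by simp
qed

lemma cong_mult:
  assumes "C \<in> SM" "s \<in> S" "a \<in> carrier Q" "b \<in> carrier Q" "a \<ominus> b \<in> C"
  shows "s \<otimes> a \<ominus> s \<otimes> b \<in> C"
proof -
  have "s \<otimes> (a \<ominus> b) = s \<otimes> a \<ominus> s \<otimes> b" using assms S_carr[OF assms(2)] by algebra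
  then show ?thesis using smodsD(4)[OF assms(1,2,5)] by simp
qed

text \<open>The only obstruction to extending h to I + S y with value q at y sits on the multiples t
  y that already lie in I, where t q has to agree with h modulo C.\<close>

lemma qhom_extend:
  assumes C: "C \<in> SM" and I: "I \<in> SM" and y: "y \<in> carrier Q" and h: "qhom C I h" and q: "q \<in> carrier Q"
    and comp: "\<And>t. t \<in> S \<Longrightarrow> t \<otimes> y \<in> I \<Longrightarrow> h (t \<otimes> y) \<ominus> t \<otimes> q \<in> C"
  obtains H where "qhom C (msum Q I (scal Q y S)) H" "\<And>a. a \<in> I \<Longrightarrow> H a \<ominus> h a \<in> C" "H y \<ominus> q \<in> C"
proof -
  let ?I = "msum Q I (scal Q y S)"
  have hc: "h a \<in> carrier Q" if "a \<in> I" for a using h that unfolding qhom_def by auto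
  have hadd: "h (a \<oplus> b) \<ominus> (h a \<oplus> h b) \<in> C" if "a \<in> I" "b \<in> I" for a b using h that unfolding qhom_def by auto
  have hm: "h (s \<otimes> a) \<ominus> s \<otimes> h a \<in> C" if "s \<in> S" "a \<in> I" for s a using h that unfolding qhom_def by auto
  note Ic = smodsD(1)[OF I]
  have wd: "(h a \<oplus> s \<otimes> q) \<ominus> (h b \<oplus> t \<otimes> q) \<in> C"
    if ab: "a \<in> I" "b \<in> I" "s \<in> S" "t \<in> S" "a \<oplus> s \<otimes> y = b \<oplus> t \<otimes> y" for a b s t
  proof -
    have c: "a \<in> carrier Q" "b \<in> carrier Q" "s \<in> carrier Q" "t \<in> carrier Q" using ab Ic by auto
    have "(t \<ominus> s) \<otimes> y = (b \<oplus> t \<otimes> y) \<ominus> s \<otimes> y \<ominus> b" using c y by algebra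
    also have "\<dots> = (a \<oplus> s \<otimes> y) \<ominus> s \<otimes> y \<ominus> b" using ab(5) by simp
    also have "\<dots> = a \<ominus> b" using c y by algebra
    finally have e: "(t \<ominus> s) \<otimes> y = a \<ominus> b" .
    have ts: "t \<ominus> s \<in> S" and abI: "a \<ominus> b \<in> I" using S_minus[OF ab(4,3)] smodsD(7)[OF I ab(1,2)] by auto
    have 1: "h (a \<ominus> b) \<ominus> (t \<ominus> s) \<otimes> q \<in> C" using comp[OF ts] e abI by simp
    have "b \<oplus> (a \<ominus> b) = a" using c by algebra
    then have 2: "h a \<ominus> (h b \<oplus> h (a \<ominus> b)) \<in> C" using hadd[OF ab(2) abI] by simp
    have hh: "h a \<in> carrier Q" "h b \<in> carrier Q" "h (a \<ominus> b) \<in> carrier Q" using hc ab abI by auto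
    have "(h a \<ominus> (h b \<oplus> h (a \<ominus> b))) \<oplus> (h (a \<ominus> b) \<ominus> (t \<ominus> s) \<otimes> q) = (h a \<oplus> s \<otimes> q) \<ominus> (h b \<oplus> t \<otimes> q)"
      using hh c q by algebra
    then show ?thesis using smodsD(3)[OF C 2 1] by simp
  qed
  \<comment> \<open>A representation v = a + s y is chosen for each v; \<open>wd\<close> shows that
    the resulting value modulo C does not depend on it.\<close>
  define P where "P v p \<longleftrightarrow> fst p \<in> I \<and> snd p \<in> S \<and> v = fst p \<oplus> snd p \<otimes> y" for v p
  define r where "r v = (SOME p. P v p)" for v
  define H where "H v = h (fst (r v)) \<oplus> snd (r v) \<otimes> q" for v
  have r: "P v (r v)" if v: "v \<in> ?I" for v
  proof -
    obtain a s where "a \<in> I" "s \<in> S" "v = a \<oplus> y \<otimes> s" using v by (auto elim!: msumE scalE)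
    then have "P v (a, s)" unfolding P_def using y by (auto simp: m_comm)
    then show ?thesis unfolding r_def by (rule someI)
  qed
  have Hval: "H v \<ominus> (h a \<oplus> s \<otimes> q) \<in> C" if "v \<in> ?I" "a \<in> I" "s \<in> S" "v = a \<oplus> s \<otimes> y" for v a s
    unfolding H_def using wd[of "fst (r v)" a "snd (r v)" s] r[OF that(1)] that unfolding P_def by auto
  have Hc: "H v \<in> carrier Q" if "v \<in> ?I" for v
    unfolding H_def using r[OF that] hc q unfolding P_def by auto
  note yS = scal_smod[OF S_smod y]
  note I' = msum_smod[OF I yS]
  have "qhom C ?I H"
    unfolding qhom_def
  proof (intro conjI ballI)
    fix v w assume vw: "v \<in> ?I" "w \<in> ?I"
    obtain a s where as: "a \<in> I" "s \<in> S" "v = a \<oplus> s \<otimes> y" using r[OF vw(1)] unfolding P_def by auto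
    obtain b t where bt: "b \<in> I" "t \<in> S" "w = b \<oplus> t \<otimes> y" using r[OF vw(2)] unfolding P_def by auto
    have c: "a \<in> carrier Q" "b \<in> carrier Q" "s \<in> carrier Q" "t \<in> carrier Q" using as bt Ic by auto
    have cc: "h a \<in> carrier Q" "h b \<in> carrier Q" "h (a \<oplus> b) \<in> carrier Q" using hc as bt smodsD(3)[OF I] by auto
    have vw': "v \<oplus> w \<in> ?I" using smodsD(3)[OF I' vw] .
    have "v \<oplus> w = (a \<oplus> b) \<oplus> (s \<oplus> t) \<otimes> y" using as bt c y by algebra
    then have 1: "H (v \<oplus> w) \<ominus> (h (a \<oplus> b) \<oplus> (s \<oplus> t) \<otimes> q) \<in> C"
      using Hval[OF vw' smodsD(3)[OF I as(1) bt(1)] S_add[OF as(2) bt(2)]] by simp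
    have "(h (a \<oplus> b) \<ominus> (h a \<oplus> h b)) = (h (a \<oplus> b) \<oplus> (s \<oplus> t) \<otimes> q) \<ominus> ((h a \<oplus> s \<otimes> q) \<oplus> (h b \<oplus> t \<otimes> q))"
      using c cc q by algebra
    then have 2: "(h (a \<oplus> b) \<oplus> (s \<oplus> t) \<otimes> q) \<ominus> ((h a \<oplus> s \<otimes> q) \<oplus> (h b \<oplus> t \<otimes> q)) \<in> C" using hadd[OF as(1) bt(1)] by simp
    have 3: "((h a \<oplus> s \<otimes> q) \<oplus> (h b \<oplus> t \<otimes> q)) \<ominus> (H v \<oplus> H w) \<in> C"
      by (rule cong_add[OF C _ _ _ _ cong_sym[OF C _ _ Hval[OF vw(1) as]] cong_sym[OF C _ _ Hval[OF vw(2) bt]]])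
        (use Hc vw c cc q in auto)
    show "H (v \<oplus> w) \<ominus> (H v \<oplus> H w) \<in> C"
      by (rule cong_trans[OF C _ _ _ cong_trans[OF C _ _ _ 1 2] 3]) (use Hc vw vw' c cc q in auto)
  next
    fix s v assume sv: "s \<in> S" "v \<in> ?I"
    obtain b t where bt: "b \<in> I" "t \<in> S" "v = b \<oplus> t \<otimes> y" using r[OF sv(2)] unfolding P_def by auto
    have c: "b \<in> carrier Q" "s \<in> carrier Q" "t \<in> carrier Q" using sv bt Ic by auto
    have cc: "h b \<in> carrier Q" "h (s \<otimes> b) \<in> carrier Q" using hc bt sv smodsD(4)[OF I] by auto
    have sv': "s \<otimes> v \<in> ?I" using smodsD(4)[OF I' sv] .
    have "s \<otimes> v = s \<otimes> b \<oplus> (s \<otimes> t) \<otimes> y" using bt c y by algebra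
    then have 1: "H (s \<otimes> v) \<ominus> (h (s \<otimes> b) \<oplus> (s \<otimes> t) \<otimes> q) \<in> C"
      using Hval[OF sv' smodsD(4)[OF I sv(1) bt(1)] S_mult[OF sv(1) bt(2)]] by simp
    have "h (s \<otimes> b) \<ominus> s \<otimes> h b = (h (s \<otimes> b) \<oplus> (s \<otimes> t) \<otimes> q) \<ominus> s \<otimes> (h b \<oplus> t \<otimes> q)"
      using c cc q by algebra
    then have 2: "(h (s \<otimes> b) \<oplus> (s \<otimes> t) \<otimes> q) \<ominus> s \<otimes> (h b \<oplus> t \<otimes> q) \<in> C" using hm[OF sv(1) bt(1)] by simp
    have 3: "s \<otimes> (h b \<oplus> t \<otimes> q) \<ominus> s \<otimes> H v \<in> C"
      by (rule cong_mult[OF C sv(1) _ _ cong_sym[OF C _ _ Hval[OF sv(2) bt]]]) (use Hc sv c cc q in auto)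
    show "H (s \<otimes> v) \<ominus> s \<otimes> H v \<in> C"
      by (rule cong_trans[OF C _ _ _ cong_trans[OF C _ _ _ 1 2] 3]) (use Hc sv sv' c cc q in auto)
  qed (rule Hc)
  moreover have "H a \<ominus> h a \<in> C" if a: "a \<in> I" for a
    using Hval[of a a \<zero>] msum_left[OF I yS] a Ic[OF a] hc[OF a] S_zero y q by auto
  moreover have "H y \<ominus> q \<in> C"
  proof -
    have yI: "y \<in> ?I" using msum_right[OF I yS] cyc_mem[OF y] by auto
    have 1: "H y \<ominus> (h \<zero> \<oplus> \<one> \<otimes> q) \<in> C" using Hval[OF yI smodsD(2)[OF I] S_one] y by simp
    have h0: "h \<zero> \<in> carrier Q" using hc smodsD(2)[OF I] by auto
    have "h \<zero> \<ominus> \<zero> \<otimes> h \<zero> \<in> C" using hm[OF S_zero smodsD(2)[OF I]] by simp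
    then have "h \<zero> \<ominus> \<zero> \<in> C" using h0 by simp
    then have "(h \<zero> \<oplus> \<one> \<otimes> q) \<ominus> (\<zero> \<oplus> \<one> \<otimes> q) \<in> C"
      by (intro cong_add[OF C]) (use h0 q smodsD(2)[OF C] in \<open>auto simp: a_minus_def r_neg\<close>)
    from cong_trans[OF C _ _ _ 1 this] show ?thesis using h0 q Hc[OF yI] by simp
  qed
  ultimately show ?thesis using that by blast
qed

text \<open>A Baer argument. Take J maximal among the ideals containing u that carry a homomorphism
  h which is no multiplication, and y outside J with m y \<subseteq> J. On m, the map a \<mapsto> h
  (a y) is multiplication by some q, so h extends to J + S y with value q at y. By maximality the
  extension is a multiplication, hence so is h. Fractional ideals are first scaled into S.\<close>

lemma qmult_from_m:
  assumes C: "C \<in> SM" and base: "\<And>h. qhom C m h \<Longrightarrow> qmult C m h" and I: "I \<in> FI" and h: "qhom C I h"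
  shows "qmult C I h"
proof -
  have ideal: "\<forall>h. qhom C I h \<longrightarrow> qmult C I h" if I: "I \<in> SM" "I \<subseteq> S" "u \<in> I" and uU: "u \<in> Units Q" for I u
  proof (rule ccontr)
    assume neg: "\<not> ?thesis"
    let ?X = "{J \<in> SM. J \<subseteq> S \<and> u \<in> J \<and> (\<exists>h. qhom C J h \<and> \<not> qmult C J h)}"
    have "I \<in> ?X" using neg I by blast
    then have "?X \<noteq> {}" "?X \<subseteq> {N \<in> SM. N \<subseteq> S}" by blast+
    from noeth[OF this] obtain J where J: "J \<in> ?X" and Jmax: "\<forall>J'\<in>?X. J \<subseteq> J' \<longrightarrow> J' = J" by (rule bexE)
    from J have JS: "J \<in> SM" "J \<subseteq> S" "u \<in> J" and "\<exists>h. qhom C J h \<and> \<not> qmult C J h" by simp_all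
    then obtain h where h: "qhom C J h" "\<not> qmult C J h" by metis
    have hc: "h a \<in> carrier Q" if "a \<in> J" for a using h that unfolding qhom_def by auto
    have "J \<noteq> S"
    proof
      assume JS: "J = S"
      have "h s \<ominus> h \<one> \<otimes> s \<in> C" if "s \<in> S" for s
      proof -
        have "h (s \<otimes> \<one>) \<ominus> s \<otimes> h \<one> \<in> C" using h(1) JS S_one that unfolding qhom_def by blast
        then show ?thesis using that hc[of \<one>] JS S_one by (simp add: m_comm)
      qed
      then have "qmult C J h" unfolding qmult_def using JS hc[of \<one>] S_one by blast
      then show False using h(2) by simp
    qed
    then obtain y where y: "y \<in> S" "y \<notin> J" "\<And>a. a \<in> m \<Longrightarrow> a \<otimes> y \<in> J" using soc[OF JS uU] by blast
    have yc: "y \<in> carrier Q" using y by auto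
    have "qhom C m (\<lambda>a. h (a \<otimes> y))"
      unfolding qhom_def
    proof (intro conjI ballI)
      fix a b assume ab: "a \<in> m" "b \<in> m"
      have "(a \<oplus> b) \<otimes> y = a \<otimes> y \<oplus> b \<otimes> y" using ab m_carr yc by (simp add: l_distr)
      then show "h ((a \<oplus> b) \<otimes> y) \<ominus> (h (a \<otimes> y) \<oplus> h (b \<otimes> y)) \<in> C"
        using h(1) y(3) ab unfolding qhom_def by simp
    next
      fix s a assume sa: "s \<in> S" "a \<in> m"
      have "s \<otimes> a \<otimes> y = s \<otimes> (a \<otimes> y)" using sa m_carr yc by (simp add: m_assoc)
      then show "h (s \<otimes> a \<otimes> y) \<ominus> s \<otimes> h (a \<otimes> y) \<in> C" using h(1) y(3) sa unfolding qhom_def by simp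
    qed (use hc y in blast)
    then obtain q where q: "q \<in> carrier Q" "\<And>a. a \<in> m \<Longrightarrow> h (a \<otimes> y) \<ominus> q \<otimes> a \<in> C"
      using base[of "\<lambda>a. h (a \<otimes> y)"] unfolding qmult_def by blast
    have comp: "h (t \<otimes> y) \<ominus> t \<otimes> q \<in> C" if t: "t \<in> S" "t \<otimes> y \<in> J" for t
    proof -
      have "t \<in> m"
      proof (rule ccontr)
        assume "t \<notin> m"
        then have tu: "t \<in> Units Q" "inv t \<in> S" using loc t by auto
        then have "inv t \<otimes> (t \<otimes> y) \<in> J" using smodsD(4)[OF JS(1)] t by blast
        then show False using y tu yc by (simp add: m_assoc[symmetric] Units_closed)
      qed
      then show ?thesis using q(2)[of t] q(1) t by (simp add: m_comm)
    qed
    let ?J = "msum Q J (scal Q y S)"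
    obtain H where H: "qhom C ?J H" "\<And>a. a \<in> J \<Longrightarrow> H a \<ominus> h a \<in> C"
      using qhom_extend[OF C JS(1) yc h(1) q(1) comp] by blast
    note yS = scal_smod[OF S_smod yc]
    have J': "?J \<in> SM" "J \<subseteq> ?J" "?J \<subseteq> S" "y \<in> ?J"
      using msum_smod[OF JS(1) yS] msum_left[OF JS(1) yS] msum_least[OF S_smod JS(2) cyc_least[OF S_smod y(1)]]
        msum_right[OF JS(1) yS] cyc_mem[OF yc] by auto
    have "qmult C ?J H"
    proof (rule ccontr)
      assume "\<not> qmult C ?J H"
      then have "?J \<in> ?X" using H(1) J' JS(3) by auto
      then have "?J = J" using Jmax J'(2) by (metis (no_types, lifting))
      then show False using J'(4) y(2) by auto
    qed
    then obtain p where p: "p \<in> carrier Q" "\<And>a. a \<in> ?J \<Longrightarrow> H a \<ominus> p \<otimes> a \<in> C" unfolding qmult_def by blast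
    have "h a \<ominus> p \<otimes> a \<in> C" if a: "a \<in> J" for a
    proof (rule cong_trans[OF C, of _ "H a"])
      show Hc: "H a \<in> carrier Q" using H(1) J'(2) a unfolding qhom_def by auto
      show "h a \<ominus> H a \<in> C" using cong_sym[OF C Hc hc[OF a] H(2)[OF a]] .
      show "H a \<ominus> p \<otimes> a \<in> C" using p J'(2) a by auto
    qed (use hc p a smodsD(1)[OF JS(1)] in auto)
    then have "qmult C J h" unfolding qmult_def using p(1) by blast
    then show False using h(2) by simp
  qed
  note IS = fidsD(1)[OF I]
  obtain s where s: "s \<in> S" "s \<in> Units Q" "\<And>a. a \<in> I \<Longrightarrow> s \<otimes> a \<in> S" using fidsD(3)[OF I] by blast
  obtain u where u: "u \<in> I" "u \<in> Units Q" using fidsD(2)[OF I] by blast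
  have sc: "inv s \<in> carrier Q" "s \<in> carrier Q" using s by auto
  have canc: "inv s \<otimes> (s \<otimes> a) = a" if "a \<in> carrier Q" for a using s(2) that sc by (simp add: m_assoc[symmetric])
  have "qhom C (scal Q s I) (\<lambda>b. h (inv s \<otimes> b))"
    unfolding qhom_def
  proof (intro conjI ballI)
    fix a b assume "a \<in> scal Q s I" "b \<in> scal Q s I"
    then obtain a' b' where ab: "a' \<in> I" "b' \<in> I" "a = s \<otimes> a'" "b = s \<otimes> b'" by (auto elim!: scalE)
    have c: "a' \<in> carrier Q" "b' \<in> carrier Q" using ab smodsD(1)[OF IS] by auto
    have "inv s \<otimes> (a \<oplus> b) = a' \<oplus> b'" using ab c canc sc by (simp add: r_distr)
    then show "h (inv s \<otimes> (a \<oplus> b)) \<ominus> (h (inv s \<otimes> a) \<oplus> h (inv s \<otimes> b)) \<in> C"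
      using h ab c canc unfolding qhom_def by simp
  next
    fix t a assume "t \<in> S" "a \<in> scal Q s I"
    then obtain a' where ab: "a' \<in> I" "a = s \<otimes> a'" "t \<in> S" by (auto elim!: scalE)
    have c: "a' \<in> carrier Q" "t \<in> carrier Q" using ab smodsD(1)[OF IS] by auto
    have "t \<otimes> a = s \<otimes> (t \<otimes> a')" using ab c sc by (simp add: m_ac)
    then have "inv s \<otimes> (t \<otimes> a) = t \<otimes> a'" using canc c by simp
    then show "h (inv s \<otimes> (t \<otimes> a)) \<ominus> t \<otimes> h (inv s \<otimes> a) \<in> C"
      using h ab c canc unfolding qhom_def by simp
  next
    fix a assume "a \<in> scal Q s I"
    then show "h (inv s \<otimes> a) \<in> carrier Q" using h canc smodsD(1)[OF IS] unfolding qhom_def by (auto elim!: scalE)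
  qed
  moreover have "scal Q s I \<in> SM" "scal Q s I \<subseteq> S" "s \<otimes> u \<in> scal Q s I" "s \<otimes> u \<in> Units Q"
    using scal_smod[OF IS] sc s u scalI[OF u(1)] by (auto elim!: scalE)
  ultimately have "qmult C (scal Q s I) (\<lambda>b. h (inv s \<otimes> b))" using ideal by blast
  then obtain q where q: "q \<in> carrier Q" "\<And>b. b \<in> scal Q s I \<Longrightarrow> h (inv s \<otimes> b) \<ominus> q \<otimes> b \<in> C" unfolding qmult_def by blast
  have "h a \<ominus> (q \<otimes> s) \<otimes> a \<in> C" if a: "a \<in> I" for a
    using q(2)[OF scalI[OF a, of s]] canc smodsD(1)[OF IS a] q(1) sc by (simp add: m_assoc)
  then show ?thesis unfolding qmult_def using q(1) sc by blast
qed

section \<open>Dualizing modules: biduality, regularity and uniqueness\<close>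

text \<open>The socle of Q/C is (C : m) / C, so the second condition makes it nonzero and excludes C
  = Q. The third condition is injectivity of Q/C tested on fractional ideals. Regularity of C is
  left out here: for ideals it is derived below.\<close>

definition dualizing :: "'a set \<Rightarrow> bool" where
  "dualizing C \<longleftrightarrow> C \<in> SM \<and> colon Q C m \<noteq> C \<and> (\<forall>I\<in>FI. \<forall>h. qhom C I h \<longrightarrow> qmult C I h)"

lemma colon_anti: "J \<subseteq> I \<Longrightarrow> colon Q C I \<subseteq> colon Q C J"
  unfolding colon_def by auto

lemma colon_S: "C \<in> SM \<Longrightarrow> colon Q C S = C"
proof (rule antisym; rule subsetI)
  fix q assume C: "C \<in> SM" and "q \<in> colon Q C S"
  then have "q \<otimes> \<one> \<in> C" "q \<in> carrier Q" using S_one unfolding colon_def by auto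
  then show "q \<in> C" by simp
qed (auto simp: colon_def dest: smodsD)

lemma colon_ge: "C \<in> SM \<Longrightarrow> J \<subseteq> S \<Longrightarrow> C \<subseteq> colon Q C J"
  using colon_S colon_anti by blast

text \<open>If y is not in I, extend the zero map on I to I + S y by sending y to some p in C : m
  outside C; this is consistent because t y \<in> I forces t \<in> m. The extension is
  multiplication by some q, and then q I \<subseteq> C while q y is congruent to p and so not in C.
  Hence y is not in C : (C : I).\<close>

lemma bidual:
  assumes C: "dualizing C" and I: "I \<in> FI"
  shows "colon Q C (colon Q C I) = I"
proof (rule antisym; rule subsetI)
  have CS: "C \<in> SM" using C unfolding dualizing_def by auto
  note IS = fidsD(1)[OF I]
  {
    fix y assume "y \<in> I"
    then show "y \<in> colon Q C (colon Q C I)" using smodsD(1)[OF IS] by (auto simp: colon_def m_comm)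
  }
  fix y assume y: "y \<in> colon Q C (colon Q C I)"
  then have yc: "y \<in> carrier Q" unfolding colon_def by auto
  show "y \<in> I"
  proof (rule ccontr)
    assume yI: "y \<notin> I"
    obtain p where p: "p \<in> colon Q C m" "p \<notin> C"
      using C colon_ge[OF CS m_sub] unfolding dualizing_def by auto
    have pc: "p \<in> carrier Q" using p unfolding colon_def by auto
    have q0: "qhom C I (\<lambda>_. \<zero>)" unfolding qhom_def using smodsD(2)[OF CS] by (auto simp: a_minus_def)
    have comp: "\<zero> \<ominus> t \<otimes> p \<in> C" if t: "t \<in> S" "t \<otimes> y \<in> I" for t
    proof -
      have "t \<in> m"
      proof (rule ccontr)
        assume "t \<notin> m"
        then have tu: "t \<in> Units Q" "inv t \<in> S" using loc t by auto
        then have "inv t \<otimes> (t \<otimes> y) \<in> I" using smodsD(4)[OF IS] t by blast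
        then show False using yI tu yc by (simp add: m_assoc[symmetric] Units_closed)
      qed
      then have "p \<otimes> t \<in> C" using p unfolding colon_def by auto
      then have "t \<otimes> p \<in> C" using pc t by (simp add: m_comm)
      then show ?thesis using smodsD(7)[OF CS smodsD(2)[OF CS]] by blast
    qed
    obtain H where H: "qhom C (msum Q I (scal Q y S)) H" "\<And>a. a \<in> I \<Longrightarrow> H a \<ominus> \<zero> \<in> C" "H y \<ominus> p \<in> C"
      using qhom_extend[OF CS IS yc q0 pc comp] by blast
    have fi: "msum Q I (scal Q y S) \<in> FI" by (rule fids_add_cyc[OF I yc])
    then obtain q where q: "q \<in> carrier Q" "\<And>a. a \<in> msum Q I (scal Q y S) \<Longrightarrow> H a \<ominus> q \<otimes> a \<in> C"
      using C H(1) unfolding dualizing_def qmult_def by blast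
    note yS = scal_smod[OF S_smod yc]
    have sub: "I \<subseteq> msum Q I (scal Q y S)" "y \<in> msum Q I (scal Q y S)"
      using msum_left[OF IS yS] msum_right[OF IS yS] cyc_mem[OF yc] by auto
    have Hc: "H a \<in> carrier Q" if "a \<in> msum Q I (scal Q y S)" for a using H(1) that unfolding qhom_def by auto
    have "q \<otimes> a \<in> C" if a: "a \<in> I" for a
    proof -
      have ac: "a \<in> carrier Q" "H a \<in> carrier Q" using a smodsD(1)[OF IS] Hc sub by auto
      have "q \<otimes> a \<ominus> \<zero> \<in> C"
        by (rule cong_trans[OF CS _ _ _ cong_sym[OF CS _ _ q(2)] H(2)[OF a]]) (use a sub ac q in auto)
      then show ?thesis using ac q(1) by (simp add: a_minus_def)
    qed
    then have "q \<in> colon Q C I" using q(1) unfolding colon_def by auto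
    then have "y \<otimes> q \<in> C" using y unfolding colon_def by auto
    then have qy: "q \<otimes> y \<in> C" using q(1) yc by (simp add: m_comm)
    have "p \<ominus> q \<otimes> y \<in> C"
      by (rule cong_trans[OF CS _ _ _ cong_sym[OF CS _ _ H(3)] q(2)[OF sub(2)]]) (use yc pc q Hc[OF sub(2)] in auto)
    then have "(p \<ominus> q \<otimes> y) \<oplus> q \<otimes> y \<in> C" using smodsD(3)[OF CS _ qy] by blast
    moreover have "(p \<ominus> q \<otimes> y) \<oplus> q \<otimes> y = p" using pc q(1) yc by algebra
    ultimately show False using p by simp
  qed
qed

lemma pow_m: "x \<in> m \<Longrightarrow> x [^] Suc n \<in> m"
proof (induction n)
  case 0
  then show ?case using m_carr by simp
next
  case (Suc n)
  then show ?case using smodsD(4)[OF m_smod, of "x [^] Suc n" x] m_sub by auto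
qed

text \<open>By noetherianity the ideals {a. x^n a \<in> C} become constant. They are the duals of
  the regular ideals C + x^n S, so by biduality these become constant as well. Then some power y of
  x lies in C + y^2 S, and Nakayama puts y into C.\<close>

lemma dualizing_ideal_regular:
  assumes C: "dualizing C" and CS: "C \<subseteq> S"
  shows "C \<in> FI"
proof -
  have CM: "C \<in> SM" using C unfolding dualizing_def by auto
  obtain x where x: "x \<in> m" "x \<in> Units Q" using nzd by blast
  have xc: "x \<in> carrier Q" using x by auto
  define K where "K n = {a \<in> S. x [^] n \<otimes> a \<in> C}" for n :: nat
  have K: "K n \<in> SM" "K n \<subseteq> S" for n
  proof -
    have "K n = S \<inter> colon Q C {x [^] n}"
      unfolding K_def colon_def using xc by (auto simp: m_comm)
    then show "K n \<in> SM" using Int_smod[OF S_smod colon_smod[OF CM]] xc by auto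
    show "K n \<subseteq> S" unfolding K_def by auto
  qed
  have Kmono: "K n \<subseteq> K (n + k)" for n k
  proof
    fix a assume a: "a \<in> K n"
    have xS: "x [^] k \<in> S" using pow_m[OF x(1)] m_sub S_one by (cases k) auto
    have ac: "a \<in> carrier Q" using a unfolding K_def by auto
    have "x [^] (n + k) \<otimes> a = x [^] k \<otimes> (x [^] n \<otimes> a)" using xc ac by (simp add: nat_pow_mult[symmetric] m_ac)
    also have "\<dots> \<in> C" using smodsD(4)[OF CM xS] a unfolding K_def by auto
    finally show "a \<in> K (n + k)" using a unfolding K_def by auto
  qed
  have "range K \<noteq> {}" "range K \<subseteq> {N \<in> SM. N \<subseteq> S}" using K by auto
  from noeth[OF this] obtain n where "\<forall>N'\<in>range K. K n \<subseteq> N' \<longrightarrow> N' = K n" by (elim bexE rangeE) simp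
  then have n: "\<And>j. K n \<subseteq> K j \<Longrightarrow> K j = K n" by simp
  \<comment> \<open>This is biduality for S, which is available before C is known to be
    regular.\<close>
  have CC: "colon Q C C = S" using bidual[OF C S_fid] colon_S[OF CM] by simp
  define N where "N j = msum Q C (scal Q (x [^] Suc j) S)" for j
  have xj: "x [^] Suc j \<in> m" "x [^] Suc j \<in> Units Q" "x [^] Suc j \<in> carrier Q" for j
    using pow_m[OF x(1)] x(2) Units_pow_closed xc by auto
  have NF: "N j \<in> FI" for j
  proof (rule fids_sub_S)
    note xS = scal_smod[OF S_smod xj(3)]
    show "N j \<in> SM" unfolding N_def by (rule msum_smod[OF CM xS])
    show "N j \<subseteq> S" unfolding N_def using msum_least[OF S_smod CS cyc_least[OF S_smod]] xj(1) m_sub by blast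
    show "x [^] Suc j \<in> N j" unfolding N_def using msum_right[OF CM xS] cyc_mem[OF xj(3)] by blast
  qed (rule xj)
  have colN: "colon Q C (N j) = K (Suc j)" for j
  proof (rule antisym; rule subsetI)
    note xS = scal_smod[OF S_smod xj(3)[of j]]
    fix q assume q: "q \<in> colon Q C (N j)"
    then have "q \<in> S" using colon_anti[OF msum_left[OF CM xS]] CC unfolding N_def by blast
    moreover have "q \<otimes> x [^] Suc j \<in> C"
      using q msum_right[OF CM xS] cyc_mem[OF xj(3)] unfolding N_def colon_def by blast
    ultimately show "q \<in> K (Suc j)" unfolding K_def using xj(3)[of j] m_comm by auto
  next
    fix q assume q: "q \<in> K (Suc j)"
    then have qS: "q \<in> S" "x [^] Suc j \<otimes> q \<in> C" unfolding K_def by auto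
    have "q \<otimes> v \<in> C" if v: "v \<in> N j" for v
    proof -
      obtain c s where cs: "c \<in> C" "s \<in> S" "v = c \<oplus> x [^] Suc j \<otimes> s" using v unfolding N_def by (auto elim!: msumE scalE)
      have "q \<otimes> v = q \<otimes> c \<oplus> s \<otimes> (x [^] Suc j \<otimes> q)"
        using cs qS(1) smodsD(1)[OF CM] xj(3)[of j] by (simp add: r_distr m_ac del: nat_pow_Suc)
      then show ?thesis using smodsD(3)[OF CM smodsD(4)[OF CM qS(1) cs(1)] smodsD(4)[OF CM cs(2) qS(2)]] by simp
    qed
    then show "q \<in> colon Q C (N j)" using qS unfolding colon_def by auto
  qed
  have Keq: "K (n + k) = K n" for k using n[OF Kmono] .
  \<comment> \<open>\<open>N j\<close> is built from the power Suc j, and Suc (2 n + 1) = 2 (Suc n);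
    so the second module is C + y^2 S when the first is C + y S.\<close>
  have "N n = N (2 * n + 1)"
  proof -
    have "K (Suc n) = K (Suc (2 * n + 1))" using Keq[of 1] Keq[of "n + 2"] by (simp add: mult_2 add.assoc)
    then show ?thesis using bidual[OF C NF[of n]] bidual[OF C NF[of "2 * n + 1"]] colN by metis
  qed
  define y where "y = x [^] Suc n"
  have y: "y \<in> m" "y \<in> Units Q" "y \<in> carrier Q" using xj[of n] unfolding y_def by auto
  have yy: "x [^] Suc (2 * n + 1) = y \<otimes> y" unfolding y_def using xc nat_pow_mult[OF xc, of "Suc n" "Suc n"] by (simp add: mult_2)
  have "y \<in> N n" unfolding N_def y_def using msum_right[OF CM scal_smod[OF S_smod xj(3)]] cyc_mem[OF xj(3)] by blast
  then have "y \<in> msum Q C (scal Q (y \<otimes> y) S)" using \<open>N n = N (2 * n + 1)\<close> yy unfolding N_def by simp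
  then obtain c t where ct: "c \<in> C" "t \<in> S" "y = c \<oplus> (y \<otimes> y) \<otimes> t" by (auto elim!: msumE scalE)
  have cc: "c \<in> carrier Q" "t \<in> carrier Q" using ct smodsD(1)[OF CM] by auto
  have "(c \<oplus> (y \<otimes> y) \<otimes> t) \<ominus> (t \<otimes> y) \<otimes> y = c" using cc y(3) by algebra
  then have "y \<ominus> (t \<otimes> y) \<otimes> y \<in> C" using ct(1) ct(3)[symmetric] by simp
  then have "y \<in> C" by (rule cancel_one_minus[OF CM smodsD(4)[OF m_smod ct(2) y(1)] y(3)])
  then show ?thesis using fids_sub_S[OF CM CS _ y(2)] by blast
qed

text \<open>Taking colons reverses inclusions, strictly so by biduality; applying the inequality to
  the dual interval gives the other direction.\<close>

lemma len_dual:
  assumes C: "dualizing C" "C \<in> FI" and JI: "J \<in> FI" "I \<in> FI" "J \<subseteq> I"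
  shows "len (colon Q C I) (colon Q C J) = len J I"
proof -
  have CM: "C \<in> SM" using C unfolding dualizing_def by auto
  have le: "len J I \<le> len (colon Q C I) (colon Q C J)" if "J \<in> FI" "I \<in> FI" for J I
  proof (rule chain_len_antimono_map[where \<Phi>="colon Q C"])
    fix N assume "N \<in> SM" "J \<subseteq> N" "N \<subseteq> I"
    then show "colon Q C N \<in> SM \<and> colon Q C I \<subseteq> colon Q C N \<and> colon Q C N \<subseteq> colon Q C J"
      using colon_smod[OF CM smod_sub] colon_anti by auto
  next
    fix N N' assume N: "N \<in> SM" "J \<subseteq> N" "N' \<subseteq> I" "N' \<in> SM" "N \<subset> N'"
    have "N \<in> FI" "N' \<in> FI" using fids_between[of _ J I] N that by auto
    then have "colon Q C N \<noteq> colon Q C N'" using bidual[OF C(1)] N(5) by (metis psubset_eq)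
    then show "colon Q C N' \<subset> colon Q C N" using colon_anti[of N N'] N(5) by auto
  qed
  have "len (colon Q C I) (colon Q C J) \<le> len J I"
    using le[of "colon Q C I" "colon Q C J"] fids_colon[OF C(2)] JI bidual[OF C(1)] by simp
  then show ?thesis using le[OF JI(1,2)] by (rule antisym)
qed

lemma lenn_dual:
  assumes "dualizing C" "C \<in> FI" "J \<in> FI" "I \<in> FI" "J \<subseteq> I"
  shows "lenn (colon Q C I) (colon Q C J) = lenn J I"
  unfolding lenn_def using len_dual[OF assms] by simp

lemma m_prod_sub: "L \<in> SM \<Longrightarrow> m \<cdot> L \<subseteq> L"
  by (rule prod_least) (use m_sub smodsD in auto)

lemma colon_mult_self:
  assumes "dualizing C"
  shows "colon Q C C = S"
  using bidual[OF assms S_fid] colon_S assms unfolding dualizing_def by simp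

text \<open>Dualizing mC \<subseteq> C into C gives S \<subseteq> S : m, because C : C = S. This
  brings in one of the two copies of the type in the final formula.\<close>

lemma type_dual:
  assumes C: "dualizing C" "C \<in> FI"
  shows "lenn (m \<cdot> C) C = lenn S (colon Q S m)"
proof -
  have CM: "C \<in> SM" using C unfolding dualizing_def by auto
  have "lenn (colon Q C C) (colon Q C (m \<cdot> C)) = lenn (m \<cdot> C) C"
    by (rule lenn_dual[OF C fids_prod[OF m_fid C(2)] C(2) m_prod_sub[OF CM]])
  moreover have "colon Q C (m \<cdot> C) = colon Q S m"
    using prod_comm[OF m_smod CM] colon_prod[OF CM CM m_smod] colon_mult_self[OF C(1)] by simp
  ultimately show ?thesis using colon_mult_self[OF C(1)] by simp
qed

lemma lenn_m_S: "lenn m S = 1"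
proof -
  have "msum Q m (scal Q \<one> S) = S" using scal_one[OF S_sub] msum_least[OF S_smod m_sub order_refl] msum_right[OF m_smod S_smod] by auto
  then have "len m S = 1" using len_step[OF m_smod one_closed one_notin_m] m_carr by simp
  then show ?thesis unfolding lenn_def by (simp add: one_enat_def)
qed

text \<open>For L = D : D', duality turns L / mL first into (D' : m) / D' and then into S / m. Both
  have length one, so L = u S by Nakayama; L is regular, so u is a unit, and D' = D : L.\<close>

lemma dualizing_unique:
  assumes D: "dualizing D" "D \<in> FI" and D': "dualizing D'" "D' \<in> FI"
  shows "\<exists>u\<in>Units Q. D' = scal Q u D"
proof -
  have DM: "D \<in> SM" "D' \<in> SM" using D D' unfolding dualizing_def by auto
  define L where "L = colon Q D D'"
  have L: "L \<in> FI" unfolding L_def by (rule fids_colon[OF D(2) D'(2)])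
  note LM = fidsD(1)[OF L]
  have DL: "colon Q D L = D'" unfolding L_def by (rule bidual[OF D(1) D'(2)])
  have mL: "m \<cdot> L \<in> FI" "m \<cdot> L \<subseteq> L" using fids_prod[OF m_fid L] m_prod_sub[OF LM] by auto
  have "colon Q D (m \<cdot> L) = colon Q D' m" using prod_comm[OF m_smod LM] colon_prod[OF DM(1) LM m_smod] DL by simp
  then have "lenn (m \<cdot> L) L = lenn D' (colon Q D' m)" using lenn_dual[OF D mL(1) L mL(2)] DL by simp
  also have "\<dots> = 1" using lenn_dual[OF D' m_fid S_fid m_sub] colon_S[OF DM(2)] lenn_m_S by simp
  finally have 1: "lenn (m \<cdot> L) L = 1" .
  then have "m \<cdot> L \<noteq> L" unfolding lenn_def by (auto simp: zero_enat_def)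
  then obtain u where u: "u \<in> L" "u \<notin> m \<cdot> L" using mL(2) by auto
  have uc: "u \<in> carrier Q" using smodsD(1)[OF LM u(1)] .
  note uS = scal_smod[OF S_smod uc]
  let ?N = "msum Q (m \<cdot> L) (scal Q u S)"
  have N: "?N \<in> FI" "m \<cdot> L \<subseteq> ?N" "?N \<subseteq> L" "u \<in> ?N"
    using fids_add_cyc[OF mL(1) uc] msum_left[OF fidsD(1)[OF mL(1)] uS] msum_least[OF LM mL(2) cyc_least[OF LM u(1)]]
      msum_right[OF fidsD(1)[OF mL(1)] uS] cyc_mem[OF uc] by auto
  have "lenn (m \<cdot> L) ?N \<noteq> 0" using lenn_0_imp[OF mL(1) N(1,2)] u(2) N(4) by auto
  then have "lenn ?N L = 0" using lenn_add[OF mL(1) N(1) L N(2,3)] 1 by simp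
  then have NL: "?N = L" using lenn_0_imp[OF N(1) L N(3)] by simp
  obtain s where s: "s \<in> S" "s \<in> Units Q" "\<And>a. a \<in> L \<Longrightarrow> s \<otimes> a \<in> S" using fidsD(3)[OF L] by blast
  have "L \<subseteq> msum Q (scal Q u S) (m \<cdot> L)"
    using msum_least[OF msum_smod[OF uS fidsD(1)[OF mL(1)]] msum_right[OF uS fidsD(1)[OF mL(1)]] msum_left[OF uS fidsD(1)[OF mL(1)]]] NL by simp
  from nakayama[OF LM s(2,3) uS cyc_least[OF LM u(1)] this] have Lu: "L = scal Q u S" .
  obtain v where v: "v \<in> L" "v \<in> Units Q" using fidsD(2)[OF L] by blast
  obtain t where t: "t \<in> S" "v = u \<otimes> t" using v(1) unfolding Lu by (rule scalE)
  have uU: "u \<in> Units Q" using Units_mult_left[of u t] v(2) t uc by auto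
  have "D' = scal Q (inv u) D"
  proof (rule antisym; rule subsetI)
    fix d assume d: "d \<in> D'"
    then have "d \<otimes> u \<in> D" using DL u(1) unfolding colon_def by auto
    then have "inv u \<otimes> (d \<otimes> u) \<in> scal Q (inv u) D" by (rule scalI)
    moreover have "inv u \<otimes> (d \<otimes> u) = d" using uU smodsD(1)[OF DM(2) d] by (simp add: m_lcomm Units_closed)
    ultimately show "d \<in> scal Q (inv u) D" by simp
  next
    fix d assume "d \<in> scal Q (inv u) D"
    then obtain b where b: "b \<in> D" "d = inv u \<otimes> b" by (auto elim!: scalE)
    have bc: "b \<in> carrier Q" using smodsD(1)[OF DM(1) b(1)] .
    have "d \<otimes> l \<in> D" if l: "l \<in> L" for l
    proof -
      obtain t where t: "t \<in> S" "l = u \<otimes> t" using l unfolding Lu by (rule scalE)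
      have "d \<otimes> l = (inv u \<otimes> u) \<otimes> (b \<otimes> t)"
        unfolding b(2) t(2) using bc S_carr[OF t(1)] Units_inv_closed[OF uU] uc by algebra
      then have "d \<otimes> l = b \<otimes> t" using uU bc t by simp
      then show ?thesis using smodsD(5)[OF DM(1) t(1) b(1)] by simp
    qed
    then have "d \<in> colon Q D L" using b bc uU unfolding colon_def by auto
    then show "d \<in> D'" using DL by simp
  qed
  then show ?thesis using uU by blast
qed

end

section \<open>Ext modules of the residue field\<close>

declare free_module_simps [simp del]

lemma ideal_module_simps [simp]:
  "carrier (ideal_module Q V) = V" "\<zero>\<^bsub>ideal_module Q V\<^esub> = \<zero>\<^bsub>Q\<^esub>"
  "x \<oplus>\<^bsub>ideal_module Q V\<^esub> y = x \<oplus>\<^bsub>Q\<^esub> y" "r \<odot>\<^bsub>ideal_module Q V\<^esub> x = r \<otimes>\<^bsub>Q\<^esub> x"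
  by (simp_all add: ideal_module_def)

lemma ideal_module_carrier_update [simp]: "ideal_module (Q\<lparr>carrier := S\<rparr>) V = ideal_module Q V"
  by (simp add: ideal_module_def)

text \<open>Presents the length of an Ext module as the length of the interval from coboundaries to
  cocycles inside Hom(F, M).\<close>

lemma Ext_length:
  assumes M: "module R M" and R: "cring R"
    and d: "\<And>i. d i \<in> mod_hom R (free_module R (rk (Suc i))) (free_module R (rk i))"
    and dd: "\<And>i x. x \<in> carrier (free_module R (rk (Suc (Suc i)))) \<Longrightarrow> d i (d (Suc i) x) = \<zero>\<^bsub>free_module R (rk i)\<^esub>"
  shows "module_length R (quot_module R ((hom_module R (free_module R (rk i)) M)\<lparr>carrier := Ext_cocycles R rk d M i\<rparr>) (Ext_coboundaries R rk d M i))
    = chain_len (submods R ((hom_module R (free_module R (rk i)) M)\<lparr>carrier := Ext_cocycles R rk d M i\<rparr>))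
        (Ext_coboundaries R rk d M i) (Ext_cocycles R rk d M i)"
    "module R ((hom_module R (free_module R (rk i)) M)\<lparr>carrier := Ext_cocycles R rk d M i\<rparr>)"
    "submodule (Ext_coboundaries R rk d M i) R ((hom_module R (free_module R (rk i)) M)\<lparr>carrier := Ext_cocycles R rk d M i\<rparr>)"
proof -
  interpret R: cring R by fact
  interpret M: module R M by fact
  let ?F = "\<lambda>i. free_module R (rk i)"
  let ?H = "\<lambda>i. hom_module R (?F i) M"
  have F: "module R (?F i)" for i by (rule R.module_free)
  have H: "module R (?H i)" for i by (rule module_hom[OF F M])
  have Hs: "carrier (?H i) = mod_hom R (?F i) M" "\<zero>\<^bsub>?H i\<^esub> = (\<lambda>x\<in>carrier (?F i). \<zero>\<^bsub>M\<^esub>)"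
    "f \<oplus>\<^bsub>?H i\<^esub> g = (\<lambda>x\<in>carrier (?F i). f x \<oplus>\<^bsub>M\<^esub> g x)" "r \<odot>\<^bsub>?H i\<^esub> f = (\<lambda>x\<in>carrier (?F i). r \<odot>\<^bsub>M\<^esub> f x)" for f g r i
    by (simp_all add: hom_module_def)
  have dc: "d i x \<in> carrier (?F i)" if "x \<in> carrier (?F (Suc i))" for i x using mod_homD(1)[OF d that] .
  have coc: "submodule (Ext_cocycles R rk d M i) R (?H i)" for i
  proof (rule submoduleI'[OF H])
    show "Ext_cocycles R rk d M i \<subseteq> carrier (?H i)" unfolding Ext_cocycles_def Hs by auto
    have "\<zero>\<^bsub>?H i\<^esub> \<in> mod_hom R (?F i) M" using abelian_monoid.zero_closed[of "?H i"] H[of i] unfolding module_def abelian_group_def Hs(1) by simp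
    then show "\<zero>\<^bsub>?H i\<^esub> \<in> Ext_cocycles R rk d M i" unfolding Ext_cocycles_def using dc by (simp add: Hs(2))
    fix f g assume fg: "f \<in> Ext_cocycles R rk d M i" "g \<in> Ext_cocycles R rk d M i"
    then have "f \<oplus>\<^bsub>?H i\<^esub> g \<in> mod_hom R (?F i) M"
      using abelian_monoid.a_closed[of "?H i" f g] H[of i] unfolding module_def abelian_group_def Hs(1) Ext_cocycles_def by simp
    then show "f \<oplus>\<^bsub>?H i\<^esub> g \<in> Ext_cocycles R rk d M i" using fg dc unfolding Ext_cocycles_def by (simp add: Hs(3))
  next
    fix r f assume rf: "r \<in> carrier R" "f \<in> Ext_cocycles R rk d M i"
    then have "r \<odot>\<^bsub>?H i\<^esub> f \<in> mod_hom R (?F i) M"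
      using module.smult_closed[OF H[of i], of r f] unfolding Hs(1) Ext_cocycles_def by simp
    then show "r \<odot>\<^bsub>?H i\<^esub> f \<in> Ext_cocycles R rk d M i" using rf dc unfolding Ext_cocycles_def by (simp add: Hs(4))
  qed
  let ?C = "\<lambda>i. (?H i)\<lparr>carrier := Ext_cocycles R rk d M i\<rparr>"
  have C: "module R (?C i)" for i by (rule module_submodule[OF H coc])
  have cob: "submodule (Ext_coboundaries R rk d M i) R (?C i)"
  proof (cases i)
    case 0
    show ?thesis
      using submoduleD(2)[OF H coc[of 0]] abelian_monoid.l_zero[of "?H 0" "\<zero>\<^bsub>?H 0\<^esub>"] abelian_monoid.zero_closed[of "?H 0"]
        module.smult_r_null[OF H[of 0]] H[of 0]
      unfolding 0 by (intro submoduleI'[OF C]) (auto simp: module_def abelian_group_def)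
  next
    case (Suc j)
    let ?c = "\<lambda>g. \<lambda>x\<in>carrier (?F (Suc j)). g (d j x)"
    have c: "?c g \<in> Ext_cocycles R rk d M (Suc j)" if g: "g \<in> mod_hom R (?F j) M" for g
    proof -
      have "?c g \<in> mod_hom R (?F (Suc j)) M"
        using mod_homD(1-3)[OF g] mod_homD(1-3)[OF d[of j]] by (intro mod_homI[OF _ _ _ F]) simp_all
      then show ?thesis unfolding Ext_cocycles_def using dd[of _ j] dc mod_hom_zero[OF g F M] by simp
    qed
    show ?thesis
      unfolding Suc Ext_coboundaries.simps
    proof (rule submoduleI'[OF C])
      show "?c ` mod_hom R (?F j) M \<subseteq> carrier (?C (Suc j))" using c by auto
      have z: "\<zero>\<^bsub>?H j\<^esub> \<in> mod_hom R (?F j) M" using abelian_monoid.zero_closed[of "?H j"] H[of j] unfolding module_def abelian_group_def Hs(1) by simp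
      have "?c \<zero>\<^bsub>?H j\<^esub> = \<zero>\<^bsub>?C (Suc j)\<^esub>" using dc by (auto simp: Hs(2) intro!: restrict_ext)
      from this[symmetric] show "\<zero>\<^bsub>?C (Suc j)\<^esub> \<in> ?c ` mod_hom R (?F j) M" by (rule rev_image_eqI[OF z])
    next
      fix f g assume "f \<in> ?c ` mod_hom R (?F j) M" "g \<in> ?c ` mod_hom R (?F j) M"
      then obtain f' g' where fg: "f' \<in> mod_hom R (?F j) M" "g' \<in> mod_hom R (?F j) M" "f = ?c f'" "g = ?c g'" by (elim imageE)
      have s: "f' \<oplus>\<^bsub>?H j\<^esub> g' \<in> mod_hom R (?F j) M"
        using abelian_monoid.a_closed[of "?H j" f' g'] H[of j] fg unfolding module_def abelian_group_def Hs(1) by simp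
      have "?c (f' \<oplus>\<^bsub>?H j\<^esub> g') = f \<oplus>\<^bsub>?C (Suc j)\<^esub> g" unfolding fg using dc by (auto simp: Hs(3) intro!: restrict_ext)
      from this[symmetric] show "f \<oplus>\<^bsub>?C (Suc j)\<^esub> g \<in> ?c ` mod_hom R (?F j) M" by (rule rev_image_eqI[OF s])
    next
      fix r f assume r: "r \<in> carrier R" and "f \<in> ?c ` mod_hom R (?F j) M"
      then obtain f' where fg: "f' \<in> mod_hom R (?F j) M" "f = ?c f'" by (elim imageE)
      have s: "r \<odot>\<^bsub>?H j\<^esub> f' \<in> mod_hom R (?F j) M"
        using module.smult_closed[OF H[of j], of r f'] fg r unfolding Hs(1) by simp
      have "?c (r \<odot>\<^bsub>?H j\<^esub> f') = r \<odot>\<^bsub>?C (Suc j)\<^esub> f" unfolding fg using dc by (auto simp: Hs(4) intro!: restrict_ext)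
      from this[symmetric] show "r \<odot>\<^bsub>?C (Suc j)\<^esub> f \<in> ?c ` mod_hom R (?F j) M" by (rule rev_image_eqI[OF s])
    qed
  qed
  show "module R (?C i)" "submodule (Ext_coboundaries R rk d M i) R (?C i)" by (rule C cob)+
  show "module_length R (quot_module R (?C i) (Ext_coboundaries R rk d M i)) =
    chain_len (submods R (?C i)) (Ext_coboundaries R rk d M i) (Ext_cocycles R rk d M i)"
    using module_length_quot[OF C cob] by simp
qed

section \<open>Ideals and submodules in the sense of the definitions\<close>

context frac_ring
begin

abbreviation "RR \<equiv> Q\<lparr>carrier := S\<rparr>"

lemma RR_cring: "cring RR"
  using subcring_iff[OF S_sub] subcringI'[OF subring] by blast

lemma ideal_RR_iff: "ideal I RR \<longleftrightarrow> I \<in> SM \<and> I \<subseteq> S"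
proof
  assume "ideal I RR"
  note D = cring_idealD[OF RR_cring this]
  show "I \<in> SM \<and> I \<subseteq> S" using D by (auto intro!: smodsI)
next
  assume I: "I \<in> SM \<and> I \<subseteq> S"
  then show "ideal I RR" using smodsD[of I] by (intro cring_idealI[OF RR_cring]) auto
qed

lemma module_SM:
  assumes V: "V \<in> SM"
  shows "module RR (ideal_module Q V)"
proof (rule moduleI[OF RR_cring])
  note D = smodsD[OF V]
  show "abelian_group (ideal_module Q V)"
  proof (rule abelian_groupI)
    fix x assume x: "x \<in> carrier (ideal_module Q V)"
    then have "\<ominus> x \<in> V" "\<ominus> x \<oplus> x = \<zero>" using D by (auto simp: l_neg)
    then show "\<exists>y\<in>carrier (ideal_module Q V). y \<oplus>\<^bsub>ideal_module Q V\<^esub> x = \<zero>\<^bsub>ideal_module Q V\<^esub>" by auto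
  qed (use D in \<open>auto simp: a_ac\<close>)
qed (use smodsD[OF V] in \<open>auto simp: l_distr r_distr m_assoc\<close>)

lemma submods_SM: "V \<in> SM \<Longrightarrow> submodule N RR (ideal_module Q V) \<longleftrightarrow> N \<in> SM \<and> N \<subseteq> V"
proof
  assume V: "V \<in> SM" and N: "submodule N RR (ideal_module Q V)"
  note D = submoduleD[OF module_SM[OF V] N]
  show "N \<in> SM \<and> N \<subseteq> V" using D(1-4) smod_sub[OF V] by (auto intro!: smodsI)
next
  assume V: "V \<in> SM" and N: "N \<in> SM \<and> N \<subseteq> V"
  then show "submodule N RR (ideal_module Q V)" using smodsD[of N] by (intro submoduleI'[OF module_SM[OF V]]) auto
qed

lemma colength_eq:
  assumes "I \<in> SM" "I \<subseteq> S"
  shows "colength RR I = the_enat (len I S)"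
proof -
  have "module_length RR (quot_module RR (ideal_module Q S) I) = chain_len (submods RR (ideal_module Q S)) I S"
    using module_length_quot[OF module_SM[OF S_smod]] submods_SM[OF S_smod] assms by simp
  also have "\<dots> = len I S"
    by (rule antisym; rule chain_len_mono_map[where \<Phi>="\<lambda>N. N"]) (use submods_SM[OF S_smod] in auto)
  finally show ?thesis unfolding colength_def by simp
qed

text \<open>A linear surjection onto W under which V pulls back to N induces an isomorphism M / N
  \<cong> W / V. It moves lengths of Ext modules into Q.\<close>

lemma surj_len:
  assumes M: "module RR M" and N: "submodule N RR M" and V: "V \<in> SM" and W: "W \<in> SM" "V \<subseteq> W"
    and add: "\<And>f g. f \<in> carrier M \<Longrightarrow> g \<in> carrier M \<Longrightarrow> \<phi> (f \<oplus>\<^bsub>M\<^esub> g) = \<phi> f \<oplus> \<phi> g"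
    and sm: "\<And>r f. r \<in> S \<Longrightarrow> f \<in> carrier M \<Longrightarrow> \<phi> (r \<odot>\<^bsub>M\<^esub> f) = r \<otimes> \<phi> f"
    and im: "\<phi> ` carrier M = W" and ker: "\<And>f. f \<in> carrier M \<Longrightarrow> \<phi> f \<in> V \<longleftrightarrow> f \<in> N"
  shows "chain_len (submods RR M) N (carrier M) = len V W"
proof -
  interpret M: module RR M by fact
  have c: "\<phi> f \<in> W" if "f \<in> carrier M" for f using im that by auto
  have cc: "\<phi> f \<in> carrier Q" if "f \<in> carrier M" for f using c[OF that] smodsD(1)[OF W(1)] by auto
  have z: "\<phi> \<zero>\<^bsub>M\<^esub> = \<zero>"
  proof -
    have "\<phi> (\<zero> \<odot>\<^bsub>M\<^esub> \<zero>\<^bsub>M\<^esub>) = \<zero> \<otimes> \<phi> \<zero>\<^bsub>M\<^esub>" by (rule sm[OF S_zero M.zero_closed])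
    moreover have "\<zero> \<odot>\<^bsub>M\<^esub> \<zero>\<^bsub>M\<^esub> = \<zero>\<^bsub>M\<^esub>" using M.smult_r_null[of \<zero>] S_zero by simp
    ultimately show ?thesis using cc[OF M.zero_closed] by simp
  qed
  have mi: "\<phi> (f \<ominus>\<^bsub>M\<^esub> g) = \<phi> f \<ominus> \<phi> g" if "f \<in> carrier M" "g \<in> carrier M" for f g
  proof -
    have "\<phi> (f \<ominus>\<^bsub>M\<^esub> g) \<oplus> \<phi> g = \<phi> f" using add[of "f \<ominus>\<^bsub>M\<^esub> g" g] that by (simp add: a_minus_def M.a_assoc M.l_neg)
    moreover have "\<phi> (f \<ominus>\<^bsub>M\<^esub> g) = (\<phi> (f \<ominus>\<^bsub>M\<^esub> g) \<oplus> \<phi> g) \<ominus> \<phi> g"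
      using cc[OF M.minus_closed[OF that]] cc[OF that(2)] by algebra
    ultimately show ?thesis by simp
  qed
  have "chain_len (submods RR M) N (carrier M) \<le> len V W"
  proof (rule chain_len_mono_map[where \<Phi>="\<lambda>U. \<phi> ` U"])
    fix U assume U: "U \<in> submods RR M" "N \<subseteq> U" "U \<subseteq> carrier M"
    have US: "submodule U RR M" using U by simp
    note UD = submoduleD[OF M US]
    have "\<phi> ` U \<in> SM"
    proof (rule smodsI)
      show "\<phi> ` U \<subseteq> carrier Q" using cc U(3) by auto
      show "\<zero> \<in> \<phi> ` U" using z UD(2) by (metis imageI)
      fix a b assume "a \<in> \<phi> ` U" "b \<in> \<phi> ` U"
      then obtain f g where fg: "f \<in> U" "g \<in> U" "a = \<phi> f" "b = \<phi> g" by (elim imageE)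
      then have "a \<oplus> b = \<phi> (f \<oplus>\<^bsub>M\<^esub> g)" using add U(3) by (simp add: subsetD)
      then show "a \<oplus> b \<in> \<phi> ` U" using UD(3)[OF fg(1,2)] by (metis imageI)
    next
      fix s a assume s: "s \<in> S" "a \<in> \<phi> ` U"
      then obtain f where f: "f \<in> U" "a = \<phi> f" by (elim imageE)
      then have e: "s \<otimes> a = \<phi> (s \<odot>\<^bsub>M\<^esub> f)" using sm s U(3) by (simp add: subsetD)
      have "s \<odot>\<^bsub>M\<^esub> f \<in> U" using UD(4)[of s f] f s by simp
      then show "s \<otimes> a \<in> \<phi> ` U" using e by (rule rev_image_eqI)
    qed
    moreover have "V \<subseteq> \<phi> ` U"
    proof
      fix v assume v: "v \<in> V"
      then obtain f where f: "f \<in> carrier M" "v = \<phi> f" using im W(2) by blast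
      then have "f \<in> U" using ker v U(2) by blast
      then show "v \<in> \<phi> ` U" using f(2) by (rule rev_image_eqI)
    qed
    ultimately show "\<phi> ` U \<in> SM \<and> V \<subseteq> \<phi> ` U \<and> \<phi> ` U \<subseteq> W" using c U(3) by auto
  next
    fix U U' assume U: "U \<in> submods RR M" "N \<subseteq> U" "U' \<subseteq> carrier M" "U' \<in> submods RR M" "U \<subset> U'"
    have US: "submodule U RR M" using U by simp
    obtain f where f: "f \<in> U'" "f \<notin> U" using U(5) by auto
    have "\<phi> f \<notin> \<phi> ` U"
    proof
      assume "\<phi> f \<in> \<phi> ` U"
      then obtain g where g: "g \<in> U" "\<phi> f = \<phi> g" by (elim imageE)
      have fg: "f \<in> carrier M" "g \<in> carrier M" using f g U by auto
      have "\<phi> (f \<ominus>\<^bsub>M\<^esub> g) = \<zero>" using mi[OF fg] g(2) cc[OF fg(2)] by (simp add: a_minus_def r_neg)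
      then have "f \<ominus>\<^bsub>M\<^esub> g \<in> N" using ker[of "f \<ominus>\<^bsub>M\<^esub> g"] fg smodsD(2)[OF V] by simp
      then have "(f \<ominus>\<^bsub>M\<^esub> g) \<oplus>\<^bsub>M\<^esub> g \<in> U" using submoduleD(3)[OF M US] g U(2) by blast
      moreover have "(f \<ominus>\<^bsub>M\<^esub> g) \<oplus>\<^bsub>M\<^esub> g = f" using fg by (simp add: a_minus_def M.a_assoc M.l_neg)
      ultimately show False using f by simp
    qed
    then show "\<phi> ` U \<subset> \<phi> ` U'" using U(5) f by blast
  qed
  moreover have "len V W \<le> chain_len (submods RR M) N (carrier M)"
  proof (rule chain_len_mono_map[where \<Phi>="\<lambda>U. {f \<in> carrier M. \<phi> f \<in> U}"])
    fix U assume U: "U \<in> SM" "V \<subseteq> U" "U \<subseteq> W"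
    have "submodule {f \<in> carrier M. \<phi> f \<in> U} RR M"
      using smodsD(2-4)[OF U(1)] add sm z by (intro submoduleI'[OF M]) auto
    moreover have "N \<subseteq> {f \<in> carrier M. \<phi> f \<in> U}" using ker U(2) submoduleD(1)[OF M N] by blast
    ultimately show "{f \<in> carrier M. \<phi> f \<in> U} \<in> submods RR M \<and> N \<subseteq> {f \<in> carrier M. \<phi> f \<in> U} \<and> {f \<in> carrier M. \<phi> f \<in> U} \<subseteq> carrier M" by blast
  next
    fix U U' assume U: "U \<in> SM" "V \<subseteq> U" "U' \<subseteq> W" "U' \<in> SM" "U \<subset> U'"
    then obtain v where v: "v \<in> U'" "v \<notin> U" by auto
    then obtain f where "f \<in> carrier M" "v = \<phi> f" using im U(3) by blast
    then show "{f \<in> carrier M. \<phi> f \<in> U} \<subset> {f \<in> carrier M. \<phi> f \<in> U'}" using v U(5) by blast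
  qed
  ultimately show ?thesis by (rule antisym)
qed

end

section \<open>The residue field and its free resolutions\<close>

context cm_one
begin

lemma RR_noetherian: "noetherian_ring RR"
proof -
  interpret R: cring RR by (rule RR_cring)
  show ?thesis
  proof (rule R.trivial_ideal_chain_imp_noetherian)
    fix C assume C: "C \<noteq> {}" "subset.chain {I. ideal I RR} C"
    then have sub: "C \<subseteq> {N \<in> SM. N \<subseteq> S}" unfolding pred_on.chain_def using ideal_RR_iff by auto
    from noeth[OF C(1) sub] obtain N where N: "N \<in> C" and mx: "\<forall>N'\<in>C. N \<subseteq> N' \<longrightarrow> N' = N" by (rule bexE)
    have "N' \<subseteq> N" if N': "N' \<in> C" for N'
    proof -
      have "N' \<subseteq> N \<or> N \<subseteq> N'" using C(2) N N' unfolding subset_chain_def by simp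
      then show ?thesis using mx[rule_format, OF N'] by auto
    qed
    then have "\<Union>C = N" using N by auto
    then show "\<Union>C \<in> C" using N by simp
  qed
qed

abbreviation "kk \<equiv> quot_module RR (ideal_module Q S) m"

lemma m_submodule: "submodule m RR (ideal_module Q S)"
  using submods_SM[OF S_smod] m_smod m_sub by simp

lemma kk_module: "module RR kk" by (rule module_quot[OF module_SM[OF S_smod] m_submodule])

lemma quotient_map:
  "(\<lambda>s\<in>S. m +>\<^bsub>ideal_module Q S\<^esub> s) \<in> mod_hom RR (ideal_module Q S) kk"
proof -
  note q = quot_add[OF module_SM[OF S_smod] m_submodule] quot_smult[OF module_SM[OF S_smod] m_submodule]
    quot_carrier[OF module_SM[OF S_smod] m_submodule]
  have "restrict (\<lambda>s. m +>\<^bsub>ideal_module Q S\<^esub> s) (carrier (ideal_module Q S)) \<in> mod_hom RR (ideal_module Q S) kk"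
  proof (rule mod_homI[OF _ _ _ module_SM[OF S_smod]])
    fix x assume "x \<in> carrier (ideal_module Q S)"
    then show "m +>\<^bsub>ideal_module Q S\<^esub> x \<in> carrier kk" unfolding q(3) by auto
  next
    fix x y assume xy: "x \<in> carrier (ideal_module Q S)" "y \<in> carrier (ideal_module Q S)"
    show "m +>\<^bsub>ideal_module Q S\<^esub> (x \<oplus>\<^bsub>ideal_module Q S\<^esub> y) = (m +>\<^bsub>ideal_module Q S\<^esub> x) \<oplus>\<^bsub>kk\<^esub> (m +>\<^bsub>ideal_module Q S\<^esub> y)"
      using q(1)[OF xy] by simp
  next
    fix r x assume rx: "r \<in> carrier RR" "x \<in> carrier (ideal_module Q S)"
    show "m +>\<^bsub>ideal_module Q S\<^esub> (r \<odot>\<^bsub>ideal_module Q S\<^esub> x) = r \<odot>\<^bsub>kk\<^esub> (m +>\<^bsub>ideal_module Q S\<^esub> x)"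
      using q(2)[OF rx] by simp
  qed
  then show ?thesis by simp
qed

lemma resolution_ex: "\<exists>rk d \<epsilon>. free_resolution RR kk rk d \<epsilon>"
proof -
  interpret R: cring RR by (rule RR_cring)
  let ?F = "free_module RR 1"
  interpret F: module RR ?F by (rule R.module_free)
  have "restrict (\<lambda>v. m +>\<^bsub>ideal_module Q S\<^esub> (v 0)) (carrier ?F) \<in> mod_hom RR ?F kk"
  proof (rule mod_homI[OF _ _ _ R.module_free])
    fix v assume v: "v \<in> carrier ?F"
    have v0: "v 0 \<in> S" using R.FM_mem[OF v, of 0] by simp
    show "m +>\<^bsub>ideal_module Q S\<^esub> v 0 \<in> carrier kk"
      unfolding quot_carrier[OF module_SM[OF S_smod] m_submodule] using v0 by auto
    {
      fix w assume w: "w \<in> carrier ?F"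
      have w0: "w 0 \<in> S" using R.FM_mem[OF w, of 0] by simp
      show "m +>\<^bsub>ideal_module Q S\<^esub> (v \<oplus>\<^bsub>?F\<^esub> w) 0 = (m +>\<^bsub>ideal_module Q S\<^esub> v 0) \<oplus>\<^bsub>kk\<^esub> (m +>\<^bsub>ideal_module Q S\<^esub> w 0)"
        using quot_add[OF module_SM[OF S_smod] m_submodule, of "v 0" "w 0"] v0 w0 by (simp add: free_module_simps)
    }
    fix r assume r: "r \<in> carrier RR"
    show "m +>\<^bsub>ideal_module Q S\<^esub> (r \<odot>\<^bsub>?F\<^esub> v) 0 = r \<odot>\<^bsub>kk\<^esub> (m +>\<^bsub>ideal_module Q S\<^esub> v 0)"
      using quot_smult[OF module_SM[OF S_smod] m_submodule, of r "v 0"] v0 r by (simp add: free_module_simps)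
  qed
  moreover have "restrict (\<lambda>v. m +>\<^bsub>ideal_module Q S\<^esub> (v 0)) (carrier ?F) ` carrier ?F = carrier kk"
  proof (rule antisym; rule subsetI)
    fix X assume "X \<in> carrier kk"
    then obtain s where s: "s \<in> S" "X = m +>\<^bsub>ideal_module Q S\<^esub> s"
      unfolding quot_carrier[OF module_SM[OF S_smod] m_submodule] by auto
    then have "(\<lambda>i\<in>{..<1}. s) \<in> carrier ?F" by (simp add: free_module_simps)
    then show "X \<in> restrict (\<lambda>v. m +>\<^bsub>ideal_module Q S\<^esub> (v 0)) (carrier ?F) ` carrier ?F"
      using s by (intro image_eqI[of _ _ "\<lambda>i\<in>{..<1}. s"]) simp_all
  qed (use mod_homD(1)[OF calculation] in auto)
  ultimately have "\<exists>rk d. free_resolution RR kk rk d (restrict (\<lambda>v. m +>\<^bsub>ideal_module Q S\<^esub> (v 0)) (carrier ?F))"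
    by (rule R.free_resolution_ex[OF RR_noetherian kk_module])
  then show ?thesis by (elim exE) (intro exI)
qed

end

text \<open>Stands for the resolution picked inside \<open>Ext\<close>, about which nothing but
  exactness is known; in particular its ranks are arbitrary.\<close>

locale cm_res = cm_one Q S m for Q (structure) and S m +
  fixes rk :: "nat \<Rightarrow> nat" and d :: "nat \<Rightarrow> (nat \<Rightarrow> 'a) \<Rightarrow> nat \<Rightarrow> 'a" and \<epsilon>
  assumes res: "free_resolution RR kk rk d \<epsilon>"
begin

abbreviation "F i \<equiv> free_module RR (rk i)"

lemma RC: "cring RR" by (rule RR_cring)
lemma FM: "module RR (F i)" by (rule cring.module_free[OF RR_cring])

lemma d_hom: "d i \<in> mod_hom RR (F (Suc i)) (F i)" using res unfolding free_resolution_def Let_def by auto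
lemma e_hom: "\<epsilon> \<in> mod_hom RR (F 0) kk" using res unfolding free_resolution_def Let_def by auto
lemma e_surj: "\<epsilon> ` carrier (F 0) = carrier kk" using res unfolding free_resolution_def Let_def by auto
lemma exact0: "d 0 ` carrier (F 1) = {x \<in> carrier (F 0). \<epsilon> x = \<zero>\<^bsub>kk\<^esub>}" using res unfolding free_resolution_def Let_def by auto
lemma exactS: "d (Suc i) ` carrier (F (Suc (Suc i))) = {x \<in> carrier (F (Suc i)). d i x = \<zero>\<^bsub>F i\<^esub>}"
  using res unfolding free_resolution_def Let_def by auto

lemma d_closed: "w \<in> carrier (F (Suc i)) \<Longrightarrow> d i w \<in> carrier (F i)" by (rule mod_homD(1)[OF d_hom])
lemma dd0: "w \<in> carrier (F (Suc (Suc i))) \<Longrightarrow> d i (d (Suc i) w) = \<zero>\<^bsub>F i\<^esub>" using exactS by blast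

text \<open>A cocycle factors through the image of the preceding differential: a - b is a cycle,
  hence a boundary, and f vanishes on boundaries.\<close>

lemma kills_kernel:
  assumes M: "module RR M" and f: "f \<in> mod_hom RR (F (Suc i)) M"
    and f0: "\<And>z. z \<in> carrier (F (Suc (Suc i))) \<Longrightarrow> f (d (Suc i) z) = \<zero>\<^bsub>M\<^esub>"
    and ab: "a \<in> carrier (F (Suc i))" "b \<in> carrier (F (Suc i))" "d i a = d i b"
  shows "f a = f b"
proof -
  interpret F: module RR "F (Suc i)" by (rule FM)
  interpret F': module RR "F i" by (rule FM)
  interpret M: module RR M by fact
  have "d i (a \<ominus>\<^bsub>F (Suc i)\<^esub> b) = d i a \<ominus>\<^bsub>F i\<^esub> d i b"
    unfolding a_minus_def using mod_homD(2)[OF d_hom] mod_hom_minus[OF d_hom FM FM ab(2)] ab by simp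
  then have "d i (a \<ominus>\<^bsub>F (Suc i)\<^esub> b) = \<zero>\<^bsub>F i\<^esub>" using ab(3) d_closed[OF ab(2)] by (simp add: a_minus_def F'.r_neg)
  then have "a \<ominus>\<^bsub>F (Suc i)\<^esub> b \<in> d (Suc i) ` carrier (F (Suc (Suc i)))" unfolding exactS using ab by simp
  then have "f (a \<ominus>\<^bsub>F (Suc i)\<^esub> b) = \<zero>\<^bsub>M\<^esub>" using f0 by (elim imageE) simp
  moreover have "f ((a \<ominus>\<^bsub>F (Suc i)\<^esub> b) \<oplus>\<^bsub>F (Suc i)\<^esub> b) = f (a \<ominus>\<^bsub>F (Suc i)\<^esub> b) \<oplus>\<^bsub>M\<^esub> f b"
    using mod_homD(2)[OF f] ab by simp
  moreover have "(a \<ominus>\<^bsub>F (Suc i)\<^esub> b) \<oplus>\<^bsub>F (Suc i)\<^esub> b = a" using ab by (simp add: a_minus_def F.a_assoc F.l_neg)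
  ultimately show ?thesis using mod_homD(1)[OF f ab(2)] by simp
qed

text \<open>The rank of F 0 may exceed one, so \<epsilon> is lifted through S \<rightarrow> k to
  \<pi>. The vector u then plays the part of a free generator lying over the unit of k.\<close>

lemma augmentation:
  obtains \<pi> u where "\<pi> \<in> mod_hom RR (F 0) (ideal_module Q S)" "u \<in> carrier (F 0)" "\<pi> u = \<one>"
    "d 0 ` carrier (F 1) = {v \<in> carrier (F 0). \<pi> v \<in> m}"
proof -
  interpret R: cring RR by (rule RC)
  interpret F: module RR "F 0" by (rule FM)
  note SM = module_SM[OF S_smod]
  note ceq = coset_eq_iff[OF SM m_submodule]
  have "\<epsilon> v \<in> (\<lambda>s\<in>S. m +>\<^bsub>ideal_module Q S\<^esub> s) ` carrier (ideal_module Q S)" if "v \<in> carrier (F 0)" for v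
    using mod_homD(1)[OF e_hom that] unfolding quot_carrier[OF SM m_submodule] by auto
  then obtain \<pi> where \<pi>: "\<pi> \<in> mod_hom RR (F 0) (ideal_module Q S)"
    "\<And>v. v \<in> carrier (F 0) \<Longrightarrow> (\<lambda>s\<in>S. m +>\<^bsub>ideal_module Q S\<^esub> s) (\<pi> v) = \<epsilon> v"
    using R.free_lift[OF SM kk_module quotient_map e_hom] by blast
  have \<pi>S: "\<pi> v \<in> S" if "v \<in> carrier (F 0)" for v using mod_homD(1)[OF \<pi>(1) that] by simp
  have im: "m +>\<^bsub>ideal_module Q S\<^esub> s = m +>\<^bsub>ideal_module Q S\<^esub> t \<longleftrightarrow> s \<ominus> t \<in> m" if "s \<in> S" "t \<in> S" for s t
  proof -
    have "\<ominus>\<^bsub>ideal_module Q S\<^esub> t = \<ominus> t"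
    proof -
      interpret I: module RR "ideal_module Q S" by (rule SM)
      have "t \<oplus>\<^bsub>ideal_module Q S\<^esub> \<ominus> t = \<zero>\<^bsub>ideal_module Q S\<^esub>" using that by (simp add: r_neg)
      then show ?thesis using I.add.inv_equality[of "\<ominus> t" t] that S_neg by (simp add: I.a_comm a_inv_def l_neg)
    qed
    then show ?thesis using ceq[of s t] that by (simp add: a_minus_def)
  qed
  have e: "\<epsilon> v = m +>\<^bsub>ideal_module Q S\<^esub> \<pi> v" if "v \<in> carrier (F 0)" for v using \<pi>(2)[OF that] \<pi>S[OF that] by simp
  have "m +>\<^bsub>ideal_module Q S\<^esub> \<one> \<in> carrier kk" unfolding quot_carrier[OF SM m_submodule] using S_one by auto
  then obtain w where w: "w \<in> carrier (F 0)" "\<epsilon> w = m +>\<^bsub>ideal_module Q S\<^esub> \<one>" unfolding e_surj[symmetric] by (elim imageE) simp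
  have "\<pi> w \<ominus> \<one> \<in> m" using e[OF w(1)] w(2) im[OF \<pi>S[OF w(1)] S_one] by simp
  have "\<pi> w \<notin> m"
  proof
    assume "\<pi> w \<in> m"
    then have "\<pi> w \<ominus> (\<pi> w \<ominus> \<one>) \<in> m" using smodsD(7)[OF m_smod] \<open>\<pi> w \<ominus> \<one> \<in> m\<close> by blast
    moreover have "\<pi> w \<ominus> (\<pi> w \<ominus> \<one>) = \<one>" using S_carr[OF \<pi>S[OF w(1)]] by algebra
    ultimately show False using one_notin_m by simp
  qed
  then have pu: "\<pi> w \<in> Units Q" "inv (\<pi> w) \<in> S" using loc \<pi>S[OF w(1)] by auto
  \<comment> \<open>\<open>w\<close> maps to 1 only modulo m, so \<pi> w is a unit of S and can be
    divided out.\<close>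
  define u where "u = inv (\<pi> w) \<odot>\<^bsub>F 0\<^esub> w"
  have u: "u \<in> carrier (F 0)" unfolding u_def using F.smult_closed pu w by simp
  have "\<pi> u = inv (\<pi> w) \<otimes> \<pi> w" unfolding u_def using mod_homD(3)[OF \<pi>(1), of "inv (\<pi> w)" w] pu w by simp
  then have "\<pi> u = \<one>" using pu by simp
  moreover have "d 0 ` carrier (F 1) = {v \<in> carrier (F 0). \<pi> v \<in> m}"
  proof -
    have "\<epsilon> v = \<zero>\<^bsub>kk\<^esub> \<longleftrightarrow> \<pi> v \<in> m" if v: "v \<in> carrier (F 0)" for v
      using e[OF v] im[OF \<pi>S[OF v] S_zero] quot_zero[OF SM m_submodule] S_carr[OF \<pi>S[OF v]] by (simp add: a_minus_def)
    then show ?thesis unfolding exact0 by auto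
  qed
  ultimately show ?thesis using that \<pi>(1) u by blast
qed

section \<open>Cocycles and coboundaries with values in submodules of Q\<close>

abbreviation "MV V \<equiv> ideal_module Q V"

lemma hom_into:
  assumes "f \<in> mod_hom RR (F i) (MV V)"
  shows "\<And>w. w \<in> carrier (F i) \<Longrightarrow> f w \<in> V" "\<And>w w'. w \<in> carrier (F i) \<Longrightarrow> w' \<in> carrier (F i) \<Longrightarrow> f (w \<oplus>\<^bsub>F i\<^esub> w') = f w \<oplus> f w'"
    "\<And>s w. s \<in> S \<Longrightarrow> w \<in> carrier (F i) \<Longrightarrow> f (s \<odot>\<^bsub>F i\<^esub> w) = s \<otimes> f w"
  using mod_homD(1-3)[OF assms] by simp_all

lemma hom_intoI:
  assumes "\<And>w. w \<in> carrier (F i) \<Longrightarrow> f w \<in> V" "\<And>w w'. w \<in> carrier (F i) \<Longrightarrow> w' \<in> carrier (F i) \<Longrightarrow> f (w \<oplus>\<^bsub>F i\<^esub> w') = f w \<oplus> f w'"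
    "\<And>s w. s \<in> S \<Longrightarrow> w \<in> carrier (F i) \<Longrightarrow> f (s \<odot>\<^bsub>F i\<^esub> w) = s \<otimes> f w"
  shows "restrict f (carrier (F i)) \<in> mod_hom RR (F i) (MV V)"
  by (rule mod_homI[OF _ _ _ FM]) (use assms in simp_all)

lemma hom_zero: "V \<in> SM \<Longrightarrow> f \<in> mod_hom RR (F i) (MV V) \<Longrightarrow> f \<zero>\<^bsub>F i\<^esub> = \<zero>"
  using mod_hom_zero[OF _ FM module_SM, of f i V] by simp

lemma hom_minus:
  assumes "V \<in> SM" "f \<in> mod_hom RR (F i) (MV V)" "w \<in> carrier (F i)"
  shows "f (\<ominus>\<^bsub>F i\<^esub> w) = \<ominus> f w"
proof -
  interpret Fi: module RR "F i" by (rule FM)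
  have "f (\<ominus>\<^bsub>F i\<^esub> w) \<oplus> f w = f (\<ominus>\<^bsub>F i\<^esub> w \<oplus>\<^bsub>F i\<^esub> w)" using hom_into(2)[OF assms(2)] assms(3) by simp
  also have "\<dots> = \<zero>" using assms hom_zero by (simp add: Fi.l_neg)
  finally have z: "f (\<ominus>\<^bsub>F i\<^esub> w) \<oplus> f w = \<zero>" .
  have c: "f (\<ominus>\<^bsub>F i\<^esub> w) \<in> carrier Q" "f w \<in> carrier Q" using hom_into(1)[OF assms(2)] assms(3) smodsD(1)[OF assms(1)] by auto
  then show ?thesis using z by (simp add: minus_equality[symmetric])
qed

lemma dsm: "s \<in> S \<Longrightarrow> w \<in> carrier (F (Suc i)) \<Longrightarrow> d i (s \<odot>\<^bsub>F (Suc i)\<^esub> w) = s \<odot>\<^bsub>F i\<^esub> d i w"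
  using mod_homD(3)[OF d_hom] by simp

lemma dadd: "w \<in> carrier (F (Suc i)) \<Longrightarrow> w' \<in> carrier (F (Suc i)) \<Longrightarrow> d i (w \<oplus>\<^bsub>F (Suc i)\<^esub> w') = d i w \<oplus>\<^bsub>F i\<^esub> d i w'"
  using mod_homD(2)[OF d_hom] by simp

lemma kills:
  assumes V: "V \<in> SM" and f: "f \<in> mod_hom RR (F (Suc i)) (MV V)"
    and f0: "\<And>z. z \<in> carrier (F (Suc (Suc i))) \<Longrightarrow> f (d (Suc i) z) = \<zero>"
    and ab: "a \<in> carrier (F (Suc i))" "b \<in> carrier (F (Suc i))" "d i a = d i b"
  shows "f a = f b"
  using kills_kernel[OF module_SM[OF V] f _ ab] f0 by simp

lemma unit_cancel: "x \<in> Units Q \<Longrightarrow> a \<in> carrier Q \<Longrightarrow> b \<in> carrier Q \<Longrightarrow> x \<otimes> a = x \<otimes> b \<Longrightarrow> a = b"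
  by simp

lemma unit_inv_mult: "x \<in> Units Q \<Longrightarrow> a \<in> carrier Q \<Longrightarrow> x \<otimes> (inv x \<otimes> a) = a" "x \<in> Units Q \<Longrightarrow> a \<in> carrier Q \<Longrightarrow> inv x \<otimes> (x \<otimes> a) = a"
  by (simp_all add: m_assoc[symmetric] Units_closed)

lemma cocycleD:
  assumes "f \<in> Ext_cocycles RR rk d (MV V) i"
  shows "f \<in> mod_hom RR (F i) (MV V)" "\<And>z. z \<in> carrier (F (Suc i)) \<Longrightarrow> f (d i z) = \<zero>"
  using assms unfolding Ext_cocycles_def by auto

lemma coboundaryI:
  assumes "f \<in> Ext_cocycles RR rk d (MV V) (Suc i)" "g \<in> mod_hom RR (F i) (MV V)"
    "\<And>w. w \<in> carrier (F (Suc i)) \<Longrightarrow> g (d i w) = f w"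
  shows "f \<in> Ext_coboundaries RR rk d (MV V) (Suc i)"
proof -
  have "f = (\<lambda>w\<in>carrier (F (Suc i)). g (d i w))"
    using assms(3) mod_homD(4)[OF cocycleD(1)[OF assms(1)]] by (intro extensionalityI[of f "carrier (F (Suc i))"]) simp_all
  then show ?thesis using assms(2) by simp
qed

lemma coboundaryE:
  assumes "f \<in> Ext_coboundaries RR rk d (MV V) (Suc i)"
  obtains g where "g \<in> mod_hom RR (F i) (MV V)" "\<And>w. w \<in> carrier (F (Suc i)) \<Longrightarrow> f w = g (d i w)"
  using assms that unfolding Ext_coboundaries.simps by (elim imageE) simp

text \<open>As x annihilates k, the vector x v is a boundary. A cocycle f then satisfies x f v = 0,
  and x is invertible in Q.\<close>

lemma ext0:
  assumes V: "V \<in> SM"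
  shows "Ext_cocycles RR rk d (MV V) 0 \<subseteq> Ext_coboundaries RR rk d (MV V) 0"
proof
  fix f assume f: "f \<in> Ext_cocycles RR rk d (MV V) 0"
  note fh = cocycleD[OF f]
  interpret F0: module RR "F 0" by (rule FM)
  obtain x where x: "x \<in> m" "x \<in> Units Q" using nzd by blast
  have xS: "x \<in> S" using x m_sub by auto
  obtain \<pi> u where \<pi>1: "\<pi> \<in> mod_hom RR (F 0) (ideal_module Q S)" "u \<in> carrier (F 0)" "\<pi> u = \<one>"
    "d 0 ` carrier (F 1) = {v \<in> carrier (F 0). \<pi> v \<in> m}" by (rule augmentation)
  note \<pi> = \<pi>1(1,4)
  have "f v = \<zero>" if v: "v \<in> carrier (F 0)" for v
  proof -
    have "\<pi> (x \<odot>\<^bsub>F 0\<^esub> v) = x \<otimes> \<pi> v" using hom_into(3)[OF \<pi>(1) xS v] .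
    then have "\<pi> (x \<odot>\<^bsub>F 0\<^esub> v) \<in> m" using smodsD(5)[OF m_smod hom_into(1)[OF \<pi>(1) v] x(1)] by simp
    then have "x \<odot>\<^bsub>F 0\<^esub> v \<in> d 0 ` carrier (F 1)" unfolding \<pi>(2) using F0.smult_closed[of x v] xS v by simp
    then obtain w where "w \<in> carrier (F 1)" "x \<odot>\<^bsub>F 0\<^esub> v = d 0 w" by (elim imageE)
    then have "x \<otimes> f v = \<zero>" using hom_into(3)[OF fh(1) xS v] fh(2)[of w] by simp
    then show ?thesis using unit_cancel[OF x(2), of "f v" \<zero>] smodsD(1)[OF V hom_into(1)[OF fh(1) v]] Units_closed[OF x(2)] by simp
  qed
  then have "f = (\<lambda>v\<in>carrier (F 0). \<zero>)"
    using mod_homD(4)[OF fh(1)] by (intro extensionalityI[of f "carrier (F 0)"]) simp_all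
  then show "f \<in> Ext_coboundaries RR rk d (MV V) 0" by (simp add: hom_module_def)
qed

text \<open>Common data for degrees 1 and 2: every a u with a in m is a boundary, and
  \<open>w0\<close> lies over x u. A cocycle on F 1 is measured by its value at \<open>w0\<close>
  divided by x.\<close>

lemma basic:
  obtains x \<pi> u w0 where "x \<in> m" "x \<in> Units Q" "\<pi> \<in> mod_hom RR (F 0) (MV S)" "u \<in> carrier (F 0)" "\<pi> u = \<one>"
    "d 0 ` carrier (F 1) = {v \<in> carrier (F 0). \<pi> v \<in> m}" "w0 \<in> carrier (F 1)" "d 0 w0 = x \<odot>\<^bsub>F 0\<^esub> u"
    "\<forall>a\<in>m. \<exists>w\<in>carrier (F 1). d 0 w = a \<odot>\<^bsub>F 0\<^esub> u"
proof -
  interpret F0: module RR "F 0" by (rule FM)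
  obtain x where x: "x \<in> m" "x \<in> Units Q" using nzd by blast
  obtain \<pi> u where \<pi>: "\<pi> \<in> mod_hom RR (F 0) (MV S)" "u \<in> carrier (F 0)" "\<pi> u = \<one>"
    "d 0 ` carrier (F 1) = {v \<in> carrier (F 0). \<pi> v \<in> m}" by (rule augmentation)
  have ex: "\<exists>w\<in>carrier (F 1). d 0 w = a \<odot>\<^bsub>F 0\<^esub> u" if a: "a \<in> m" for a
  proof -
    have aS: "a \<in> S" using a m_sub by auto
    have "\<pi> (a \<odot>\<^bsub>F 0\<^esub> u) = a" using hom_into(3)[OF \<pi>(1) aS \<pi>(2)] \<pi>(3) aS by simp
    then have "a \<odot>\<^bsub>F 0\<^esub> u \<in> d 0 ` carrier (F 1)" unfolding \<pi>(4) using F0.smult_closed[of a u] aS \<pi>(2) a by simp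
    then obtain w where "w \<in> carrier (F 1)" "a \<odot>\<^bsub>F 0\<^esub> u = d 0 w" by (elim imageE)
    then show ?thesis by (intro bexI[of _ w]) simp_all
  qed
  obtain w0 where w0: "w0 \<in> carrier (F 1)" "d 0 w0 = x \<odot>\<^bsub>F 0\<^esub> u" using ex[OF x(1)] by (rule bexE)
  show ?thesis by (rule that[OF x \<pi> w0]) (use ex in blast)
qed

text \<open>A cocycle f determines the fraction q = f w0 / x, and f w = a q for every w over a u;
  hence q m \<subseteq> V. The coboundaries turn out to be the cocycles with q in V, so Ext of
  degree 1 of (k, V) is (V : m) / V.\<close>

lemma ext1:
  assumes V: "V \<in> SM"
  shows "module_length RR (quot_module RR ((hom_module RR (F 1) (MV V))\<lparr>carrier := Ext_cocycles RR rk d (MV V) 1\<rparr>) (Ext_coboundaries RR rk d (MV V) 1))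
    = len V (colon Q V m)"
proof -
  obtain x \<pi> u w0 where x: "x \<in> m" "x \<in> Units Q" and \<pi>: "\<pi> \<in> mod_hom RR (F 0) (MV S)" and u: "u \<in> carrier (F 0)" "\<pi> u = \<one>"
    and im: "d 0 ` carrier (F 1) = {v \<in> carrier (F 0). \<pi> v \<in> m}" and w0: "w0 \<in> carrier (F 1)" "d 0 w0 = x \<odot>\<^bsub>F 0\<^esub> u"
    and wa': "\<forall>a\<in>m. \<exists>w\<in>carrier (F 1). d 0 w = a \<odot>\<^bsub>F 0\<^esub> u" by (rule basic)
  note wa = wa'[rule_format]
  interpret R: cring RR by (rule RC)
  interpret F0: module RR "F 0" by (rule FM)
  interpret F1: module RR "F 1" by (rule FM)
  have xS: "x \<in> S" and xc: "x \<in> carrier Q" using x m_sub by auto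
  let ?M = "(hom_module RR (F 1) (MV V))\<lparr>carrier := Ext_cocycles RR rk d (MV V) 1\<rparr>"
  note E = Ext_length[where rk=rk and d=d, OF module_SM[OF V] RC d_hom dd0, of 1]
  define \<phi> where "\<phi> f = inv x \<otimes> f w0" for f :: "(nat \<Rightarrow> 'a) \<Rightarrow> 'a"
  note pic = hom_into(1)[OF \<pi>]
  have key: "f w = a \<otimes> \<phi> f" if f: "f \<in> Ext_cocycles RR rk d (MV V) 1" and a: "a \<in> m" and w: "w \<in> carrier (F 1)" "d 0 w = a \<odot>\<^bsub>F 0\<^esub> u" for f a w
  proof -
    note fh = cocycleD[OF f]
    have aS: "a \<in> S" using a m_sub by auto
    have c: "f w \<in> carrier Q" "f w0 \<in> carrier Q" using hom_into(1)[OF fh(1)] w(1) w0(1) smodsD(1)[OF V] by auto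
    have "d 0 (x \<odot>\<^bsub>F 1\<^esub> w) = x \<odot>\<^bsub>F 0\<^esub> (a \<odot>\<^bsub>F 0\<^esub> u)" using dsm[of x w 0] xS w by simp
    also have "\<dots> = (x \<otimes> a) \<odot>\<^bsub>F 0\<^esub> u" using F0.smult_assoc1[of x a u] xS aS u by simp
    also have "\<dots> = (a \<otimes> x) \<odot>\<^bsub>F 0\<^esub> u" using xc aS by (simp add: m_comm)
    also have "\<dots> = a \<odot>\<^bsub>F 0\<^esub> (x \<odot>\<^bsub>F 0\<^esub> u)" using F0.smult_assoc1[of a x u] xS aS u by simp
    also have "\<dots> = d 0 (a \<odot>\<^bsub>F 1\<^esub> w0)" using dsm[of a w0 0] aS w0 by simp
    finally have "f (x \<odot>\<^bsub>F 1\<^esub> w) = f (a \<odot>\<^bsub>F 1\<^esub> w0)"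
      using kills[OF V, of f 0 "x \<odot>\<^bsub>F 1\<^esub> w" "a \<odot>\<^bsub>F 1\<^esub> w0"] fh F1.smult_closed[of x w] F1.smult_closed[of a w0] xS aS w w0 by simp
    then have "x \<otimes> f w = a \<otimes> f w0" using hom_into(3)[OF fh(1)] xS aS w w0 by simp
    then have "inv x \<otimes> (x \<otimes> f w) = inv x \<otimes> (a \<otimes> f w0)" by simp
    then show ?thesis unfolding \<phi>_def using unit_inv_mult(2)[OF x(2) c(1)] c aS x by (simp add: m_lcomm)
  qed
  have phic: "\<phi> f \<in> carrier Q" if "f \<in> Ext_cocycles RR rk d (MV V) 1" for f
    unfolding \<phi>_def using hom_into(1)[OF cocycleD(1)[OF that] w0(1)] smodsD(1)[OF V] x by simp
  have "chain_len (submods RR ?M) (Ext_coboundaries RR rk d (MV V) 1) (carrier ?M) = len V (colon Q V m)"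
  proof (rule surj_len[where \<phi>=\<phi>, OF E(2,3) V colon_smod[OF V smod_sub[OF m_smod]] colon_ge[OF V m_sub]])
    fix f g assume fg: "f \<in> carrier ?M" "g \<in> carrier ?M"
    then have c: "f w0 \<in> carrier Q" "g w0 \<in> carrier Q"
      using hom_into(1)[OF cocycleD(1) w0(1)] smodsD(1)[OF V] by auto
    show "\<phi> (f \<oplus>\<^bsub>?M\<^esub> g) = \<phi> f \<oplus> \<phi> g" unfolding \<phi>_def using w0 c x by (simp add: hom_module_def r_distr)
  next
    fix r f assume rf: "r \<in> S" "f \<in> carrier ?M"
    then have c: "f w0 \<in> carrier Q" using hom_into(1)[OF cocycleD(1) w0(1)] smodsD(1)[OF V] by auto
    show "\<phi> (r \<odot>\<^bsub>?M\<^esub> f) = r \<otimes> \<phi> f" unfolding \<phi>_def using w0 c x rf by (simp add: hom_module_def m_lcomm)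
  next
    show "\<phi> ` carrier ?M = colon Q V m"
    proof (rule antisym; rule subsetI)
      fix q assume "q \<in> \<phi> ` carrier ?M"
      then obtain f where f: "f \<in> Ext_cocycles RR rk d (MV V) 1" "q = \<phi> f" by (elim imageE) simp
      have "q \<otimes> a \<in> V" if a: "a \<in> m" for a
      proof -
        obtain w where w: "w \<in> carrier (F 1)" "d 0 w = a \<odot>\<^bsub>F 0\<^esub> u" using wa[OF a] by (rule bexE)
        have "a \<otimes> q = f w" using key[OF f(1) a w] f(2) by simp
        then have "a \<otimes> q \<in> V" using hom_into(1)[OF cocycleD(1)[OF f(1)] w(1)] by simp
        then show ?thesis using m_comm[OF m_carr[OF a], of q] phic[OF f(1)] f(2) by simp
      qed
      then show "q \<in> colon Q V m" unfolding colon_def using phic[OF f(1)] f(2) by simp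
    next
      fix q assume "q \<in> colon Q V m"
      then have q: "q \<in> carrier Q" "\<And>a. a \<in> m \<Longrightarrow> q \<otimes> a \<in> V" unfolding colon_def by auto
      \<comment> \<open>The cocycle with fraction q: its value on w is q times the element of m
        given by \<pi> on the boundary of w.\<close>
      define f where "f = restrict (\<lambda>w. \<pi> (d 0 w) \<otimes> q) (carrier (F 1))"
      have dm: "\<pi> (d 0 w) \<in> m" if "w \<in> carrier (F 1)" for w using im that by blast
      have dc: "d 0 w \<in> carrier (F 0)" if "w \<in> carrier (F 1)" for w using d_closed[of w 0] that by simp
      have "f \<in> mod_hom RR (F 1) (MV V)"
        unfolding f_def
      proof (rule hom_intoI)
        fix w assume w: "w \<in> carrier (F 1)"
        show "\<pi> (d 0 w) \<otimes> q \<in> V" using q(2)[OF dm[OF w]] m_comm[OF q(1) m_carr[OF dm[OF w]]] by simp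
        fix w' assume w': "w' \<in> carrier (F 1)"
        show "\<pi> (d 0 (w \<oplus>\<^bsub>F 1\<^esub> w')) \<otimes> q = \<pi> (d 0 w) \<otimes> q \<oplus> \<pi> (d 0 w') \<otimes> q"
          using dadd[of w 0 w'] w w' hom_into(2)[OF \<pi> dc[OF w] dc[OF w']] q(1) m_carr[OF dm[OF w]] m_carr[OF dm[OF w']] by (simp add: l_distr)
      next
        fix s w assume w: "s \<in> S" "w \<in> carrier (F 1)"
        show "\<pi> (d 0 (s \<odot>\<^bsub>F 1\<^esub> w)) \<otimes> q = s \<otimes> (\<pi> (d 0 w) \<otimes> q)"
          using dsm[of s w 0] w hom_into(3)[OF \<pi> w(1) dc[OF w(2)]] q(1) m_carr[OF dm[OF w(2)]] by (simp add: m_assoc)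
      qed
      moreover have "f (d 1 z) = \<zero>" if z: "z \<in> carrier (F (Suc 1))" for z
      proof -
        have "d 0 (d 1 z) = \<zero>\<^bsub>F 0\<^esub>" using dd0[of z 0] z by simp
        moreover have "d 1 z \<in> carrier (F 1)" using d_closed[of z 1] z by simp
        ultimately show ?thesis unfolding f_def using hom_zero[OF S_smod \<pi>] q(1) by simp
      qed
      ultimately have f: "f \<in> Ext_cocycles RR rk d (MV V) 1" unfolding Ext_cocycles_def by simp
      have "\<pi> (x \<odot>\<^bsub>F 0\<^esub> u) = x" using hom_into(3)[OF \<pi> xS u(1)] u(2) xc by simp
      then have "f w0 = x \<otimes> q" unfolding f_def using w0 by simp
      then have "\<phi> f = q" unfolding \<phi>_def using unit_inv_mult(2)[OF x(2) q(1)] by simp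
      then show "q \<in> \<phi> ` carrier ?M" using f by (intro image_eqI[of _ _ f]) simp_all
    qed
  next
    fix f assume "f \<in> carrier ?M"
    then have f: "f \<in> Ext_cocycles RR rk d (MV V) 1" by simp
    note fh = cocycleD[OF f]
    show "\<phi> f \<in> V \<longleftrightarrow> f \<in> Ext_coboundaries RR rk d (MV V) 1"
    proof
      assume "f \<in> Ext_coboundaries RR rk d (MV V) 1"
      then obtain g where g: "g \<in> mod_hom RR (F 0) (MV V)" "\<And>w. w \<in> carrier (F 1) \<Longrightarrow> f w = g (d 0 w)"
        using coboundaryE[of f V 0] unfolding One_nat_def by blast
      have "f w0 = x \<otimes> g u" using g(2)[OF w0(1)] w0(2) hom_into(3)[OF g(1) xS u(1)] by simp
      then have "\<phi> f = g u" unfolding \<phi>_def using unit_inv_mult(2)[OF x(2)] smodsD(1)[OF V hom_into(1)[OF g(1) u(1)]] by simp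
      then show "\<phi> f \<in> V" using hom_into(1)[OF g(1) u(1)] by simp
    next
      assume qV: "\<phi> f \<in> V"
      \<comment> \<open>The projection of F 0 along u onto the kernel of \<pi>. That kernel consists
        of boundaries, so \<psi> lifts to \<sigma>.\<close>
      define \<psi> where "\<psi> = restrict (\<lambda>v. v \<oplus>\<^bsub>F 0\<^esub> (\<ominus> \<pi> v) \<odot>\<^bsub>F 0\<^esub> u) (carrier (F 0))"
      have npi: "\<ominus> \<pi> v \<in> carrier RR" if "v \<in> carrier (F 0)" for v using S_neg[OF pic[OF that]] by simp
      have \<psi>c: "v \<oplus>\<^bsub>F 0\<^esub> (\<ominus> \<pi> v) \<odot>\<^bsub>F 0\<^esub> u \<in> carrier (F 0)" if "v \<in> carrier (F 0)" for v
        using F0.a_closed[OF that F0.smult_closed[OF npi[OF that] u(1)]] .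
      have \<psi>: "\<psi> \<in> mod_hom RR (F 0) (F 0)"
        unfolding \<psi>_def
      proof (rule mod_homI[OF \<psi>c _ _ FM])
        fix v v' assume v: "v \<in> carrier (F 0)" "v' \<in> carrier (F 0)"
        have "\<ominus> \<pi> (v \<oplus>\<^bsub>F 0\<^esub> v') = (\<ominus> \<pi> v) \<oplus> (\<ominus> \<pi> v')" using hom_into(2)[OF \<pi> v] pic[OF v(1)] pic[OF v(2)] by (simp add: minus_add)
        then have "(\<ominus> \<pi> (v \<oplus>\<^bsub>F 0\<^esub> v')) \<odot>\<^bsub>F 0\<^esub> u = (\<ominus> \<pi> v) \<odot>\<^bsub>F 0\<^esub> u \<oplus>\<^bsub>F 0\<^esub> (\<ominus> \<pi> v') \<odot>\<^bsub>F 0\<^esub> u"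
          using F0.smult_l_distr[OF npi[OF v(1)] npi[OF v(2)] u(1)] by simp
        then show "v \<oplus>\<^bsub>F 0\<^esub> v' \<oplus>\<^bsub>F 0\<^esub> (\<ominus> \<pi> (v \<oplus>\<^bsub>F 0\<^esub> v')) \<odot>\<^bsub>F 0\<^esub> u =
          (v \<oplus>\<^bsub>F 0\<^esub> (\<ominus> \<pi> v) \<odot>\<^bsub>F 0\<^esub> u) \<oplus>\<^bsub>F 0\<^esub> (v' \<oplus>\<^bsub>F 0\<^esub> (\<ominus> \<pi> v') \<odot>\<^bsub>F 0\<^esub> u)"
          using v F0.smult_closed[OF npi[OF v(1)] u(1)] F0.smult_closed[OF npi[OF v(2)] u(1)] by (simp add: F0.a_ac)
      next
        fix r v assume v: "r \<in> carrier RR" "v \<in> carrier (F 0)"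
        have rS: "r \<in> S" using v by simp
        have "\<ominus> \<pi> (r \<odot>\<^bsub>F 0\<^esub> v) = r \<otimes> (\<ominus> \<pi> v)" using hom_into(3)[OF \<pi> rS v(2)] S_carr[OF pic[OF v(2)]] rS by (simp add: r_minus)
        then have "(\<ominus> \<pi> (r \<odot>\<^bsub>F 0\<^esub> v)) \<odot>\<^bsub>F 0\<^esub> u = r \<odot>\<^bsub>F 0\<^esub> ((\<ominus> \<pi> v) \<odot>\<^bsub>F 0\<^esub> u)"
          using F0.smult_assoc1[OF v(1) npi[OF v(2)] u(1)] by simp
        then show "r \<odot>\<^bsub>F 0\<^esub> v \<oplus>\<^bsub>F 0\<^esub> (\<ominus> \<pi> (r \<odot>\<^bsub>F 0\<^esub> v)) \<odot>\<^bsub>F 0\<^esub> u = r \<odot>\<^bsub>F 0\<^esub> (v \<oplus>\<^bsub>F 0\<^esub> (\<ominus> \<pi> v) \<odot>\<^bsub>F 0\<^esub> u)"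
          using F0.smult_r_distr[OF v F0.smult_closed[OF npi[OF v(2)] u(1)]] by simp
      qed
      have "\<psi> v \<in> d 0 ` carrier (F 1)" if v: "v \<in> carrier (F 0)" for v
      proof -
        have "\<pi> (\<psi> v) = \<pi> v \<oplus> (\<ominus> \<pi> v) \<otimes> \<one>"
          unfolding \<psi>_def using v hom_into(2)[OF \<pi> v F0.smult_closed[OF npi[OF v] u(1)]] hom_into(3)[OF \<pi> _ u(1), of "\<ominus> \<pi> v"] npi[OF v] u(2) by simp
        then have "\<pi> (\<psi> v) = \<zero>" using S_carr[OF pic[OF v]] by (simp add: r_neg)
        then show ?thesis unfolding im using \<psi>c[OF v] smodsD(2)[OF m_smod] v by (simp add: \<psi>_def)
      qed
      moreover have d1h: "d 0 \<in> mod_hom RR (F 1) (F 0)" using d_hom[of 0] by simp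
      ultimately obtain \<sigma> where \<sigma>: "\<sigma> \<in> mod_hom RR (F 0) (F 1)" "\<And>v. v \<in> carrier (F 0) \<Longrightarrow> d 0 (\<sigma> v) = \<psi> v"
        using R.free_lift[OF FM FM d1h \<psi>] by blast
      note \<sigma>D = mod_homD(1-3)[OF \<sigma>(1)]
      define q where "q = \<phi> f"
      have qc: "q \<in> carrier Q" using phic[OF f] q_def by simp
      \<comment> \<open>The first summand is f on the part of v in the kernel of \<pi>, the second
        its value on the multiple of u; for v = d w they add up to f w.\<close>
      define g where "g = restrict (\<lambda>v. f (\<sigma> v) \<oplus> \<pi> v \<otimes> q) (carrier (F 0))"
      have fc: "f w \<in> carrier Q" if "w \<in> carrier (F 1)" for w using smodsD(1)[OF V hom_into(1)[OF fh(1) that]] .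
      have g: "g \<in> mod_hom RR (F 0) (MV V)"
        unfolding g_def
      proof (rule hom_intoI)
        fix v assume v: "v \<in> carrier (F 0)"
        show "f (\<sigma> v) \<oplus> \<pi> v \<otimes> q \<in> V"
          using smodsD(3)[OF V hom_into(1)[OF fh(1) \<sigma>D(1)[OF v]] smodsD(4)[OF V pic[OF v] qV]] q_def by simp
        fix v' assume v': "v' \<in> carrier (F 0)"
        have "f (\<sigma> (v \<oplus>\<^bsub>F 0\<^esub> v')) = f (\<sigma> v) \<oplus> f (\<sigma> v')" using \<sigma>D(2)[OF v v'] hom_into(2)[OF fh(1) \<sigma>D(1)[OF v] \<sigma>D(1)[OF v']] by simp
        then show "f (\<sigma> (v \<oplus>\<^bsub>F 0\<^esub> v')) \<oplus> \<pi> (v \<oplus>\<^bsub>F 0\<^esub> v') \<otimes> q = f (\<sigma> v) \<oplus> \<pi> v \<otimes> q \<oplus> (f (\<sigma> v') \<oplus> \<pi> v' \<otimes> q)"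
          using hom_into(2)[OF \<pi> v v'] S_carr[OF pic[OF v]] S_carr[OF pic[OF v']] qc fc[OF \<sigma>D(1)[OF v]] fc[OF \<sigma>D(1)[OF v']] by (simp add: l_distr a_ac)
      next
        fix s v assume v: "s \<in> S" "v \<in> carrier (F 0)"
        have "f (\<sigma> (s \<odot>\<^bsub>F 0\<^esub> v)) = s \<otimes> f (\<sigma> v)" using \<sigma>D(3)[of s v] v hom_into(3)[OF fh(1) v(1) \<sigma>D(1)[OF v(2)]] by simp
        then show "f (\<sigma> (s \<odot>\<^bsub>F 0\<^esub> v)) \<oplus> \<pi> (s \<odot>\<^bsub>F 0\<^esub> v) \<otimes> q = s \<otimes> (f (\<sigma> v) \<oplus> \<pi> v \<otimes> q)"
          using hom_into(3)[OF \<pi> v] S_carr[OF pic[OF v(2)]] qc fc[OF \<sigma>D(1)[OF v(2)]] v by (simp add: r_distr m_assoc)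
      qed
      have "g (d 0 w) = f w" if w: "w \<in> carrier (F 1)" for w
      proof -
        have dw: "d 0 w \<in> carrier (F 0)" using d_closed[of w 0] w by simp
        define a where "a = \<pi> (d 0 w)"
        have a: "a \<in> m" unfolding a_def using im w by blast
        have aS: "a \<in> S" using a m_sub by auto
        obtain w' where w': "w' \<in> carrier (F 1)" "d 0 w' = a \<odot>\<^bsub>F 0\<^esub> u" using wa[OF a] by (rule bexE)
        have "d 0 (\<sigma> (d 0 w) \<oplus>\<^bsub>F 1\<^esub> w') = d 0 w \<oplus>\<^bsub>F 0\<^esub> (\<ominus> a) \<odot>\<^bsub>F 0\<^esub> u \<oplus>\<^bsub>F 0\<^esub> a \<odot>\<^bsub>F 0\<^esub> u"
          using dadd[of "\<sigma> (d 0 w)" 0 w'] \<sigma>D(1)[OF dw] w' \<sigma>(2)[OF dw] dw unfolding \<psi>_def a_def by simp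
        also have "\<dots> = d 0 w \<oplus>\<^bsub>F 0\<^esub> ((\<ominus> a) \<odot>\<^bsub>F 0\<^esub> u \<oplus>\<^bsub>F 0\<^esub> a \<odot>\<^bsub>F 0\<^esub> u)"
          using F0.a_assoc[OF dw] F0.smult_closed[of "\<ominus> a" u] F0.smult_closed[of a u] u aS S_neg[OF aS] by simp
        also have "(\<ominus> a) \<odot>\<^bsub>F 0\<^esub> u \<oplus>\<^bsub>F 0\<^esub> a \<odot>\<^bsub>F 0\<^esub> u = (\<ominus> a \<oplus> a) \<odot>\<^bsub>F 0\<^esub> u"
          using F0.smult_l_distr[of "\<ominus> a" a u] u aS S_neg[OF aS] by simp
        also have "\<dots> = \<zero>\<^bsub>F 0\<^esub>" using F0.smult_l_null[OF u(1)] aS by (simp add: l_neg)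
        finally have "d 0 (\<sigma> (d 0 w) \<oplus>\<^bsub>F 1\<^esub> w') = d 0 w" using dw by simp
        then have "f (\<sigma> (d 0 w) \<oplus>\<^bsub>F 1\<^esub> w') = f w"
          using kills[OF V, of f 0 "\<sigma> (d 0 w) \<oplus>\<^bsub>F 1\<^esub> w'" w] fh F1.a_closed[OF \<sigma>D(1)[OF dw] w'(1)] w by simp
        then have "f (\<sigma> (d 0 w)) \<oplus> f w' = f w" using hom_into(2)[OF fh(1) \<sigma>D(1)[OF dw] w'(1)] by simp
        moreover have "f w' = a \<otimes> q" using key[OF f a w'] q_def by simp
        ultimately show ?thesis unfolding g_def a_def using dw by simp
      qed
      then show "f \<in> Ext_coboundaries RR rk d (MV V) 1" using coboundaryI[of f V 0 g] f g by simp
    qed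
  qed
  then show ?thesis using E(1) by simp
qed

text \<open>The connecting map from degree 1 with values in Q/C to degree 2 with values in C. The
  homomorphism h, pulled back to F 1, lifts to H with values in Q. Its composite with the next
  differential is a cocycle in C, hence a coboundary; subtracting the corresponding g from H leaves
  a cocycle in Q, which is given by a fraction q as in degree 1.\<close>

lemma ext2_imp:
  assumes C: "C \<in> SM" and e2: "Ext_cocycles RR rk d (MV C) 2 \<subseteq> Ext_coboundaries RR rk d (MV C) 2" and h: "qhom C m h"
  shows "qmult C m h"
proof -
  obtain x \<pi> u w0 where x: "x \<in> m" "x \<in> Units Q" and \<pi>: "\<pi> \<in> mod_hom RR (F 0) (MV S)" and u: "u \<in> carrier (F 0)" "\<pi> u = \<one>"
    and im: "d 0 ` carrier (F 1) = {v \<in> carrier (F 0). \<pi> v \<in> m}" and w0: "w0 \<in> carrier (F 1)" "d 0 w0 = x \<odot>\<^bsub>F 0\<^esub> u"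
    and wa': "\<forall>a\<in>m. \<exists>w\<in>carrier (F 1). d 0 w = a \<odot>\<^bsub>F 0\<^esub> u" by (rule basic)
  note wa = wa'[rule_format]
  interpret R: cring RR by (rule RC)
  interpret F0: module RR "F 0" by (rule FM)
  interpret F1: module RR "F 1" by (rule FM)
  have xS: "x \<in> S" and xc: "x \<in> carrier Q" using x m_sub by auto
  have hc: "h a \<in> carrier Q" if "a \<in> m" for a using h that unfolding qhom_def by auto
  have hadd: "h (a \<oplus> b) \<ominus> (h a \<oplus> h b) \<in> C" if "a \<in> m" "b \<in> m" for a b using h that unfolding qhom_def by auto
  have hm: "h (s \<otimes> a) \<ominus> s \<otimes> h a \<in> C" if "s \<in> S" "a \<in> m" for s a using h that unfolding qhom_def by auto
  have h0: "h \<zero> \<in> C" using hm[OF S_zero smodsD(2)[OF m_smod]] hc[OF smodsD(2)[OF m_smod]] by (simp add: a_minus_def)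
  define p where "p w = \<pi> (d 0 w)" for w
  have dc: "d 0 w \<in> carrier (F 0)" if "w \<in> carrier (F 1)" for w using d_closed[of w 0] that by simp
  have pm: "p w \<in> m" if "w \<in> carrier (F 1)" for w unfolding p_def using im that by blast
  have padd: "p (w \<oplus>\<^bsub>F 1\<^esub> w') = p w \<oplus> p w'" if "w \<in> carrier (F 1)" "w' \<in> carrier (F 1)" for w w'
    unfolding p_def using dadd[of w 0 w'] that hom_into(2)[OF \<pi> dc dc] by simp
  have psm: "p (s \<odot>\<^bsub>F 1\<^esub> w) = s \<otimes> p w" if "s \<in> S" "w \<in> carrier (F 1)" for s w
    unfolding p_def using dsm[of s w 0] that hom_into(3)[OF \<pi> _ dc] by simp
  \<comment> \<open>\<open>h\<close> is linear modulo C only; prescribing values on unit vectors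
    gives a map that is linear on the nose, and \<open>Hh\<close> shows that it still agrees with h
    modulo C.\<close>
  obtain H where H: "H \<in> mod_hom RR (F 1) (MV (carrier Q))" "\<And>j. j < rk 1 \<Longrightarrow> H (unit_vec RR (rk 1) j) = h (p (unit_vec RR (rk 1) j))"
    using R.free_hom_ex[OF module_SM[OF carrier_smod], of "rk 1" "\<lambda>j. h (p (unit_vec RR (rk 1) j))"] hc[OF pm[OF R.unit_vec_closed]] unfolding ideal_module_simps(1) by blast
  note HD = hom_into[OF H(1)]
  have Hh: "H w \<ominus> h (p w) \<in> C" if w: "w \<in> carrier (F 1)" for w
  proof -
    have "submodule {w \<in> carrier (F 1). H w \<ominus> h (p w) \<in> C} RR (F 1)"
    proof (rule submoduleI'[OF FM])
      have "p \<zero>\<^bsub>F 1\<^esub> = \<zero>" using psm[OF S_zero F1.zero_closed] F1.smult_r_null[of \<zero>] S_zero m_carr[OF pm[OF F1.zero_closed]] by simp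
      moreover have "H \<zero>\<^bsub>F 1\<^esub> = \<zero>" by (rule hom_zero[OF carrier_smod H(1)])
      ultimately show "\<zero>\<^bsub>F 1\<^esub> \<in> {w \<in> carrier (F 1). H w \<ominus> h (p w) \<in> C}" using smodsD(7)[OF C smodsD(2)[OF C] h0] F1.zero_closed by simp
    next
      fix w w' assume "w \<in> {w \<in> carrier (F 1). H w \<ominus> h (p w) \<in> C}" "w' \<in> {w \<in> carrier (F 1). H w \<ominus> h (p w) \<in> C}"
      then have w: "w \<in> carrier (F 1)" "H w \<ominus> h (p w) \<in> C" "w' \<in> carrier (F 1)" "H w' \<ominus> h (p w') \<in> C" by auto
      note c = HD(1)[OF w(1)] HD(1)[OF w(3)] hc[OF pm[OF w(1)]] hc[OF pm[OF w(3)]] hc[OF smodsD(3)[OF m_smod pm[OF w(1)] pm[OF w(3)]]]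
      have "(H w \<oplus> H w') \<ominus> h (p w \<oplus> p w') \<in> C"
        by (rule cong_trans[OF C _ _ _ cong_add[OF C c(1) c(3) c(2) c(4) w(2) w(4)] cong_sym[OF C _ _ hadd[OF pm[OF w(1)] pm[OF w(3)]]]]) (use c in simp_all)
      then show "w \<oplus>\<^bsub>F 1\<^esub> w' \<in> {w \<in> carrier (F 1). H w \<ominus> h (p w) \<in> C}" using HD(2)[OF w(1,3)] padd[OF w(1,3)] F1.a_closed[OF w(1,3)] by simp
    next
      fix r w assume "r \<in> carrier RR" "w \<in> {w \<in> carrier (F 1). H w \<ominus> h (p w) \<in> C}"
      then have w: "r \<in> S" "w \<in> carrier (F 1)" "H w \<ominus> h (p w) \<in> C" by auto
      note c = HD(1)[OF w(2)] hc[OF pm[OF w(2)]] hc[OF smodsD(4)[OF m_smod w(1) pm[OF w(2)]]]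
      have "r \<otimes> H w \<ominus> h (r \<otimes> p w) \<in> C"
        by (rule cong_trans[OF C _ _ _ cong_mult[OF C w(1) c(1,2) w(3)] cong_sym[OF C _ _ hm[OF w(1) pm[OF w(2)]]]]) (use c w in simp_all)
      then show "r \<odot>\<^bsub>F 1\<^esub> w \<in> {w \<in> carrier (F 1). H w \<ominus> h (p w) \<in> C}" using HD(3)[OF w(1,2)] psm[OF w(1,2)] F1.smult_closed[of r w] w by simp
    qed auto
    then have "{w \<in> carrier (F 1). H w \<ominus> h (p w) \<in> C} = carrier (F 1)"
    proof (rule R.free_submodule_all)
      fix j assume "j < rk 1"
      then show "unit_vec RR (rk 1) j \<in> {w \<in> carrier (F 1). H w \<ominus> h (p w) \<in> C}"
        using H(2) R.unit_vec_closed[of "rk 1" j] hc[OF pm[OF R.unit_vec_closed]] smodsD(2)[OF C] by (simp add: a_minus_def r_neg)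
    qed
    then show ?thesis using w by blast
  qed
  have d1c: "d 1 z \<in> carrier (F 1)" if "z \<in> carrier (F 2)" for z using d_closed[of z 1] that by (simp add: numeral_2_eq_2)
  have d2c: "d 2 z \<in> carrier (F 2)" if "z \<in> carrier (F (Suc 2))" for z using d_closed[of z 2] that by simp
  \<comment> \<open>On cycles H is congruent to h at zero, which lies in C; so this composite takes
    values in C.\<close>
  define f where "f = restrict (\<lambda>z. H (d 1 z)) (carrier (F 2))"
  have fC: "H (d 1 z) \<in> C" if z: "z \<in> carrier (F 2)" for z
  proof -
    have "d 0 (d 1 z) = \<zero>\<^bsub>F 0\<^esub>" using dd0[of z 0] z by (simp add: numeral_2_eq_2)
    then have "p (d 1 z) = \<zero>" unfolding p_def using hom_zero[OF S_smod \<pi>] by simp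
    then have "H (d 1 z) \<ominus> h \<zero> \<in> C" using Hh[OF d1c[OF z]] by simp
    then have "(H (d 1 z) \<ominus> h \<zero>) \<oplus> h \<zero> \<in> C" using smodsD(3)[OF C _ h0] by blast
    moreover have "(H (d 1 z) \<ominus> h \<zero>) \<oplus> h \<zero> = H (d 1 z)" using HD(1)[OF d1c[OF z]] smodsD(1)[OF C h0] by algebra
    ultimately show ?thesis by simp
  qed
  have "f \<in> mod_hom RR (F 2) (MV C)"
    unfolding f_def
  proof (rule hom_intoI[OF fC])
    fix w w' assume w: "w \<in> carrier (F 2)" "w' \<in> carrier (F 2)"
    have "d 1 (w \<oplus>\<^bsub>F 2\<^esub> w') = d 1 w \<oplus>\<^bsub>F 1\<^esub> d 1 w'" using dadd[of w 1 w'] w by (simp add: numeral_2_eq_2)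
    then show "H (d 1 (w \<oplus>\<^bsub>F 2\<^esub> w')) = H (d 1 w) \<oplus> H (d 1 w')" using HD(2)[OF d1c[OF w(1)] d1c[OF w(2)]] by simp
  next
    fix s w assume w: "s \<in> S" "w \<in> carrier (F 2)"
    have "d 1 (s \<odot>\<^bsub>F 2\<^esub> w) = s \<odot>\<^bsub>F 1\<^esub> d 1 w" using dsm[of s w 1] w by (simp add: numeral_2_eq_2)
    then show "H (d 1 (s \<odot>\<^bsub>F 2\<^esub> w)) = s \<otimes> H (d 1 w)" using HD(3)[OF w(1) d1c[OF w(2)]] by simp
  qed
  moreover have "f (d 2 z) = \<zero>" if z: "z \<in> carrier (F (Suc 2))" for z
  proof -
    have "d 1 (d 2 z) = \<zero>\<^bsub>F 1\<^esub>" using dd0[of z 1] z by (simp add: numeral_2_eq_2)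
    then show ?thesis unfolding f_def using d2c[OF z] hom_zero[OF carrier_smod H(1)] by simp
  qed
  ultimately have "f \<in> Ext_cocycles RR rk d (MV C) 2" unfolding Ext_cocycles_def by simp
  from subsetD[OF e2 this] have "f \<in> Ext_coboundaries RR rk d (MV C) (Suc 1)" by (simp only: Suc_1)
  then obtain g where g: "g \<in> mod_hom RR (F 1) (MV C)" "\<And>z. z \<in> carrier (F (Suc 1)) \<Longrightarrow> f z = g (d 1 z)"
    by (rule coboundaryE) blast
  note gD = hom_into[OF g(1)]
  have gc: "g w \<in> carrier Q" if "w \<in> carrier (F 1)" for w using smodsD(1)[OF C gD(1)[OF that]] .
  \<comment> \<open>\<open>H\<close> and g agree on boundaries, so G factors through the boundary
    map into F 0; since g takes values in C, G still represents h.\<close>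
  define G where "G = restrict (\<lambda>w. H w \<ominus> g w) (carrier (F 1))"
  have G: "G \<in> mod_hom RR (F 1) (MV (carrier Q))"
    unfolding G_def
  proof (rule hom_intoI)
    fix w assume w: "w \<in> carrier (F 1)"
    show "H w \<ominus> g w \<in> carrier Q" using HD(1)[OF w] gc[OF w] by simp
    fix w' assume w': "w' \<in> carrier (F 1)"
    show "H (w \<oplus>\<^bsub>F 1\<^esub> w') \<ominus> g (w \<oplus>\<^bsub>F 1\<^esub> w') = H w \<ominus> g w \<oplus> (H w' \<ominus> g w')"
      unfolding HD(2)[OF w w'] gD(2)[OF w w'] using HD(1)[OF w] HD(1)[OF w'] gc[OF w] gc[OF w'] by algebra
  next
    fix s w assume w: "s \<in> S" "w \<in> carrier (F 1)"
    show "H (s \<odot>\<^bsub>F 1\<^esub> w) \<ominus> g (s \<odot>\<^bsub>F 1\<^esub> w) = s \<otimes> (H w \<ominus> g w)"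
      unfolding HD(3)[OF w] gD(3)[OF w] using HD(1)[OF w(2)] gc[OF w(2)] S_carr[OF w(1)] by algebra
  qed
  have G0: "G (d 1 z) = \<zero>" if z: "z \<in> carrier (F (Suc 1))" for z
  proof -
    have z2: "z \<in> carrier (F 2)" using z by (simp add: numeral_2_eq_2)
    have "H (d 1 z) = g (d 1 z)" using g(2)[OF z] z2 unfolding f_def by simp
    then show ?thesis unfolding G_def using d1c[OF z2] gc[OF d1c[OF z2]] by (simp add: a_minus_def r_neg)
  qed
  note GD = hom_into[OF G]
  define q where "q = inv x \<otimes> G w0"
  have G0c: "G w0 \<in> carrier Q" using GD(1)[OF w0(1)] .
  have qc: "q \<in> carrier Q" unfolding q_def using G0c x by simp
  have "h a \<ominus> q \<otimes> a \<in> C" if a: "a \<in> m" for a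
  proof -
    have aS: "a \<in> S" using a m_sub by auto
    obtain w where w: "w \<in> carrier (F 1)" "d 0 w = a \<odot>\<^bsub>F 0\<^esub> u" using wa[OF a] by (rule bexE)
    have "d 0 (x \<odot>\<^bsub>F 1\<^esub> w) = x \<odot>\<^bsub>F 0\<^esub> (a \<odot>\<^bsub>F 0\<^esub> u)" using dsm[of x w 0] xS w by simp
    also have "\<dots> = (x \<otimes> a) \<odot>\<^bsub>F 0\<^esub> u" using F0.smult_assoc1[of x a u] xS aS u by simp
    also have "\<dots> = (a \<otimes> x) \<odot>\<^bsub>F 0\<^esub> u" using xc aS by (simp add: m_comm)
    also have "\<dots> = a \<odot>\<^bsub>F 0\<^esub> (x \<odot>\<^bsub>F 0\<^esub> u)" using F0.smult_assoc1[of a x u] xS aS u by simp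
    also have "\<dots> = d 0 (a \<odot>\<^bsub>F 1\<^esub> w0)" using dsm[of a w0 0] aS w0 by simp
    finally have "G (x \<odot>\<^bsub>F 1\<^esub> w) = G (a \<odot>\<^bsub>F 1\<^esub> w0)"
      using kills[OF carrier_smod, of G 0 "x \<odot>\<^bsub>F 1\<^esub> w" "a \<odot>\<^bsub>F 1\<^esub> w0"] G G0 F1.smult_closed[of x w] F1.smult_closed[of a w0] xS aS w w0 by simp
    then have "x \<otimes> G w = a \<otimes> G w0" using GD(3) xS aS w w0 by simp
    then have "inv x \<otimes> (x \<otimes> G w) = inv x \<otimes> (a \<otimes> G w0)" by simp
    then have Gw: "G w = q \<otimes> a" unfolding q_def using unit_inv_mult(2)[OF x(2) GD(1)[OF w(1)]] G0c aS x by (simp add: m_ac)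
    have pw: "p w = a" unfolding p_def w(2) using hom_into(3)[OF \<pi> aS u(1)] u(2) aS by simp
    have 1: "h a \<ominus> H w \<in> C" using cong_sym[OF C HD(1)[OF w(1)] _ Hh[OF w(1)]] pw hc[OF a] by simp
    have "H w \<ominus> G w = g w" unfolding G_def using w(1) HD(1)[OF w(1)] gc[OF w(1)] apply simp by algebra
    then have 2: "H w \<ominus> q \<otimes> a \<in> C" using Gw gD(1)[OF w(1)] by simp
    show ?thesis by (rule cong_trans[OF C hc[OF a] HD(1)[OF w(1)] _ 1 2]) (use qc aS in simp)
  qed
  then show ?thesis unfolding qmult_def using qc by blast
qed

text \<open>Multiplication by x induces zero on k, hence is null-homotopic on the resolution. Each
  next homotopy lifts x - \<sigma> d, whose values are cycles. Only the resulting identity d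
  \<sigma> d = x d is recorded.\<close>

lemma null_homotopy:
  assumes x: "x \<in> m"
  shows "\<exists>\<sigma>\<in>mod_hom RR (F n) (F (Suc n)). \<forall>w\<in>carrier (F (Suc n)). d n (\<sigma> (d n w)) = x \<odot>\<^bsub>F n\<^esub> d n w"
proof (induction n)
  case 0
  interpret R: cring RR by (rule RC)
  interpret F0: module RR "F 0" by (rule FM)
  have xS: "x \<in> S" using x m_sub by auto
  obtain \<pi> u where \<pi>: "\<pi> \<in> mod_hom RR (F 0) (ideal_module Q S)" "u \<in> carrier (F 0)" "\<pi> u = \<one>"
    "d 0 ` carrier (F 1) = {v \<in> carrier (F 0). \<pi> v \<in> m}" by (rule augmentation)
  define s where "s = restrict (\<lambda>v. x \<odot>\<^bsub>F 0\<^esub> v) (carrier (F 0))"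
  have s: "s \<in> mod_hom RR (F 0) (F 0)"
    unfolding s_def
  proof (rule mod_homI[OF _ _ _ FM])
    fix r v assume v: "r \<in> carrier RR" "v \<in> carrier (F 0)"
    have "x \<odot>\<^bsub>F 0\<^esub> (r \<odot>\<^bsub>F 0\<^esub> v) = (x \<otimes> r) \<odot>\<^bsub>F 0\<^esub> v" using F0.smult_assoc1[of x r v] v xS by simp
    also have "\<dots> = (r \<otimes> x) \<odot>\<^bsub>F 0\<^esub> v" using v xS by (simp add: m_comm)
    also have "\<dots> = r \<odot>\<^bsub>F 0\<^esub> (x \<odot>\<^bsub>F 0\<^esub> v)" using F0.smult_assoc1[of r x v] v xS by simp
    finally show "x \<odot>\<^bsub>F 0\<^esub> (r \<odot>\<^bsub>F 0\<^esub> v) = r \<odot>\<^bsub>F 0\<^esub> (x \<odot>\<^bsub>F 0\<^esub> v)" .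
  qed (use xS F0.smult_r_distr[of x] F0.smult_closed[of x] in simp_all)
  have "s v \<in> d 0 ` carrier (F (Suc 0))" if v: "v \<in> carrier (F 0)" for v
  proof -
    have "\<pi> (x \<odot>\<^bsub>F 0\<^esub> v) \<in> m" using hom_into(3)[OF \<pi>(1) xS v] smodsD(5)[OF m_smod hom_into(1)[OF \<pi>(1) v] x] by simp
    then show ?thesis using \<pi>(4) F0.smult_closed[of x v] xS v by (simp add: s_def)
  qed
  then obtain \<sigma> where \<sigma>: "\<sigma> \<in> mod_hom RR (F 0) (F (Suc 0))" "\<And>v. v \<in> carrier (F 0) \<Longrightarrow> d 0 (\<sigma> v) = s v"
    using R.free_lift[OF FM FM d_hom s] by blast
  then show ?case using d_closed[of _ 0] by (intro bexI[OF _ \<sigma>(1)]) (simp add: s_def)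
next
  case (Suc n)
  interpret R: cring RR by (rule RC)
  interpret G: module RR "F (Suc n)" by (rule FM)
  interpret Fn: module RR "F n" by (rule FM)
  have xS: "x \<in> S" using x m_sub by auto
  obtain \<sigma> where \<sigma>: "\<sigma> \<in> mod_hom RR (F n) (F (Suc n))" "\<And>w. w \<in> carrier (F (Suc n)) \<Longrightarrow> d n (\<sigma> (d n w)) = x \<odot>\<^bsub>F n\<^esub> d n w"
    using Suc.IH by blast
  note \<sigma>D = mod_homD(1-3)[OF \<sigma>(1)]
  have no: "\<ominus> \<one> \<in> carrier RR" using S_neg[OF S_one] by simp
  define s where "s = restrict (\<lambda>v. x \<odot>\<^bsub>F (Suc n)\<^esub> v \<oplus>\<^bsub>F (Suc n)\<^esub> (\<ominus> \<one>) \<odot>\<^bsub>F (Suc n)\<^esub> \<sigma> (d n v)) (carrier (F (Suc n)))"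
  have c1: "x \<odot>\<^bsub>F (Suc n)\<^esub> v \<in> carrier (F (Suc n))" if "v \<in> carrier (F (Suc n))" for v using G.smult_closed[of x v] xS that by simp
  have c2: "(\<ominus> \<one>) \<odot>\<^bsub>F (Suc n)\<^esub> \<sigma> (d n v) \<in> carrier (F (Suc n))" if "v \<in> carrier (F (Suc n))" for v
    by (rule G.smult_closed[OF no \<sigma>D(1)[OF d_closed[OF that]]])
  have comm: "a \<odot>\<^bsub>F (Suc n)\<^esub> (r \<odot>\<^bsub>F (Suc n)\<^esub> v) = r \<odot>\<^bsub>F (Suc n)\<^esub> (a \<odot>\<^bsub>F (Suc n)\<^esub> v)"
    if "a \<in> S" "r \<in> S" "v \<in> carrier (F (Suc n))" for a r v
    using G.smult_assoc1[of a r v] G.smult_assoc1[of r a v] that by (simp add: m_comm)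
  have s: "s \<in> mod_hom RR (F (Suc n)) (F (Suc n))"
    unfolding s_def
  proof (rule mod_homI[OF _ _ _ FM])
    fix v assume v: "v \<in> carrier (F (Suc n))"
    show "x \<odot>\<^bsub>F (Suc n)\<^esub> v \<oplus>\<^bsub>F (Suc n)\<^esub> (\<ominus> \<one>) \<odot>\<^bsub>F (Suc n)\<^esub> \<sigma> (d n v) \<in> carrier (F (Suc n))" using c1[OF v] c2[OF v] by simp
    {
      fix w assume w: "w \<in> carrier (F (Suc n))"
      have "\<sigma> (d n (v \<oplus>\<^bsub>F (Suc n)\<^esub> w)) = \<sigma> (d n v) \<oplus>\<^bsub>F (Suc n)\<^esub> \<sigma> (d n w)" using dadd[OF v w] \<sigma>D(2)[OF d_closed[OF v] d_closed[OF w]] by simp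
      then have "(\<ominus> \<one>) \<odot>\<^bsub>F (Suc n)\<^esub> \<sigma> (d n (v \<oplus>\<^bsub>F (Suc n)\<^esub> w)) = (\<ominus> \<one>) \<odot>\<^bsub>F (Suc n)\<^esub> \<sigma> (d n v) \<oplus>\<^bsub>F (Suc n)\<^esub> (\<ominus> \<one>) \<odot>\<^bsub>F (Suc n)\<^esub> \<sigma> (d n w)"
        using G.smult_r_distr[OF no \<sigma>D(1)[OF d_closed[OF v]] \<sigma>D(1)[OF d_closed[OF w]]] by simp
      moreover have "x \<odot>\<^bsub>F (Suc n)\<^esub> (v \<oplus>\<^bsub>F (Suc n)\<^esub> w) = x \<odot>\<^bsub>F (Suc n)\<^esub> v \<oplus>\<^bsub>F (Suc n)\<^esub> x \<odot>\<^bsub>F (Suc n)\<^esub> w"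
        using G.smult_r_distr[of x v w] v w xS by simp
      ultimately show "x \<odot>\<^bsub>F (Suc n)\<^esub> (v \<oplus>\<^bsub>F (Suc n)\<^esub> w) \<oplus>\<^bsub>F (Suc n)\<^esub> (\<ominus> \<one>) \<odot>\<^bsub>F (Suc n)\<^esub> \<sigma> (d n (v \<oplus>\<^bsub>F (Suc n)\<^esub> w)) =
        (x \<odot>\<^bsub>F (Suc n)\<^esub> v \<oplus>\<^bsub>F (Suc n)\<^esub> (\<ominus> \<one>) \<odot>\<^bsub>F (Suc n)\<^esub> \<sigma> (d n v)) \<oplus>\<^bsub>F (Suc n)\<^esub> (x \<odot>\<^bsub>F (Suc n)\<^esub> w \<oplus>\<^bsub>F (Suc n)\<^esub> (\<ominus> \<one>) \<odot>\<^bsub>F (Suc n)\<^esub> \<sigma> (d n w))"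
        using c1[OF v] c1[OF w] c2[OF v] c2[OF w] by (simp add: G.a_ac)
    }
    fix r assume "r \<in> carrier RR"
    then have r: "r \<in> S" by simp
    have "\<sigma> (d n (r \<odot>\<^bsub>F (Suc n)\<^esub> v)) = r \<odot>\<^bsub>F (Suc n)\<^esub> \<sigma> (d n v)" using dsm[OF r v] \<sigma>D(3)[of r "d n v"] d_closed[OF v] r by simp
    then have "(\<ominus> \<one>) \<odot>\<^bsub>F (Suc n)\<^esub> \<sigma> (d n (r \<odot>\<^bsub>F (Suc n)\<^esub> v)) = r \<odot>\<^bsub>F (Suc n)\<^esub> ((\<ominus> \<one>) \<odot>\<^bsub>F (Suc n)\<^esub> \<sigma> (d n v))"
      using comm[OF S_neg[OF S_one] r \<sigma>D(1)[OF d_closed[OF v]]] by simp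
    then show "x \<odot>\<^bsub>F (Suc n)\<^esub> (r \<odot>\<^bsub>F (Suc n)\<^esub> v) \<oplus>\<^bsub>F (Suc n)\<^esub> (\<ominus> \<one>) \<odot>\<^bsub>F (Suc n)\<^esub> \<sigma> (d n (r \<odot>\<^bsub>F (Suc n)\<^esub> v)) =
      r \<odot>\<^bsub>F (Suc n)\<^esub> (x \<odot>\<^bsub>F (Suc n)\<^esub> v \<oplus>\<^bsub>F (Suc n)\<^esub> (\<ominus> \<one>) \<odot>\<^bsub>F (Suc n)\<^esub> \<sigma> (d n v))"
      using comm[OF xS r v] G.smult_r_distr[OF _ c1[OF v] c2[OF v], of r] r by simp
  qed
  have "s v \<in> d (Suc n) ` carrier (F (Suc (Suc n)))" if v: "v \<in> carrier (F (Suc n))" for v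
  proof -
    have "d n (s v) = x \<odot>\<^bsub>F n\<^esub> d n v \<oplus>\<^bsub>F n\<^esub> (\<ominus> \<one>) \<odot>\<^bsub>F n\<^esub> (x \<odot>\<^bsub>F n\<^esub> d n v)"
      unfolding s_def using v dadd[OF c1[OF v] c2[OF v]] dsm[OF xS v] dsm[OF S_neg[OF S_one] \<sigma>D(1)[OF d_closed[OF v]]] \<sigma>(2)[OF v] by simp
    also have "(\<ominus> \<one>) \<odot>\<^bsub>F n\<^esub> (x \<odot>\<^bsub>F n\<^esub> d n v) = \<ominus>\<^bsub>F n\<^esub> (x \<odot>\<^bsub>F n\<^esub> d n v)"
    proof -
      have xd: "x \<odot>\<^bsub>F n\<^esub> d n v \<in> carrier (F n)" using Fn.smult_closed[of x "d n v"] xS d_closed[OF v] by simp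
      have "(\<ominus> \<one>) \<odot>\<^bsub>F n\<^esub> (x \<odot>\<^bsub>F n\<^esub> d n v) \<oplus>\<^bsub>F n\<^esub> \<one> \<odot>\<^bsub>F n\<^esub> (x \<odot>\<^bsub>F n\<^esub> d n v) = (\<ominus> \<one> \<oplus> \<one>) \<odot>\<^bsub>F n\<^esub> (x \<odot>\<^bsub>F n\<^esub> d n v)"
        using Fn.smult_l_distr[OF no _ xd, of \<one>] S_one by simp
      also have "\<dots> = \<zero>\<^bsub>F n\<^esub>" using Fn.smult_l_null[OF xd] by (simp add: l_neg)
      finally have "(\<ominus> \<one>) \<odot>\<^bsub>F n\<^esub> (x \<odot>\<^bsub>F n\<^esub> d n v) \<oplus>\<^bsub>F n\<^esub> (x \<odot>\<^bsub>F n\<^esub> d n v) = \<zero>\<^bsub>F n\<^esub>" using Fn.smult_one[OF xd] by simp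
      then show ?thesis using Fn.minus_equality[OF _ xd Fn.smult_closed[OF no xd]] by simp
    qed
    also have "x \<odot>\<^bsub>F n\<^esub> d n v \<oplus>\<^bsub>F n\<^esub> \<ominus>\<^bsub>F n\<^esub> (x \<odot>\<^bsub>F n\<^esub> d n v) = \<zero>\<^bsub>F n\<^esub>"
      using Fn.smult_closed[of x "d n v"] xS d_closed[OF v] by (simp add: Fn.r_neg)
    finally show ?thesis unfolding exactS using mod_homD(1)[OF s v] by simp
  qed
  then obtain \<sigma>' where \<sigma>': "\<sigma>' \<in> mod_hom RR (F (Suc n)) (F (Suc (Suc n)))" "\<And>v. v \<in> carrier (F (Suc n)) \<Longrightarrow> d (Suc n) (\<sigma>' v) = s v"
    using R.free_lift[OF FM FM d_hom s] by blast
  have "d (Suc n) (\<sigma>' (d (Suc n) w)) = x \<odot>\<^bsub>F (Suc n)\<^esub> d (Suc n) w" if w: "w \<in> carrier (F (Suc (Suc n)))" for w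
  proof -
    note dw = d_closed[OF w]
    have "\<sigma> (d n (d (Suc n) w)) = \<zero>\<^bsub>F (Suc n)\<^esub>" using dd0[OF w] mod_hom_zero[OF \<sigma>(1) FM FM] by simp
    then show ?thesis using \<sigma>'(2)[OF dw] dw G.smult_r_null[OF no] c1[OF dw] unfolding s_def by simp
  qed
  then show ?case using \<sigma>'(1) by blast
qed

text \<open>On the submodule im d + x F n, put d w + x p \<mapsto> f w / x modulo C, and extend this
  to a linear T on F n by treating one unit vector after another. Then x T and f / x - T d have
  values in C. The first makes x T d a coboundary, and x times the second is one by the null
  homotopy; their sum is f.\<close>

lemma ext_ge2:
  assumes C: "C \<in> SM" and inj: "\<And>I h. I \<in> FI \<Longrightarrow> qhom C I h \<Longrightarrow> qmult C I h"
  shows "Ext_cocycles RR rk d (MV C) (Suc (Suc i)) \<subseteq> Ext_coboundaries RR rk d (MV C) (Suc (Suc i))"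
proof
  fix f assume f: "f \<in> Ext_cocycles RR rk d (MV C) (Suc (Suc i))"
  define n where "n = Suc i"
  obtain x where x: "x \<in> m" "x \<in> Units Q" using nzd by blast
  have xS: "x \<in> S" and xc: "x \<in> carrier Q" and xi: "inv x \<in> carrier Q" using x m_sub by auto
  interpret R: cring RR by (rule RC)
  interpret G: module RR "F n" by (rule FM)
  interpret P: module RR "F (Suc n)" by (rule FM)
  interpret F': module RR "F i" by (rule FM)
  have fh: "f \<in> mod_hom RR (F (Suc n)) (MV C)" "\<And>z. z \<in> carrier (F (Suc (Suc n))) \<Longrightarrow> f (d (Suc n) z) = \<zero>"
    using cocycleD[OF f] unfolding n_def by auto
  note fD = hom_into[OF fh(1)]
  have fc: "f w \<in> carrier Q" if "w \<in> carrier (F (Suc n))" for w using smodsD(1)[OF C fD(1)[OF that]] .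
  \<comment> \<open>The vectors \<open>?val w p v\<close> with \<open>?dom k w p v\<close> form im d
    + x F n + (span of the first k unit vectors).\<close>
  let ?dom = "\<lambda>k w p v. w \<in> carrier (F (Suc n)) \<and> p \<in> carrier (F n) \<and> v \<in> carrier (F n) \<and> (\<forall>j. k \<le> j \<longrightarrow> j < rk n \<longrightarrow> v j = \<zero>)"
  let ?val = "\<lambda>w p v. d n w \<oplus>\<^bsub>F n\<^esub> x \<odot>\<^bsub>F n\<^esub> p \<oplus>\<^bsub>F n\<^esub> v"
  have xp: "x \<odot>\<^bsub>F n\<^esub> p \<in> carrier (F n)" if "p \<in> carrier (F n)" for p using G.smult_closed[of x p] xS that by simp
  have xP: "s \<odot>\<^bsub>F (Suc n)\<^esub> p \<in> carrier (F (Suc n))" if "s \<in> S" "p \<in> carrier (F (Suc n))" for s p using P.smult_closed[of s p] that by simp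
  have sn: "s \<odot>\<^bsub>F n\<^esub> p \<in> carrier (F n)" if "s \<in> S" "p \<in> carrier (F n)" for s p using G.smult_closed[of s p] that by simp
  have coord0: "\<zero>\<^bsub>F n\<^esub> j = \<zero>" if "j < rk n" for j using that by (simp add: free_module_simps)
  have coorda: "(v \<oplus>\<^bsub>F n\<^esub> v') j = v j \<oplus> v' j" if "j < rk n" for v v' j using that by (simp add: free_module_simps)
  have coords: "(s \<odot>\<^bsub>F n\<^esub> v) j = s \<otimes> v j" if "j < rk n" for v s j using that by (simp add: free_module_simps)
  have vS: "v j \<in> S" if "v \<in> carrier (F n)" "j < rk n" for v j using R.FM_mem[OF that] by simp
  have val_add: "?val (w \<oplus>\<^bsub>F (Suc n)\<^esub> w') (p \<oplus>\<^bsub>F n\<^esub> p') (v \<oplus>\<^bsub>F n\<^esub> v') = ?val w p v \<oplus>\<^bsub>F n\<^esub> ?val w' p' v'"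
    if "w \<in> carrier (F (Suc n))" "w' \<in> carrier (F (Suc n))" "p \<in> carrier (F n)" "p' \<in> carrier (F n)" "v \<in> carrier (F n)" "v' \<in> carrier (F n)" for w w' p p' v v'
  proof -
    have "x \<odot>\<^bsub>F n\<^esub> (p \<oplus>\<^bsub>F n\<^esub> p') = x \<odot>\<^bsub>F n\<^esub> p \<oplus>\<^bsub>F n\<^esub> x \<odot>\<^bsub>F n\<^esub> p'" using G.smult_r_distr[of x p p'] xS that by simp
    then show ?thesis using dadd[OF that(1,2)] d_closed[OF that(1)] d_closed[OF that(2)] xp that by (simp add: G.a_ac)
  qed
  have comm: "a \<odot>\<^bsub>F n\<^esub> (r \<odot>\<^bsub>F n\<^esub> v) = r \<odot>\<^bsub>F n\<^esub> (a \<odot>\<^bsub>F n\<^esub> v)"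
    if "a \<in> S" "r \<in> S" "v \<in> carrier (F n)" for a r v
    using G.smult_assoc1[of a r v] G.smult_assoc1[of r a v] that by (simp add: m_comm)
  have val_sm: "?val (s \<odot>\<^bsub>F (Suc n)\<^esub> w) (s \<odot>\<^bsub>F n\<^esub> p) (s \<odot>\<^bsub>F n\<^esub> v) = s \<odot>\<^bsub>F n\<^esub> ?val w p v"
    if s: "s \<in> S" and w: "w \<in> carrier (F (Suc n))" "p \<in> carrier (F n)" "v \<in> carrier (F n)" for s w p v
    using dsm[OF s w(1)] comm[OF xS s w(2)] G.smult_r_distr[of s] s d_closed[OF w(1)] xp[OF w(2)] w(3) by simp
  \<comment> \<open>Stage k makes T compatible with d w + x p \<mapsto> f w / x on the first k
    coordinates. The relation is written as a sum equal to zero, whence the plus sign before T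
    v.\<close>
  have "\<exists>T\<in>mod_hom RR (F n) (MV (carrier Q)). \<forall>w p v. ?dom k w p v \<longrightarrow> ?val w p v = \<zero>\<^bsub>F n\<^esub> \<longrightarrow> inv x \<otimes> f w \<oplus> T v \<in> C"
    if "k \<le> rk n" for k
    using that
  proof (induction k)
    case 0
    define T where "T = restrict (\<lambda>v. \<zero>) (carrier (F n))"
    have T: "T \<in> mod_hom RR (F n) (MV (carrier Q))" unfolding T_def by (rule hom_intoI) simp_all
    \<comment> \<open>The map on im d + x F n is well defined: if d w + x p = 0, then p is a cycle,
      so p = d w', and the cocycle f vanishes on w + x w'. Hence f w / x = - f w' lies in C.\<close>
    have "inv x \<otimes> f w \<oplus> T v \<in> C" if dom: "?dom 0 w p v" and z: "?val w p v = \<zero>\<^bsub>F n\<^esub>" for w p v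
    proof -
      have w: "w \<in> carrier (F (Suc n))" "p \<in> carrier (F n)" "v \<in> carrier (F n)" using dom by auto
      have v0: "v = \<zero>\<^bsub>F n\<^esub>" by (rule R.FM_eqI[OF w(3) G.zero_closed]) (use dom coord0 in simp)
      have z': "d n w \<oplus>\<^bsub>F n\<^esub> x \<odot>\<^bsub>F n\<^esub> p = \<zero>\<^bsub>F n\<^esub>" using z v0 d_closed[OF w(1)] xp[OF w(2)] by simp
      have p': "p \<in> carrier (F (Suc i))" and dw: "d n w \<in> carrier (F (Suc i))" using w(2) d_closed[OF w(1)] unfolding n_def by auto
      have "d i (d n w \<oplus>\<^bsub>F n\<^esub> x \<odot>\<^bsub>F n\<^esub> p) = d i (d n w) \<oplus>\<^bsub>F i\<^esub> x \<odot>\<^bsub>F i\<^esub> d i p"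
        using dadd[OF dw, of "x \<odot>\<^bsub>F n\<^esub> p"] xp[OF w(2)] dsm[OF xS p'] unfolding n_def by simp
      also have "d i (d n w) = \<zero>\<^bsub>F i\<^esub>" using dd0[of w i] w(1) unfolding n_def by simp
      finally have "x \<odot>\<^bsub>F i\<^esub> d i p = \<zero>\<^bsub>F i\<^esub>"
        using z' mod_hom_zero[OF d_hom[of i] FM FM] F'.smult_closed[of x "d i p"] xS d_closed[OF p'] unfolding n_def by simp
      have "d i p = \<zero>\<^bsub>F i\<^esub>"
      proof (rule R.FM_eqI[OF d_closed[OF p'] F'.zero_closed])
        fix j assume j: "j < rk i"
        have c: "d i p j \<in> carrier Q" using R.FM_mem[OF d_closed[OF p'] j] by auto
        have "x \<otimes> d i p j = \<zero>" using fun_cong[OF \<open>x \<odot>\<^bsub>F i\<^esub> d i p = \<zero>\<^bsub>F i\<^esub>\<close>, of j] j by (simp add: free_module_simps)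
        then have "d i p j = \<zero>" using unit_cancel[OF x(2) c zero_closed] xc by simp
        then show "d i p j = \<zero>\<^bsub>F i\<^esub> j" using j by (simp add: free_module_simps)
      qed
      then have "p \<in> d (Suc i) ` carrier (F (Suc (Suc i)))" unfolding exactS using p' by simp
      then obtain w' where w': "w' \<in> carrier (F (Suc n))" "p = d n w'" unfolding n_def by (elim imageE)
      have xw: "x \<odot>\<^bsub>F (Suc n)\<^esub> w' \<in> carrier (F (Suc n))" using xP[OF xS w'(1)] .
      have "d n (w \<oplus>\<^bsub>F (Suc n)\<^esub> x \<odot>\<^bsub>F (Suc n)\<^esub> w') = d n \<zero>\<^bsub>F (Suc n)\<^esub>"
        using dadd[OF w(1) xw] dsm[OF xS w'(1)] w'(2) z' mod_hom_zero[OF d_hom[of n] FM FM] by simp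
      then have "f (w \<oplus>\<^bsub>F (Suc n)\<^esub> x \<odot>\<^bsub>F (Suc n)\<^esub> w') = f \<zero>\<^bsub>F (Suc n)\<^esub>"
        using kills[OF C, of f n "w \<oplus>\<^bsub>F (Suc n)\<^esub> x \<odot>\<^bsub>F (Suc n)\<^esub> w'" "\<zero>\<^bsub>F (Suc n)\<^esub>"] fh w(1) xw by simp
      then have e: "f w \<oplus> x \<otimes> f w' = \<zero>" using fD(2)[OF w(1) xw] fD(3)[OF xS w'(1)] hom_zero[OF C fh(1)] by simp
      have "inv x \<otimes> f w = inv x \<otimes> ((f w \<oplus> x \<otimes> f w') \<ominus> x \<otimes> f w')" using fc[OF w(1)] fc[OF w'(1)] xc xi by algebra
      also have "\<dots> = inv x \<otimes> (x \<otimes> (\<ominus> f w'))" unfolding e using fc[OF w'(1)] xc xi by algebra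
      also have "\<dots> = \<ominus> f w'" using unit_inv_mult(2)[OF x(2)] fc[OF w'(1)] by simp
      finally have "inv x \<otimes> f w \<in> C" using smodsD(6)[OF C fD(1)[OF w'(1)]] by simp
      then show ?thesis unfolding T_def using w(3) fc[OF w(1)] xi by simp
    qed
    then show ?case using T by blast
  next
    case (Suc k)
    have k: "k < rk n" using Suc.prems by simp
    obtain T where T: "T \<in> mod_hom RR (F n) (MV (carrier Q))"
      and Tz': "\<forall>w p v. ?dom k w p v \<longrightarrow> ?val w p v = \<zero>\<^bsub>F n\<^esub> \<longrightarrow> inv x \<otimes> f w \<oplus> T v \<in> C"
      using Suc.IH[OF less_imp_le[OF k]] by (rule bexE)
    have Tz: "inv x \<otimes> f w \<oplus> T v \<in> C" if "?dom k w p v" "?val w p v = \<zero>\<^bsub>F n\<^esub>" for w p v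
      using Tz'[THEN spec, THEN spec, THEN spec, THEN mp, OF that(1), THEN mp, OF that(2)] .
    note TD = hom_into[OF T]
    define e where "e = unit_vec RR (rk n) k"
    have ec: "e \<in> carrier (F n)" unfolding e_def by (rule R.unit_vec_closed)
    \<comment> \<open>\<open>Rl a c\<close> says that the multiple a e of the next unit vector is
      already in the domain and that c represents its value there. Values are unique modulo C, so
      they define a homomorphism to Q/C on the ideal I of all such a.\<close>
    define Rl where "Rl a c \<longleftrightarrow> (\<exists>w p v. ?dom k w p v \<and> ?val w p v = a \<odot>\<^bsub>F n\<^esub> e \<and> c = inv x \<otimes> f w \<oplus> T v)" for a c
    have RlI: "Rl a c" if "?dom k w p v" "?val w p v = a \<odot>\<^bsub>F n\<^esub> e" "c = inv x \<otimes> f w \<oplus> T v" for a c w p v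
      unfolding Rl_def using that by (intro exI[of _ w] exI[of _ p] exI[of _ v]) simp
    have Rl_c: "c \<in> carrier Q" if "Rl a c" for a c
      using that fc TD(1) xi unfolding Rl_def by (elim exE conjE) simp
    have Rl_add: "Rl (a \<oplus> b) (c \<oplus> c')" if ab: "a \<in> S" "b \<in> S" and 1: "Rl a c" and 2: "Rl b c'" for a b c c'
    proof -
      obtain w p v where w: "?dom k w p v" "?val w p v = a \<odot>\<^bsub>F n\<^esub> e" "c = inv x \<otimes> f w \<oplus> T v" using 1 unfolding Rl_def by (elim exE conjE) simp
      obtain w' p' v' where w': "?dom k w' p' v'" "?val w' p' v' = b \<odot>\<^bsub>F n\<^esub> e" "c' = inv x \<otimes> f w' \<oplus> T v'" using 2 unfolding Rl_def by (elim exE conjE) simp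
      have c: "w \<in> carrier (F (Suc n))" "w' \<in> carrier (F (Suc n))" "p \<in> carrier (F n)" "p' \<in> carrier (F n)" "v \<in> carrier (F n)" "v' \<in> carrier (F n)"
        using w(1) w'(1) by auto
      show ?thesis
      proof (rule RlI[where w="w \<oplus>\<^bsub>F (Suc n)\<^esub> w'" and p="p \<oplus>\<^bsub>F n\<^esub> p'" and v="v \<oplus>\<^bsub>F n\<^esub> v'"])
        show "?dom k (w \<oplus>\<^bsub>F (Suc n)\<^esub> w') (p \<oplus>\<^bsub>F n\<^esub> p') (v \<oplus>\<^bsub>F n\<^esub> v')" using w(1) w'(1) c by (simp add: coorda)
        show "?val (w \<oplus>\<^bsub>F (Suc n)\<^esub> w') (p \<oplus>\<^bsub>F n\<^esub> p') (v \<oplus>\<^bsub>F n\<^esub> v') = (a \<oplus> b) \<odot>\<^bsub>F n\<^esub> e"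
          using val_add[OF c] w(2) w'(2) G.smult_l_distr[of a b e] ab ec by simp
        show "c \<oplus> c' = inv x \<otimes> f (w \<oplus>\<^bsub>F (Suc n)\<^esub> w') \<oplus> T (v \<oplus>\<^bsub>F n\<^esub> v')"
          unfolding w(3) w'(3) fD(2)[OF c(1,2)] TD(2)[OF c(5,6)]
          using fc[OF c(1)] fc[OF c(2)] TD(1)[OF c(5)] TD(1)[OF c(6)] xi by algebra
      qed
    qed
    have Rl_sm: "Rl (s \<otimes> a) (s \<otimes> c)" if s: "s \<in> S" and a: "a \<in> S" and 1: "Rl a c" for s a c
    proof -
      obtain w p v where w: "?dom k w p v" "?val w p v = a \<odot>\<^bsub>F n\<^esub> e" "c = inv x \<otimes> f w \<oplus> T v" using 1 unfolding Rl_def by (elim exE conjE) simp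
      have c: "w \<in> carrier (F (Suc n))" "p \<in> carrier (F n)" "v \<in> carrier (F n)" using w(1) by auto
      show ?thesis
      proof (rule RlI[where w="s \<odot>\<^bsub>F (Suc n)\<^esub> w" and p="s \<odot>\<^bsub>F n\<^esub> p" and v="s \<odot>\<^bsub>F n\<^esub> v"])
        show "?dom k (s \<odot>\<^bsub>F (Suc n)\<^esub> w) (s \<odot>\<^bsub>F n\<^esub> p) (s \<odot>\<^bsub>F n\<^esub> v)"
          using w(1) c xP[OF s] sn[OF s] S_carr[OF s] by (simp add: coords)
        show "?val (s \<odot>\<^bsub>F (Suc n)\<^esub> w) (s \<odot>\<^bsub>F n\<^esub> p) (s \<odot>\<^bsub>F n\<^esub> v) = (s \<otimes> a) \<odot>\<^bsub>F n\<^esub> e"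
          using val_sm[OF s c] w(2) G.smult_assoc1[of s a e] s a ec by simp
        show "s \<otimes> c = inv x \<otimes> f (s \<odot>\<^bsub>F (Suc n)\<^esub> w) \<oplus> T (s \<odot>\<^bsub>F n\<^esub> v)"
          unfolding w(3) fD(3)[OF s c(1)] TD(3)[OF s c(3)] using fc[OF c(1)] TD(1)[OF c(3)] xi S_carr[OF s] by algebra
      qed
    qed
    have Rl_minus: "Rl (a \<ominus> b) (c \<ominus> c')" if "a \<in> S" "b \<in> S" "Rl a c" "Rl b c'" for a b c c'
    proof -
      have "Rl ((\<ominus> \<one>) \<otimes> b) ((\<ominus> \<one>) \<otimes> c')" by (rule Rl_sm[OF S_neg[OF S_one] that(2,4)])
      then have "Rl (\<ominus> b) (\<ominus> c')" using S_carr[OF that(2)] Rl_c[OF that(4)] by (simp add: l_minus)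
      then show ?thesis using Rl_add[OF that(1) S_neg[OF that(2)] that(3)] by (simp add: a_minus_def)
    qed
    have Rl_0: "c \<in> C" if Rc: "Rl \<zero> c" for c
    proof -
      obtain w p v where w: "?dom k w p v" "?val w p v = \<zero> \<odot>\<^bsub>F n\<^esub> e" "c = inv x \<otimes> f w \<oplus> T v" using Rc unfolding Rl_def by (elim exE conjE) simp
      have "\<zero> \<odot>\<^bsub>F n\<^esub> e = \<zero>\<^bsub>F n\<^esub>" using G.smult_l_null[OF ec] by simp
      then show ?thesis using Tz[OF w(1)] w(2,3) by simp
    qed
    have Rl_cong: "c \<ominus> c' \<in> C" if "a \<in> S" "Rl a c" "Rl a c'" for a c c'
      using Rl_0[of "c \<ominus> c'"] Rl_minus[OF that(1,1,2,3)] that(1) by (simp add: a_minus_def r_neg)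
    define I where "I = {a \<in> S. \<exists>c. Rl a c}"
    define h where "h a = (SOME c. Rl a c)" for a
    have hR: "Rl a (h a)" if "a \<in> I" for a using that unfolding I_def h_def by (auto intro: someI_ex)
    have R0: "Rl \<zero> (inv x \<otimes> f \<zero>\<^bsub>F (Suc n)\<^esub> \<oplus> T \<zero>\<^bsub>F n\<^esub>)"
    proof (rule RlI[where p="\<zero>\<^bsub>F n\<^esub>"])
      show "?dom k \<zero>\<^bsub>F (Suc n)\<^esub> \<zero>\<^bsub>F n\<^esub> \<zero>\<^bsub>F n\<^esub>" using coord0 by simp
      show "?val \<zero>\<^bsub>F (Suc n)\<^esub> \<zero>\<^bsub>F n\<^esub> \<zero>\<^bsub>F n\<^esub> = \<zero> \<odot>\<^bsub>F n\<^esub> e"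
        using mod_hom_zero[OF d_hom[of n] FM FM] G.smult_r_null[of x] xS G.smult_l_null[OF ec] by simp
    qed simp
    \<comment> \<open>The summand x F n of the domain makes each I contain x; this is what turns I
      into a regular ideal.\<close>
    have Rx: "Rl x (inv x \<otimes> f \<zero>\<^bsub>F (Suc n)\<^esub> \<oplus> T \<zero>\<^bsub>F n\<^esub>)"
    proof (rule RlI[where p=e])
      show "?dom k \<zero>\<^bsub>F (Suc n)\<^esub> e \<zero>\<^bsub>F n\<^esub>" using coord0 ec by simp
      show "?val \<zero>\<^bsub>F (Suc n)\<^esub> e \<zero>\<^bsub>F n\<^esub> = x \<odot>\<^bsub>F n\<^esub> e"
        using mod_hom_zero[OF d_hom[of n] FM FM] xp[OF ec] by simp
    qed simp
    have IM: "I \<in> SM"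
    proof (rule smodsI)
      show "I \<subseteq> carrier Q" unfolding I_def by auto
      show "\<zero> \<in> I" unfolding I_def using R0 S_zero by blast
      show "a \<oplus> b \<in> I" if "a \<in> I" "b \<in> I" for a b using that Rl_add S_add unfolding I_def by blast
      show "s \<otimes> a \<in> I" if "s \<in> S" "a \<in> I" for s a using that Rl_sm S_mult unfolding I_def by blast
    qed
    have "I \<in> FI" by (rule fids_sub_S[OF IM _ _ x(2)]) (use Rx xS in \<open>auto simp: I_def\<close>)
    moreover have "qhom C I h"
      unfolding qhom_def
    proof (intro conjI ballI)
      fix a assume a: "a \<in> I"
      show "h a \<in> carrier Q" using Rl_c[OF hR[OF a]] .
      have aS: "a \<in> S" using a unfolding I_def by auto
      fix b assume b: "b \<in> I"
      have bS: "b \<in> S" using b unfolding I_def by auto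
      show "h (a \<oplus> b) \<ominus> (h a \<oplus> h b) \<in> C"
        by (rule Rl_cong[OF S_add[OF aS bS] hR[OF smodsD(3)[OF IM a b]] Rl_add[OF aS bS hR[OF a] hR[OF b]]])
    next
      fix s a assume s: "s \<in> S" "a \<in> I"
      then have aS: "a \<in> S" unfolding I_def by auto
      show "h (s \<otimes> a) \<ominus> s \<otimes> h a \<in> C"
        by (rule Rl_cong[OF S_mult[OF s(1) aS] hR[OF smodsD(4)[OF IM s]] Rl_sm[OF s(1) aS hR[OF s(2)]]])
    qed
    ultimately have "qmult C I h" by (rule inj)
    then obtain q where q: "q \<in> carrier Q" "\<And>a. a \<in> I \<Longrightarrow> h a \<ominus> q \<otimes> a \<in> C" unfolding qmult_def by blast
    \<comment> \<open>Corrects T so that its value on the k-th unit vector becomes q.\<close>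
    define t where "t = q \<ominus> T e"
    have tc: "t \<in> carrier Q" unfolding t_def using q(1) TD(1)[OF ec] by simp
    define T' where "T' = restrict (\<lambda>v. T v \<oplus> v k \<otimes> t) (carrier (F n))"
    have T': "T' \<in> mod_hom RR (F n) (MV (carrier Q))"
      unfolding T'_def
    proof (rule hom_intoI)
      fix v assume v: "v \<in> carrier (F n)"
      note vk = S_carr[OF vS[OF v k]]
      show "T v \<oplus> v k \<otimes> t \<in> carrier Q" using TD(1)[OF v] vk tc by simp
      fix v' assume v': "v' \<in> carrier (F n)"
      note vk' = S_carr[OF vS[OF v' k]]
      show "T (v \<oplus>\<^bsub>F n\<^esub> v') \<oplus> (v \<oplus>\<^bsub>F n\<^esub> v') k \<otimes> t = T v \<oplus> v k \<otimes> t \<oplus> (T v' \<oplus> v' k \<otimes> t)"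
        unfolding TD(2)[OF v v'] coorda[OF k] using TD(1)[OF v] TD(1)[OF v'] vk vk' tc by algebra
    next
      fix s v assume v: "s \<in> S" "v \<in> carrier (F n)"
      note vk = S_carr[OF vS[OF v(2) k]]
      show "T (s \<odot>\<^bsub>F n\<^esub> v) \<oplus> (s \<odot>\<^bsub>F n\<^esub> v) k \<otimes> t = s \<otimes> (T v \<oplus> v k \<otimes> t)"
        unfolding TD(3)[OF v] coords[OF k] using TD(1)[OF v(2)] vk tc S_carr[OF v(1)] by algebra
    qed
    have "inv x \<otimes> f w \<oplus> T' v \<in> C" if dom: "?dom (Suc k) w p v" and z: "?val w p v = \<zero>\<^bsub>F n\<^esub>" for w p v
    proof -
      have w: "w \<in> carrier (F (Suc n))" "p \<in> carrier (F n)" "v \<in> carrier (F n)" using dom by auto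
      define a where "a = \<ominus> v k"
      have aS: "a \<in> S" unfolding a_def using S_neg[OF vS[OF w(3) k]] .
      define v' where "v' = v \<oplus>\<^bsub>F n\<^esub> a \<odot>\<^bsub>F n\<^esub> e"
      have v': "v' \<in> carrier (F n)" unfolding v'_def using w(3) sn[OF aS ec] by simp
      have ej: "e j = (if j = k then \<one> else \<zero>)" if "j < rk n" for j unfolding e_def unit_vec_def using that by simp
      have dom': "?dom k w p v'"
      proof (intro conjI allI impI w v')
        fix j assume j: "k \<le> j" "j < rk n"
        have "v' j = v j \<oplus> a \<otimes> e j" unfolding v'_def using coorda[OF j(2)] coords[OF j(2)] by simp
        then show "v' j = \<zero>"
          using dom j ej[OF j(2)] S_carr[OF vS[OF w(3) j(2)]] S_carr[OF aS] by (cases "j = k") (auto simp: a_def r_neg)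
      qed
      have "?val w p v' = ?val w p v \<oplus>\<^bsub>F n\<^esub> a \<odot>\<^bsub>F n\<^esub> e"
        unfolding v'_def using d_closed[OF w(1)] xp[OF w(2)] w(3) sn[OF aS ec] by (simp add: G.a_assoc)
      then have "?val w p v' = a \<odot>\<^bsub>F n\<^esub> e" using z sn[OF aS ec] by simp
      from RlI[OF dom' this refl] have Ra: "Rl a (inv x \<otimes> f w \<oplus> T v')" .
      then have aI: "a \<in> I" unfolding I_def using aS by blast
      note cc = Rl_c[OF Ra] Rl_c[OF hR[OF aI]]
      have 1: "(inv x \<otimes> f w \<oplus> T v') \<ominus> q \<otimes> a \<in> C"
        by (rule cong_trans[OF C cc _ Rl_cong[OF aS Ra hR[OF aI]] q(2)[OF aI]]) (use q(1) S_carr[OF aS] in simp)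
      have Tv': "T v' = T v \<oplus> a \<otimes> T e" unfolding v'_def using TD(2)[OF w(3) sn[OF aS ec]] TD(3)[OF aS ec] by simp
      have "(inv x \<otimes> f w \<oplus> T v') \<ominus> q \<otimes> a = inv x \<otimes> f w \<oplus> (T v \<oplus> v k \<otimes> t)"
        unfolding Tv' a_def t_def using fc[OF w(1)] xi TD(1)[OF w(3)] TD(1)[OF ec] q(1) S_carr[OF vS[OF w(3) k]] by algebra
      then show ?thesis using 1 w(3) unfolding T'_def by simp
    qed
    then show ?case using T' by blast
  qed
  from this[OF order_refl] obtain T where T: "T \<in> mod_hom RR (F n) (MV (carrier Q))"
    and Tz': "\<forall>w p v. ?dom (rk n) w p v \<longrightarrow> ?val w p v = \<zero>\<^bsub>F n\<^esub> \<longrightarrow> inv x \<otimes> f w \<oplus> T v \<in> C" by (rule bexE)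
  note TD = hom_into[OF T]
  have Tz: "inv x \<otimes> f w \<oplus> T v \<in> C" if "w \<in> carrier (F (Suc n))" "p \<in> carrier (F n)" "v \<in> carrier (F n)" "?val w p v = \<zero>\<^bsub>F n\<^esub>" for w p v
  proof -
    have "?dom (rk n) w p v" using that by simp
    then show ?thesis using Tz'[THEN spec, THEN spec, THEN spec, THEN mp, OF _ , THEN mp, OF _ that(4)] by blast
  qed
  \<comment> \<open>The case w = 0, v = - x p of the relation.\<close>
  have xT: "x \<otimes> T p \<in> C" if p: "p \<in> carrier (F n)" for p
  proof -
    let ?v = "(\<ominus> x) \<odot>\<^bsub>F n\<^esub> p"
    have v: "?v \<in> carrier (F n)" using sn[OF S_neg[OF xS] p] .
    have "?val \<zero>\<^bsub>F (Suc n)\<^esub> p ?v = (x \<oplus> \<ominus> x) \<odot>\<^bsub>F n\<^esub> p"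
      using mod_hom_zero[OF d_hom[of n] FM FM] xp[OF p] G.smult_l_distr[of x "\<ominus> x" p] p xS S_neg[OF xS] v by simp
    also have "\<dots> = \<zero>\<^bsub>F n\<^esub>" using G.smult_l_null[OF p] xc by (simp add: r_neg)
    finally have "inv x \<otimes> f \<zero>\<^bsub>F (Suc n)\<^esub> \<oplus> T ?v \<in> C" by (rule Tz[OF P.zero_closed p v])
    then have "\<ominus> x \<otimes> T p \<in> C" using hom_zero[OF C fh(1)] xi TD(3)[OF S_neg[OF xS] p] TD(1)[OF p] xc by simp
    then have "\<ominus> (\<ominus> x \<otimes> T p) \<in> C" using smodsD(6)[OF C] by blast
    then show ?thesis using xc TD(1)[OF p] by (simp add: l_minus)
  qed
  define f' where "f' = restrict (\<lambda>w. inv x \<otimes> f w \<ominus> T (d n w)) (carrier (F (Suc n)))"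
  have f'C: "inv x \<otimes> f w \<ominus> T (d n w) \<in> C" if w: "w \<in> carrier (F (Suc n))" for w
  proof -
    have dw: "d n w \<in> carrier (F n)" using d_closed[OF w] .
    have "?val w \<zero>\<^bsub>F n\<^esub> (\<ominus>\<^bsub>F n\<^esub> d n w) = \<zero>\<^bsub>F n\<^esub>" using dw G.smult_r_null[of x] xS by (simp add: G.r_neg)
    then have "inv x \<otimes> f w \<oplus> T (\<ominus>\<^bsub>F n\<^esub> d n w) \<in> C" using Tz[OF w G.zero_closed G.a_inv_closed[OF dw]] by blast
    then show ?thesis using hom_minus[OF carrier_smod T dw] by (simp add: a_minus_def)
  qed
  have f': "f' \<in> mod_hom RR (F (Suc n)) (MV C)"
    unfolding f'_def
  proof (rule hom_intoI[OF f'C])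
    fix w w' assume w: "w \<in> carrier (F (Suc n))" "w' \<in> carrier (F (Suc n))"
    note dw = d_closed[OF w(1)] d_closed[OF w(2)]
    show "inv x \<otimes> f (w \<oplus>\<^bsub>F (Suc n)\<^esub> w') \<ominus> T (d n (w \<oplus>\<^bsub>F (Suc n)\<^esub> w')) = inv x \<otimes> f w \<ominus> T (d n w) \<oplus> (inv x \<otimes> f w' \<ominus> T (d n w'))"
      unfolding fD(2)[OF w] dadd[OF w] TD(2)[OF dw] using fc[OF w(1)] fc[OF w(2)] TD(1)[OF dw(1)] TD(1)[OF dw(2)] xi by algebra
  next
    fix s w assume w: "s \<in> S" "w \<in> carrier (F (Suc n))"
    note dw = d_closed[OF w(2)]
    show "inv x \<otimes> f (s \<odot>\<^bsub>F (Suc n)\<^esub> w) \<ominus> T (d n (s \<odot>\<^bsub>F (Suc n)\<^esub> w)) = s \<otimes> (inv x \<otimes> f w \<ominus> T (d n w))"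
      unfolding fD(3)[OF w] dsm[OF w] TD(3)[OF w(1) dw] using fc[OF w(2)] TD(1)[OF dw] xi S_carr[OF w(1)] by algebra
  qed
  note f'D = hom_into[OF f']
  have f'0: "f' (d (Suc n) z) = \<zero>" if z: "z \<in> carrier (F (Suc (Suc n)))" for z
    unfolding f'_def using d_closed[OF z] dd0[OF z] fh(2)[OF z] hom_zero[OF carrier_smod T] xi by (simp add: a_minus_def)
  obtain \<sigma> where \<sigma>: "\<sigma> \<in> mod_hom RR (F n) (F (Suc n))" "\<forall>w\<in>carrier (F (Suc n)). d n (\<sigma> (d n w)) = x \<odot>\<^bsub>F n\<^esub> d n w"
    using null_homotopy[OF x(1), of n] by (rule bexE)
  note \<sigma>D = mod_homD(1-3)[OF \<sigma>(1)]
  \<comment> \<open>Since f' factors through d, the null homotopy gives f' (\<sigma> (d w)) = x f'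
    w, and x T (d w) + x f' w = f w.\<close>
  define g where "g = restrict (\<lambda>v. x \<otimes> T v \<oplus> f' (\<sigma> v)) (carrier (F n))"
  have f'c: "f' w \<in> carrier Q" if "w \<in> carrier (F (Suc n))" for w using smodsD(1)[OF C f'D(1)[OF that]] .
  have g: "g \<in> mod_hom RR (F n) (MV C)"
    unfolding g_def
  proof (rule hom_intoI)
    fix v assume v: "v \<in> carrier (F n)"
    show "x \<otimes> T v \<oplus> f' (\<sigma> v) \<in> C" using smodsD(3)[OF C xT[OF v] f'D(1)[OF \<sigma>D(1)[OF v]]] .
    fix v' assume v': "v' \<in> carrier (F n)"
    show "x \<otimes> T (v \<oplus>\<^bsub>F n\<^esub> v') \<oplus> f' (\<sigma> (v \<oplus>\<^bsub>F n\<^esub> v')) = x \<otimes> T v \<oplus> f' (\<sigma> v) \<oplus> (x \<otimes> T v' \<oplus> f' (\<sigma> v'))"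
      unfolding TD(2)[OF v v'] \<sigma>D(2)[OF v v'] f'D(2)[OF \<sigma>D(1)[OF v] \<sigma>D(1)[OF v']]
      using TD(1)[OF v] TD(1)[OF v'] xc f'c[OF \<sigma>D(1)[OF v]] f'c[OF \<sigma>D(1)[OF v']] by algebra
  next
    fix s v assume v: "s \<in> S" "v \<in> carrier (F n)"
    have e: "\<sigma> (s \<odot>\<^bsub>F n\<^esub> v) = s \<odot>\<^bsub>F (Suc n)\<^esub> \<sigma> v" using \<sigma>D(3)[of s v] v by simp
    show "x \<otimes> T (s \<odot>\<^bsub>F n\<^esub> v) \<oplus> f' (\<sigma> (s \<odot>\<^bsub>F n\<^esub> v)) = s \<otimes> (x \<otimes> T v \<oplus> f' (\<sigma> v))"
      unfolding TD(3)[OF v] e f'D(3)[OF v(1) \<sigma>D(1)[OF v(2)]]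
      using TD(1)[OF v(2)] xc f'c[OF \<sigma>D(1)[OF v(2)]] S_carr[OF v(1)] by algebra
  qed
  have "g (d n w) = f w" if w: "w \<in> carrier (F (Suc n))" for w
  proof -
    have dw: "d n w \<in> carrier (F n)" using d_closed[OF w] .
    have "d n (\<sigma> (d n w)) = d n (x \<odot>\<^bsub>F (Suc n)\<^esub> w)" using \<sigma>(2) w dsm[OF xS w] by simp
    then have "f' (\<sigma> (d n w)) = f' (x \<odot>\<^bsub>F (Suc n)\<^esub> w)"
      using kills[OF C f' f'0 \<sigma>D(1)[OF dw] xP[OF xS w]] by simp
    also have "\<dots> = x \<otimes> (inv x \<otimes> f w \<ominus> T (d n w))" using f'D(3)[OF xS w] w unfolding f'_def by simp
    finally have e: "f' (\<sigma> (d n w)) = x \<otimes> (inv x \<otimes> f w \<ominus> T (d n w))" .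
    have "g (d n w) = x \<otimes> T (d n w) \<oplus> x \<otimes> (inv x \<otimes> f w \<ominus> T (d n w))" unfolding g_def using dw e by simp
    also have "\<dots> = x \<otimes> (inv x \<otimes> f w)" using TD(1)[OF dw] xc xi fc[OF w] by algebra
    also have "\<dots> = f w" using unit_inv_mult(1)[OF x(2) fc[OF w]] .
    finally show ?thesis .
  qed
  then show "f \<in> Ext_coboundaries RR rk d (MV C) (Suc (Suc i))"
    using coboundaryI[of f C n g] f g unfolding n_def by simp
qed

end

section \<open>Canonical ideals are the dualizing ideals\<close>

context cm_one
begin

lemma Ext_kk:
  assumes V: "V \<in> SM"
  shows "module_length RR (Ext RR 0 kk (ideal_module Q V)) = 0"
    "module_length RR (Ext RR 1 kk (ideal_module Q V)) = len V (colon Q V m)"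
    "module_length RR (Ext RR 2 kk (ideal_module Q V)) = 0 \<Longrightarrow> qhom V m h \<Longrightarrow> qmult V m h"
    "(\<And>I h. I \<in> FI \<Longrightarrow> qhom V I h \<Longrightarrow> qmult V I h) \<Longrightarrow> module_length RR (Ext RR (Suc (Suc i)) kk (ideal_module Q V)) = 0"
proof -
  obtain rk d \<epsilon> where res: "free_resolution RR kk rk d \<epsilon>"
    and E: "\<forall>i M. Ext RR i kk M = quot_module RR
          ((hom_module RR (free_module RR (rk i)) (M :: ('a, 'a) module))\<lparr>carrier := Ext_cocycles RR rk d M i\<rparr>)
          (Ext_coboundaries RR rk d M i)"
    using Ext_resolution[OF resolution_ex] by blast
  interpret cm_res Q S m rk d \<epsilon> by unfold_locales (rule res)
  note L = Ext_length[where rk=rk and d=d, OF module_SM[OF V] RC d_hom dd0]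
  note EV = E[THEN spec, THEN spec, of _ "ideal_module Q V"]
  have sub: "Ext_coboundaries RR rk d (MV V) i \<subseteq> Ext_cocycles RR rk d (MV V) i" for i
    using submoduleD(1)[OF L(2,3)] by simp
  have zero: "module_length RR (Ext RR i kk (MV V)) = 0" if "Ext_cocycles RR rk d (MV V) i \<subseteq> Ext_coboundaries RR rk d (MV V) i" for i
    using L(1)[of i] equalityI[OF sub that] unfolding EV by simp
  have zeroD: "Ext_cocycles RR rk d (MV V) i \<subseteq> Ext_coboundaries RR rk d (MV V) i" if "module_length RR (Ext RR i kk (MV V)) = 0" for i
  proof -
    let ?M = "(hom_module RR (F i) (MV V))\<lparr>carrier := Ext_cocycles RR rk d (MV V) i\<rparr>"
    have c: "submodule (Ext_cocycles RR rk d (MV V) i) RR ?M" using module.carrier_is_submodule[OF L(2)[of i]] by simp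
    have "chain_len (submods RR ?M) (Ext_coboundaries RR rk d (MV V) i) (Ext_cocycles RR rk d (MV V) i) = 0"
      using that L(1)[of i] unfolding EV by simp
    then have "Ext_coboundaries RR rk d (MV V) i = Ext_cocycles RR rk d (MV V) i"
      by (rule chain_len_0_imp_eq) (use L(3)[of i] c sub in simp_all)
    then show ?thesis by simp
  qed
  show "module_length RR (Ext RR 0 kk (ideal_module Q V)) = 0" by (rule zero[OF ext0[OF V]])
  show "module_length RR (Ext RR 1 kk (ideal_module Q V)) = len V (colon Q V m)" unfolding EV by (rule ext1[OF V])
  show "qmult V m h" if "module_length RR (Ext RR 2 kk (ideal_module Q V)) = 0" "qhom V m h"
    by (rule ext2_imp[OF V zeroD[OF that(1)] that(2)])
  show "module_length RR (Ext RR (Suc (Suc i)) kk (ideal_module Q V)) = 0"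
    if "\<And>I h. I \<in> FI \<Longrightarrow> qhom V I h \<Longrightarrow> qmult V I h"
    by (rule zero[OF ext_ge2[OF V that]])
qed

text \<open>Length one in degree 1 gives C : m \<noteq> C, and vanishing in degree 2 gives the
  extension property on m and hence on all fractional ideals. Regularity is obtained last, from
  duality.\<close>

lemma canonical_imp_dualizing:
  assumes C: "canonical_ideal RR m C" and dim: "krull_dim RR = 1"
  shows "dualizing C" "C \<subseteq> S" "C \<in> FI"
proof -
  have CS: "C \<in> SM" "C \<subseteq> S" using C ideal_RR_iff unfolding canonical_ideal_def by auto
  have E: "module_length RR (Ext RR i kk (ideal_module Q C)) = (if enat i = 1 then 1 else 0)" for i
    using C dim unfolding canonical_ideal_def canonical_module_def by simp
  have "module_length RR (Ext RR 1 kk (ideal_module Q C)) = 1" using E[of 1] by (simp add: one_enat_def)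
  then have "len C (colon Q C m) = 1" using Ext_kk(2)[OF CS(1)] by simp
  then have "colon Q C m \<noteq> C" by auto
  moreover have "module_length RR (Ext RR 2 kk (ideal_module Q C)) = 0" using E[of 2] by (simp add: one_enat_def)
  then have "qmult C I h" if "I \<in> FI" "qhom C I h" for I h
    using qmult_from_m[OF CS(1) Ext_kk(3)[OF CS(1)] that] by blast
  ultimately show D: "dualizing C" unfolding dualizing_def using CS(1) by blast
  show "C \<subseteq> S" by (rule CS)
  show "C \<in> FI" by (rule dualizing_ideal_regular[OF D CS(2)])
qed

text \<open>In degree 1, (D : m) / D is dual to S / m, hence of length one. Finite generation comes
  from noetherianity of S.\<close>

lemma dualizing_imp_canonical:
  assumes D: "dualizing D" "D \<in> FI" "D \<subseteq> S" and CM: "cohen_macaulay_local RR m" and dim: "krull_dim RR = 1"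
  shows "canonical_ideal RR m D"
proof -
  interpret R: cring RR by (rule RR_cring)
  interpret N: noetherian_ring RR by (rule RR_noetherian)
  have DM: "D \<in> SM" using fidsD(1)[OF D(2)] .
  have id: "ideal D RR" using ideal_RR_iff DM D(3) by simp
  obtain T where T: "T \<subseteq> carrier RR" "finite T" "D = Idl\<^bsub>RR\<^esub> T" using N.finetely_gen[OF id] by blast
  have "fin_gen_module RR (ideal_module RR D)"
    unfolding fin_gen_module_def
  proof (intro conjI exI[of _ T] allI impI)
    show "module RR (ideal_module RR D)" using module_SM[OF DM] by simp
    show "finite T" by fact
    show "T \<subseteq> carrier (ideal_module RR D)" using R.genideal_self[OF T(1)] T(3) by simp
    fix N assume N: "submodule N RR (ideal_module RR D)" "T \<subseteq> N"
    then have NS: "N \<in> SM" "N \<subseteq> D" using submods_SM[OF DM] by auto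
    then have "ideal N RR" using ideal_RR_iff D(3) by auto
    then have "D \<subseteq> N" using R.genideal_minimal[OF _ N(2)] T(3) by simp
    then show "N = carrier (ideal_module RR D)" using NS(2) by simp
  qed
  moreover have "module_length RR (Ext RR i kk (ideal_module Q D)) = (if enat i = 1 then 1 else 0)" for i
  proof -
    consider "i = 0" | "i = 1" | j where "i = Suc (Suc j)" by (metis One_nat_def not0_implies_Suc)
    then show ?thesis
    proof cases
      case 1
      then show ?thesis using Ext_kk(1)[OF DM] by (simp add: one_enat_def)
    next
      case 2
      have "len D (colon Q D m) = len m S" using len_dual[OF D(1,2) m_fid S_fid m_sub] colon_S[OF DM] by simp
      also have "\<dots> = 1" using len_lenn[OF m_fid S_fid m_sub] lenn_m_S by (simp add: one_enat_def)
      finally show ?thesis using 2 Ext_kk(2)[OF DM] by (simp add: one_enat_def)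
    next
      case 3
      have "module_length RR (Ext RR (Suc (Suc j)) kk (ideal_module Q D)) = 0"
        by (rule Ext_kk(4)[OF DM]) (use D(1) in \<open>auto simp: dualizing_def\<close>)
      then show ?thesis using 3 by (simp add: one_enat_def)
    qed
  qed
  ultimately show ?thesis unfolding canonical_ideal_def canonical_module_def using id CM dim by simp
qed

lemma cm_type_eq:
  assumes "krull_dim RR = 1"
  shows "cm_type RR m = lenn S (colon Q S m)"
  unfolding cm_type_def lenn_def using assms Ext_kk(2)[OF S_smod] by (simp add: one_enat_def)

end

section \<open>Reductions and multiplicities\<close>

text \<open>The base ring is an argument because powers are compared over S and over
  \<open>AA\<close>; the products are the same and only exponent 0 differs.\<close>

primrec ipow :: "('a, 'c) ring_scheme \<Rightarrow> 'a set \<Rightarrow> 'a set \<Rightarrow> nat \<Rightarrow> 'a set" where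
  "ipow Q S I 0 = S"
| "ipow Q S I (Suc n) = ideal_prod Q (ipow Q S I n) I"

text \<open>The inductive definition of the product refers to addition and multiplication alone,
  which S, \<open>AA\<close> and Q share.\<close>

lemma ideal_prod_carrier_update: "ideal_prod (Q\<lparr>carrier := S\<rparr>) I J = ideal_prod Q I J"
proof (rule antisym; rule subsetI)
  fix x assume "x \<in> ideal_prod (Q\<lparr>carrier := S\<rparr>) I J"
  then show "x \<in> ideal_prod Q I J"
  proof (induct rule: ideal_prod.induct)
    case (prod i j)
    then show ?case using ideal_prod.prod[of i I j J Q] by simp
  next
    case (sum s1 s2)
    then show ?case using ideal_prod.sum[of s1 Q I J s2] by simp
  qed
next
  fix x assume "x \<in> ideal_prod Q I J"
  then show "x \<in> ideal_prod (Q\<lparr>carrier := S\<rparr>) I J"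
  proof (induct rule: ideal_prod.induct)
    case (prod i j)
    then show ?case using ideal_prod.prod[of i I j J "Q\<lparr>carrier := S\<rparr>"] by simp
  next
    case (sum s1 s2)
    then show ?case using ideal_prod.sum[of s1 "Q\<lparr>carrier := S\<rparr>" I J s2] by simp
  qed
qed

lemma ideals_pow_eq_ipow: "I [^]\<^bsub>ideals_set (Q\<lparr>carrier := S\<rparr>)\<^esub> (n::nat) = ipow Q S I n"
  by (induction n) (simp_all add: nat_pow_def ideals_set_def ideal_prod_carrier_update)

section \<open>Powers of fractional ideals\<close>

context frac_ring
begin

lemma ipow_SM: "I \<in> SM \<Longrightarrow> ipow Q S I n \<in> SM"
  by (induction n) (simp_all add: S_smod prod_smod)

lemma ipow_sub: "I \<in> SM \<Longrightarrow> I \<subseteq> S \<Longrightarrow> ipow Q S I n \<subseteq> S"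
proof (induction n)
  case (Suc n)
  then show ?case using prod_mono[of "ipow Q S I n" S I S] prod_S[OF S_smod] by simp
qed simp

lemma ipow_FI: "I \<in> FI \<Longrightarrow> ipow Q S I n \<in> FI"
  by (induction n) (simp_all add: S_fid fids_prod)

lemma ipow_add: "I \<in> SM \<Longrightarrow> ipow Q S I (a + b) = ipow Q S I a \<cdot> ipow Q S I b"
proof (induction b)
  case 0
  then show ?case using prod_S[OF ipow_SM] by simp
next
  case (Suc b)
  then show ?case using prod_assoc[OF ipow_SM ipow_SM] by simp
qed

lemma ipow_mult: "I \<in> SM \<Longrightarrow> g \<in> ipow Q S I a \<Longrightarrow> h \<in> ipow Q S I b \<Longrightarrow> g \<otimes> h \<in> ipow Q S I (a + b)"
  using ideal_prod.prod[of g "ipow Q S I a" h "ipow Q S I b" Q] ipow_add by simp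

lemma ipow_pow: "I \<in> SM \<Longrightarrow> y \<in> ipow Q S I k \<Longrightarrow> y [^] (N::nat) \<in> ipow Q S I (k * N)"
proof (induction N)
  case 0
  then show ?case using S_one by simp
next
  case (Suc N)
  then show ?case using ipow_mult[of I "y [^] N" "k * N" y k] by (simp add: add.commute)
qed

lemma ipow_1: "I \<in> SM \<Longrightarrow> ipow Q S I 1 = I"
  using prod_S prod_comm[OF S_smod] by simp

lemma ipow_mono: "J \<subseteq> I \<Longrightarrow> ipow Q S J n \<subseteq> ipow Q S I n"
  by (induction n) (simp_all add: prod_mono)

lemma msum_mono: "N \<subseteq> N' \<Longrightarrow> K \<subseteq> K' \<Longrightarrow> msum Q N K \<subseteq> msum Q N' K'"
  unfolding msum_def by blast

lemma msum_prod_sub: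
  assumes "A \<in> SM" "B \<in> SM" "J \<in> SM" "Z \<in> SM" "A \<cdot> J \<subseteq> Z" "B \<cdot> J \<subseteq> Z"
  shows "msum Q A B \<cdot> J \<subseteq> Z"
proof (rule prod_least[OF assms(4)])
  fix i j assume "i \<in> msum Q A B" "j \<in> J"
  then obtain a b where ab: "a \<in> A" "b \<in> B" "i = a \<oplus> b" "j \<in> J" by (auto elim: msumE)
  have "i \<otimes> j = a \<otimes> j \<oplus> b \<otimes> j" using ab smodsD(1) assms(1-3) by (simp add: l_distr)
  moreover have "a \<otimes> j \<in> Z" "b \<otimes> j \<in> Z" using ideal_prod.prod[of _ _ j J Q] ab assms(5,6) by blast+
  ultimately show "i \<otimes> j \<in> Z" using smodsD(3)[OF assms(4)] by simp
qed

text \<open>Among a + b factors taken from J and w, either at least a come from J or at least b are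
  w. This lets ideals that are nilpotent modulo something be enlarged one element at a time.\<close>

lemma ipow_msum_cyc:
  assumes I: "I \<in> SM" and J: "J \<in> SM" "J \<subseteq> I" and w: "w \<in> I"
  shows "ipow Q S (msum Q J (scal Q w S)) (a + b) \<subseteq> msum Q (ipow Q S J a \<cdot> ipow Q S I b) (scal Q (w [^] b) (ipow Q S I a))"
proof (induction "a + b" arbitrary: a b)
  case 0
  then show ?case using msum_left[OF prod_smod[OF S_smod S_smod] scal_smod[OF S_smod one_closed]] prod_S[OF S_smod] by simp
next
  case (Suc n)
  let ?J = "msum Q J (scal Q w S)" and ?E = "ipow Q S I"
  have wc: "w \<in> carrier Q" using smodsD(1)[OF I w] .
  note wS = scal_smod[OF S_smod wc]
  have J': "?J \<in> SM" "?J \<subseteq> I" using msum_smod[OF J(1) wS] msum_least[OF I J(2) cyc_least[OF I w]] by auto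
  note EM = ipow_SM[OF I] and JM = ipow_SM[OF J(1)]
  have AM: "ipow Q S J a \<cdot> ?E b \<in> SM" and BM: "scal Q (w [^] b) (?E a) \<in> SM" for a b
    using prod_smod[OF JM EM] scal_smod[OF EM] wc by auto
  let ?Z = "\<lambda>a b. msum Q (ipow Q S J a \<cdot> ?E b) (scal Q (w [^] b) (?E a))"
  have ZM: "?Z a b \<in> SM" for a b by (rule msum_smod[OF AM BM])
  show ?case
  proof (cases "a = 0 \<or> b = 0")
    case True
    then show ?thesis
    proof
      assume a: "a = 0"
      have "ipow Q S ?J b \<subseteq> ?E b" by (rule ipow_mono[OF J'(2)])
      also have "\<dots> = ipow Q S J 0 \<cdot> ?E b" using prod_S[OF EM] prod_comm[OF S_smod EM] by simp
      finally show ?thesis using msum_left[OF AM[where a=0 and b=b] BM[where a=0 and b=b]] a by auto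
    next
      assume b: "b = 0"
      have "ipow Q S ?J a \<subseteq> ?E a" by (rule ipow_mono[OF J'(2)])
      also have "\<dots> = scal Q (w [^] (0::nat)) (?E a)" using scal_one[OF smod_sub[OF EM]] by simp
      finally show ?thesis using msum_right[OF AM[where a=a and b=0] BM[where a=a and b=0]] b by auto
    qed
  next
    case False
    then obtain a' b' where ab: "a = Suc a'" "b = Suc b'" by (metis not0_implies_Suc)
    have n: "n = a' + b" "n = a + b'" using Suc.hyps(2) ab by auto
    have "ipow Q S ?J (a + b) = ipow Q S ?J n \<cdot> ?J" using Suc.hyps(2)[symmetric] by simp
    also have "\<dots> = ?J \<cdot> ipow Q S ?J n" by (rule prod_comm[OF ipow_SM[OF J'(1)] J'(1)])
    also have "\<dots> \<subseteq> ?Z a b"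
    proof (rule msum_prod_sub[OF J(1) wS ipow_SM[OF J'(1)] ZM])
      have "J \<cdot> ipow Q S ?J n = ipow Q S ?J n \<cdot> J" by (rule prod_comm[OF J(1) ipow_SM[OF J'(1)]])
      also have "\<dots> \<subseteq> ?Z a' b \<cdot> J" using Suc.hyps(1)[OF n(1)] n(1) by (intro prod_mono) auto
      also have "\<dots> \<subseteq> ?Z a b"
      proof (rule msum_prod_sub[OF AM BM J(1) ZM])
        have "ipow Q S J a' \<cdot> ?E b \<cdot> J = ipow Q S J a \<cdot> ?E b"
          unfolding ab(1) ipow.simps prod_assoc[OF JM EM J(1)] prod_assoc[OF JM J(1) EM] prod_comm[OF J(1) EM] by (rule refl)
        then show "ipow Q S J a' \<cdot> ?E b \<cdot> J \<subseteq> ?Z a b" using msum_left[OF AM BM] by simp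
        have "scal Q (w [^] b) (?E a') \<cdot> J = scal Q (w [^] b) (?E a' \<cdot> J)" by (rule prod_scal[OF EM J(1)]) (use wc in simp)
        also have "\<dots> \<subseteq> scal Q (w [^] b) (?E a)" using scal_mono[OF prod_mono[OF order_refl J(2)]] ab by simp
        finally show "scal Q (w [^] b) (?E a') \<cdot> J \<subseteq> ?Z a b" using msum_right[OF AM BM] by blast
      qed
      finally show "J \<cdot> ipow Q S ?J n \<subseteq> ?Z a b" .
      have "scal Q w S \<cdot> ipow Q S ?J n = scal Q w (ipow Q S ?J n)"
        using prod_scal[OF S_smod ipow_SM[OF J'(1)] wc] prod_comm[OF S_smod ipow_SM[OF J'(1)]] prod_S[OF ipow_SM[OF J'(1)]] by simp
      also have "\<dots> \<subseteq> ?Z a b"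
      proof
        fix v assume "v \<in> scal Q w (ipow Q S ?J n)"
        then obtain g where g: "g \<in> ipow Q S ?J n" "v = w \<otimes> g" by (auto elim: scalE)
        then have "g \<in> ?Z a b'" using Suc.hyps(1)[OF n(2)] n(2) by auto
        then obtain p q where pq: "p \<in> ipow Q S J a \<cdot> ?E b'" "q \<in> ?E a" "g = p \<oplus> w [^] b' \<otimes> q" by (auto elim!: msumE scalE)
        have c: "p \<in> carrier Q" "q \<in> carrier Q" "w [^] b' \<in> carrier Q" using smodsD(1)[OF AM pq(1)] smodsD(1)[OF EM pq(2)] wc by auto
        have "v = p \<otimes> w \<oplus> w [^] b \<otimes> q" unfolding g(2) pq(3) using ab c wc by (simp add: r_distr m_ac)
        moreover have "p \<otimes> w \<in> ipow Q S J a \<cdot> ?E b"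
        proof -
          have "p \<otimes> w \<in> ipow Q S J a \<cdot> ?E b' \<cdot> I" by (rule ideal_prod.prod[OF pq(1) w])
          then show ?thesis unfolding ab(2) ipow.simps prod_assoc[OF JM EM I] .
        qed
        ultimately show "v \<in> ?Z a b" using msumI[OF _ scalI[OF pq(2)]] by simp
      qed
      finally show "scal Q w S \<cdot> ipow Q S ?J n \<subseteq> ?Z a b" .
    qed
    finally show ?thesis .
  qed
qed

end

context cm_one
begin

text \<open>
  Some power of a regular ideal has a principal reduction, also when the residue field is finite.
  In the fiber cone, whose components have bounded length, an element \<open>y\<close> of degree \<open>k\<close> for which
  the part not killed by powers of \<open>y\<close> is as large as possible works: otherwise a non-nilpotent
  element annihilated by a power of \<open>y\<close> could be added to a power of \<open>y\<close> to enlarge that part.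
\<close>

lemma principal_reduction:
  assumes I: "I \<in> FI" "I \<subseteq> S"
  shows "\<exists>k y n. 1 \<le> k \<and> y \<in> ipow Q S I k \<and> scal Q y (ipow Q S I n) = ipow Q S I (n + k)"
proof -
  let ?E = "ipow Q S I"
  note IM = fidsD(1)[OF I(1)]
  note EM = ipow_SM[OF IM] and EF = ipow_FI[OF I(1)] and ES = ipow_sub[OF IM I(2)] and Emult = ipow_mult[OF IM]
  have Ec: "g \<in> carrier Q" if "g \<in> ?E a" for g a using smodsD(1)[OF EM that] .
  let ?m = "\<lambda>n. m \<cdot> ?E n"
  have mM: "?m n \<in> SM" and mF: "?m n \<in> FI" and mE: "?m n \<subseteq> ?E n" for n
    using prod_smod[OF m_smod EM] fids_prod[OF m_fid EF] m_prod_sub[OF EM] by auto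
  have mmult: "g \<otimes> h \<in> ?m (a + b)" if "g \<in> ?m a" "h \<in> ?E b" for g h a b
    using ideal_prod.prod[OF that, of Q] prod_assoc[OF m_smod EM EM] ipow_add[OF IM] by simp
  have mmult': "h \<otimes> g \<in> ?m (b + a)" if "g \<in> ?m a" "h \<in> ?E b" for g h a b
    using mmult[OF that] m_comm[OF smodsD(1)[OF mM that(1)] Ec[OF that(2)]] by (simp add: add.commute)
  have pw: "y [^] N \<in> ?E (k * N)" if "y \<in> ?E k" for y k and N :: nat using ipow_pow[OF IM that] .
  obtain x where x: "x \<in> m" "x \<in> Units Q" using nzd by blast
  have xS: "x \<in> S" using x m_sub by auto
  \<comment> \<open>In the fiber cone, whose degree n part is E_n / m E_n for the powers E_n of I,
    this is the part of degree n killed by some power of y.\<close>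
  define K where "K y k n = {g \<in> ?E n. \<exists>N::nat. y [^] N \<otimes> g \<in> ?m (n + k * N)}" for y k n
  have Kup: "y [^] (N + N') \<otimes> g \<in> ?m (n + k * (N + N'))" if "y \<in> ?E k" "g \<in> ?E n" "y [^] N \<otimes> g \<in> ?m (n + k * N)" for y k n g and N N' :: nat
  proof -
    have "y [^] (N + N') \<otimes> g = y [^] N' \<otimes> (y [^] N \<otimes> g)"
      using Ec[OF that(1)] Ec[OF that(2)] by (simp add: nat_pow_mult[symmetric] m_ac)
    also have "\<dots> \<in> ?m (k * N' + (n + k * N))" by (rule mmult'[OF that(3) pw[OF that(1)]])
    finally show ?thesis by (simp add: algebra_simps)
  qed
  have KM: "K y k n \<in> SM" if y: "y \<in> ?E k" for y k n
  proof (rule smodsI)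
    show "K y k n \<subseteq> carrier Q" unfolding K_def using Ec by auto
    have "y [^] (0::nat) \<otimes> \<zero> \<in> ?m (n + k * 0)" using smodsD(2)[OF mM] by simp
    then show "\<zero> \<in> K y k n" unfolding K_def using smodsD(2)[OF EM] by blast
    fix a b assume "a \<in> K y k n" "b \<in> K y k n"
    then obtain N N' :: nat where a: "a \<in> ?E n" "y [^] N \<otimes> a \<in> ?m (n + k * N)" and b: "b \<in> ?E n" "y [^] N' \<otimes> b \<in> ?m (n + k * N')"
      unfolding K_def by auto
    have "y [^] (N + N') \<otimes> (a \<oplus> b) = y [^] (N + N') \<otimes> a \<oplus> y [^] (N' + N) \<otimes> b"
      using Ec[OF y] Ec[OF a(1)] Ec[OF b(1)] by (simp add: r_distr add.commute)
    also have "\<dots> \<in> ?m (n + k * (N + N'))"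
      using smodsD(3)[OF mM Kup[OF y a, of N']] Kup[OF y b, of N] by (simp add: add.commute)
    finally show "a \<oplus> b \<in> K y k n" unfolding K_def using smodsD(3)[OF EM a(1) b(1)] by blast
  next
    fix s a assume s: "s \<in> S" "a \<in> K y k n"
    then obtain N :: nat where a: "a \<in> ?E n" "y [^] N \<otimes> a \<in> ?m (n + k * N)" unfolding K_def by auto
    have "y [^] N \<otimes> (s \<otimes> a) = s \<otimes> (y [^] N \<otimes> a)" using Ec[OF y] Ec[OF a(1)] s by (simp add: m_lcomm)
    then have "y [^] N \<otimes> (s \<otimes> a) \<in> ?m (n + k * N)" using smodsD(4)[OF mM s(1) a(2)] by simp
    then show "s \<otimes> a \<in> K y k n" unfolding K_def using smodsD(4)[OF EM s(1) a(1)] by blast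
  qed
  have mK: "?m n \<subseteq> K y k n" if y: "y \<in> ?E k" for y k n
  proof
    fix g assume g: "g \<in> ?m n"
    then have "y [^] (0::nat) \<otimes> g \<in> ?m (n + k * 0)" using smodsD(1)[OF mM g] by simp
    then show "g \<in> K y k n" unfolding K_def using g mE by blast
  qed
  have KE: "K y k n \<subseteq> ?E n" for y k n unfolding K_def by auto
  have KF: "K y k n \<in> FI" if "y \<in> ?E k" for y k n by (rule fids_between[OF KM[OF that] mF EF mK[OF that] KE])
  \<comment> \<open>The bound depends on x alone: x E_n \<subseteq> m E_n, and E_n / x E_n has the
    same length as S / xS.\<close>
  have bound: "lenn (K y k n) (?E n) \<le> lenn (scal Q x S) S" if "y \<in> ?E k" for y k n
  proof -
    have xm: "scal Q x (?E n) \<subseteq> ?m n" using ideal_prod.prod[OF x(1)] by (auto elim!: scalE)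
    have "lenn (K y k n) (?E n) \<le> lenn (scal Q x (?E n)) (?E n)"
      by (rule lenn_mono[OF fids_scal[OF EF x(2)] KF[OF that] EF _ KE]) (use xm mK[OF that] in blast)
    also have "\<dots> = lenn (scal Q x S) S" by (rule lenn_scal_self[OF EF xS x(2)])
    finally show ?thesis .
  qed
  \<comment> \<open>The degree k of y has to divide n, so that a power of y later meets an element
    of degree n + k in the same degree.\<close>
  let ?T = "\<lambda>(k::nat, y, n::nat). 1 \<le> k \<and> y \<in> ?E k \<and> k dvd n"
  let ?f = "\<lambda>(k, y, n). lenn (K y k n) (?E n)"
  have "\<exists>t. ?T t \<and> (\<forall>t'. ?T t' \<longrightarrow> ?f t' \<le> ?f t)"
  proof (rule ex_has_greatest_nat[of ?T "(1, \<zero>, 0)" ?f "Suc (lenn (scal Q x S) S)"])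
    show "?T (1, \<zero>, 0)" using smodsD(2)[OF EM, of 1] by simp
    show "\<forall>t. ?T t \<longrightarrow> ?f t < Suc (lenn (scal Q x S) S)" using bound by (auto simp: less_Suc_eq_le)
  qed
  then obtain k y n where k: "1 \<le> k" and y: "y \<in> ?E k" and kn: "k dvd n"
    and mx: "\<And>k' y' n'. 1 \<le> k' \<Longrightarrow> y' \<in> ?E k' \<Longrightarrow> k' dvd n' \<Longrightarrow> lenn (K y' k' n') (?E n') \<le> lenn (K y k n) (?E n)"
    by auto
  have yc: "y \<in> carrier Q" using Ec[OF y] .
  \<comment> \<open>Multiplication by y is injective modulo the elements killed by powers of y, so
    the part that survives cannot shrink from degree a to a + k.\<close>
  have shift: "lenn (K y k a) (?E a) \<le> lenn (K y k (a + k)) (msum Q (scal Q y (?E a)) (K y k (a + k)))"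
    "msum Q (scal Q y (?E a)) (K y k (a + k)) \<in> FI" "msum Q (scal Q y (?E a)) (K y k (a + k)) \<subseteq> ?E (a + k)"
    "K y k (a + k) \<subseteq> msum Q (scal Q y (?E a)) (K y k (a + k))" for a
  proof -
    let ?P = "msum Q (scal Q y (?E a)) (K y k (a + k))"
    have yE: "scal Q y (?E a) \<subseteq> ?E (a + k)" using Emult[OF y] by (auto elim!: scalE simp: add.commute)
    note yM = scal_smod[OF EM yc]
    show sub: "K y k (a + k) \<subseteq> ?P" by (rule msum_right[OF yM KM[OF y]])
    show P: "?P \<subseteq> ?E (a + k)" by (rule msum_least[OF EM yE KE])
    show PF: "?P \<in> FI" by (rule fids_between[OF msum_smod[OF yM KM[OF y]] KF[OF y] EF sub P])
    have "len (K y k a) (?E a) \<le> len (K y k (a + k)) ?P"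
    proof (rule chain_len_mono_map[where \<Phi>="\<lambda>N. msum Q (scal Q y N) (K y k (a + k))"])
      fix N assume N: "N \<in> SM" "K y k a \<subseteq> N" "N \<subseteq> ?E a"
      show "msum Q (scal Q y N) (K y k (a + k)) \<in> SM \<and> K y k (a + k) \<subseteq> msum Q (scal Q y N) (K y k (a + k)) \<and> msum Q (scal Q y N) (K y k (a + k)) \<subseteq> ?P"
        using msum_smod[OF scal_smod[OF N(1) yc] KM[OF y]] msum_right[OF scal_smod[OF N(1) yc] KM[OF y]] msum_mono[OF scal_mono[OF N(3)] order_refl] by simp
    next
      fix N N' assume N: "N \<in> SM" "K y k a \<subseteq> N" "N' \<subseteq> ?E a" "N' \<in> SM" "N \<subset> N'"
      obtain g where g: "g \<in> N'" "g \<notin> N" using N(5) by auto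
      have gE: "g \<in> ?E a" using g N(3) by auto
      have "y \<otimes> g \<notin> msum Q (scal Q y N) (K y k (a + k))"
      proof
        assume "y \<otimes> g \<in> msum Q (scal Q y N) (K y k (a + k))"
        then obtain g0 c where g0: "g0 \<in> N" "c \<in> K y k (a + k)" "y \<otimes> g = y \<otimes> g0 \<oplus> c" by (auto elim!: msumE scalE)
        have g0E: "g0 \<in> ?E a" using g0(1) N(3,5) by auto
        have c: "g \<in> carrier Q" "g0 \<in> carrier Q" "c \<in> carrier Q" using Ec[OF gE] Ec[OF g0E] g0(2) Ec unfolding K_def by auto
        have "y \<otimes> (g \<ominus> g0) = y \<otimes> g \<ominus> y \<otimes> g0" using c yc by algebra
        also have "\<dots> = c" unfolding g0(3) using c yc by algebra
        finally have e: "y \<otimes> (g \<ominus> g0) = c" .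
        obtain M :: nat where M: "y [^] M \<otimes> c \<in> ?m (a + k + k * M)" using g0(2) unfolding K_def by auto
        have "y [^] Suc M \<otimes> (g \<ominus> g0) = y [^] M \<otimes> (y \<otimes> (g \<ominus> g0))" using c yc by (simp add: m_assoc)
        also have "\<dots> \<in> ?m (a + k * Suc M)" unfolding e using M by (simp add: algebra_simps)
        finally have "g \<ominus> g0 \<in> K y k a" unfolding K_def using smodsD(7)[OF EM gE g0E] by blast
        then have "(g \<ominus> g0) \<oplus> g0 \<in> N" using smodsD(3)[OF N(1) _ g0(1)] N(2) by blast
        moreover have "(g \<ominus> g0) \<oplus> g0 = g" using c by algebra
        ultimately show False using g by simp
      qed
      moreover have "y \<otimes> g \<in> msum Q (scal Q y N') (K y k (a + k))"
        using msum_left[OF scal_smod[OF N(4) yc] KM[OF y]] scalI[OF g(1)] by blast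
      moreover have "msum Q (scal Q y N) (K y k (a + k)) \<subseteq> msum Q (scal Q y N') (K y k (a + k))"
        using msum_mono[OF scal_mono order_refl] N(5) by blast
      ultimately show "msum Q (scal Q y N) (K y k (a + k)) \<subset> msum Q (scal Q y N') (K y k (a + k))" by blast
    qed
    then show "lenn (K y k a) (?E a) \<le> lenn (K y k (a + k)) ?P"
      using len_lenn[OF KF[OF y] EF KE] len_lenn[OF KF[OF y] PF sub] by simp
  qed
  have mono: "lenn (K y k n) (?E n) \<le> lenn (K y k (n + k * j)) (?E (n + k * j))" for j
  proof (induction j)
    case (Suc j)
    let ?a = "n + k * j"
    have "lenn (K y k ?a) (?E ?a) \<le> lenn (K y k (?a + k)) (msum Q (scal Q y (?E ?a)) (K y k (?a + k)))" by (rule shift(1))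
    also have "\<dots> \<le> lenn (K y k (?a + k)) (?E (?a + k))"
      using lenn_add[OF KF[OF y] shift(2) EF shift(4,3)] by simp
    finally show ?case using Suc by (simp add: algebra_simps)
  qed simp
  define n' where "n' = n + k"
  have kn': "k dvd n'" using kn unfolding n'_def by simp
  \<comment> \<open>By maximality the surviving part does not grow from n to n + k, so it is all
    reached by multiplication with y.\<close>
  have split: "msum Q (scal Q y (?E n)) (K y k n') = ?E n'"
  proof -
    have "lenn (K y k n') (?E n') \<le> lenn (K y k n') (msum Q (scal Q y (?E n)) (K y k n'))"
      using mx[OF k y kn'] shift(1)[of n] unfolding n'_def by simp
    then have "lenn (msum Q (scal Q y (?E n)) (K y k n')) (?E n') = 0"
      using lenn_add[OF KF[OF y] shift(2) EF shift(4,3), of n] unfolding n'_def by simp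
    then show ?thesis using lenn_0_imp[OF shift(2)[of n] EF shift(3)[of n]] unfolding n'_def by simp
  qed
  \<comment> \<open>The preimage in degree i of the ideal generated by y in the fiber cone. Below
    degree k only m E_i remains.\<close>
  define P where "P i = msum Q (if k \<le> i then scal Q y (?E (i - k)) else {\<zero>}) (?m i)" for i
  have zM: "{\<zero>} \<in> SM" by (rule smodsI) auto
  have P1: "(if k \<le> i then scal Q y (?E (i - k)) else {\<zero>}) \<in> SM" for i using scal_smod[OF EM yc] zM by simp
  have PM: "P i \<in> SM" for i unfolding P_def by (rule msum_smod[OF P1 mM])
  have mP: "?m i \<subseteq> P i" for i unfolding P_def by (rule msum_right[OF P1 mM])
  have yP: "y \<otimes> g \<in> P i" if "k \<le> i" "g \<in> ?E (i - k)" for g i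
    using msum_left[OF P1[of i] mM[of i]] scalI[OF that(2), of y] that(1) unfolding P_def by auto
  have Pmult: "g \<otimes> h \<in> P (a + b)" if g: "g \<in> P a" and h: "h \<in> ?E b" for g h a b
  proof -
    obtain p q where pq: "p \<in> (if k \<le> a then scal Q y (?E (a - k)) else {\<zero>})" "q \<in> ?m a" "g = p \<oplus> q"
      using g unfolding P_def by (rule msumE)
    have c: "p \<in> carrier Q" "q \<in> carrier Q" "h \<in> carrier Q" using smodsD(1)[OF P1 pq(1)] smodsD(1)[OF mM pq(2)] Ec[OF h] by auto
    have 1: "p \<otimes> h \<in> P (a + b)"
    proof (cases "k \<le> a")
      case True
      then obtain e where e: "e \<in> ?E (a - k)" "p = y \<otimes> e" using pq(1) by (auto elim: scalE)
      have "p \<otimes> h = y \<otimes> (e \<otimes> h)" using e c Ec[OF e(1)] yc by (simp add: m_assoc)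
      moreover have "e \<otimes> h \<in> ?E (a + b - k)" using Emult[OF e(1) h] True by simp
      ultimately show ?thesis using yP[of "a + b"] True by simp
    next
      case False
      then show ?thesis using pq(1) c smodsD(2)[OF PM] by simp
    qed
    have "g \<otimes> h = p \<otimes> h \<oplus> q \<otimes> h" unfolding pq(3) using c by (simp add: l_distr)
    then show ?thesis using smodsD(3)[OF PM 1] mmult[OF pq(2) h] mP by auto
  qed
  show ?thesis
  proof (cases "\<exists>i\<ge>k. ?E i \<subseteq> P i")
    case True
    then obtain i where i: "k \<le> i" "?E i \<subseteq> P i" by blast
    obtain s where s: "s \<in> S" "s \<in> Units Q" "\<And>a. a \<in> ?E i \<Longrightarrow> s \<otimes> a \<in> S" using fidsD(3)[OF EF] by blast
    have A: "scal Q y (?E (i - k)) \<subseteq> ?E i" using Emult[OF y, of _ "i - k"] i(1) by (auto elim!: scalE)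
    have B: "?E i \<subseteq> msum Q (scal Q y (?E (i - k))) (?m i)" using i unfolding P_def by simp
    \<comment> \<open>If y generates some degree i of the fiber cone, Nakayama removes m E_i and y
      is a reduction.\<close>
    from nakayama[OF EM s(2,3) scal_smod[OF EM yc] A B] have "?E i = scal Q y (?E (i - k))" .
    then have "scal Q y (?E (i - k)) = ?E (i - k + k)" using i(1) by simp
    then show ?thesis using k y by blast
  next
    case False
    \<comment> \<open>Otherwise every element of I is nilpotent modulo P. An ideal in I that is
      maximal among those with a power in P absorbs each element of I, so I itself has a power in
      P.\<close>
    have "\<exists>w\<in>I. \<forall>i. w [^] i \<notin> P i"
    proof (rule ccontr)
      assume "\<not> ?thesis"
      then have nil: "\<exists>i::nat. w [^] i \<in> P i" if "w \<in> I" for w using that by blast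
      let ?X = "{J \<in> SM. J \<subseteq> I \<and> (\<exists>a. ipow Q S J a \<subseteq> P a)}"
      have "ipow Q S {\<zero>} 1 \<subseteq> P 1" using ipow_1[OF zM] smodsD(2)[OF PM] by simp
      then have "{\<zero>} \<in> ?X" using zM smodsD(2)[OF IM] by blast
      then have "?X \<noteq> {}" "?X \<subseteq> {N \<in> SM. N \<subseteq> S}" using I(2) by blast+
      from noeth[OF this] obtain J where JX: "J \<in> ?X" and Jmax: "\<forall>J'\<in>?X. J \<subseteq> J' \<longrightarrow> J' = J" by (rule bexE)
      from JX obtain a where J: "J \<in> SM" "J \<subseteq> I" and a: "ipow Q S J a \<subseteq> P a" by blast
      have "w \<in> J" if w: "w \<in> I" for w
      proof -
        have wc: "w \<in> carrier Q" using smodsD(1)[OF IM w] .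
        note wS = scal_smod[OF S_smod wc]
        obtain b :: nat where b: "w [^] b \<in> P b" using nil[OF w] by blast
        let ?J = "msum Q J (scal Q w S)"
        have "ipow Q S ?J (a + b) \<subseteq> msum Q (ipow Q S J a \<cdot> ?E b) (scal Q (w [^] b) (?E a))" by (rule ipow_msum_cyc[OF IM J w])
        also have "\<dots> \<subseteq> P (a + b)"
        proof (rule msum_least[OF PM])
          show "ipow Q S J a \<cdot> ?E b \<subseteq> P (a + b)" by (rule prod_least[OF PM]) (use Pmult a in blast)
          show "scal Q (w [^] b) (?E a) \<subseteq> P (a + b)" using Pmult[OF b] by (auto elim!: scalE simp: add.commute)
        qed
        finally have "ipow Q S ?J (a + b) \<subseteq> P (a + b)" .
        moreover have "?J \<in> SM" "?J \<subseteq> I" using msum_smod[OF J(1) wS] msum_least[OF IM J(2) cyc_least[OF IM w]] by auto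
        ultimately have "?J \<in> ?X" by blast
        then have "?J = J" using Jmax msum_left[OF J(1) wS] by (metis (no_types, lifting))
        then show ?thesis using msum_right[OF J(1) wS] cyc_mem[OF wc] by blast
      qed
      then have "J = I" using J(2) by blast
      then have Ea: "?E a \<subseteq> P a" using a by simp
      \<comment> \<open>The exponent a may be below k, whereas the case at hand speaks of degrees at
        least k.\<close>
      have "?E (a + k) \<subseteq> P (a + k)" unfolding ipow_add[OF IM] by (rule prod_least[OF PM]) (use Pmult Ea in blast)
      then show False using False by auto
    qed
    then obtain w where w: "w \<in> I" "\<And>i::nat. w [^] i \<notin> P i" by blast
    have w1: "w \<in> ?E 1" using w(1) ipow_1[OF IM] by simp
    have wn: "w [^] n' \<in> ?E n'" using pw[OF w1, of n'] by simp
    then obtain g \<kappa> where g: "g \<in> ?E n" and \<kappa>K: "\<kappa> \<in> K y k n'" and wn': "w [^] n' = y \<otimes> g \<oplus> \<kappa>"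
      unfolding split[symmetric] by (auto elim!: msumE scalE)
    have \<kappa>E: "\<kappa> \<in> ?E n'" using \<kappa>K KE by blast
    have gc: "g \<in> carrier Q" and \<kappa>c: "\<kappa> \<in> carrier Q" and wc: "w \<in> carrier Q" using Ec[OF g] Ec[OF \<kappa>E] Ec[OF w1] by auto
    obtain N0 :: nat where N0: "y [^] N0 \<otimes> \<kappa> \<in> ?m (n' + k * N0)" using \<kappa>K unfolding K_def by auto
    \<comment> \<open>The successor makes N positive, so that k2 = n' N is positive and at least
      n.\<close>
    define N where "N = Suc N0"
    have N: "y [^] N \<otimes> \<kappa> \<in> ?m (n' + k * N)" using Kup[OF y \<kappa>E N0, of 1] unfolding N_def by simp
    \<comment> \<open>Modulo y, \<kappa> equals a power of w; were \<kappa> nilpotent in the fiber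
      cone, a power of w would lie in P.\<close>
    have nonnil: "\<kappa> [^] s \<notin> ?m (n' * s)" for s :: nat
    proof
      assume s: "\<kappa> [^] s \<in> ?m (n' * s)"
      have "(w [^] n') [^] t \<ominus> \<kappa> [^] t \<in> P (n' * t)" for t :: nat
      proof (induction t)
        case 0
        then show ?case using smodsD(2)[OF PM] by (simp add: a_minus_def r_neg)
      next
        case (Suc t)
        let ?v = "w [^] n'"
        have vc: "?v \<in> carrier Q" using wc by simp
        have c: "?v [^] t \<in> carrier Q" "\<kappa> [^] t \<in> carrier Q" using vc \<kappa>c by auto
        have "?v [^] Suc t \<ominus> \<kappa> [^] Suc t = ?v [^] t \<otimes> ?v \<ominus> \<kappa> [^] t \<otimes> \<kappa>" by simp
        also have "\<dots> = (?v [^] t \<ominus> \<kappa> [^] t) \<otimes> ?v \<oplus> (?v \<ominus> \<kappa>) \<otimes> \<kappa> [^] t" using vc c \<kappa>c by algebra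
        also have "?v \<ominus> \<kappa> = y \<otimes> g" unfolding wn' using yc gc \<kappa>c by algebra
        also have "y \<otimes> g \<otimes> \<kappa> [^] t = y \<otimes> (g \<otimes> \<kappa> [^] t)" using yc gc c by (simp add: m_assoc)
        finally have e: "?v [^] Suc t \<ominus> \<kappa> [^] Suc t = (?v [^] t \<ominus> \<kappa> [^] t) \<otimes> ?v \<oplus> y \<otimes> (g \<otimes> \<kappa> [^] t)" .
        have 1: "(?v [^] t \<ominus> \<kappa> [^] t) \<otimes> ?v \<in> P (n' * Suc t)" using Pmult[OF Suc.IH wn] by (simp add: add.commute)
        have "g \<otimes> \<kappa> [^] t \<in> ?E (n + n' * t)" by (rule Emult[OF g pw[OF \<kappa>E]])
        moreover have "n' * Suc t - k = n + n' * t" "k \<le> n' * Suc t" unfolding n'_def by simp_all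
        ultimately have 2: "y \<otimes> (g \<otimes> \<kappa> [^] t) \<in> P (n' * Suc t)" using yP by simp
        show ?case unfolding e by (rule smodsD(3)[OF PM 1 2])
      qed
      from this[of s] have 1: "(w [^] n') [^] s \<ominus> \<kappa> [^] s \<in> P (n' * s)" .
      have "((w [^] n') [^] s \<ominus> \<kappa> [^] s) \<oplus> \<kappa> [^] s \<in> P (n' * s)" using smodsD(3)[OF PM 1] s mP by blast
      moreover have "((w [^] n') [^] s \<ominus> \<kappa> [^] s) \<oplus> \<kappa> [^] s = (w [^] n') [^] s"
        using nat_pow_closed[OF nat_pow_closed[OF wc, of n'], of s] nat_pow_closed[OF \<kappa>c, of s] by algebra
      ultimately have "w [^] (n' * s) \<in> P (n' * s)" using nat_pow_pow[OF wc] by simp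
      then show False using w(2) by blast
    qed
    obtain j where j: "n' = k * j" using kn' by blast
    have j1: "1 \<le> j" using j k unfolding n'_def by (cases j) auto
    \<comment> \<open>Powers of y and \<kappa> in one common degree whose product vanishes in the
      fiber cone, since y^N already kills \<kappa>.\<close>
    define k2 where "k2 = n' * N"
    define y2 where "y2 = y [^] (j * N)"
    define \<kappa>2 where "\<kappa>2 = \<kappa> [^] N"
    have y2E: "y2 \<in> ?E k2" using pw[OF y, of "j * N"] unfolding y2_def k2_def j by (simp add: mult.assoc)
    have \<kappa>2E: "\<kappa>2 \<in> ?E k2" using pw[OF \<kappa>E, of N] unfolding \<kappa>2_def k2_def .
    have c2: "y2 \<in> carrier Q" "\<kappa>2 \<in> carrier Q" using Ec[OF y2E] Ec[OF \<kappa>2E] by auto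
    have k2: "1 \<le> k2" unfolding k2_def N_def n'_def using k by simp
    have prod0: "y2 \<otimes> \<kappa>2 \<in> ?m (k2 + k2)"
    proof -
      have jN: "j * N = (j - 1) * N + N" using j1 by (cases j) auto
      have "y2 \<otimes> \<kappa>2 = (y [^] ((j - 1) * N) \<otimes> \<kappa> [^] N0) \<otimes> (y [^] N \<otimes> \<kappa>)"
        unfolding y2_def \<kappa>2_def jN nat_pow_mult[OF yc, symmetric] using yc \<kappa>c unfolding N_def by (simp add: m_ac)
      also have "\<dots> \<in> ?m ((k * ((j - 1) * N) + n' * N0) + (n' + k * N))"
        by (rule mmult'[OF N Emult[OF pw[OF y] pw[OF \<kappa>E]]])
      also have "(k * ((j - 1) * N) + n' * N0) + (n' + k * N) = k * ((j - 1) * N + N) + n' * Suc N0" by (simp add: algebra_simps)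
      also have "\<dots> = k2 + k2" unfolding k2_def jN[symmetric] N_def[symmetric] j by (simp add: mult.assoc)
      finally show ?thesis .
    qed
    \<comment> \<open>The sum of two elements with product zero: a power of z that kills h also
      yields powers of both summands killing h.\<close>
    define z where "z = y2 \<oplus> \<kappa>2"
    have zE: "z \<in> ?E k2" unfolding z_def by (rule smodsD(3)[OF EM y2E \<kappa>2E])
    have zc: "z \<in> carrier Q" using Ec[OF zE] .
    \<comment> \<open>As a b = 0 in the fiber cone, z^p a = a^(p+1) there. It is applied with the
      two summands of z in either order.\<close>
    have zpow: "z [^] p \<otimes> a \<ominus> a [^] Suc p \<in> ?m (k2 * Suc p)"
      if a: "a \<in> ?E k2" and zb: "z = a \<oplus> b" and b: "b \<in> ?E k2" and ab: "a \<otimes> b \<in> ?m (k2 + k2)" for p :: nat and a b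
    proof (induction p)
      case 0
      then show ?case using smodsD(2)[OF mM] Ec[OF a] by (simp add: a_minus_def r_neg)
    next
      case (Suc p)
      have c: "a \<in> carrier Q" "b \<in> carrier Q" "z [^] p \<in> carrier Q" "a [^] p \<in> carrier Q" using Ec[OF a] Ec[OF b] zc by auto
      have "z [^] Suc p \<otimes> a \<ominus> a [^] Suc (Suc p) = z [^] p \<otimes> z \<otimes> a \<ominus> a [^] p \<otimes> a \<otimes> a" by simp
      also have "\<dots> = z \<otimes> (z [^] p \<otimes> a \<ominus> a [^] p \<otimes> a) \<oplus> (z \<ominus> a) \<otimes> (a [^] p \<otimes> a)" using c zc by algebra
      also have "z \<ominus> a = b" unfolding zb using c by algebra
      also have "b \<otimes> (a [^] p \<otimes> a) = a [^] p \<otimes> (a \<otimes> b)" using c by algebra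
      finally have e: "z [^] Suc p \<otimes> a \<ominus> a [^] Suc (Suc p) = z \<otimes> (z [^] p \<otimes> a \<ominus> a [^] Suc p) \<oplus> a [^] p \<otimes> (a \<otimes> b)" by simp
      have 1: "z \<otimes> (z [^] p \<otimes> a \<ominus> a [^] Suc p) \<in> ?m (k2 * Suc (Suc p))" using mmult'[OF Suc.IH zE] by (simp add: algebra_simps)
      have 2: "a [^] p \<otimes> (a \<otimes> b) \<in> ?m (k2 * Suc (Suc p))" using mmult'[OF ab pw[OF a, of p]] by (simp add: algebra_simps)
      show ?case unfolding e by (rule smodsD(3)[OF mM 1 2])
    qed
    have zy: "a [^] Suc p \<otimes> h \<in> ?m (k2 + k2 * Suc p)"
      if a: "a \<in> ?E k2" and zb: "z = a \<oplus> b" and b: "b \<in> ?E k2" and ab: "a \<otimes> b \<in> ?m (k2 + k2)"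
        and h: "h \<in> ?E k2" "z [^] p \<otimes> h \<in> ?m (k2 + k2 * p)" for p :: nat and a b h
    proof -
      have c: "a \<in> carrier Q" "h \<in> carrier Q" "z [^] p \<in> carrier Q" "a [^] Suc p \<in> carrier Q" using Ec[OF a] Ec[OF h(1)] zc by auto
      have "a [^] Suc p \<otimes> h = a \<otimes> (z [^] p \<otimes> h) \<ominus> (z [^] p \<otimes> a \<ominus> a [^] Suc p) \<otimes> h" using c by algebra
      moreover have "a \<otimes> (z [^] p \<otimes> h) \<in> ?m (k2 + k2 * Suc p)" using mmult'[OF h(2) a] by (simp add: algebra_simps)
      moreover have "(z [^] p \<otimes> a \<ominus> a [^] Suc p) \<otimes> h \<in> ?m (k2 + k2 * Suc p)" using mmult[OF zpow[OF a zb b ab, of p] h(1)] by (simp add: algebra_simps)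
      ultimately show ?thesis using smodsD(7)[OF mM] by simp
    qed
    have sub: "K z k2 k2 \<subseteq> K y k k2"
    proof
      fix h assume "h \<in> K z k2 k2"
      then obtain p :: nat where h: "h \<in> ?E k2" "z [^] p \<otimes> h \<in> ?m (k2 + k2 * p)" unfolding K_def by auto
      have e1: "y2 [^] Suc p = y [^] (j * N * Suc p)" unfolding y2_def by (rule nat_pow_pow[OF yc])
      have e2: "k2 * Suc p = k * (j * N * Suc p)" unfolding k2_def j by (simp add: algebra_simps)
      have "y2 [^] Suc p \<otimes> h \<in> ?m (k2 + k2 * Suc p)" by (rule zy[OF y2E z_def \<kappa>2E prod0 h])
      then have "y [^] (j * N * Suc p) \<otimes> h \<in> ?m (k2 + k * (j * N * Suc p))" unfolding e1 e2 .
      then show "h \<in> K y k k2" unfolding K_def using h(1) by blast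
    qed
    have in1: "\<kappa>2 \<in> K y k k2"
    proof -
      have "k * (j * N) = k2" unfolding k2_def j by (simp add: mult.assoc)
      then have "y [^] (j * N) \<otimes> \<kappa>2 \<in> ?m (k2 + k * (j * N))" using prod0 unfolding y2_def by (simp only:)
      then show ?thesis unfolding K_def using \<kappa>2E by blast
    qed
    have notin: "\<kappa>2 \<notin> K z k2 k2"
    proof
      assume "\<kappa>2 \<in> K z k2 k2"
      then obtain p :: nat where p: "z [^] p \<otimes> \<kappa>2 \<in> ?m (k2 + k2 * p)" unfolding K_def by auto
      have zb: "z = \<kappa>2 \<oplus> y2" unfolding z_def using c2 by (simp add: a_comm)
      have ab: "\<kappa>2 \<otimes> y2 \<in> ?m (k2 + k2)" using prod0 c2 by (simp add: m_comm)
      have e1: "\<kappa>2 [^] Suc p \<otimes> \<kappa>2 = \<kappa> [^] (N * Suc (Suc p))"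
        using nat_pow_pow[OF \<kappa>c, of N "Suc (Suc p)"] unfolding \<kappa>2_def by simp
      have e2: "k2 + k2 * Suc p = n' * (N * Suc (Suc p))" unfolding k2_def by (simp add: algebra_simps)
      have "\<kappa>2 [^] Suc p \<otimes> \<kappa>2 \<in> ?m (k2 + k2 * Suc p)" by (rule zy[OF \<kappa>2E zb y2E ab \<kappa>2E p])
      then have "\<kappa> [^] (N * Suc (Suc p)) \<in> ?m (n' * (N * Suc (Suc p)))" unfolding e1 e2 .
      then show False using nonnil by blast
    qed
    \<comment> \<open>The inclusion \<open>sub\<close> is strict by \<open>in1\<close> and
      \<open>notin\<close>, so z would leave a strictly larger part than y in degree k2, which is
      already at least the maximum.\<close>
    have "lenn (K z k2 k2) (?E k2) \<le> lenn (K y k n) (?E n)" by (rule mx[OF k2 zE dvd_refl])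
    also have "\<dots> \<le> lenn (K y k k2) (?E k2)"
    proof -
      have "k dvd k2" unfolding k2_def using kn' by simp
      moreover have "n \<le> k2" unfolding k2_def N_def n'_def by simp
      ultimately obtain i where "k2 = n + k * i" using kn by (metis dvd_diff_nat dvdE le_add_diff_inverse)
      then show ?thesis using mono[of i] by simp
    qed
    finally have le: "lenn (K z k2 k2) (?E k2) \<le> lenn (K y k k2) (?E k2)" .
    then have "lenn (K z k2 k2) (K y k k2) = 0" using lenn_add[OF KF[OF zE] KF[OF y] EF sub KE] by simp
    then have "K z k2 k2 = K y k k2" by (rule lenn_0_imp[OF KF[OF zE] KF[OF y] sub])
    then show ?thesis using in1 notin by simp
  qed
qed

text \<open>The generator y is a unit of Q because the powers of I are regular. Multiplying the
  reduction equation by further powers of I carries it to all larger exponents.\<close>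

lemma periodic_reduction:
  assumes I: "I \<in> FI" "I \<subseteq> S"
  shows "\<exists>k u n0. 1 \<le> k \<and> u \<in> S \<and> u \<in> Units Q \<and> (\<forall>n\<ge>n0. \<forall>j. ipow Q S I (n + k * j) = scal Q (u [^] j) (ipow Q S I n))"
proof -
  let ?E = "ipow Q S I"
  note IM = fidsD(1)[OF I(1)]
  note EM = ipow_SM[OF IM]
  obtain k y n0 where k: "1 \<le> k" "y \<in> ?E k" "scal Q y (?E n0) = ?E (n0 + k)" using principal_reduction[OF I] by blast
  have yS: "y \<in> S" using k(2) ipow_sub[OF IM I(2)] by blast
  have yc: "y \<in> carrier Q" using yS by auto
  obtain v where v: "v \<in> ?E (n0 + k)" "v \<in> Units Q" using fidsD(2)[OF ipow_FI[OF I(1)]] by blast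
  then obtain t where t: "t \<in> ?E n0" "v = y \<otimes> t" using k(3)[symmetric] by (auto elim: scalE)
  have yU: "y \<in> Units Q" using Units_mult_left[of y t] v(2) t yc smodsD(1)[OF EM t(1)] by simp
  have step: "?E (n + k) = scal Q y (?E n)" if n: "n0 \<le> n" for n
  proof -
    have "?E (n + k) = ?E (n0 + k) \<cdot> ?E (n - n0)" using ipow_add[OF IM, of "n0 + k" "n - n0"] n by (simp add: algebra_simps)
    also have "\<dots> = scal Q y (?E n0 \<cdot> ?E (n - n0))" unfolding k(3)[symmetric] by (rule prod_scal[OF EM EM yc])
    also have "?E n0 \<cdot> ?E (n - n0) = ?E n" using ipow_add[OF IM, of n0 "n - n0"] n by simp
    finally show ?thesis .
  qed
  have "?E (n + k * j) = scal Q (y [^] j) (?E n)" if n: "n0 \<le> n" for n j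
  proof (induction j)
    case 0
    then show ?case using scal_one[OF smod_sub[OF EM]] by simp
  next
    case (Suc j)
    have "?E (n + k * Suc j) = ?E ((n + k * j) + k)" by (simp add: algebra_simps)
    also have "\<dots> = scal Q y (scal Q (y [^] j) (?E n))" using step[of "n + k * j"] n Suc by simp
    also have "\<dots> = scal Q (y [^] Suc j) (?E n)" using scal_scal[OF smod_sub[OF EM] yc, of "y [^] j"] yc by (simp add: m_comm)
    finally show ?case .
  qed
  then show ?thesis using k(1) yS yU by blast
qed

end

text \<open>The difference of a n and (\<alpha> / K) n is eventually periodic, hence bounded, and
  disappears after division by n.\<close>

lemma lim_periodic_increment:
  fixes a :: "nat \<Rightarrow> nat" and K \<alpha> :: nat
  assumes K: "1 \<le> K" and a: "\<And>n. n0 \<le> n \<Longrightarrow> a (n + K) = a n + \<alpha>"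
  shows "(\<lambda>n. real (a n) / real n) \<longlonglongrightarrow> real \<alpha> / real K"
proof -
  define b where "b n = real (a n) - real \<alpha> / real K * real n" for n
  have per: "b (n + K) = b n" if "n0 \<le> n" for n
    unfolding b_def using a[OF that] K by (simp add: field_simps)
  define B where "B = Max ((\<lambda>n. \<bar>b n\<bar>) ` {n0..<n0 + K})"
  have bd: "\<bar>b n\<bar> \<le> B" if "n0 \<le> n" for n
    using that
  proof (induction n rule: less_induct)
    case (less n)
    show ?case
    proof (cases "n < n0 + K")
      case True
      then show ?thesis unfolding B_def using less.prems by (intro Max_ge) auto
    next
      case False
      then have "b n = b (n - K)" using per[of "n - K"] by simp
      moreover have "\<bar>b (n - K)\<bar> \<le> B" using less.IH[of "n - K"] False K by auto
      ultimately show ?thesis by simp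
    qed
  qed
  have "(\<lambda>n. b n / real n) \<longlonglongrightarrow> 0"
  proof (rule tendsto_rabs_zero_cancel, rule tendsto_sandwich[of "\<lambda>_. 0" _ _ "\<lambda>n. B / real n"])
    show "\<forall>\<^sub>F n in sequentially. \<bar>b n / real n\<bar> \<le> B / real n"
      using eventually_ge_at_top[of n0] by eventually_elim (use bd in \<open>auto simp: divide_right_mono abs_divide\<close>)
    show "(\<lambda>n. B / real n) \<longlonglongrightarrow> 0" by (rule lim_const_over_n)
  qed simp_all
  then have A: "(\<lambda>n. b n / real n + real \<alpha> / real K) \<longlonglongrightarrow> 0 + real \<alpha> / real K" by (intro tendsto_add tendsto_const)
  have B: "\<forall>\<^sub>F n in sequentially. b n / real n + real \<alpha> / real K = real (a n) / real n"
    using eventually_gt_at_top[of 0] by eventually_elim (simp add: b_def field_simps)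
  show ?thesis using Lim_transform_eventually[OF A B] by simp
qed

section \<open>Primes of one-dimensional rings\<close>

lemma enat_SupE:
  assumes "enat n \<le> Sup {enat (f z) | z. P z}" "0 < n"
  shows "\<exists>z. P z \<and> n \<le> f z"
proof (rule ccontr)
  assume *: "\<not> ?thesis"
  have "Sup {enat (f z) | z. P z} \<le> enat (n - 1)"
  proof (rule Sup_least)
    fix e assume "e \<in> {enat (f z) | z. P z}"
    then obtain z where z: "e = enat (f z)" "P z" by blast
    then have "\<not> n \<le> f z" using * by blast
    then show "e \<le> enat (n - 1)" using z(1) by simp
  qed
  then have "enat n \<le> enat (n - 1)" using assms(1) by (rule order_trans[rotated])
  then show False using assms(2) by simp
qed

lemma krull_dim_ge:
  assumes "\<And>i. i \<le> n \<Longrightarrow> primeideal (P i) R" "\<And>i. i < n \<Longrightarrow> P i \<subset> P (Suc i)"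
  shows "enat n \<le> krull_dim R"
  unfolding krull_dim_def by (rule Sup_upper) (use assms in blast)

lemma krull_dim_leI:
  assumes "\<And>P0 P1 P2. primeideal P0 R \<Longrightarrow> primeideal P1 R \<Longrightarrow> primeideal P2 R \<Longrightarrow> P0 \<subset> P1 \<Longrightarrow> P1 \<subset> P2 \<Longrightarrow> False"
  shows "krull_dim R \<le> 1"
  unfolding krull_dim_def
proof (rule Sup_least)
  fix e assume "e \<in> {enat n |n. \<exists>P. (\<forall>i\<le>n. primeideal (P i) R) \<and> (\<forall>i<n. P i \<subset> P (Suc i))}"
  then obtain n P where e: "e = enat n" and P: "\<forall>i\<le>n. primeideal (P i) R" "\<forall>i<n. P i \<subset> P (Suc i)" by blast
  have "n \<le> 1"
  proof (rule ccontr)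
    assume n: "\<not> n \<le> 1"
    then have "primeideal (P 0) R" "primeideal (P 1) R" "primeideal (P 2) R" using P(1) by simp_all
    moreover have "P 0 \<subset> P 1" "P 1 \<subset> P 2" using P(2)[rule_format, of 0] P(2)[rule_format, of 1] n by (simp_all add: numeral_2_eq_2)
    ultimately show False by (rule assms)
  qed
  then show "e \<le> 1" using e by (simp add: one_enat_def)
qed

lemma no_chain_two:
  assumes "krull_dim R = 1" "primeideal P0 R" "primeideal P1 R" "primeideal P2 R" "P0 \<subset> P1" "P1 \<subset> P2"
  shows False
proof -
  let ?P = "\<lambda>i::nat. if i = 0 then P0 else if i = 1 then P1 else P2"
  have "enat 2 \<le> krull_dim R" by (rule krull_dim_ge[of 2 ?P]) (use assms(2-6) in \<open>auto simp: less_Suc_eq numeral_2_eq_2\<close>)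
  then show False using assms(1) by (simp add: one_enat_def)
qed

section \<open>Units and primes from the maximal condition\<close>

context frac_ring
begin

lemma primeideal_RR_iff:
  "primeideal P RR \<longleftrightarrow> P \<in> SM \<and> P \<subseteq> S \<and> P \<noteq> S \<and> (\<forall>a\<in>S. \<forall>b\<in>S. a \<otimes> b \<in> P \<longrightarrow> a \<in> P \<or> b \<in> P)"
proof
  assume P: "primeideal P RR"
  show "P \<in> SM \<and> P \<subseteq> S \<and> P \<noteq> S \<and> (\<forall>a\<in>S. \<forall>b\<in>S. a \<otimes> b \<in> P \<longrightarrow> a \<in> P \<or> b \<in> P)"
    using primeideal.axioms(1)[OF P] ideal_RR_iff primeideal.I_notcarr[OF P] primeideal.I_prime[OF P] by auto
next
  assume "P \<in> SM \<and> P \<subseteq> S \<and> P \<noteq> S \<and> (\<forall>a\<in>S. \<forall>b\<in>S. a \<otimes> b \<in> P \<longrightarrow> a \<in> P \<or> b \<in> P)"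
  then show "primeideal P RR" using ideal_RR_iff RR_cring by (intro primeidealI) auto
qed

text \<open>If s is not invertible, the maximal condition gives an ideal containing s that is
  maximal among proper ones; this is the unique maximal ideal m.\<close>

lemma maximal_in_noeth:
  assumes noeth: "\<And>X. X \<noteq> {} \<Longrightarrow> X \<subseteq> {N \<in> SM. N \<subseteq> S} \<Longrightarrow> \<exists>N\<in>X. \<forall>N'\<in>X. N \<subseteq> N' \<longrightarrow> N' = N"
    and loc: "local_ring RR m" and s: "s \<in> S" "s \<notin> m"
  shows "s \<in> Units Q \<and> inv s \<in> S"
proof (cases "\<one> \<in> scal Q s S")
  case True
  then obtain t where t: "t \<in> S" "\<one> = s \<otimes> t" by (rule scalE)
  have c: "s \<in> carrier Q" "t \<in> carrier Q" using s t by auto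
  have "inv s = t" using t(2) c by (intro comm_inv_char) auto
  moreover have "s \<in> Units Q" using t(2) c m_comm unfolding Units_def by auto
  ultimately show ?thesis using t(1) by simp
next
  case False
  let ?X = "{N \<in> SM. N \<subseteq> S \<and> s \<in> N \<and> \<one> \<notin> N}"
  have sc: "s \<in> carrier Q" using s by auto
  have "scal Q s S \<in> ?X" using scal_smod[OF S_smod sc] cyc_least[OF S_smod s(1)] cyc_mem[OF sc] False by blast
  then have "?X \<noteq> {}" "?X \<subseteq> {N \<in> SM. N \<subseteq> S}" by blast+
  from noeth[OF this] obtain N where NX: "N \<in> ?X" and Nmax: "\<forall>N'\<in>?X. N \<subseteq> N' \<longrightarrow> N' = N" by (rule bexE)
  have "maximalideal N RR"
  proof (rule maximalidealI)
    show "ideal N RR" using NX ideal_RR_iff by blast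
    show "carrier RR \<noteq> N" using NX S_one by auto
    fix J assume J: "ideal J RR" "N \<subseteq> J" "J \<subseteq> carrier RR"
    have JS: "J \<in> SM" "J \<subseteq> S" using J(1) ideal_RR_iff by auto
    show "J = N \<or> J = carrier RR"
    proof (cases "\<one> \<in> J")
      case True
      have "S \<subseteq> J"
      proof
        fix t assume t: "t \<in> S"
        have "t \<otimes> \<one> \<in> J" by (rule smodsD(4)[OF JS(1) t True])
        then show "t \<in> J" using t by simp
      qed
      then show ?thesis using JS by simp
    next
      case False
      then have "J \<in> ?X" using JS J(2) NX by blast
      then show ?thesis using Nmax J(2) by (metis (no_types, lifting))
    qed
  qed
  then have "N = m" using loc unfolding local_ring_def by blast
  then show ?thesis using NX s(2) by blast
qed

text \<open>An ideal maximal among those disjoint from a multiplicative set is prime: if a and b lie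
  outside J, both J + aS and J + bS meet T, and the product of two such elements would lie in J if a
  b did.\<close>

lemma prime_avoiding:
  assumes noeth: "\<And>X. X \<noteq> {} \<Longrightarrow> X \<subseteq> {N \<in> SM. N \<subseteq> S} \<Longrightarrow> \<exists>N\<in>X. \<forall>N'\<in>X. N \<subseteq> N' \<longrightarrow> N' = N"
    and T: "T \<subseteq> S" "\<one> \<in> T" "\<zero> \<notin> T" "\<And>a b. a \<in> T \<Longrightarrow> b \<in> T \<Longrightarrow> a \<otimes> b \<in> T"
  shows "\<exists>P. primeideal P RR \<and> P \<inter> T = {}"
proof -
  let ?X = "{N \<in> SM. N \<subseteq> S \<and> N \<inter> T = {}}"
  have "{\<zero>} \<in> ?X" using T(3) S_zero by (auto intro!: smodsI)
  then have "?X \<noteq> {}" "?X \<subseteq> {N \<in> SM. N \<subseteq> S}" by blast+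
  from noeth[OF this] obtain J where JX: "J \<in> ?X" and Jmax: "\<forall>N'\<in>?X. J \<subseteq> N' \<longrightarrow> N' = J" by (rule bexE)
  from JX have J: "J \<in> SM" "J \<subseteq> S" "J \<inter> T = {}" by blast+
  have meet: "\<exists>j\<in>J. \<exists>s\<in>S. j \<oplus> a \<otimes> s \<in> T" if a: "a \<in> S" "a \<notin> J" for a
  proof (rule ccontr)
    assume n: "\<not> ?thesis"
    have ac: "a \<in> carrier Q" using a by auto
    note aS = scal_smod[OF S_smod ac]
    have "msum Q J (scal Q a S) \<inter> T = {}" using n by (auto elim!: msumE scalE)
    then have "msum Q J (scal Q a S) \<in> ?X" using msum_smod[OF J(1) aS] msum_least[OF S_smod J(2) cyc_least[OF S_smod a(1)]] by blast
    then have "msum Q J (scal Q a S) = J" using Jmax msum_left[OF J(1) aS] by (metis (no_types, lifting))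
    then show False using msum_right[OF J(1) aS] cyc_mem[OF ac] a(2) by blast
  qed
  have "a \<in> J \<or> b \<in> J" if ab: "a \<in> S" "b \<in> S" "a \<otimes> b \<in> J" for a b
  proof (rule ccontr)
    assume "\<not> ?thesis"
    then obtain j s j' s' where js: "j \<in> J" "s \<in> S" "j \<oplus> a \<otimes> s \<in> T" "j' \<in> J" "s' \<in> S" "j' \<oplus> b \<otimes> s' \<in> T"
      using meet[OF ab(1)] meet[OF ab(2)] by blast
    have c: "a \<in> carrier Q" "b \<in> carrier Q" "s \<in> carrier Q" "s' \<in> carrier Q" "j \<in> carrier Q" "j' \<in> carrier Q"
      using ab js J(2) by auto
    have e: "(j \<oplus> a \<otimes> s) \<otimes> (j' \<oplus> b \<otimes> s') = (j' \<oplus> b \<otimes> s') \<otimes> j \<oplus> ((a \<otimes> s) \<otimes> j' \<oplus> (s \<otimes> s') \<otimes> (a \<otimes> b))" using c by algebra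
    have "(j' \<oplus> b \<otimes> s') \<otimes> j \<oplus> ((a \<otimes> s) \<otimes> j' \<oplus> (s \<otimes> s') \<otimes> (a \<otimes> b)) \<in> J"
      using smodsD(4)[OF J(1) _ js(1), of "j' \<oplus> b \<otimes> s'"] smodsD(4)[OF J(1) S_mult[OF ab(1) js(2)] js(4)]
        smodsD(4)[OF J(1) S_mult[OF js(2,5)] ab(3)] js(6) T(1) smodsD(3)[OF J(1)] by blast
    then have "(j \<oplus> a \<otimes> s) \<otimes> (j' \<oplus> b \<otimes> s') \<in> J" using e by simp
    then show False using T(4)[OF js(3,6)] J(3) by blast
  qed
  moreover have "J \<noteq> S" using J(3) T(2) S_one by blast
  ultimately have "primeideal J RR" using primeideal_RR_iff J by blast
  then show ?thesis using J(3) by blast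
qed

end

text \<open>Depth one supplies the nonzerodivisor in m. For the socle axiom, an associated prime P
  of S / N contains the regular element u. If P were not m, a prime strictly below P would give a
  chain of two strict inclusions.\<close>

lemma cm_one_intro:
  fixes R Q :: "'a ring"
  assumes CM: "cohen_macaulay_local R m" and dim: "krull_dim R = 1" and tot: "total_ring_of_fractions R Q"
  shows "cm_one Q (carrier R) m"
proof -
  define S where "S = carrier R"
  have Q: "cring Q" "subring S Q" "R = Q\<lparr>carrier := S\<rparr>" and nz: "nonzerodivisors R \<subseteq> Units Q"
    and fr: "\<And>q. q \<in> carrier Q \<Longrightarrow> \<exists>a\<in>S. \<exists>s\<in>nonzerodivisors R. q = a \<otimes>\<^bsub>Q\<^esub> inv\<^bsub>Q\<^esub> s"
    using tot unfolding total_ring_of_fractions_def S_def by auto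
  interpret Q: cring Q by (rule Q(1))
  interpret frac_ring Q S
  proof (intro frac_ring.intro frac_ring_axioms.intro Q(1,2))
    fix q assume "q \<in> carrier Q"
    then obtain a s where a: "a \<in> S" "s \<in> nonzerodivisors R" "q = a \<otimes>\<^bsub>Q\<^esub> inv\<^bsub>Q\<^esub> s" using fr by blast
    have s: "s \<in> S" "s \<in> Units Q" using a(2) nz unfolding nonzerodivisors_def S_def by auto
    have ac: "a \<in> carrier Q" using subringE(1)[OF Q(2)] a(1) by auto
    have "s \<otimes>\<^bsub>Q\<^esub> q = (s \<otimes>\<^bsub>Q\<^esub> inv\<^bsub>Q\<^esub> s) \<otimes>\<^bsub>Q\<^esub> a" unfolding a(3) using s ac by (simp add: Q.m_ac Q.Units_closed del: Q.Units_r_inv)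
    then have "s \<otimes>\<^bsub>Q\<^esub> q = a" using s ac by simp
    then show "\<exists>s\<in>S \<inter> Units Q. s \<otimes>\<^bsub>Q\<^esub> q \<in> S" using s a(1) by auto
  qed
  have RQ: "R = RR" by (rule Q(3))
  have lr: "local_ring RR m" and nr: "noetherian_ring RR" and dp: "depth RR m = 1"
    using CM dim RQ unfolding cohen_macaulay_local_def by auto
  have mx: "maximalideal m RR" using lr unfolding local_ring_def by blast
  have m: "m \<in> SM" "m \<subseteq> S" using maximalideal.axioms(1)[OF mx] ideal_RR_iff by auto
  have m1: "\<one>\<^bsub>Q\<^esub> \<notin> m"
  proof
    assume m1: "\<one>\<^bsub>Q\<^esub> \<in> m"
    have "t \<in> m" if t: "t \<in> S" for t using smodsD(4)[OF m(1) t m1] S_carr[OF t] by simp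
    then show False using maximalideal.I_notcarr[OF mx] m(2) by auto
  qed
  have noeth: "\<exists>N\<in>X. \<forall>N'\<in>X. N \<subseteq> N' \<longrightarrow> N' = N" if X: "X \<noteq> {}" "X \<subseteq> {N \<in> SM. N \<subseteq> S}" for X
  proof (rule subset_Zorn_nonempty[OF X(1)])
    fix C assume C: "C \<noteq> {}" "subset.chain X C"
    interpret N: noetherian_ring RR by (rule nr)
    have CX: "C \<subseteq> X" and lin: "\<forall>A\<in>C. \<forall>B\<in>C. A \<subseteq> B \<or> B \<subseteq> A" using C(2) unfolding subset_chain_def by simp_all
    have "ideal N RR" if N: "N \<in> C" for N
    proof -
      have "N \<in> {N \<in> SM. N \<subseteq> S}" by (rule subsetD[OF X(2) subsetD[OF CX N]])
      then show ?thesis unfolding ideal_RR_iff by simp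
    qed
    then have "subset.chain {I. ideal I RR} C" unfolding subset_chain_def using lin by (simp add: subset_iff)
    then have "\<Union>C \<in> C" by (rule N.ideal_chain_is_trivial[OF C(1)])
    then show "\<Union>C \<in> X" by (rule subsetD[OF CX])
  qed
  have nzd: "\<exists>x\<in>m. x \<in> Units Q"
  proof -
    have "enat 1 \<le> Sup {enat (length xs) | xs. regular_seq_in RR m xs}" using dp unfolding depth_def by (simp add: one_enat_def)
    then have "\<exists>xs. regular_seq_in RR m xs \<and> 1 \<le> length xs" by (rule enat_SupE) simp
    then obtain xs where xs0: "regular_seq_in RR m xs" "1 \<le> length xs" by blast
    then have xs: "regular_seq_in RR m xs" "0 < length xs" by linarith+
    interpret RC: cring RR by (rule RR_cring)
    have "ideal {\<zero>\<^bsub>Q\<^esub>} RR" using RC.zeroideal by simp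
    then have "Idl\<^bsub>RR\<^esub> {} \<subseteq> {\<zero>\<^bsub>Q\<^esub>}" by (rule RC.genideal_minimal) simp
    moreover have "\<zero>\<^bsub>Q\<^esub> \<in> Idl\<^bsub>RR\<^esub> {}"
      using cring_idealD(2)[OF RR_cring RC.genideal_ideal[of "{}"]] by simp
    ultimately have Z: "Idl\<^bsub>RR\<^esub> {} = {\<zero>\<^bsub>Q\<^esub>}" by blast
    have "xs ! 0 \<in> m" using xs unfolding regular_seq_in_def by auto
    moreover have "xs ! 0 \<otimes>\<^bsub>Q\<^esub> a = \<zero>\<^bsub>Q\<^esub> \<longrightarrow> a = \<zero>\<^bsub>Q\<^esub>" if "a \<in> S" for a
      using xs(1,2) that Z unfolding regular_seq_in_def by auto
    ultimately have "xs ! 0 \<in> nonzerodivisors R" using m(2) RQ unfolding nonzerodivisors_def by auto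
    then show ?thesis using nz \<open>xs ! 0 \<in> m\<close> by blast
  qed
  have soc: "\<exists>y\<in>S - N. \<forall>a\<in>m. a \<otimes>\<^bsub>Q\<^esub> y \<in> N"
    if N: "N \<in> SM" "N \<subseteq> S" and u: "u \<in> N" "u \<in> Units Q" and NS: "N \<noteq> S" for N u
  proof -
    \<comment> \<open>The annihilator of y modulo N; one that is maximal among those of elements
      outside N is prime.\<close>
    define A where "A y = {s \<in> S. s \<otimes>\<^bsub>Q\<^esub> y \<in> N}" for y
    have AM: "A y \<in> SM" "A y \<subseteq> S" if "y \<in> S" for y
    proof -
      have "A y = S \<inter> colon Q N {y}" unfolding A_def colon_def by auto
      then show "A y \<in> SM" using Int_smod[OF S_smod colon_smod[OF N(1)]] that by auto
    qed (auto simp: A_def)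
    have "A ` (S - N) \<noteq> {}" "A ` (S - N) \<subseteq> {N \<in> SM. N \<subseteq> S}" using N NS AM by auto
    from noeth[OF this] obtain P where PX: "P \<in> A ` (S - N)" and Pmax: "\<forall>N'\<in>A ` (S - N). P \<subseteq> N' \<longrightarrow> N' = P" by (rule bexE)
    from PX obtain y where y: "y \<in> S" "y \<notin> N" "P = A y" by auto
    have yc: "y \<in> carrier Q" using y by auto
    have PM: "P \<in> SM" "P \<subseteq> S" using AM y by auto
    have P1: "\<one>\<^bsub>Q\<^esub> \<notin> P" using y yc unfolding A_def by simp
    have pr: "a \<in> P \<or> b \<in> P" if ab: "a \<in> S" "b \<in> S" "a \<otimes>\<^bsub>Q\<^esub> b \<in> P" for a b
    proof (rule disjCI)
      assume b: "b \<notin> P"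
      let ?y = "b \<otimes>\<^bsub>Q\<^esub> y"
      have c: "a \<in> carrier Q" "b \<in> carrier Q" using ab by auto
      have y': "?y \<in> S" "?y \<notin> N" using S_mult[OF ab(2) y(1)] b ab(2) y(3) unfolding A_def by auto
      have "P \<subseteq> A ?y"
      proof
        fix s assume s: "s \<in> P"
        then have "s \<in> S" "s \<otimes>\<^bsub>Q\<^esub> y \<in> N" using y(3) unfolding A_def by auto
        moreover have "s \<otimes>\<^bsub>Q\<^esub> ?y = b \<otimes>\<^bsub>Q\<^esub> (s \<otimes>\<^bsub>Q\<^esub> y)" using \<open>s \<in> S\<close> c yc by (simp add: Q.m_lcomm)
        ultimately show "s \<in> A ?y" unfolding A_def using smodsD(4)[OF N(1) ab(2)] by simp
      qed
      then have "A ?y = P" using Pmax y' by blast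
      moreover have "a \<in> A ?y" unfolding A_def using ab(1,3) y(3) c yc unfolding A_def by (simp add: Q.m_assoc)
      ultimately show "a \<in> P" by simp
    qed
    have prime: "primeideal P RR" using primeideal_RR_iff PM P1 S_one pr by blast
    have uP: "u \<in> P" using smodsD(5)[OF N(1) y(1) u(1)] u(1) N(2) y(3) unfolding A_def by auto
    have Pm: "P \<subseteq> m"
    proof
      fix s assume s: "s \<in> P"
      show "s \<in> m"
      proof (rule ccontr)
        assume "s \<notin> m"
        then have "s \<in> Units Q" "inv\<^bsub>Q\<^esub> s \<in> S" using maximal_in_noeth[OF noeth lr] s PM(2) by blast+
        then have "inv\<^bsub>Q\<^esub> s \<otimes>\<^bsub>Q\<^esub> s \<in> P" using smodsD(4)[OF PM(1) _ s] by blast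
        then show False using \<open>s \<in> Units Q\<close> P1 by simp
      qed
    qed
    have mprime: "primeideal m RR" using cring.maximalideal_prime[OF RR_cring mx] .
    have "P = m"
    proof (rule ccontr)
      assume ne: "P \<noteq> m"
      \<comment> \<open>A prime disjoint from T is contained in P and misses u. Zero is not in T
        because u is a unit of Q and P contains zero.\<close>
      define T where "T = {u [^]\<^bsub>Q\<^esub> n \<otimes>\<^bsub>Q\<^esub> s | (n::nat) s. s \<in> S - P}"
      have uS: "u [^]\<^bsub>Q\<^esub> (n::nat) \<in> S" for n using S_one S_mult u(1) N(2) by (induction n) auto
      have uc: "u \<in> carrier Q" using u(2) by blast
      have "\<exists>P'. primeideal P' RR \<and> P' \<inter> T = {}"
      proof (rule prime_avoiding[OF noeth])
        show "T \<subseteq> S" unfolding T_def using S_mult[OF uS] by auto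
        have "\<one>\<^bsub>Q\<^esub> = u [^]\<^bsub>Q\<^esub> (0::nat) \<otimes>\<^bsub>Q\<^esub> \<one>\<^bsub>Q\<^esub>" by simp
        then show "\<one>\<^bsub>Q\<^esub> \<in> T" unfolding T_def using S_one P1 by blast
        show "\<zero>\<^bsub>Q\<^esub> \<notin> T"
        proof
          assume "\<zero>\<^bsub>Q\<^esub> \<in> T"
          then obtain n :: nat and s where s: "\<zero>\<^bsub>Q\<^esub> = u [^]\<^bsub>Q\<^esub> n \<otimes>\<^bsub>Q\<^esub> s" "s \<in> S" "s \<notin> P" unfolding T_def by auto
          have "u [^]\<^bsub>Q\<^esub> n \<otimes>\<^bsub>Q\<^esub> s = u [^]\<^bsub>Q\<^esub> n \<otimes>\<^bsub>Q\<^esub> \<zero>\<^bsub>Q\<^esub>" using s(1)[symmetric] uc by simp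
          then have "s = \<zero>\<^bsub>Q\<^esub>" using Q.Units_l_cancel[OF Q.Units_pow_closed[OF u(2)]] s(2) by blast
          then show False using s(3) smodsD(2)[OF PM(1)] by simp
        qed
        fix a b assume "a \<in> T" "b \<in> T"
        then obtain n n' :: nat and s s' where ab: "a = u [^]\<^bsub>Q\<^esub> n \<otimes>\<^bsub>Q\<^esub> s" "b = u [^]\<^bsub>Q\<^esub> n' \<otimes>\<^bsub>Q\<^esub> s'" "s \<in> S - P" "s' \<in> S - P"
          unfolding T_def by blast
        have "a \<otimes>\<^bsub>Q\<^esub> b = u [^]\<^bsub>Q\<^esub> (n + n') \<otimes>\<^bsub>Q\<^esub> (s \<otimes>\<^bsub>Q\<^esub> s')"
          unfolding ab(1,2) using ab(3,4) uc by (simp add: Q.nat_pow_mult[symmetric] Q.m_ac)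
        moreover have "s \<otimes>\<^bsub>Q\<^esub> s' \<in> S - P" using ab(3,4) pr S_mult by blast
        ultimately show "a \<otimes>\<^bsub>Q\<^esub> b \<in> T" unfolding T_def by blast
      qed
      then obtain P' where P': "primeideal P' RR" "P' \<inter> T = {}" by blast
      have P'S: "P' \<subseteq> S" using P'(1) primeideal_RR_iff by blast
      have "s \<in> T" if "s \<in> S - P" for s
      proof -
        have "s = u [^]\<^bsub>Q\<^esub> (0::nat) \<otimes>\<^bsub>Q\<^esub> s" using that by auto
        then show ?thesis unfolding T_def using that by blast
      qed
      then have "P' \<subseteq> P" using P'(2) P'S by blast
      moreover have "u = u [^]\<^bsub>Q\<^esub> (1::nat) \<otimes>\<^bsub>Q\<^esub> \<one>\<^bsub>Q\<^esub>" using uc by simp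
      then have "u \<in> T" unfolding T_def using S_one P1 by blast
      then have "u \<notin> P'" using P'(2) by blast
      ultimately have "P' \<subset> P" using uP by blast
      moreover have "P \<subset> m" using Pm ne by blast
      ultimately show False using no_chain_two[OF _ P'(1) prime mprime] dim RQ by simp
    qed
    then have "\<forall>a\<in>m. a \<otimes>\<^bsub>Q\<^esub> y \<in> N" using y(3) unfolding A_def by blast
    then show ?thesis using y by blast
  qed
  have "cm_one_axioms Q S m"
  proof (rule cm_one_axioms.intro)
    show "m \<in> SM" "m \<subseteq> S" "\<one>\<^bsub>Q\<^esub> \<notin> m" "\<exists>x\<in>m. x \<in> Units Q" by (rule m m1 nzd)+
  next
    fix s assume s: "s \<in> S" "s \<notin> m"
    show "s \<in> Units Q \<and> inv\<^bsub>Q\<^esub> s \<in> S" using maximal_in_noeth[OF noeth lr s] by blast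
  next
    fix X assume X: "X \<noteq> {}" "X \<subseteq> {N \<in> SM. N \<subseteq> S}"
    show "\<exists>N\<in>X. \<forall>N'\<in>X. N \<subseteq> N' \<longrightarrow> N' = N" by (rule noeth[OF X])
  next
    fix N u assume N: "N \<in> SM" "N \<subseteq> S" "u \<in> N" "u \<in> Units Q" "N \<noteq> S"
    show "\<exists>y\<in>S - N. \<forall>a\<in>m. a \<otimes>\<^bsub>Q\<^esub> y \<in> N" by (rule soc[OF N])
  qed
  then show ?thesis using cm_one.intro[OF frac_ring_axioms] unfolding S_def by blast
qed

section \<open>Endomorphisms of the maximal ideal and discrete valuation rings\<close>

context cm_one
begin

text \<open>If q m \<subseteq> S but q b is not in m for some b in m, then q b is a unit and m is
  principal, generated by a regular element. A Noetherian local ring of this kind is a discrete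
  valuation ring.\<close>

lemma colon_mm_not_dvr:
  assumes dvr: "\<not> discrete_valuation_ring RR" and lr: "local_ring RR m"
  shows "colon Q m m = colon Q S m"
proof (rule antisym; rule subsetI)
  fix q assume "q \<in> colon Q m m"
  then show "q \<in> colon Q S m" using m_sub unfolding colon_def by auto
next
  fix q assume "q \<in> colon Q S m"
  then have q: "q \<in> carrier Q" "\<And>a. a \<in> m \<Longrightarrow> q \<otimes> a \<in> S" unfolding colon_def by auto
  show "q \<in> colon Q m m"
  proof (rule ccontr)
    assume "q \<notin> colon Q m m"
    then obtain b where b: "b \<in> m" "q \<otimes> b \<notin> m" using q(1) unfolding colon_def by auto
    then have qb: "q \<otimes> b \<in> Units Q" "inv (q \<otimes> b) \<in> S" using loc q(2)[OF b(1)] by auto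
    \<comment> \<open>Normalised so that q a = 1; then c = a (q c) with q c \<in> S for each c in m,
      that is, m = aS.\<close>
    define a where "a = b \<otimes> inv (q \<otimes> b)"
    have bc: "b \<in> carrier Q" using m_carr[OF b(1)] .
    have ic: "inv (q \<otimes> b) \<in> carrier Q" using qb by auto
    have am: "a \<in> m" unfolding a_def by (rule smodsD(5)[OF m_smod qb(2) b(1)])
    have ac: "a \<in> carrier Q" using m_carr[OF am] .
    have "q \<otimes> a = (q \<otimes> b) \<otimes> inv (q \<otimes> b)" unfolding a_def using q(1) bc ic by (simp add: m_assoc)
    then have qa: "q \<otimes> a = \<one>" using qb by simp
    have aU: "a \<in> Units Q" using qa q(1) ac m_comm[of q a] unfolding Units_def by auto
    have gen: "\<exists>s\<in>S. c = a \<otimes> s" if c: "c \<in> m" for c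
    proof -
      have cc: "c \<in> carrier Q" using m_carr[OF c] .
      have "a \<otimes> (q \<otimes> c) = (q \<otimes> a) \<otimes> c" using ac q(1) cc by (simp add: m_ac)
      then have "c = a \<otimes> (q \<otimes> c)" using qa cc by simp
      then show ?thesis using q(2)[OF c] by blast
    qed
    have aS: "a \<in> S" using am m_sub by auto
    have apS: "a [^] n \<in> S" for n :: nat using S_one S_mult aS by (induction n) auto
    have apU: "a [^] n \<in> Units Q" for n :: nat using Units_pow_closed[OF aU] .
    \<comment> \<open>The powers of a intersect in zero. If r were divisible by all of them, the
      ideals generated by the quotients r / a^n would ascend, hence stabilise, and Nakayama would
      make a quotient zero.\<close>
    have fac: "\<exists>n::nat. \<exists>v\<in>S - m. r = a [^] n \<otimes> v" if r: "r \<in> S" "r \<noteq> \<zero>" for r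
    proof (rule ccontr)
      assume no: "\<not> ?thesis"
      have ex: "\<exists>t\<in>S. r = a [^] n \<otimes> t" for n :: nat
      proof (induction n)
        case 0
        then show ?case using r by auto
      next
        case (Suc n)
        then obtain t where t: "t \<in> S" "r = a [^] n \<otimes> t" by blast
        then have "t \<in> m" using no by blast
        then obtain s where s: "s \<in> S" "t = a \<otimes> s" using gen by blast
        then have "r = a [^] Suc n \<otimes> s" using t ac by (simp add: m_assoc)
        then show ?case using s by blast
      qed
      define t where "t n = inv (a [^] n) \<otimes> r" for n :: nat
      have rc: "r \<in> carrier Q" using r by auto
      have tS: "t n \<in> S" for n
      proof -
        obtain s where s: "s \<in> S" "r = a [^] n \<otimes> s" using ex by blast
        have "t n = s" unfolding t_def s(2) using apU[of n] s(1) by (simp add: m_assoc[symmetric] Units_closed)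
        then show ?thesis using s by simp
      qed
      have tS': "t n = a \<otimes> t (Suc n)" for n
      proof -
        have c: "t n \<in> carrier Q" "t (Suc n) \<in> carrier Q" using tS by auto
        have e: "a [^] k \<otimes> t k = r" for k
          unfolding t_def using apU[of k] rc by (simp add: m_assoc[symmetric] Units_closed)
        have "a [^] n \<otimes> t n = a [^] n \<otimes> (a \<otimes> t (Suc n))" using e[of n] e[of "Suc n"] ac c by (simp add: m_assoc)
        then show ?thesis using Units_l_cancel[OF apU] c ac by simp
      qed
      have "range (\<lambda>n. scal Q (t n) S) \<noteq> {}" "range (\<lambda>n. scal Q (t n) S) \<subseteq> {N \<in> SM. N \<subseteq> S}"
        using scal_smod[OF S_smod] tS cyc_least[OF S_smod] by auto
      from noeth[OF this] obtain N where "N \<in> range (\<lambda>n. scal Q (t n) S)" and mx: "\<forall>N'\<in>range (\<lambda>n. scal Q (t n) S). N \<subseteq> N' \<longrightarrow> N' = N" by (rule bexE)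
      then obtain n where N: "N = scal Q (t n) S" by blast
      have c: "t n \<in> carrier Q" "t (Suc n) \<in> carrier Q" using tS by auto
      have "N \<subseteq> scal Q (t (Suc n)) S"
        unfolding N using cyc_least[OF scal_smod[OF S_smod c(2)]] scalI[OF aS, of "t (Suc n)"] tS'[of n] ac c by (simp add: m_comm)
      moreover have "scal Q (t (Suc n)) S \<in> range (\<lambda>n. scal Q (t n) S)" by (rule rangeI)
      ultimately have "scal Q (t (Suc n)) S = scal Q (t n) S" using mx N by simp
      then have "t (Suc n) \<in> scal Q (t n) S" using cyc_mem[OF c(2)] by simp
      then obtain s where s: "s \<in> S" "t (Suc n) = t n \<otimes> s" by (rule scalE)
      have zM: "{\<zero>} \<in> SM" by (rule smodsI) auto
      have "(s \<otimes> a) \<otimes> t (Suc n) = (a \<otimes> t (Suc n)) \<otimes> s" using c ac S_carr[OF s(1)] by algebra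
      then have "(s \<otimes> a) \<otimes> t (Suc n) = t (Suc n)" unfolding tS'[of n, symmetric] s(2)[symmetric] .
      then have "t (Suc n) \<ominus> (s \<otimes> a) \<otimes> t (Suc n) \<in> {\<zero>}" using c(2) by (simp add: a_minus_def r_neg)
      then have "t (Suc n) \<in> {\<zero>}" by (rule cancel_one_minus[OF zM smodsD(4)[OF m_smod s(1) am] c(2)])
      then have "inv (a [^] Suc n) \<otimes> r = \<zero>" unfolding t_def by simp
      then have "inv (a [^] Suc n) \<otimes> r = inv (a [^] Suc n) \<otimes> \<zero>" using Units_inv_closed[OF apU, of "Suc n"] by simp
      then have "r = \<zero>" using Units_l_cancel[OF Units_inv_Units[OF apU] rc zero_closed, of "Suc n"] by blast
      then show False using r by simp
    qed
    interpret R: cring RR by (rule RR_cring)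
    have nz: "a [^] n \<otimes> v \<noteq> \<zero>" if "v \<in> S - m" for n :: nat and v
    proof
      assume z: "a [^] n \<otimes> v = \<zero>"
      have vU: "v \<in> Units Q" using loc that by blast
      have "a [^] n \<otimes> v \<in> Units Q" using apU vU by simp
      then have "\<zero> \<in> Units Q" using z by simp
      then have "\<one> = \<zero>" using Units_l_inv[of \<zero>] Units_inv_closed[of \<zero>] r_null[of "inv \<zero>"] by metis
      then show False using smodsD(2)[OF m_smod] one_notin_m by simp
    qed
    have "domain RR"
    proof (rule domain.intro[OF RR_cring domain_axioms.intro])
      have "\<one> \<noteq> \<zero>" using smodsD(2)[OF m_smod] one_notin_m by auto
      then show "\<one>\<^bsub>RR\<^esub> \<noteq> \<zero>\<^bsub>RR\<^esub>" by simp
      fix r s assume rs: "r \<otimes>\<^bsub>RR\<^esub> s = \<zero>\<^bsub>RR\<^esub>" "r \<in> carrier RR" "s \<in> carrier RR"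
      show "r = \<zero>\<^bsub>RR\<^esub> \<or> s = \<zero>\<^bsub>RR\<^esub>"
      proof (rule ccontr)
        assume "\<not> ?thesis"
        then obtain n n' :: nat and v v' where v: "v \<in> S - m" "r = a [^] n \<otimes> v" "v' \<in> S - m" "s = a [^] n' \<otimes> v'"
          using fac[of r] fac[of s] rs(2,3) by auto
        have vU: "v \<in> Units Q" using loc v(1) by blast
        have "r \<otimes> s = (a [^] n \<otimes> v) \<otimes> s" using v by simp
        moreover have "a [^] n \<otimes> v \<in> Units Q" using apU vU by simp
        ultimately have "s = \<zero>" using rs(1,3) Units_l_cancel[of "a [^] n \<otimes> v" s \<zero>] Units_closed by auto
        then show False using nz[OF v(3)] v(4) by simp
      qed
    qed
    moreover have "\<exists>c\<in>carrier RR. I = PIdl\<^bsub>RR\<^esub> c" if I: "ideal I RR" for I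
    proof (cases "I = {\<zero>}")
      case True
      have "PIdl\<^bsub>RR\<^esub> \<zero> = {\<zero>}"
      proof (rule antisym; rule subsetI)
        fix c assume "c \<in> {\<zero>}"
        then show "c \<in> PIdl\<^bsub>RR\<^esub> \<zero>" unfolding cgenideal_def using S_zero by (intro CollectI exI[of _ \<zero>]) simp
      qed (auto simp: cgenideal_def)
      then show ?thesis using True S_zero by auto
    next
      case False
      have IS: "I \<in> SM" "I \<subseteq> S" using I ideal_RR_iff by auto
      have pin: "a [^] n \<in> I" if "a [^] n \<otimes> v \<in> I" "v \<in> S - m" for n :: nat and v
      proof -
        have vU: "v \<in> Units Q" "inv v \<in> S" using loc that(2) by auto
        have "inv v \<otimes> (a [^] n \<otimes> v) \<in> I" using smodsD(4)[OF IS(1) vU(2) that(1)] .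
        moreover have "inv v \<otimes> (a [^] n \<otimes> v) = a [^] n \<otimes> (inv v \<otimes> v)"
          using vU(1) Units_closed[OF vU(1)] Units_inv_closed[OF vU(1)] ac nat_pow_closed[OF ac, of n] by algebra
        ultimately show ?thesis using vU(1) ac by simp
      qed
      have "\<exists>n::nat. a [^] n \<in> I"
      proof -
        obtain r where r: "r \<in> I" "r \<noteq> \<zero>" using False smodsD(2)[OF IS(1)] by blast
        then show ?thesis using fac[of r] pin IS(2) by blast
      qed
      \<comment> \<open>Every nonzero element is a power of a times a unit, so the least power of a
        in I generates I.\<close>
      define n where "n = (LEAST n::nat. a [^] n \<in> I)"
      have n: "a [^] n \<in> I" unfolding n_def using \<open>\<exists>n::nat. a [^] n \<in> I\<close> by (rule LeastI_ex)
      have "I \<subseteq> PIdl\<^bsub>RR\<^esub> (a [^] n)"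
      proof
        fix r assume r: "r \<in> I"
        show "r \<in> PIdl\<^bsub>RR\<^esub> (a [^] n)"
        proof (cases "r = \<zero>")
          case True
          then have "r = \<zero> \<otimes> a [^] n" using ac by simp
          then show ?thesis unfolding cgenideal_def using S_zero by auto
        next
          case False
          then obtain n' :: nat and v where v: "v \<in> S - m" "r = a [^] n' \<otimes> v" using fac r IS(2) by blast
          then have "a [^] n' \<in> I" using pin r by blast
          then have le: "n \<le> n'" unfolding n_def by (rule Least_le)
          have vc: "v \<in> carrier Q" using v(1) by auto
          have "a [^] n' = a [^] (n' - n) \<otimes> a [^] n" using nat_pow_mult[OF ac, of "n' - n" n] le by simp
          then have "r = (a [^] (n' - n) \<otimes> v) \<otimes> a [^] n" using v(2) ac vc by (simp add: m_ac)
          then show ?thesis unfolding cgenideal_def using S_mult[OF apS] v(1) by auto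
        qed
      qed
      moreover have "PIdl\<^bsub>RR\<^esub> (a [^] n) \<subseteq> I" unfolding cgenideal_def using smodsD(4)[OF IS(1) _ n] by auto
      ultimately show ?thesis using apS by auto
    qed
    ultimately have "principal_domain RR" by (intro principal_domain.intro principal_domain_axioms.intro)
    moreover have "\<not> field RR"
    proof
      assume F: "field RR"
      have "a [^] (1::nat) \<otimes> \<one> \<noteq> \<zero>" by (rule nz) (use S_one one_notin_m in blast)
      then have "a \<noteq> \<zero>" using ac by simp
      then have "a \<in> Units RR" unfolding field.field_Units[OF F] using aS by simp
      then have "\<exists>t\<in>S. t \<otimes> a = \<one> \<and> a \<otimes> t = \<one>" unfolding Units_def by simp
      then obtain t where t: "t \<in> S" "t \<otimes> a = \<one>" by blast
      then show False using smodsD(4)[OF m_smod t(1) am] one_notin_m by simp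
    qed
    ultimately show False using dvr lr unfolding discrete_valuation_ring_def by blast
  qed
qed

section \<open>Primes, socles and depth in dimension one\<close>

lemma proper_sub_m:
  assumes "P \<in> SM" "P \<subseteq> S" "P \<noteq> S"
  shows "P \<subseteq> m"
proof
  fix s assume s: "s \<in> P"
  show "s \<in> m"
  proof (rule ccontr)
    assume "s \<notin> m"
    then have u: "s \<in> Units Q" "inv s \<in> S" using loc s assms(2) by blast+
    then have "inv s \<otimes> s \<in> P" using smodsD(4)[OF assms(1) _ s] by blast
    then have "\<one> \<in> P" using u(1) by simp
    then have "S \<subseteq> P" using smodsD(4)[OF assms(1), of _ \<one>] by (metis S_carr r_one subsetI)
    then show False using assms(2,3) by blast
  qed
qed

text \<open>A socle element y modulo P satisfies m y \<subseteq> P with y outside P, so primality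
  gives m \<subseteq> P.\<close>

lemma regular_prime_eq_m:
  assumes P: "primeideal P RR" and u: "u \<in> P" "u \<in> Units Q"
  shows "P = m"
proof -
  have PD: "P \<in> SM" "P \<subseteq> S" "P \<noteq> S" "\<And>a b. a \<in> S \<Longrightarrow> b \<in> S \<Longrightarrow> a \<otimes> b \<in> P \<Longrightarrow> a \<in> P \<or> b \<in> P"
    using P primeideal_RR_iff by auto
  obtain y where y: "y \<in> S" "y \<notin> P" "\<And>a. a \<in> m \<Longrightarrow> a \<otimes> y \<in> P" using soc[OF PD(1,2) u PD(3)] by blast
  have "m \<subseteq> P" using PD(4)[OF _ y(1)] y(2,3) m_sub by blast
  then show ?thesis using proper_sub_m[OF PD(1-3)] by blast
qed

text \<open>Pick z in I outside J. The ideal of all s with s z \<in> J is proper, and it is regular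
  because J is; z times a socle element modulo this ideal is a socle element of I / J.\<close>

lemma soc_module:
  assumes J: "J \<in> FI" and I: "I \<in> SM" "J \<subseteq> I" "J \<noteq> I"
  shows "\<exists>y\<in>I - J. \<forall>a\<in>m. a \<otimes> y \<in> J"
proof -
  note JM = fidsD(1)[OF J]
  obtain z where z: "z \<in> I" "z \<notin> J" using I by blast
  have zc: "z \<in> carrier Q" using smodsD(1)[OF I(1) z(1)] .
  obtain v where v: "v \<in> J" "v \<in> Units Q" using fidsD(2)[OF J] by blast
  define N where "N = {s \<in> S. s \<otimes> z \<in> J}"
  have "N = S \<inter> colon Q J {z}" unfolding N_def colon_def by auto
  then have N: "N \<in> SM" "N \<subseteq> S" using Int_smod[OF S_smod colon_smod[OF JM]] zc by auto
  have vc: "v \<in> carrier Q" "inv v \<in> carrier Q" using v(2) by auto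
  obtain t where t: "t \<in> S" "t \<in> Units Q" "t \<otimes> (z \<otimes> inv v) \<in> S" using frac[of "z \<otimes> inv v"] zc vc by auto
  have "(t \<otimes> (z \<otimes> inv v)) \<otimes> v \<in> J" by (rule smodsD(4)[OF JM t(3) v(1)])
  moreover have "(t \<otimes> (z \<otimes> inv v)) \<otimes> v = t \<otimes> z \<otimes> (inv v \<otimes> v)" using t(1) zc vc by (simp add: m_assoc del: Units_l_inv)
  ultimately have "t \<in> N" unfolding N_def using t v(2) zc vc by simp
  moreover have "\<one> \<notin> N" using z(2) zc unfolding N_def by simp
  then have "N \<noteq> S" using S_one by blast
  ultimately obtain y where y: "y \<in> S" "y \<notin> N" "\<And>a. a \<in> m \<Longrightarrow> a \<otimes> y \<in> N" using soc[OF N _ t(2)] by blast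
  have "y \<otimes> z \<in> I - J" using smodsD(4)[OF I(1) y(1) z(1)] y(1,2) unfolding N_def by blast
  moreover have "a \<otimes> (y \<otimes> z) \<in> J" if a: "a \<in> m" for a
    using y(3)[OF a] m_carr[OF a] S_carr[OF y(1)] zc unfolding N_def by (simp add: m_assoc)
  ultimately show ?thesis by blast
qed

text \<open>A prime avoiding all powers of x. Together with the maximal ideal it shows that the
  dimension is at least one.\<close>

lemma prime_without_unit:
  assumes x: "x \<in> m" "x \<in> Units Q"
  shows "\<exists>P. primeideal P RR \<and> x \<notin> P"
proof -
  have xS: "x [^] n \<in> S" for n :: nat using S_one S_mult x(1) m_sub by (induction n) auto
  have xc: "x \<in> carrier Q" using x by auto
  have "\<exists>P. primeideal P RR \<and> P \<inter> range (\<lambda>n::nat. x [^] n) = {}"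
  proof (rule prime_avoiding[OF noeth])
    show "range (\<lambda>n::nat. x [^] n) \<subseteq> S" using xS by auto
    show "\<one> \<in> range (\<lambda>n::nat. x [^] n)" using nat_pow_0[of x] by (metis rangeI)
    show "\<zero> \<notin> range (\<lambda>n::nat. x [^] n)"
    proof
      assume "\<zero> \<in> range (\<lambda>n::nat. x [^] n)"
      then obtain n :: nat where n: "\<zero> = x [^] n" by blast
      then have zU: "\<zero> \<in> Units Q" using Units_pow_closed[OF x(2), of n] by simp
      then have "\<one> = \<zero>" using Units_l_inv[of \<zero>] Units_inv_closed[of \<zero>] r_null[of "inv \<zero>"] by metis
      then show False using smodsD(2)[OF m_smod] one_notin_m by simp
    qed
    fix a b assume "a \<in> range (\<lambda>n::nat. x [^] n)" "b \<in> range (\<lambda>n::nat. x [^] n)"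
    then obtain i j :: nat where "a = x [^] i" "b = x [^] j" by blast
    then have "a \<otimes> b = x [^] (i + j)" using nat_pow_mult[OF xc] by simp
    then show "a \<otimes> b \<in> range (\<lambda>n::nat. x [^] n)" by (rule range_eqI)
  qed
  moreover have "x \<in> range (\<lambda>n::nat. x [^] n)" using nat_pow_eone[OF xc] by (metis rangeI)
  ultimately show ?thesis by blast
qed

lemma m_prime:
  assumes "local_ring RR m"
  shows "primeideal m RR"
  using cring.maximalideal_prime[OF RR_cring] assms unfolding local_ring_def by blast

text \<open>After a regular a in m, a socle element y modulo aS is killed by every b in m, so no
  regular sequence continues. The hypothesis turns the first entry into a unit of Q, as the socle
  axiom demands.\<close>

lemma depth_eq_one:
  assumes nzu: "\<And>a. a \<in> S \<Longrightarrow> (\<And>b. b \<in> S \<Longrightarrow> a \<otimes> b = \<zero> \<Longrightarrow> b = \<zero>) \<Longrightarrow> a \<in> Units Q"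
  shows "depth RR m = 1"
proof (rule antisym)
  interpret R: cring RR by (rule RR_cring)
  have "Idl\<^bsub>RR\<^esub> {} \<subseteq> {\<zero>}" by (rule R.genideal_minimal) (use R.zeroideal in simp_all)
  moreover have "\<zero> \<in> Idl\<^bsub>RR\<^esub> {}" using cring_idealD(2)[OF RR_cring R.genideal_ideal[of "{}"]] by simp
  ultimately have Z: "Idl\<^bsub>RR\<^esub> {} = {\<zero>}" by blast
  obtain x where x: "x \<in> m" "x \<in> Units Q" using nzd by blast
  have "regular_seq_in RR m [x]"
    unfolding regular_seq_in_def using x(1) Z Units_l_cancel[OF x(2) S_carr zero_closed] Units_closed[OF x(2)] by simp
  then have "enat (length [x]) \<le> depth RR m" unfolding depth_def by (intro Sup_upper) blast
  then show "1 \<le> depth RR m" by (simp add: one_enat_def)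
  show "depth RR m \<le> 1"
    unfolding depth_def
  proof (rule Sup_least)
    fix e assume "e \<in> {enat (length xs) |xs. regular_seq_in RR m xs}"
    then obtain xs where e: "e = enat (length xs)" and xs: "regular_seq_in RR m xs" by blast
    have "length xs \<le> 1"
    proof (rule ccontr)
      assume "\<not> length xs \<le> 1"
      then obtain a b ys where l: "xs = a # b # ys" by (cases xs; cases "tl xs") auto
      have ab: "a \<in> m" "b \<in> m" using xs unfolding l regular_seq_in_def by auto
      have aS: "a \<in> S" using ab m_sub by auto
      have ac: "a \<in> carrier Q" using aS by auto
      have reg: "\<And>i c. i < length xs \<Longrightarrow> c \<in> S \<Longrightarrow> xs ! i \<otimes> c \<in> Idl\<^bsub>RR\<^esub> (set (take i xs)) \<Longrightarrow> c \<in> Idl\<^bsub>RR\<^esub> (set (take i xs))"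
        using xs unfolding regular_seq_in_def by auto
      have "c = \<zero>" if "c \<in> S" "a \<otimes> c = \<zero>" for c using reg[of 0 c] that Z unfolding l by simp
      then have aU: "a \<in> Units Q" by (rule nzu[OF aS])
      let ?N = "scal Q a S"
      have N: "?N \<in> SM" "?N \<subseteq> S" "a \<in> ?N" using scal_smod[OF S_smod ac] cyc_least[OF S_smod aS] cyc_mem[OF ac] by auto
      have "?N \<subseteq> m" by (rule cyc_least[OF m_smod ab(1)])
      then have "?N \<noteq> S" using one_notin_m S_one by blast
      then obtain y where y: "y \<in> S" "y \<notin> ?N" "\<And>c. c \<in> m \<Longrightarrow> c \<otimes> y \<in> ?N" using soc[OF N aU] by blast
      have "Idl\<^bsub>RR\<^esub> {a} \<subseteq> ?N" by (rule R.genideal_minimal) (use N ideal_RR_iff in auto)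
      moreover have "?N \<subseteq> Idl\<^bsub>RR\<^esub> {a}"
      proof -
        have id: "ideal (Idl\<^bsub>RR\<^esub> {a}) RR" by (rule R.genideal_ideal) (use aS in simp)
        moreover have "a \<in> Idl\<^bsub>RR\<^esub> {a}" using R.genideal_self[of "{a}"] aS by simp
        ultimately show ?thesis using cyc_least ideal_RR_iff by blast
      qed
      ultimately have I: "Idl\<^bsub>RR\<^esub> {a} = ?N" by blast
      have "b \<otimes> y \<in> ?N" by (rule y(3)[OF ab(2)])
      then have "y \<in> ?N" using reg[of 1 y] y(1) I unfolding l by simp
      then show False using y(2) by blast
    qed
    then show "e \<le> 1" using e by (simp add: one_enat_def)
  qed
qed

section \<open>The ring \<open>AA\<close> is again Cohen-Macaulay of dimension one\<close>

definition AA :: "'a set" where "AA = colon Q m m"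

lemma AA_D: "a \<in> AA \<Longrightarrow> a \<in> carrier Q" "a \<in> AA \<Longrightarrow> c \<in> m \<Longrightarrow> a \<otimes> c \<in> m"
  unfolding AA_def colon_def by auto

lemma AA_I: "a \<in> carrier Q \<Longrightarrow> (\<And>c. c \<in> m \<Longrightarrow> a \<otimes> c \<in> m) \<Longrightarrow> a \<in> AA"
  unfolding AA_def colon_def by auto

lemma S_sub_AA: "S \<subseteq> AA" using smodsD(4)[OF m_smod] by (auto intro!: AA_I)

lemma AA_fid: "AA \<in> FI" unfolding AA_def by (rule fids_colon[OF m_fid m_fid])

lemma AA_subring: "subring AA Q"
proof (rule subringI)
  show "AA \<subseteq> carrier Q" using AA_D by auto
  show "\<one> \<in> AA" using S_sub_AA S_one by auto
  show "\<ominus> a \<in> AA" if "a \<in> AA" for a using smodsD(6)[OF fidsD(1)[OF AA_fid] that] .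
  show "a \<oplus> b \<in> AA" if "a \<in> AA" "b \<in> AA" for a b using smodsD(3)[OF fidsD(1)[OF AA_fid] that] .
  show "a \<otimes> b \<in> AA" if ab: "a \<in> AA" "b \<in> AA" for a b
  proof (rule AA_I)
    show "a \<otimes> b \<in> carrier Q" using AA_D(1) ab by simp
    fix c assume c: "c \<in> m"
    have "a \<otimes> b \<otimes> c = a \<otimes> (b \<otimes> c)" using AA_D(1) ab m_carr[OF c] by (simp add: m_assoc)
    then show "a \<otimes> b \<otimes> c \<in> m" using AA_D(2)[OF ab(1) AA_D(2)[OF ab(2) c]] by simp
  qed
qed

lemma AA_frac_ring: "frac_ring Q AA"
proof (intro frac_ring.intro frac_ring_axioms.intro AA_subring cring_axioms)
  fix q assume "q \<in> carrier Q"
  then show "\<exists>s\<in>AA \<inter> Units Q. s \<otimes> q \<in> AA" using frac S_sub_AA by blast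
qed

lemma smods_AA: "N \<in> smods Q AA \<Longrightarrow> N \<in> SM"
  using S_sub_AA unfolding smods_def by blast

text \<open>\<open>AA\<close> has a common denominator over S, which composes with denominators over
  \<open>AA\<close>.\<close>

lemma fids_AA: "N \<in> fids Q AA \<Longrightarrow> N \<in> FI"
proof -
  assume N: "N \<in> fids Q AA"
  interpret A: frac_ring Q AA by (rule AA_frac_ring)
  note NM = smods_AA[OF A.fidsD(1)[OF N]]
  obtain u where u: "u \<in> N" "u \<in> Units Q" using A.fidsD(2)[OF N] by blast
  obtain s where s: "s \<in> AA" "s \<in> Units Q" "\<And>a. a \<in> N \<Longrightarrow> s \<otimes> a \<in> AA" using A.fidsD(3)[OF N] by blast
  obtain t where t: "t \<in> S" "t \<in> Units Q" "\<And>a. a \<in> AA \<Longrightarrow> t \<otimes> a \<in> S" using fidsD(3)[OF AA_fid] by blast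
  show ?thesis
  proof (rule fidsI[where s="t \<otimes> s", OF NM u])
    fix a assume a: "a \<in> N"
    have "t \<otimes> s \<otimes> a = t \<otimes> (s \<otimes> a)" using t(1) AA_D(1)[OF s(1)] smodsD(1)[OF NM a] by (simp add: m_assoc)
    then show "t \<otimes> s \<otimes> a \<in> S" using t(3)[OF s(3)[OF a]] by simp
  qed (use t s in auto)
qed

lemma fids_AA_iff: "N \<in> smods Q AA \<Longrightarrow> N \<in> FI \<Longrightarrow> N \<in> fids Q AA"
  using S_sub_AA unfolding fids_def by blast

text \<open>The ring is Noetherian because x \<open>AA\<close> \<subseteq> S for x in m. The socle
  axiom comes from finiteness of S-lengths, without a dimension count for \<open>AA\<close>.\<close>

lemma AA_cm_one:
  assumes loc: "local_ring (Q\<lparr>carrier := AA\<rparr>) M"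
  shows "cm_one Q AA M"
proof -
  interpret A: frac_ring Q AA by (rule AA_frac_ring)
  have mx: "maximalideal M A.RR" using loc unfolding local_ring_def by blast
  have M: "M \<in> smods Q AA" "M \<subseteq> AA" using maximalideal.axioms(1)[OF mx] A.ideal_RR_iff by auto
  have M1: "\<one> \<notin> M"
  proof
    assume M1: "\<one> \<in> M"
    have "t \<in> M" if t: "t \<in> AA" for t using A.smodsD(4)[OF M(1) t M1] AA_D(1)[OF t] by simp
    then show False using maximalideal.I_notcarr[OF mx] M(2) by auto
  qed
  obtain x where x: "x \<in> m" "x \<in> Units Q" using nzd by blast
  have noeth: "\<exists>N\<in>X. \<forall>N'\<in>X. N \<subseteq> N' \<longrightarrow> N' = N" if X: "X \<noteq> {}" "X \<subseteq> {N \<in> smods Q AA. N \<subseteq> AA}" for X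
  proof (rule noeth_frac[OF X(1) _ x(2)])
    fix N assume N: "N \<in> X"
    then have NA: "N \<in> smods Q AA" "N \<subseteq> AA" using X(2) by auto
    show "N \<in> SM" by (rule smods_AA[OF NA(1)])
    fix a assume "a \<in> N"
    then have a: "a \<in> AA" using NA(2) by auto
    have "x \<otimes> a = a \<otimes> x" using m_comm[OF m_carr[OF x(1)] AA_D(1)[OF a]] .
    then show "x \<otimes> a \<in> S" using AA_D(2)[OF a x(1)] m_sub by auto
  qed
  have lc: "s \<in> Units Q \<and> inv s \<in> AA" if "s \<in> AA" "s \<notin> M" for s
    using A.maximal_in_noeth[OF noeth loc that] by blast
  have om: "\<one> \<ominus> a \<in> Units Q \<and> inv (\<one> \<ominus> a) \<in> AA" if a: "a \<in> M" for a
  proof (rule lc)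
    show "\<one> \<ominus> a \<in> AA" using A.S_minus[OF A.S_one] a M(2) by auto
    show "\<one> \<ominus> a \<notin> M"
    proof
      assume "\<one> \<ominus> a \<in> M"
      then have "(\<one> \<ominus> a) \<oplus> a \<in> M" using A.smodsD(3)[OF M(1) _ a] by blast
      moreover have "(\<one> \<ominus> a) \<oplus> a = \<one>" using A.smodsD(1)[OF M(1) a] by algebra
      ultimately show False using M1 by simp
    qed
  qed
  have "cm_one_axioms Q AA M"
  proof (rule cm_one_axioms.intro)
    show "M \<in> smods Q AA" "M \<subseteq> AA" "\<one> \<notin> M" by (rule M M1)+
    \<comment> \<open>Otherwise the inverse of x would map m into m, and 1 would lie in m.\<close>
    have "x \<in> M"
    proof (rule ccontr)
      assume "x \<notin> M"
      moreover have "x \<in> AA" using x(1) m_sub S_sub_AA by auto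
      ultimately have "inv x \<in> AA" using lc by blast
      then have "inv x \<otimes> x \<in> m" using AA_D(2) x(1) by blast
      then show False using x(2) one_notin_m by simp
    qed
    then show "\<exists>x\<in>M. x \<in> Units Q" using x(2) by blast
  next
    fix s assume "s \<in> AA" "s \<notin> M"
    then show "s \<in> Units Q \<and> inv s \<in> AA" by (rule lc)
  next
    fix X assume X: "X \<noteq> {}" "X \<subseteq> {N \<in> smods Q AA. N \<subseteq> AA}"
    show "\<exists>N\<in>X. \<forall>N'\<in>X. N \<subseteq> N' \<longrightarrow> N' = N" by (rule noeth[OF X])
  next
    fix N u assume N: "N \<in> smods Q AA" "N \<subseteq> AA" "u \<in> N" "u \<in> Units Q" "N \<noteq> AA"
    have NF: "N \<in> fids Q AA" by (rule A.fids_sub_S[OF N(1-4)])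
    let ?N = "\<lambda>y. msum Q N (scal Q y AA)"
    have NyF: "?N y \<in> FI" if "y \<in> AA" for y by (rule fids_AA[OF A.fids_add_cyc[OF NF AA_D(1)[OF that]]])
    obtain y0 where y0: "y0 \<in> AA - N" using N(2,5) by blast
    \<comment> \<open>For y of least length over N, each a y with a in M lies in N: otherwise a y
      generates the same module as y over N, and (1 - t a) y \<in> N for some t, where 1 - t a is a
      unit.\<close>
    obtain y where y: "y \<in> AA - N" and ymin: "\<And>z. z \<in> AA - N \<Longrightarrow> lenn N (?N y) \<le> lenn N (?N z)"
      using ex_has_least_nat[of "\<lambda>z. z \<in> AA - N" y0 "\<lambda>z. lenn N (?N z)"] y0 by blast
    have yA: "y \<in> AA" and yc: "y \<in> carrier Q" using y AA_D(1) by auto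
    note yS = A.scal_smod[OF A.S_smod yc]
    have "a \<otimes> y \<in> N" if a: "a \<in> M" for a
    proof (rule ccontr)
      assume n: "a \<otimes> y \<notin> N"
      have aA: "a \<in> AA" and ac: "a \<in> carrier Q" using a M(2) AA_D(1) by auto
      have ayA: "a \<otimes> y \<in> AA" by (rule A.S_mult[OF aA yA])
      have ayc: "a \<otimes> y \<in> carrier Q" using AA_D(1)[OF ayA] .
      note ayS = A.scal_smod[OF A.S_smod ayc]
      have "a \<otimes> y \<in> ?N y" using A.msum_right[OF N(1) yS] A.smodsD(4)[OF yS aA A.cyc_mem[OF yc]] by blast
      then have sub: "?N (a \<otimes> y) \<subseteq> ?N y"
        by (intro A.msum_least[OF A.msum_smod[OF N(1) yS] A.msum_left[OF N(1) yS]] A.cyc_least[OF A.msum_smod[OF N(1) yS]])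
      have "lenn N (?N y) \<le> lenn N (?N (a \<otimes> y))" using ymin[of "a \<otimes> y"] n ayA by blast
      then have "lenn (?N (a \<otimes> y)) (?N y) = 0"
        using lenn_add[OF fids_AA[OF NF] NyF[OF ayA] NyF[OF yA] A.msum_left[OF N(1) ayS] sub] by simp
      then have "?N (a \<otimes> y) = ?N y" by (rule lenn_0_imp[OF NyF[OF ayA] NyF[OF yA] sub])
      then have "y \<in> ?N (a \<otimes> y)" using A.msum_right[OF N(1) yS] A.cyc_mem[OF yc] by blast
      then obtain b t where bt: "b \<in> N" "t \<in> AA" "y = b \<oplus> (a \<otimes> y) \<otimes> t" by (auto elim!: msumE scalE)
      have bc: "b \<in> carrier Q" and tc: "t \<in> carrier Q" using A.smodsD(1)[OF N(1) bt(1)] AA_D(1)[OF bt(2)] by auto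
      note u = om[OF A.smodsD(4)[OF M(1) bt(2) a]]
      have "(\<one> \<ominus> t \<otimes> a) \<otimes> y = y \<ominus> (a \<otimes> y) \<otimes> t" using ac yc tc by algebra
      also have "\<dots> = (b \<oplus> (a \<otimes> y) \<otimes> t) \<ominus> (a \<otimes> y) \<otimes> t" using bt(3) by simp
      also have "\<dots> = b" using ac yc tc bc by algebra
      finally have "inv (\<one> \<ominus> t \<otimes> a) \<otimes> ((\<one> \<ominus> t \<otimes> a) \<otimes> y) \<in> N" using A.smodsD(4)[OF N(1) _ bt(1)] u by simp
      then have "y \<in> N" using u yc by (simp add: m_assoc[symmetric] Units_closed)
      then show False using y by simp
    qed
    then show "\<exists>y\<in>AA - N. \<forall>a\<in>M. a \<otimes> y \<in> N" using y by blast
  qed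
  then show ?thesis using cm_one.intro[OF AA_frac_ring] by blast
qed

text \<open>Two strict inclusions of primes of \<open>AA\<close> would contract to two in S. The
  middle prime misses x, and x \<open>AA\<close> \<subseteq> S, so multiplication by x pushes a
  witness of the first strict inclusion into S.\<close>

lemma AA_cohen_macaulay:
  assumes loc: "local_ring (Q\<lparr>carrier := AA\<rparr>) M" and lr: "local_ring RR m" and dim: "krull_dim RR = 1"
    and nz: "nonzerodivisors RR \<subseteq> Units Q"
  shows "krull_dim (Q\<lparr>carrier := AA\<rparr>) = 1" "cohen_macaulay_local (Q\<lparr>carrier := AA\<rparr>) M"
proof -
  interpret A: cm_one Q AA M by (rule AA_cm_one[OF loc])
  obtain x where x: "x \<in> m" "x \<in> Units Q" using nzd by blast
  have xA: "x \<in> AA" using x(1) m_sub S_sub_AA by auto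
  have xS: "x \<in> S" using x(1) m_sub by auto
  have Mpr: "primeideal M A.RR" by (rule A.m_prime[OF loc])
  have contr: "primeideal (P \<inter> S) RR" if P: "primeideal P A.RR" for P
  proof -
    have PD: "P \<in> smods Q AA" "P \<subseteq> AA" "P \<noteq> AA" "\<And>a b. a \<in> AA \<Longrightarrow> b \<in> AA \<Longrightarrow> a \<otimes> b \<in> P \<Longrightarrow> a \<in> P \<or> b \<in> P"
      using P A.primeideal_RR_iff by auto
    have "\<one> \<notin> P" using A.proper_sub_m[OF PD(1-3)] A.one_notin_m by blast
    then show ?thesis unfolding primeideal_RR_iff using Int_smod[OF smods_AA[OF PD(1)] S_smod] PD(4) S_sub_AA S_one by blast
  qed
  show kd: "krull_dim (Q\<lparr>carrier := AA\<rparr>) = 1"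
  proof (rule antisym)
    show "krull_dim (Q\<lparr>carrier := AA\<rparr>) \<le> 1"
    proof (rule krull_dim_leI)
      fix P0 P1 P2 assume P: "primeideal P0 A.RR" "primeideal P1 A.RR" "primeideal P2 A.RR" "P0 \<subset> P1" "P1 \<subset> P2"
      have P2: "P2 \<subseteq> M" using A.proper_sub_m P(3) A.primeideal_RR_iff by blast
      have xP1: "x \<notin> P1" using A.regular_prime_eq_m[OF P(2) _ x(2)] P(5) P2 by blast
      obtain a where a: "a \<in> P1" "a \<notin> P0" using P(4) by blast
      have P1D: "P1 \<in> smods Q AA" "P1 \<subseteq> AA" using P(2) A.primeideal_RR_iff by auto
      have aA: "a \<in> AA" using a(1) P1D(2) by blast
      have "x \<otimes> a = a \<otimes> x" using m_comm[OF m_carr[OF x(1)] AA_D(1)[OF aA]] .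
      then have xaS: "x \<otimes> a \<in> S" using AA_D(2)[OF aA x(1)] m_sub by auto
      have "x \<otimes> a \<in> P1" by (rule A.smodsD(4)[OF P1D(1) xA a(1)])
      moreover have "x \<otimes> a \<notin> P0" using P(1) A.primeideal_RR_iff xA aA a(2) xP1 P(4) by blast
      ultimately have 1: "P0 \<inter> S \<subset> P1 \<inter> S" using P(4) xaS by blast
      have "P1 \<inter> S \<subseteq> m" by (rule proper_sub_m) (use contr[OF P(2)] in \<open>simp_all add: primeideal_RR_iff\<close>)
      then have 2: "P1 \<inter> S \<subset> m" using xP1 x(1) by blast
      show False by (rule no_chain_two[OF dim contr[OF P(1)] contr[OF P(2)] m_prime[OF lr] 1 2])
    qed
    obtain xx where xx: "xx \<in> M" "xx \<in> Units Q" using A.nzd by blast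
    obtain P where P: "primeideal P A.RR" "xx \<notin> P" using A.prime_without_unit[OF xx] by blast
    have "P \<subseteq> M" by (rule A.proper_sub_m) (use P(1) in \<open>simp_all add: A.primeideal_RR_iff\<close>)
    then have "P \<subset> M" using P(2) xx(1) by blast
    then have "enat 1 \<le> krull_dim A.RR"
      by (intro krull_dim_ge[of 1 "\<lambda>i. if i = 0 then P else M"]) (use P(1) Mpr in auto)
    then show "1 \<le> krull_dim (Q\<lparr>carrier := AA\<rparr>)" by (simp add: one_enat_def)
  qed
  have "depth A.RR M = 1"
  proof (rule A.depth_eq_one)
    fix a assume a: "a \<in> AA" and na: "\<And>b. b \<in> AA \<Longrightarrow> a \<otimes> b = \<zero> \<Longrightarrow> b = \<zero>"
    have ac: "a \<in> carrier Q" using AA_D(1)[OF a] .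
    obtain s where s: "s \<in> S" "s \<in> Units Q" "s \<otimes> a \<in> S" using frac[OF ac] by blast
    have "s \<otimes> a \<in> nonzerodivisors RR"
      unfolding nonzerodivisors_def
    proof (intro CollectI conjI ballI impI)
      show "s \<otimes> a \<in> carrier RR" using s by simp
      fix b assume b: "b \<in> carrier RR" "(s \<otimes> a) \<otimes>\<^bsub>RR\<^esub> b = \<zero>\<^bsub>RR\<^esub>"
      have bS: "b \<in> S" using b(1) by simp
      have "a \<otimes> (s \<otimes> b) = (s \<otimes> a) \<otimes> b" using ac s(1) bS by (simp add: m_ac)
      then have "a \<otimes> (s \<otimes> b) = \<zero>" using b(2) by simp
      then have "s \<otimes> b = \<zero>" using na S_mult[OF s(1) bS] S_sub_AA by blast
      then have "s \<otimes> b = s \<otimes> \<zero>" using s(1) by simp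
      then show "b = \<zero>\<^bsub>RR\<^esub>" using Units_l_cancel[OF s(2) S_carr[OF bS] zero_closed] by simp
    qed
    then have "s \<otimes> a \<in> Units Q" using nz by blast
    then have "a \<otimes> s \<in> Units Q" using m_comm[OF S_carr[OF s(1)] ac] by simp
    then show "a \<in> Units Q" using Units_mult_left[OF _ ac S_carr[OF s(1)]] by blast
  qed
  then show "cohen_macaulay_local (Q\<lparr>carrier := AA\<rparr>) M"
    unfolding cohen_macaulay_local_def using loc A.RR_noetherian kd by simp
qed

end

section \<open>The endomorphism ring of the maximal ideal\<close>

locale local_AA = cm_one Q S m for Q (structure) and S and m +
  fixes M
  assumes AA_local: "local_ring (Q\<lparr>carrier := AA\<rparr>) M"
begin

interpretation A: cm_one Q AA M by (rule AA_cm_one[OF AA_local])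

lemma M_FI: "M \<in> FI" by (rule fids_AA[OF A.m_fid])

lemma m_sub_M: "m \<subseteq> M"
proof (rule A.proper_sub_m)
  show "m \<in> smods Q AA"
    by (rule A.smodsI) (use m_carr smodsD(2,3)[OF m_smod] AA_D(2) in auto)
  show "m \<subseteq> AA" using m_sub S_sub_AA by auto
  show "m \<noteq> AA" using one_notin_m A.S_one by auto
qed

text \<open>As m \<subseteq> M, the image of S in AA / M is a copy of the residue field, and each
  step of length one adds one vector to a basis over it.\<close>

lemma residue_degree_eq_lenn: "residue_degree RR (Q\<lparr>carrier := AA\<rparr>) M = lenn M AA"
proof -
  let ?F = "A.RR Quot M"
  let ?c = "\<lambda>x. M +>\<^bsub>A.RR\<^esub> x"
  have mx: "maximalideal M A.RR" using AA_local unfolding local_ring_def by blast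
  interpret I: ideal M A.RR by (rule maximalideal.axioms(1)[OF mx])
  interpret F: field ?F by (rule maximalideal.quotient_is_field[OF mx A.RR_cring])
  have cadd: "?c x \<oplus>\<^bsub>?F\<^esub> ?c y = ?c (x \<oplus> y)" if "x \<in> AA" "y \<in> AA" for x y
    using I.a_rcos_sum[of x y] that by (simp add: FactRing_def)
  have cmult: "?c x \<otimes>\<^bsub>?F\<^esub> ?c y = ?c (x \<otimes> y)" if "x \<in> AA" "y \<in> AA" for x y
    using I.rcoset_mult_add[of x y] that by (simp add: FactRing_def)
  have mem: "z \<in> ?c x \<longleftrightarrow> (\<exists>a\<in>M. z = a \<oplus> x)" for z x by (auto simp: a_r_coset_def')
  have ceq: "x \<ominus> y \<in> M" if xy: "x \<in> AA" "y \<in> AA" "?c x = ?c y" for x y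
  proof -
    have "x \<in> ?c x" unfolding mem using A.smodsD(2)[OF A.m_smod] AA_D(1)[OF xy(1)] by (intro bexI[of _ \<zero>]) auto
    then have "x \<in> ?c y" using xy(3) by simp
    then obtain a where a: "a \<in> M" "x = a \<oplus> y" unfolding mem by (rule bexE)
    have "x \<ominus> y = a" unfolding a(2) using A.m_carr[OF a(1)] AA_D(1)[OF xy(2)] by algebra
    then show ?thesis using a(1) by simp
  qed
  have cM: "?c x = M" if x: "x \<in> M" for x
  proof (rule antisym; rule subsetI)
    fix z assume "z \<in> ?c x"
    then obtain a where "a \<in> M" "z = a \<oplus> x" unfolding mem by (rule bexE)
    then show "z \<in> M" using A.smodsD(3)[OF A.m_smod _ x] by simp
  next
    fix z assume z: "z \<in> M"
    have "z = (z \<ominus> x) \<oplus> x" using A.m_carr[OF z] A.m_carr[OF x] by algebra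
    then show "z \<in> ?c x" unfolding mem by (rule bexI) (rule A.smodsD(7)[OF A.m_smod z x])
  qed
  have zero: "\<zero>\<^bsub>?F\<^esub> = M" and one: "\<one>\<^bsub>?F\<^esub> = ?c \<one>" by (simp_all add: FactRing_def)
  have carr: "carrier ?F = ?c ` AA" by (auto simp: FactRing_def A_RCOSETS_def')
  have SA: "s \<in> AA" if "s \<in> S" for s using S_sub_AA that by auto
  have sf: "subfield (?c ` S) ?F"
  proof (rule F.subfieldI'[OF F.subringI])
    show "?c ` S \<subseteq> carrier ?F" unfolding carr using S_sub_AA by auto
    show "\<one>\<^bsub>?F\<^esub> \<in> ?c ` S" unfolding one using S_one by auto
  next
    fix h assume "h \<in> ?c ` S"
    then obtain s where s: "s \<in> S" "h = ?c s" by auto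
    have "?c (\<ominus> s) \<oplus>\<^bsub>?F\<^esub> ?c s = \<zero>\<^bsub>?F\<^esub>"
      using cadd[OF SA[OF S_neg[OF s(1)]] SA[OF s(1)]] cM[OF A.smodsD(2)[OF A.m_smod]] s(1) zero by (simp add: l_neg)
    then have "\<ominus>\<^bsub>?F\<^esub> h = ?c (\<ominus> s)"
      unfolding s(2) by (rule F.minus_equality) (use carr SA[OF s(1)] SA[OF S_neg[OF s(1)]] in auto)
    then show "\<ominus>\<^bsub>?F\<^esub> h \<in> ?c ` S" using S_neg[OF s(1)] by auto
  next
    fix h h' assume "h \<in> ?c ` S" "h' \<in> ?c ` S"
    then obtain s t where s: "s \<in> S" "h = ?c s" "t \<in> S" "h' = ?c t" by auto
    show "h \<otimes>\<^bsub>?F\<^esub> h' \<in> ?c ` S" unfolding s(2,4) cmult[OF SA[OF s(1)] SA[OF s(3)]] using S_mult[OF s(1,3)] by auto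
    show "h \<oplus>\<^bsub>?F\<^esub> h' \<in> ?c ` S" unfolding s(2,4) cadd[OF SA[OF s(1)] SA[OF s(3)]] using S_add[OF s(1,3)] by auto
  next
    fix h assume "h \<in> ?c ` S - {\<zero>\<^bsub>?F\<^esub>}"
    then obtain s where s: "s \<in> S" "h = ?c s" "h \<noteq> M" using zero by auto
    have "s \<notin> m" using cM[of s] s(2,3) m_sub_M by auto
    then have i: "s \<in> Units Q" "inv s \<in> S" using loc[OF s(1)] by auto
    have "h \<otimes>\<^bsub>?F\<^esub> ?c (inv s) = \<one>\<^bsub>?F\<^esub>" unfolding s(2) one cmult[OF SA[OF s(1)] SA[OF i(2)]] using i(1) by simp
    then have "inv\<^bsub>?F\<^esub> h = ?c (inv s)"
      by (intro F.comm_inv_char) (use carr s(2) SA[OF s(1)] SA[OF i(2)] in auto)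
    then show "inv\<^bsub>?F\<^esub> h \<in> ?c ` S" using i(2) by auto
  qed
  \<comment> \<open>The induction runs over all S-submodules between M and \<open>AA\<close>: below
    N there is a maximal L, and N = L + S y with m y \<subseteq> L.\<close>
  have dimen: "F.dimension n (?c ` S) (?c ` N)" if "N \<in> SM" "M \<subseteq> N" "N \<subseteq> AA" "lenn M N = n" for n N
    using that
  proof (induction n arbitrary: N)
    case 0
    have "M = N" by (rule lenn_0_imp[OF M_FI fids_between[OF 0(1) M_FI AA_fid 0(2,3)] 0(2,4)])
    then have "?c ` N = {\<zero>\<^bsub>?F\<^esub>}" using cM zero A.smodsD(2)[OF A.m_smod] by auto
    then show ?case using F.zero_dim by simp
  next
    case (Suc n)
    have NF: "N \<in> FI" by (rule fids_between[OF Suc(2) M_FI AA_fid Suc(3,4)])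
    have ne: "M \<noteq> N" using Suc(5) unfolding lenn_def by (auto simp: zero_enat_def)
    let ?X = "{L \<in> SM. M \<subseteq> L \<and> L \<subset> N}"
    obtain s where s: "s \<in> Units Q" "\<And>a. a \<in> AA \<Longrightarrow> s \<otimes> a \<in> S" using fidsD(3)[OF AA_fid] by blast
    have "\<exists>L\<in>?X. \<forall>L'\<in>?X. L \<subseteq> L' \<longrightarrow> L' = L"
    proof (rule noeth_frac[OF _ _ s(1)])
      show "?X \<noteq> {}" using fidsD(1)[OF M_FI] Suc(3) ne by blast
      show "s \<otimes> a \<in> S" if "L \<in> ?X" "a \<in> L" for L a using s(2) that Suc(4) by blast
    qed auto
    then obtain L where LX: "L \<in> ?X" and Lmax: "\<forall>L'\<in>?X. L \<subseteq> L' \<longrightarrow> L' = L" by (rule bexE)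
    have L: "L \<in> SM" "M \<subseteq> L" "L \<subseteq> N" "L \<noteq> N" using LX by auto
    have LF: "L \<in> FI" by (rule fids_between[OF L(1) M_FI NF L(2,3)])
    obtain y where y: "y \<in> N" "y \<notin> L" "\<And>a. a \<in> m \<Longrightarrow> a \<otimes> y \<in> L" using soc_module[OF LF Suc(2) L(3,4)] by blast
    have yc: "y \<in> carrier Q" using smodsD(1)[OF Suc(2) y(1)] .
    have yA: "y \<in> AA" using y(1) Suc(4) by auto
    note yS = scal_smod[OF S_smod yc]
    let ?L = "msum Q L (scal Q y S)"
    have sub: "?L \<subseteq> N" by (rule msum_least[OF Suc(2) L(3) cyc_least[OF Suc(2) y(1)]])
    have yL: "y \<in> ?L" using msum_right[OF L(1) yS] cyc_mem[OF yc] by auto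
    have N: "?L = N"
    proof (rule ccontr)
      assume "?L \<noteq> N"
      then have "?L \<in> ?X" using msum_smod[OF L(1) yS] msum_left[OF L(1) yS] L(2) sub by blast
      then have "?L = L" using Lmax msum_left[OF L(1) yS] by blast
      then show False using yL y(2) by simp
    qed
    have "len L N = 1" using len_step[OF L(1) yc y(2,3)] N by simp
    then have "lenn L N = 1" unfolding lenn_def by (simp add: one_enat_def)
    then have "lenn M L = n" using lenn_add[OF M_FI LF NF L(2,3)] Suc(5) by linarith
    then have IH: "F.dimension n (?c ` S) (?c ` L)" using Suc(1)[OF L(1,2)] L(3) Suc(4) by auto
    have LA: "l \<in> AA" if "l \<in> L" for l using that L(3) Suc(4) by auto
    have ny: "?c y \<notin> ?c ` L"
    proof
      assume "?c y \<in> ?c ` L"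
      then obtain l where l: "l \<in> L" "?c y = ?c l" by auto
      have "y \<ominus> l \<in> L" using ceq[OF yA LA[OF l(1)] l(2)] L(2) by auto
      then have "(y \<ominus> l) \<oplus> l \<in> L" using smodsD(3)[OF L(1) _ l(1)] by blast
      moreover have "(y \<ominus> l) \<oplus> l = y" using yc smodsD(1)[OF L(1) l(1)] by algebra
      ultimately show False using y(2) by simp
    qed
    have "F.line_extension (?c ` S) (?c y) (?c ` L) = ?c ` N"
    proof (rule Set.set_eqI)
      fix u
      have ex: "?c s \<otimes>\<^bsub>?F\<^esub> ?c y \<oplus>\<^bsub>?F\<^esub> ?c l = ?c (l \<oplus> y \<otimes> s)" if sl: "s \<in> S" "l \<in> L" for s l
      proof -
        have "?c s \<otimes>\<^bsub>?F\<^esub> ?c y \<oplus>\<^bsub>?F\<^esub> ?c l = ?c (s \<otimes> y \<oplus> l)"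
          using cmult[OF SA[OF sl(1)] yA] cadd[OF A.S_mult[OF SA[OF sl(1)] yA] LA[OF sl(2)]] by simp
        moreover have "s \<otimes> y \<oplus> l = l \<oplus> y \<otimes> s" using S_carr[OF sl(1)] yc smodsD(1)[OF L(1) sl(2)] by algebra
        ultimately show ?thesis by simp
      qed
      have "u \<in> F.line_extension (?c ` S) (?c y) (?c ` L) \<longleftrightarrow> (\<exists>s\<in>S. \<exists>l\<in>L. u = ?c (l \<oplus> y \<otimes> s))"
        unfolding F.line_extension_mem_iff using ex by simp
      also have "\<dots> \<longleftrightarrow> u \<in> ?c ` ?L" unfolding msum_def scal_def by blast
      finally show "u \<in> F.line_extension (?c ` S) (?c y) (?c ` L) \<longleftrightarrow> u \<in> ?c ` N" unfolding N .
    qed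
    then show ?case using F.Suc_dim[OF _ ny IH] carr yA by auto
  qed
  have "F.dim (?c ` S) (?c ` AA) = lenn M AA"
    using F.dimI[OF sf dimen[OF fidsD(1)[OF AA_fid] A.m_sub order_refl refl]] unfolding over_def by simp
  then show ?thesis unfolding residue_degree_def carr by simp
qed

section \<open>Lengths over S and over \<open>AA\<close>\<close>

text \<open>Multiplication by y identifies AA / M with (N + y AA) / N, since a y \<in> N exactly for
  a \<in> M; the two maps are image and preimage of S-submodules.\<close>

lemma len_AA_step:
  assumes N: "N \<in> smods Q AA" and y: "y \<in> carrier Q" "y \<notin> N" "\<And>a. a \<in> M \<Longrightarrow> a \<otimes> y \<in> N"
  shows "len N (msum Q N (scal Q y AA)) = len M AA"
proof (rule antisym)
  note NS = smods_AA[OF N]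
  note AS = fidsD(1)[OF AA_fid]
  have yM: "a \<in> M" if a: "a \<in> AA" "a \<otimes> y \<in> N" for a
  proof (rule ccontr)
    assume "a \<notin> M"
    then have i: "a \<in> Units Q" "inv a \<in> AA" using A.loc[OF a(1)] by auto
    have "inv a \<otimes> (a \<otimes> y) \<in> N" by (rule A.smodsD(4)[OF N i(2) a(2)])
    then show False using i y(1,2) by (simp add: m_assoc[symmetric] Units_closed)
  qed
  show "len M AA \<le> len N (msum Q N (scal Q y AA))"
  proof (rule chain_len_mono_map[where \<Phi>="\<lambda>L. msum Q N (scal Q y L)"])
    fix L assume L: "L \<in> SM" "M \<subseteq> L" "L \<subseteq> AA"
    note yL = scal_smod[OF L(1) y(1)] and yA = scal_smod[OF AS y(1)]
    show "msum Q N (scal Q y L) \<in> SM \<and> N \<subseteq> msum Q N (scal Q y L) \<and> msum Q N (scal Q y L) \<subseteq> msum Q N (scal Q y AA)"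
      using msum_smod[OF NS yL] msum_left[OF NS yL] msum_mono[OF order_refl scal_mono[OF L(3)]] by blast
  next
    fix L L' assume L: "L \<in> SM" "M \<subseteq> L" "L' \<subseteq> AA" "L' \<in> SM" "L \<subset> L'"
    obtain t where t: "t \<in> L'" "t \<notin> L" using L(5) by blast
    have tA: "t \<in> AA" using t(1) L(3) by auto
    have "y \<otimes> t \<in> msum Q N (scal Q y L')" using msum_right[OF NS scal_smod[OF L(4) y(1)]] scalI[OF t(1)] by blast
    moreover have "y \<otimes> t \<notin> msum Q N (scal Q y L)"
    proof
      assume "y \<otimes> t \<in> msum Q N (scal Q y L)"
      then obtain n l where nl: "n \<in> N" "l \<in> L" "y \<otimes> t = n \<oplus> y \<otimes> l" by (auto elim!: msumE scalE)
      have c: "n \<in> carrier Q" "l \<in> carrier Q" "t \<in> carrier Q"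
        using smodsD(1)[OF NS nl(1)] smodsD(1)[OF L(1) nl(2)] AA_D(1)[OF tA] by auto
      have "(t \<ominus> l) \<otimes> y = y \<otimes> t \<ominus> y \<otimes> l" using c y(1) by algebra
      also have "\<dots> = n" unfolding nl(3) using c y(1) by algebra
      finally have "t \<ominus> l \<in> M" using yM[of "t \<ominus> l"] A.S_minus[OF tA, of l] nl(1,2) L(3,5) by auto
      then have "(t \<ominus> l) \<oplus> l \<in> L" using smodsD(3)[OF L(1) _ nl(2)] L(2) by blast
      moreover have "(t \<ominus> l) \<oplus> l = t" using c by algebra
      ultimately show False using t(2) by simp
    qed
    moreover have "msum Q N (scal Q y L) \<subseteq> msum Q N (scal Q y L')"
      using msum_mono[OF order_refl scal_mono] L(5) by blast
    ultimately show "msum Q N (scal Q y L) \<subset> msum Q N (scal Q y L')" by blast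
  qed
  show "len N (msum Q N (scal Q y AA)) \<le> len M AA"
  proof (rule chain_len_mono_map[where \<Phi>="\<lambda>K. {a \<in> AA. a \<otimes> y \<in> K}"])
    fix K assume K: "K \<in> SM" "N \<subseteq> K"
    note D = smodsD[OF K(1)]
    have "{a \<in> AA. a \<otimes> y \<in> K} \<in> SM"
    proof (rule smodsI)
      show "{a \<in> AA. a \<otimes> y \<in> K} \<subseteq> carrier Q" using AA_D(1) by auto
      show "\<zero> \<in> {a \<in> AA. a \<otimes> y \<in> K}" using A.S_zero D(2) y(1) by simp
      show "a \<oplus> b \<in> {a \<in> AA. a \<otimes> y \<in> K}" if "a \<in> {a \<in> AA. a \<otimes> y \<in> K}" "b \<in> {a \<in> AA. a \<otimes> y \<in> K}" for a b
        using that A.S_add D(3) AA_D(1) y(1) by (simp add: l_distr)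
      show "s \<otimes> a \<in> {a \<in> AA. a \<otimes> y \<in> K}" if "s \<in> S" "a \<in> {a \<in> AA. a \<otimes> y \<in> K}" for s a
        using that smodsD(4)[OF AS] D(4) AA_D(1) y(1) by (simp add: m_assoc)
    qed
    moreover have "M \<subseteq> {a \<in> AA. a \<otimes> y \<in> K}" using y(3) K(2) A.m_sub by blast
    ultimately show "{a \<in> AA. a \<otimes> y \<in> K} \<in> SM \<and> M \<subseteq> {a \<in> AA. a \<otimes> y \<in> K} \<and> {a \<in> AA. a \<otimes> y \<in> K} \<subseteq> AA" by blast
  next
    fix K K' assume K: "K \<in> SM" "N \<subseteq> K" "K' \<subseteq> msum Q N (scal Q y AA)" "K' \<in> SM" "K \<subset> K'"
    obtain x where x: "x \<in> K'" "x \<notin> K" using K(5) by blast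
    obtain n a where na: "n \<in> N" "a \<in> AA" "x = n \<oplus> y \<otimes> a" using x(1) K(3) by (auto elim!: msumE scalE)
    have c: "n \<in> carrier Q" "a \<in> carrier Q" using smodsD(1)[OF NS na(1)] AA_D(1)[OF na(2)] by auto
    have "x \<ominus> n = a \<otimes> y" unfolding na(3) using c y(1) by algebra
    then have "a \<otimes> y \<in> K'" using smodsD(7)[OF K(4) x(1), of n] na(1) K(2,5) by auto
    moreover have "a \<otimes> y \<notin> K"
    proof
      assume "a \<otimes> y \<in> K"
      then have "n \<oplus> a \<otimes> y \<in> K" using smodsD(3)[OF K(1), of n] na(1) K(2) by auto
      then show False using x(2) na(3) m_comm[OF y(1) c(2)] by simp
    qed
    ultimately show "{a \<in> AA. a \<otimes> y \<in> K} \<subset> {a \<in> AA. a \<otimes> y \<in> K'}" using K(5) na(2) by blast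
  qed
qed

text \<open>Each simple step over \<open>AA\<close> has the S-length of AA / M; the induction peels
  off one socle element at a time.\<close>

lemma lenn_AA:
  assumes "N1 \<in> fids Q AA" "N2 \<in> fids Q AA" "N1 \<subseteq> N2"
  shows "lenn N1 N2 = lenn M AA * A.lenn N1 N2"
  using assms
proof (induction "A.lenn N1 N2" arbitrary: N1)
  case 0
  have "N1 = N2" using A.lenn_0_imp[OF 0(2-4)] 0(1) by simp
  then show ?case unfolding lenn_def A.lenn_def by (simp add: zero_enat_def)
next
  case (Suc k)
  have ne: "N1 \<noteq> N2" using Suc(2) unfolding A.lenn_def by (auto simp: zero_enat_def)
  note NA = A.fidsD(1)[OF Suc(3)] A.fidsD(1)[OF Suc(4)]
  obtain y where y: "y \<in> N2" "y \<notin> N1" "\<And>a. a \<in> M \<Longrightarrow> a \<otimes> y \<in> N1" using A.soc_module[OF Suc(3) NA(2) Suc(5) ne] by blast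
  have yc: "y \<in> carrier Q" using A.smodsD(1)[OF NA(2) y(1)] .
  note yA = A.scal_smod[OF A.S_smod yc]
  let ?N = "msum Q N1 (scal Q y AA)"
  have NF: "?N \<in> fids Q AA" by (rule A.fids_add_cyc[OF Suc(3) yc])
  have sub: "N1 \<subseteq> ?N" "?N \<subseteq> N2"
    using A.msum_left[OF NA(1) yA] A.msum_least[OF NA(2) Suc(5) A.cyc_least[OF NA(2) y(1)]] by auto
  have "A.lenn N1 ?N = 1" unfolding A.lenn_def using A.len_step[OF NA(1) yc y(2,3)] by (simp add: one_enat_def)
  then have k: "k = A.lenn ?N N2" using A.lenn_add[OF Suc(3) NF Suc(4) sub] Suc(2) by linarith
  have "lenn N1 N2 = lenn N1 ?N + lenn ?N N2"
    by (rule lenn_add[OF fids_AA[OF Suc(3)] fids_AA[OF NF] fids_AA[OF Suc(4)] sub])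
  also have "lenn N1 ?N = lenn M AA" unfolding lenn_def using len_AA_step[OF NA(1) yc y(2,3)] by simp
  also have "lenn ?N N2 = lenn M AA * k" using Suc(1)[OF k NF Suc(4) sub(2)] k by simp
  finally show ?case using Suc(2)[symmetric] by simp
qed

lemma lenn_M_AA_pos: "0 < lenn M AA"
  using lenn_0_imp[OF M_FI AA_fid A.m_sub] A.one_notin_m A.S_one by auto

text \<open>Since \<open>AA = S : m = C : mC\<close>, duality identifies \<open>mC\<close> with \<open>C : AA\<close>, the canonical module of \<open>AA\<close>.\<close>

lemma dualizing_AA:
  assumes C: "dualizing C" "C \<in> FI" "C \<subseteq> S" and AA_colon: "AA = colon Q S m"
  shows "A.dualizing (m \<cdot> C)" "m \<cdot> C \<in> fids Q AA" "m \<cdot> C \<subseteq> AA" "m \<cdot> C \<subseteq> C"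
proof -
  note CM = fidsD(1)[OF C(2)]
  let ?D = "m \<cdot> C"
  have DF: "?D \<in> FI" by (rule fids_prod[OF m_fid C(2)])
  show DC: "?D \<subseteq> C" by (rule m_prod_sub[OF CM])
  have "colon Q C ?D = AA"
    using prod_comm[OF m_smod CM] colon_prod[OF CM CM m_smod] colon_mult_self[OF C(1)] AA_colon by simp
  then have D: "colon Q C AA = ?D" using bidual[OF C(1) DF] by simp
  have DA: "?D \<in> smods Q AA"
  proof (rule A.smodsI)
    show "?D \<subseteq> carrier Q" using smod_sub[OF fidsD(1)[OF DF]] .
    show "\<zero> \<in> ?D" "\<And>a b. a \<in> ?D \<Longrightarrow> b \<in> ?D \<Longrightarrow> a \<oplus> b \<in> ?D" using smodsD(2,3)[OF fidsD(1)[OF DF]] by auto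
    fix s a assume s: "s \<in> AA" and "a \<in> ?D"
    then have a: "a \<in> carrier Q" "\<And>b. b \<in> AA \<Longrightarrow> a \<otimes> b \<in> C" using D unfolding colon_def by auto
    have "(s \<otimes> a) \<otimes> b \<in> C" if b: "b \<in> AA" for b
    proof -
      have "(s \<otimes> a) \<otimes> b = a \<otimes> (s \<otimes> b)" using AA_D(1)[OF s] AA_D(1)[OF b] a(1) by (simp add: m_ac)
      then show ?thesis using a(2)[OF A.S_mult[OF s b]] by simp
    qed
    then have "s \<otimes> a \<in> colon Q C AA" unfolding colon_def using AA_D(1)[OF s] a(1) by auto
    then show "s \<otimes> a \<in> ?D" using D by simp
  qed
  show DfA: "?D \<in> fids Q AA" by (rule fids_AA_iff[OF DA DF])
  show "?D \<subseteq> AA" using DC C(3) S_sub_AA by auto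
  have mult: "A.qmult ?D I h" if I: "I \<in> fids Q AA" and h: "A.qhom ?D I h" for I h
  proof -
    note IM = A.fidsD(1)[OF I]
    have hD: "\<And>a. a \<in> I \<Longrightarrow> h a \<in> carrier Q" "\<And>s a. s \<in> AA \<Longrightarrow> a \<in> I \<Longrightarrow> h (s \<otimes> a) \<ominus> s \<otimes> h a \<in> ?D"
      using h unfolding A.qhom_def by auto
    have "qhom C I h" using h DC S_sub_AA unfolding A.qhom_def qhom_def by blast
    then have "qmult C I h" using C(1) fids_AA[OF I] unfolding dualizing_def by blast
    then obtain q where q: "q \<in> carrier Q" "\<And>a. a \<in> I \<Longrightarrow> h a \<ominus> q \<otimes> a \<in> C" unfolding qmult_def by blast
    \<comment> \<open>Duality over S gives the congruence modulo C only. For b in \<open>AA\<close>,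
      linearity of h over \<open>AA\<close> turns b (h a - q a) into h (b a) - q (b a) modulo mC, so
      h a - q a lies in C : AA = mC.\<close>
    have "h a \<ominus> q \<otimes> a \<in> ?D" if a: "a \<in> I" for a
    proof -
      have ac: "a \<in> carrier Q" using A.smodsD(1)[OF IM a] .
      have "(h a \<ominus> q \<otimes> a) \<otimes> b \<in> C" if b: "b \<in> AA" for b
      proof -
        have bc: "b \<in> carrier Q" using AA_D(1)[OF b] .
        have baI: "b \<otimes> a \<in> I" by (rule A.smodsD(4)[OF IM b a])
        note hb = hD(1)[OF baI]
        have "(h (b \<otimes> a) \<ominus> q \<otimes> (b \<otimes> a)) \<ominus> (h (b \<otimes> a) \<ominus> b \<otimes> h a) \<in> C"
          using smodsD(7)[OF CM q(2)[OF baI]] hD(2)[OF b a] DC by blast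
        moreover have "(h (b \<otimes> a) \<ominus> q \<otimes> (b \<otimes> a)) \<ominus> (h (b \<otimes> a) \<ominus> b \<otimes> h a) = (h a \<ominus> q \<otimes> a) \<otimes> b"
          using hb hD(1)[OF a] ac bc q(1) by algebra
        ultimately show ?thesis by simp
      qed
      then have "h a \<ominus> q \<otimes> a \<in> colon Q C AA" unfolding colon_def using hD(1)[OF a] ac q(1) by auto
      then show ?thesis using D by simp
    qed
    then show ?thesis unfolding A.qmult_def using q(1) by blast
  qed
  \<comment> \<open>With mC = C : AA, the colon by M is C : M. It differs from C : AA by biduality,
    as M \<noteq> AA.\<close>
  have "colon Q ?D M \<noteq> ?D"
  proof
    assume e: "colon Q ?D M = ?D"
    have MM: "M \<in> SM" using fidsD(1)[OF M_FI] .
    have "AA \<cdot> M = M"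
    proof (rule antisym)
      show "AA \<cdot> M \<subseteq> M" by (rule prod_least[OF MM]) (rule A.smodsD(4)[OF A.m_smod])
      show "M \<subseteq> AA \<cdot> M" using A.prod_S[OF A.m_smod] A.prod_comm[OF A.m_smod A.S_smod] by simp
    qed
    then have "colon Q ?D M = colon Q C M" using colon_prod[OF CM fidsD(1)[OF AA_fid] MM] D by simp
    then have "colon Q C M = colon Q C AA" using e D by simp
    then have "colon Q C (colon Q C M) = colon Q C (colon Q C AA)" by (rule arg_cong)
    then have "M = AA" unfolding bidual[OF C(1) M_FI] bidual[OF C(1) AA_fid] .
    then show False using A.one_notin_m A.S_one by simp
  qed
  then show "A.dualizing ?D" unfolding A.dualizing_def using DA mult by blast
qed

end

section \<open>Multiplicities under scaling and independence of the canonical ideal\<close>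

context cm_one
begin

lemma colength_lenn: "I \<in> SM \<Longrightarrow> I \<subseteq> S \<Longrightarrow> colength RR I = lenn I S"
  unfolding lenn_def by (rule colength_eq)

lemma hs_multiplicity_limit:
  assumes dim: "krull_dim RR = 1" and I: "I \<in> SM" "I \<subseteq> S"
    and lim: "(\<lambda>n. real (lenn (ipow Q S I n) S) / real n) \<longlonglongrightarrow> L"
  shows "hs_multiplicity RR I = L"
proof -
  have "colength RR (I [^]\<^bsub>ideals_set RR\<^esub> n) = lenn (ipow Q S I n) S" for n :: nat
    unfolding ideals_pow_eq_ipow by (rule colength_lenn[OF ipow_SM[OF I(1)] ipow_sub[OF I]])
  moreover have "the_enat (krull_dim RR) = 1" unfolding dim by (simp add: one_enat_def)
  ultimately show ?thesis unfolding hs_multiplicity_def Let_def using limI[OF lim] by simp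
qed

lemma pow_S: "u \<in> S \<Longrightarrow> u [^] (n::nat) \<in> S"
  by (induction n) (simp_all add: S_one S_mult)

lemma pow_Units: "u \<in> Units Q \<Longrightarrow> u [^] (n::nat) \<in> Units Q"
  by (induction n) simp_all

lemma lenn_pow_S:
  assumes u: "u \<in> S" "u \<in> Units Q"
  shows "lenn (scal Q (u [^] (n::nat)) S) S = n * lenn (scal Q u S) S"
proof (induction n)
  case 0
  then show ?case unfolding lenn_def using scal_one[OF S_sub] by (simp add: zero_enat_def)
next
  case (Suc n)
  have "scal Q (u [^] Suc n) S = scal Q (u [^] n) (scal Q u S)"
    using scal_scal[OF S_sub, of "u [^] n" u] u by simp
  then show ?case
    using lenn_scal_S[OF fids_scal[OF S_fid u(2)] scal_sub[OF S_smod u(1)] pow_S[OF u(1)] pow_Units[OF u(2)]] Suc by simp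
qed

lemma prod_scal_right:
  assumes "N \<in> SM" "K \<in> SM" "u \<in> carrier Q"
  shows "N \<cdot> scal Q u K = scal Q u (N \<cdot> K)"
  using prod_comm[OF assms(1) scal_smod[OF assms(2,3)]] prod_scal[OF assms(2,1,3)] prod_comm[OF assms(1,2)] by simp

lemma ipow_scal:
  assumes I: "I \<in> SM" and u: "u \<in> carrier Q"
  shows "ipow Q S (scal Q u I) n = scal Q (u [^] n) (ipow Q S I n)"
proof (induction n)
  case 0
  then show ?case using scal_one[OF S_sub] by simp
next
  case (Suc n)
  note E = ipow_SM[OF I, of n]
  have "scal Q (u [^] n) (ipow Q S I n) \<cdot> scal Q u I = scal Q (u [^] n) (ipow Q S I n \<cdot> scal Q u I)"
    by (rule prod_scal[OF E scal_smod[OF I u]]) (use u in simp)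
  also have "ipow Q S I n \<cdot> scal Q u I = scal Q u (ipow Q S I n \<cdot> I)" by (rule prod_scal_right[OF E I u])
  also have "scal Q (u [^] n) (scal Q u (ipow Q S I n \<cdot> I)) = scal Q (u [^] n \<otimes> u) (ipow Q S I n \<cdot> I)"
    by (rule scal_scal[OF smod_sub[OF prod_smod[OF E I]]]) (use u in auto)
  finally show ?case using Suc by simp
qed

text \<open>Additivity of multiplicity on products: over a common period K, the n-th powers of I, J
  and IJ are multiplied by a unit, by another one, and by the product of both. With I = J it also
  gives the limit for a single ideal.\<close>

lemma joint_increment:
  assumes I: "I \<in> FI" "I \<subseteq> S" and J: "J \<in> FI" "J \<subseteq> S"
  obtains K n0 \<alpha> \<beta> where "1 \<le> K"
    "\<And>n. n0 \<le> n \<Longrightarrow> lenn (ipow Q S I (n + K)) S = lenn (ipow Q S I n) S + \<alpha>"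
    "\<And>n. n0 \<le> n \<Longrightarrow> lenn (ipow Q S J (n + K)) S = lenn (ipow Q S J n) S + \<beta>"
    "\<And>n. n0 \<le> n \<Longrightarrow> lenn (ipow Q S I (n + K) \<cdot> ipow Q S J (n + K)) S = lenn (ipow Q S I n \<cdot> ipow Q S J n) S + (\<alpha> + \<beta>)"
proof -
  note EI = ipow_FI[OF I(1)] ipow_sub[OF fidsD(1)[OF I(1)] I(2)]
  note EJ = ipow_FI[OF J(1)] ipow_sub[OF fidsD(1)[OF J(1)] J(2)]
  note EM = fidsD(1)[OF EI(1)] fidsD(1)[OF EJ(1)]
  obtain k1 u n1 where k1: "1 \<le> k1" "u \<in> S" "u \<in> Units Q" "\<forall>n\<ge>n1. \<forall>j. ipow Q S I (n + k1 * j) = scal Q (u [^] j) (ipow Q S I n)"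
    using periodic_reduction[OF I] by blast
  obtain k2 v n2 where k2: "1 \<le> k2" "v \<in> S" "v \<in> Units Q" "\<forall>n\<ge>n2. \<forall>j. ipow Q S J (n + k2 * j) = scal Q (v [^] j) (ipow Q S J n)"
    using periodic_reduction[OF J] by blast
  \<comment> \<open>The common period k1 k2 consists of k2 periods of I and k1 periods of J.\<close>
  let ?u = "u [^] k2" and ?v = "v [^] k1"
  have u: "?u \<in> S" "?u \<in> Units Q" and v: "?v \<in> S" "?v \<in> Units Q"
    by (rule pow_S[OF k1(2)], rule pow_Units[OF k1(3)], rule pow_S[OF k2(2)], rule pow_Units[OF k2(3)])
  have P: "ipow Q S I n \<cdot> ipow Q S J n \<in> FI" "ipow Q S I n \<cdot> ipow Q S J n \<subseteq> S" for n
    using fids_prod[OF EI(1) EJ(1)] prod_mono[OF EI(2) EJ(2)] prod_S[OF S_smod] by auto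
  show thesis
  proof (rule that[of "k1 * k2" "max n1 n2" "lenn (scal Q ?u S) S" "lenn (scal Q ?v S) S"])
    show "1 \<le> k1 * k2" using k1(1) k2(1) by simp
    fix n assume n: "max n1 n2 \<le> n"
    have iI: "ipow Q S I (n + k1 * k2) = scal Q ?u (ipow Q S I n)" using k1(4) n by simp
    have iJ: "ipow Q S J (n + k1 * k2) = scal Q ?v (ipow Q S J n)" using k2(4) n by (simp add: mult.commute)
    show "lenn (ipow Q S I (n + k1 * k2)) S = lenn (ipow Q S I n) S + lenn (scal Q ?u S) S"
      unfolding iI using lenn_scal_S[OF EI u] by simp
    show "lenn (ipow Q S J (n + k1 * k2)) S = lenn (ipow Q S J n) S + lenn (scal Q ?v S) S"
      unfolding iJ using lenn_scal_S[OF EJ v] by simp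
    have "ipow Q S I (n + k1 * k2) \<cdot> ipow Q S J (n + k1 * k2) = scal Q ?u (scal Q ?v (ipow Q S I n \<cdot> ipow Q S J n))"
      unfolding iI iJ prod_scal[OF EM(1) scal_smod[OF EM(2) S_carr[OF v(1)]] S_carr[OF u(1)]]
        prod_scal_right[OF EM S_carr[OF v(1)]] ..
    moreover have "scal Q ?v (ipow Q S I n \<cdot> ipow Q S J n) \<in> FI" "scal Q ?v (ipow Q S I n \<cdot> ipow Q S J n) \<subseteq> S"
      using fids_scal[OF P(1) v(2)] scal_sub[OF fidsD(1)[OF P(1)] v(1)] P(2) by blast+
    ultimately show "lenn (ipow Q S I (n + k1 * k2) \<cdot> ipow Q S J (n + k1 * k2)) S
        = lenn (ipow Q S I n \<cdot> ipow Q S J n) S + (lenn (scal Q ?u S) S + lenn (scal Q ?v S) S)"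
      using lenn_scal_S[OF _ _ u] lenn_scal_S[OF P v] by simp
  qed
qed

text \<open>u need not lie in S, so the n-th powers of uI and I are compared through s^n (uI)^n =
  (su)^n I^n with s and su in S. The increment per exponent is a difference of two lengths and may
  be negative, hence a real \<delta>.\<close>

lemma lenn_ipow_scal:
  assumes I: "I \<in> FI" "I \<subseteq> S" and u: "u \<in> Units Q" "scal Q u I \<subseteq> S"
  shows "\<exists>\<delta>. \<forall>n. real (lenn (ipow Q S (scal Q u I) n) S) = real (lenn (ipow Q S I n) S) + real n * \<delta>"
proof -
  note IM = fidsD(1)[OF I(1)]
  have uc: "u \<in> carrier Q" using Units_closed[OF u(1)] .
  note J = fids_scal[OF I(1) u(1)]
  obtain s where s: "s \<in> S" "s \<in> Units Q" "s \<otimes> u \<in> S" using frac[OF uc] by blast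
  have su: "s \<otimes> u \<in> Units Q" using s(2) u(1) by simp
  have sc: "s \<in> carrier Q" using s(1) by auto
  let ?\<sigma> = "lenn (scal Q s S) S" and ?\<tau> = "lenn (scal Q (s \<otimes> u) S) S"
  have "real (lenn (ipow Q S (scal Q u I) n) S) = real (lenn (ipow Q S I n) S) + real n * (real ?\<tau> - real ?\<sigma>)" for n
  proof -
    let ?E = "ipow Q S I n" and ?J = "ipow Q S (scal Q u I) n"
    have "scal Q (s [^] n) ?J = scal Q (s [^] n \<otimes> u [^] n) ?E"
      unfolding ipow_scal[OF IM uc] by (rule scal_scal[OF smod_sub[OF ipow_SM[OF IM]]]) (use uc sc in auto)
    also have "s [^] n \<otimes> u [^] n = (s \<otimes> u) [^] n" using nat_pow_distrib[OF sc uc] by simp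
    finally have "lenn (scal Q (s [^] n) ?J) S = lenn (scal Q ((s \<otimes> u) [^] n) ?E) S" by simp
    moreover have "lenn (scal Q (s [^] n) ?J) S = n * ?\<sigma> + lenn ?J S"
      using lenn_scal_S[OF ipow_FI[OF J] ipow_sub[OF fidsD(1)[OF J] u(2)] pow_S[OF s(1)] pow_Units[OF s(2)]] lenn_pow_S[OF s(1,2)] by simp
    moreover have "lenn (scal Q ((s \<otimes> u) [^] n) ?E) S = n * ?\<tau> + lenn ?E S"
      using lenn_scal_S[OF ipow_FI[OF I(1)] ipow_sub[OF IM I(2)] pow_S[OF s(3)] pow_Units[OF su]] lenn_pow_S[OF s(3) su] by simp
    ultimately have "n * ?\<sigma> + lenn ?J S = n * ?\<tau> + lenn ?E S" by linarith
    then have "real (n * ?\<sigma> + lenn ?J S) = real (n * ?\<tau> + lenn ?E S)" by (rule arg_cong)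
    then show ?thesis by (simp add: algebra_simps)
  qed
  then show ?thesis by (intro exI allI)
qed

text \<open>The same \<delta> enters the multiplicity as a limit and the colength as the case n = 1,
  and cancels in the difference.\<close>

lemma hs_minus_colength_scal:
  assumes dim: "krull_dim RR = 1" and I: "I \<in> FI" "I \<subseteq> S" and u: "u \<in> Units Q" "scal Q u I \<subseteq> S"
  shows "hs_multiplicity RR (scal Q u I) - real (lenn (scal Q u I) S) = hs_multiplicity RR I - real (lenn I S)"
proof -
  note IM = fidsD(1)[OF I(1)]
  note JM = fidsD(1)[OF fids_scal[OF I(1) u(1)]]
  let ?a = "\<lambda>n. real (lenn (ipow Q S I n) S)" and ?b = "\<lambda>n. real (lenn (ipow Q S (scal Q u I) n) S)"
  obtain \<delta> where d: "\<And>n. ?b n = ?a n + real n * \<delta>" using lenn_ipow_scal[OF I u] by blast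
  obtain K n0 \<alpha> \<beta> where K: "1 \<le> K" "\<And>n. n0 \<le> n \<Longrightarrow> lenn (ipow Q S I (n + K)) S = lenn (ipow Q S I n) S + \<alpha>"
    using joint_increment[OF I I] by (metis (no_types, lifting))
  have L: "(\<lambda>n. ?a n / real n) \<longlonglongrightarrow> real \<alpha> / real K" by (rule lim_periodic_increment[where a="\<lambda>n. lenn (ipow Q S I n) S", OF K])
  have "(\<lambda>n. ?a n / real n + \<delta>) \<longlonglongrightarrow> real \<alpha> / real K + \<delta>" by (rule tendsto_add[OF L tendsto_const])
  moreover have "\<forall>\<^sub>F n in sequentially. ?a n / real n + \<delta> = ?b n / real n"
    using eventually_gt_at_top[of 0] by eventually_elim (simp add: d add_divide_distrib)
  ultimately have "(\<lambda>n. ?b n / real n) \<longlonglongrightarrow> real \<alpha> / real K + \<delta>" by (rule Lim_transform_eventually)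
  from hs_multiplicity_limit[OF dim JM u(2) this] hs_multiplicity_limit[OF dim IM I(2) L]
  have "hs_multiplicity RR (scal Q u I) = hs_multiplicity RR I + \<delta>" by simp
  moreover have "real (lenn (scal Q u I) S) = real (lenn I S) + \<delta>"
    using d[of 1] unfolding ipow_1[OF IM] ipow_1[OF JM] by simp
  ultimately show ?thesis by simp
qed

text \<open>Removes the choice in \<open>cdeg\<close>: the chosen canonical ideal is a multiple of D
  by a unit of Q.\<close>

lemma cdeg_eq:
  assumes dim: "krull_dim RR = 1" and CM: "cohen_macaulay_local RR m" and D: "dualizing D" "D \<in> FI" "D \<subseteq> S"
  shows "cdeg RR m = hs_multiplicity RR D - real (lenn D S)"
proof -
  define C where "C = (SOME C. canonical_ideal RR m C)"
  have "canonical_ideal RR m C" unfolding C_def by (rule someI[where P="canonical_ideal RR m", OF dualizing_imp_canonical[OF D CM dim]])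
  note C = canonical_imp_dualizing[OF this dim]
  obtain u where u: "u \<in> Units Q" "C = scal Q u D" using dualizing_unique[OF D(1,2) C(1,3)] by blast
  have "cdeg RR m = hs_multiplicity RR C - real (lenn C S)"
    unfolding cdeg_def Let_def C_def[symmetric] using colength_lenn[OF fidsD(1)[OF C(3)] C(2)] by simp
  then show ?thesis using hs_minus_colength_scal[OF dim D(2,3) u(1)] C(2) u(2) by simp
qed

end

section \<open>The canonical degree of \<open>AA\<close>\<close>

context local_AA
begin

interpretation A: cm_one Q AA M by (rule AA_cm_one[OF AA_local])

text \<open>Stated for positive exponents, since the zeroth powers are \<open>AA\<close> on the left
  and S on the right.\<close>

lemma ipow_AA_prod:
  assumes C: "C \<in> SM" and D: "m \<cdot> C \<in> smods Q AA"
  shows "ipow Q AA (m \<cdot> C) (Suc n) = ipow Q S m (Suc n) \<cdot> ipow Q S C (Suc n)"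
proof (induction n)
  case 0
  then show ?case using A.ipow_1[OF D] ipow_1[OF m_smod] ipow_1[OF C] by simp
next
  case (Suc n)
  let ?E = "ipow Q S m (Suc n)" and ?F = "ipow Q S C (Suc n)"
  note E = ipow_SM[OF m_smod, of "Suc n"] and F = ipow_SM[OF C, of "Suc n"]
  have "ipow Q AA (m \<cdot> C) (Suc (Suc n)) = (?E \<cdot> ?F) \<cdot> (m \<cdot> C)" unfolding ipow.simps(2)[of Q AA _ "Suc n"] Suc ..
  also have "\<dots> = ?E \<cdot> (?F \<cdot> (m \<cdot> C))" by (rule prod_assoc[OF E F prod_smod[OF m_smod C]])
  also have "?F \<cdot> (m \<cdot> C) = (?F \<cdot> m) \<cdot> C" by (rule prod_assoc[OF F m_smod C, symmetric])
  also have "?F \<cdot> m = m \<cdot> ?F" by (rule prod_comm[OF F m_smod])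
  also have "(m \<cdot> ?F) \<cdot> C = m \<cdot> (?F \<cdot> C)" by (rule prod_assoc[OF m_smod F C])
  also have "?E \<cdot> (m \<cdot> (?F \<cdot> C)) = (?E \<cdot> m) \<cdot> (?F \<cdot> C)" by (rule prod_assoc[OF E m_smod prod_smod[OF F C], symmetric])
  finally show ?case unfolding ipow.simps(2)[of _ _ _ "Suc n"] .
qed

theorem cdeg_AA:
  assumes dim: "krull_dim RR = 1" and CM: "cohen_macaulay_local RR m" and nz: "nonzerodivisors RR \<subseteq> Units Q"
    and C: "canonical_ideal RR m C" and AA_colon: "AA = colon Q S m"
  shows "cdeg (Q\<lparr>carrier := AA\<rparr>) M
    = inverse (real (lenn M AA)) * (cdeg RR m + hs_multiplicity RR m - 2 * real (lenn S AA))"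
proof -
  have lr: "local_ring RR m" using CM unfolding cohen_macaulay_local_def by blast
  note Adim = AA_cohen_macaulay(1)[OF AA_local lr dim nz] and ACM = AA_cohen_macaulay(2)[OF AA_local lr dim nz]
  note C = canonical_imp_dualizing[OF C dim]
  note CS = fidsD(1)[OF C(3)]
  let ?D = "m \<cdot> C"
  note D = dualizing_AA[OF C(1,3,2) AA_colon]
  note DA = A.fidsD(1)[OF D(2)]
  let ?e = "lenn M AA" and ?r = "lenn S AA"
  have e: "0 < real ?e" using lenn_M_AA_pos by simp
  have AF: "AA \<in> fids Q AA" by (rule A.S_fid)
  obtain K n0 \<alpha> \<beta> where K: "1 \<le> K"
    "\<And>n. n0 \<le> n \<Longrightarrow> lenn (ipow Q S m (n + K)) S = lenn (ipow Q S m n) S + \<alpha>"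
    "\<And>n. n0 \<le> n \<Longrightarrow> lenn (ipow Q S C (n + K)) S = lenn (ipow Q S C n) S + \<beta>"
    "\<And>n. n0 \<le> n \<Longrightarrow> lenn (ipow Q S m (n + K) \<cdot> ipow Q S C (n + K)) S = lenn (ipow Q S m n \<cdot> ipow Q S C n) S + (\<alpha> + \<beta>)"
    by (rule joint_increment[OF m_fid m_sub C(3,2)], rule that) assumption+
  have hm: "hs_multiplicity RR m = real \<alpha> / real K"
    by (rule hs_multiplicity_limit[OF dim m_smod m_sub lim_periodic_increment[where a="\<lambda>n. lenn (ipow Q S m n) S", OF K(1,2)]])
  have hC: "hs_multiplicity RR C = real \<beta> / real K"
    by (rule hs_multiplicity_limit[OF dim CS C(2) lim_periodic_increment[where a="\<lambda>n. lenn (ipow Q S C n) S", OF K(1,3)]])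
  let ?P = "\<lambda>n. ipow Q S m n \<cdot> ipow Q S C n"
  have P: "?P n \<in> FI" "?P n \<subseteq> S" for n
    using fids_prod[OF ipow_FI[OF m_fid] ipow_FI[OF C(3)]]
      prod_mono[OF ipow_sub[OF m_smod m_sub] ipow_sub[OF CS C(2)]] prod_S[OF S_smod] by auto
  \<comment> \<open>Lengths up to \<open>AA\<close> exceed lengths up to S by \<open>?r\<close>.
    This constant vanishes in the multiplicity but is one of the two copies of the type in the
    colength.\<close>
  have Alen: "real (A.lenn (ipow Q AA ?D n) AA) = (real (lenn (?P n) S) + real ?r) / real ?e" if n: "0 < n" for n
  proof -
    have eq: "ipow Q AA ?D n = ?P n" using ipow_AA_prod[OF CS DA, of "n - 1"] n by simp
    have "lenn (ipow Q AA ?D n) AA = ?e * A.lenn (ipow Q AA ?D n) AA"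
      by (rule lenn_AA[OF A.ipow_FI[OF D(2)] AF A.ipow_sub[OF DA D(3)]])
    moreover have "lenn (?P n) AA = lenn (?P n) S + ?r" by (rule lenn_add[OF P(1) S_fid AA_fid P(2) S_sub_AA])
    ultimately have "?e * A.lenn (ipow Q AA ?D n) AA = lenn (?P n) S + ?r" unfolding eq by linarith
    then have "real (?e * A.lenn (ipow Q AA ?D n) AA) = real (lenn (?P n) S + ?r)" by (rule arg_cong)
    then show ?thesis using e by (simp add: field_simps)
  qed
  have "(\<lambda>n. real (lenn (?P n) S) / real n) \<longlonglongrightarrow> real (\<alpha> + \<beta>) / real K"
    by (rule lim_periodic_increment[where a="\<lambda>n. lenn (?P n) S", OF K(1,4)])
  moreover have "(\<lambda>n. real ?r / real n) \<longlonglongrightarrow> 0" by (rule lim_const_over_n)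
  ultimately have "(\<lambda>n. (real (lenn (?P n) S) / real n + real ?r / real n) / real ?e) \<longlonglongrightarrow> (real (\<alpha> + \<beta>) / real K + 0) / real ?e"
    by (intro tendsto_divide[OF tendsto_add tendsto_const]) (use e in auto)
  moreover have "\<forall>\<^sub>F n in sequentially. (real (lenn (?P n) S) / real n + real ?r / real n) / real ?e = real (A.lenn (ipow Q AA ?D n) AA) / real n"
    using eventually_gt_at_top[of 0] by eventually_elim (simp add: Alen add_divide_distrib mult.commute)
  ultimately have "(\<lambda>n. real (A.lenn (ipow Q AA ?D n) AA) / real n) \<longlonglongrightarrow> (real (\<alpha> + \<beta>) / real K + 0) / real ?e"
    by (rule Lim_transform_eventually)
  then have hD: "hs_multiplicity A.RR ?D = (hs_multiplicity RR m + hs_multiplicity RR C) / real ?e"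
    using A.hs_multiplicity_limit[OF Adim DA D(3)] unfolding hm hC by (simp add: add_divide_distrib)
  \<comment> \<open>The second copy of the type: the length of C / mC equals that of (S : m) /
    S.\<close>
  have "lenn ?D S = ?r + lenn C S"
    using lenn_add[OF fids_AA[OF D(2)] C(3) S_fid D(4) C(2)] type_dual[OF C(1,3)] AA_colon by simp
  moreover have "?P 1 = ?D" unfolding ipow_1[OF m_smod] ipow_1[OF CS] ..
  ultimately have lD: "real (A.lenn ?D AA) = (2 * real ?r + real (lenn C S)) / real ?e"
    using Alen[of 1] unfolding A.ipow_1[OF DA] by simp
  have cA: "cdeg A.RR M = hs_multiplicity A.RR ?D - real (A.lenn ?D AA)" by (rule A.cdeg_eq[OF Adim ACM D(1-3)])
  have cR: "cdeg RR m = hs_multiplicity RR C - real (lenn C S)" by (rule cdeg_eq[OF dim CM C(1,3,2)])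
  show ?thesis unfolding cA cR hD lD by (simp add: divide_inverse algebra_simps)
qed

end

theorem theorem8p3:
  fixes R Q A :: "'a ring" and m M :: "'a set" and e r :: nat
  assumes "cohen_macaulay_local R m"
    and "krull_dim R = 1"
    and "\<exists>C. canonical_ideal R m C"
    and "\<not> discrete_valuation_ring R"
    and "total_ring_of_fractions R Q"
    and "A = Q\<lparr>carrier := colon Q m m\<rparr>"
    and "local_ring A M"
    and "e = residue_degree R A M"
    and "r = cm_type R m"
  shows "cdeg A M = inverse (real e) * (cdeg R m + hs_multiplicity R m - 2 * real r)"
proof -
  interpret S: cm_one Q "carrier R" m by (rule cm_one_intro[OF assms(1,2,5)])
  have RR: "Q\<lparr>carrier := carrier R\<rparr> = R" and nz: "nonzerodivisors R \<subseteq> Units Q"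
    using assms(5) unfolding total_ring_of_fractions_def by simp_all
  have A: "A = Q\<lparr>carrier := S.AA\<rparr>" unfolding assms(6) S.AA_def ..
  interpret L: local_AA Q "carrier R" m M by unfold_locales (use assms(7) A in simp)
  have lr: "local_ring R m" using assms(1) unfolding cohen_macaulay_local_def by blast
  \<comment> \<open>This is where R must not be a discrete valuation ring; with it, both the type
    and the dual of mC refer to \<open>AA\<close>.\<close>
  have colon: "S.AA = colon Q (carrier R) m"
    unfolding S.AA_def by (rule S.colon_mm_not_dvr) (simp_all add: RR assms(4) lr)
  have e: "e = S.lenn M S.AA" using L.residue_degree_eq_lenn unfolding RR A[symmetric] assms(8) .
  have r: "r = S.lenn (carrier R) S.AA" using S.cm_type_eq assms(2) unfolding RR assms(9) colon by blast
  obtain C where "canonical_ideal R m C" using assms(3) by blast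
  then show ?thesis
    unfolding e r A using L.cdeg_AA[of C] assms(1,2) nz colon unfolding RR by blast
qed

end
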